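(* Let $D$ be a classifying space of graded-polarized mixed Hodge structures, $F\in D$, $U^p=\bigoplus_qI^{p,q}_{(F,W)}\cong F^p/F^{p+1}$, and let $\Pi'$ denote the orthogonal projection from $V_{\mathbb C}$ to $U^p$ with respect to the mixed Hodge metric $h_F$. Then the curvature at $F$ of the Hodge bundle $\mathcal F^p/\mathcal F^{p+1}$ over $D$ (with the mixed Hodge metric) in the directions $u,v\in T^{\rm hol}_F(D)\cong\mathfrak q_F$, as an endomorphism of $U^p$, is $$R_\nabla(u,\bar v)=-\big[\Pi'\circ(\bar u_+^* ),\Pi'\circ(\bar v_+)\big]-\tfrac12\big([u,\bar v]_0+[v,\bar u]_0^*\big)+\Pi'\circ\big([\bar v,u]_++[\bar u,v]_+^*\big).$$
   Context: Classifying space: fix a finite-dimensional real vector space $V_{\mathbb R}$, an increasing (weight) filtration $W$, non-degenerate $(-1)^k$-symmetric real bilinear forms $Q_k$ on $\operatorname{gr}^W_k$, and numbers $h^{p,q}$. $D$ is the set of decreasing filtrations $F$ of $V_{\mathbb C}$ such that $(F,W)$ is a mixed Hodge structure, graded-polarized by $\{Q_k\}$, with Hodge numbers $h^{p,q}$. For $F\in D$ the Deligne bigrading is the unique functorial $V_{\mathbb C}=\bigoplus I^{p,q}$ with $F^p=\bigoplus_{a\ge p}I^{a,b}$, $W_k=\bigoplus_{a+b\le k}I^{a,b}$, $\overline{I^{p,q}}\equiv I^{q,p}$ mod $\bigoplus_{a<q,b<p}I^{a,b}$. The mixed Hodge metric $h_F$ on $V_{\mathbb C}$ makes the bigrading orthogonal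 with $h_F(u,v)=\mathrm i^{p-q}Q_{p+q}([u],[\bar v])$ for $u,v\in I^{p,q}$; on $\operatorname{End}(V_{\mathbb C})$ put $h_F(\alpha,\beta)=\operatorname{Tr}(\alpha\beta^* )$, $\beta^*$ the $h_F$-adjoint. $G_{\mathbb C}$ is the group of complex automorphisms of $V_{\mathbb C}$ preserving $W$ and inducing automorphisms of the $Q_k$; $\mathfrak g_{\mathbb C}$ its Lie algebra, bar complex conjugation. $\mathfrak g^{r,s}$ is the set of elements of $\mathfrak g_{\mathbb C}$ mapping each $I^{p,q}$ to $I^{p+r,q+s}$. $\mathfrak q_F=\bigoplus_{r<0}\mathfrak g^{r,s}$, $\Lambda=\bigoplus_{r,s<0}\mathfrak g^{r,s}$, $\mathfrak n_+=\bigoplus_{a\ge0,b<0}\mathfrak g^{a,b}$, $\mathfrak n_-=\bigoplus_{a<0,b\ge0}\mathfrak g^{a,b}$, so $\mathfrak g_{\mathbb C}=\mathfrak n_+\oplus\mathfrak g^{0,0}\oplus\mathfrak n_-\oplus\Lambda$; $x_+$ and $x_0$ denote the components in $\mathfrak n_+$ and $\mathfrak g^{0,0}$. $D$ is a complex manifold, open in $G_{\mathbb C}\cdot F$, and $u\mapsto\frac{d}{dt}|_0e^{tu}\cdot F$ identifies $\mathfrak q_F$ with the holomorphic tangent space. Order of operations: conjugate, then project, then take adjoint: $\bar u_+^*=((\bar u)_+)^*$, $[x,y]_+^*=([x,y]_+)^*$, $[x,y]_0^*=([x,y]_0)^*$. $\mathcal F^p$ is the tautological holomorphic bundle with fibre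 $F^p$ at $F$; the quotient $\mathcal F^p/\mathcal F^{p+1}$ gets its metric from $h_F$ via $F^p/F^{p+1}\cong U^p$. Elements of $\operatorname{End}(V_{\mathbb C})$ act linearly on $V_{\mathbb C}$; all operators are restricted to $U^p$. Curvature is that of the Chern connection $\nabla$: $R_\nabla=\bar\partial\theta$, $\theta=\mathbf h^{-1}\partial\mathbf h$ in a local holomorphic frame ($\mathbf h$ the transposed Gram matrix); for a line bundle $R(\partial_z,\partial_{\bar z})=-\partial_z\partial_{\bar z}\log h$. *)

theory Defs
  imports "HOL-Analysis.Analysis"
begin

text \<open>
  The real vector space \<open>V\<^sub>\<real>\<close> is \<open>real ^ 'n\<close>, its complexification is \<open>complex ^ 'n\<close>, and
  \<open>End(V\<^sub>\<complex>)\<close> is \<open>complex ^ 'n ^ 'n\<close>, acting by \<open>*v\<close>.  Complex subspaces are those of the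
  interpretation \<open>vec\<close> (scalar multiplication \<open>*s\<close>).  Sums of subspaces are written with the
  elementwise \<open>+\<close> of sets.
\<close>

subsection \<open>Complexification\<close>

definition re_vec :: "complex ^ 'n \<Rightarrow> real ^ 'n" where
  "re_vec x = (\<chi> i. Re (x $ i))"

definition im_vec :: "complex ^ 'n \<Rightarrow> real ^ 'n" where
  "im_vec x = (\<chi> i. Im (x $ i))"

definition cnj_vec :: "complex ^ 'n \<Rightarrow> complex ^ 'n" where
  "cnj_vec x = (\<chi> i. cnj (x $ i))"

text \<open>\<open>cnj_mat A\<close> is the endomorphism \<open>x \<mapsto> cnj_vec (A *v cnj_vec x)\<close>.\<close>

definition cnj_mat :: "complex ^ 'n ^ 'n \<Rightarrow> complex ^ 'n ^ 'n" where
  "cnj_mat A = (\<chi> i j. cnj (A $ i $ j))"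

definition scale_mat :: "complex \<Rightarrow> complex ^ 'n ^ 'n \<Rightarrow> complex ^ 'n ^ 'n" where
  "scale_mat c A = (\<chi> i j. c * A $ i $ j)"

definition commutator :: "complex ^ 'n ^ 'n \<Rightarrow> complex ^ 'n ^ 'n \<Rightarrow> complex ^ 'n ^ 'n" where
  "commutator A B = A ** B - B ** A"

definition mexp :: "complex ^ 'n ^ 'n \<Rightarrow> complex ^ 'n ^ 'n" where
  "mexp A = (\<Sum>k. (1 / fact k) *\<^sub>R (((**) A ^^ k) (mat 1)))"

definition cplx_space :: "(real ^ 'n) set \<Rightarrow> (complex ^ 'n) set" where
  "cplx_space S = {x. re_vec x \<in> S \<and> im_vec x \<in> S}"

text \<open>The complex-bilinear extension of a real bilinear form.\<close>

definition cplx_form :: "(real ^ 'n \<Rightarrow> real ^ 'n \<Rightarrow> real) \<Rightarrow> complex ^ 'n \<Rightarrow> complex ^ 'n \<Rightarrow> complex" where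
  "cplx_form B x y =
     Complex (B (re_vec x) (re_vec y) - B (im_vec x) (im_vec y))
             (B (re_vec x) (im_vec y) + B (im_vec x) (re_vec y))"

subsection \<open>The classifying space\<close>

definition weight_filtration :: "(int \<Rightarrow> (real ^ 'n) set) \<Rightarrow> bool" where
  "weight_filtration W \<longleftrightarrow>
     (\<forall>k. subspace (W k)) \<and> mono W \<and> (\<exists>a. W a = {0}) \<and> (\<exists>b. W b = UNIV)"

text \<open>
  A bilinear form on \<open>gr\<^sub>k = W k / W (k - 1)\<close> is represented by a bilinear form \<open>Q k\<close> on
  \<open>V\<^sub>\<real>\<close> whose restriction to \<open>W k\<close> descends to the quotient.  Every form on \<open>gr\<^sub>k\<close> arises in this
  way, and the values of \<open>Q k\<close> outside \<open>W k\<close> are never used.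
\<close>

definition graded_forms ::
    "(int \<Rightarrow> (real ^ 'n) set) \<Rightarrow> (int \<Rightarrow> real ^ 'n \<Rightarrow> real ^ 'n \<Rightarrow> real) \<Rightarrow> bool" where
  "graded_forms W Q \<longleftrightarrow>
     (\<forall>k. bilinear (Q k)
        \<and> (\<forall>x\<in>W k. \<forall>y\<in>W k. Q k x y = (-1) powi k * Q k y x)
        \<and> (\<forall>x\<in>W k. \<forall>y\<in>W (k - 1). Q k x y = 0)
        \<and> (\<forall>x\<in>W k. (\<forall>y\<in>W k. Q k x y = 0) \<longrightarrow> x \<in> W (k - 1)))"

abbreviation WC :: "(int \<Rightarrow> (real ^ 'n) set) \<Rightarrow> int \<Rightarrow> (complex ^ 'n) set" where
  "WC W k \<equiv> cplx_space (W k)"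

definition hodge_filtration :: "(int \<Rightarrow> (complex ^ 'n) set) \<Rightarrow> bool" where
  "hodge_filtration F \<longleftrightarrow>
     (\<forall>p. vec.subspace (F p)) \<and> antimono F \<and> (\<exists>a. F a = UNIV) \<and> (\<exists>b. F b = {0})"

text \<open>
  Subspaces of \<open>gr\<^sub>k\<close> are represented by their preimages in \<open>WC W k\<close>, which contain
  \<open>WC W (k - 1)\<close>.  \<open>gr_filtration W F k p\<close> represents the induced \<open>F\<^sup>p gr\<^sub>k\<close>, and
  \<open>hodge_component W F p q\<close> represents \<open>H\<^sup>p\<^sup>,\<^sup>q = F\<^sup>p gr\<^sub>k \<inter> cnj (F\<^sup>q gr\<^sub>k)\<close> for \<open>k = p + q\<close>.
\<close>

definition gr_filtration ::
    "(int \<Rightarrow> (real ^ 'n) set) \<Rightarrow> (int \<Rightarrow> (complex ^ 'n) set) \<Rightarrow> int \<Rightarrow> int \<Rightarrow> (complex ^ 'n) set" where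
  "gr_filtration W F k p = (F p \<inter> WC W k) + WC W (k - 1)"

definition hodge_component ::
    "(int \<Rightarrow> (real ^ 'n) set) \<Rightarrow> (int \<Rightarrow> (complex ^ 'n) set) \<Rightarrow> int \<Rightarrow> int \<Rightarrow> (complex ^ 'n) set" where
  "hodge_component W F p q =
     gr_filtration W F (p + q) p \<inter> cnj_vec ` gr_filtration W F (p + q) q"

text \<open>Each \<open>gr\<^sub>k\<close> is a pure Hodge structure of weight \<open>k\<close>: \<open>gr\<^sub>k = F\<^sup>p \<oplus> cnj F\<^sup>k\<^sup>-\<^sup>p\<^sup>+\<^sup>1\<close>.\<close>

definition mixed_hodge_structure ::
    "(int \<Rightarrow> (real ^ 'n) set) \<Rightarrow> (int \<Rightarrow> (complex ^ 'n) set) \<Rightarrow> bool" where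
  "mixed_hodge_structure W F \<longleftrightarrow> hodge_filtration F \<and>
     (\<forall>k p. gr_filtration W F k p + cnj_vec ` gr_filtration W F k (k - p + 1) = WC W k
          \<and> gr_filtration W F k p \<inter> cnj_vec ` gr_filtration W F k (k - p + 1) = WC W (k - 1))"

text \<open>
  The two Hodge-Riemann relations on each \<open>gr\<^sub>k\<close>.  The number in the second one is
  automatically real, by the symmetry of \<open>Q k\<close>.
\<close>

definition graded_polarized ::
    "(int \<Rightarrow> (real ^ 'n) set) \<Rightarrow> (int \<Rightarrow> real ^ 'n \<Rightarrow> real ^ 'n \<Rightarrow> real) \<Rightarrow>
     (int \<Rightarrow> (complex ^ 'n) set) \<Rightarrow> bool" where
  "graded_polarized W Q F \<longleftrightarrow>
     (\<forall>k p. \<forall>x\<in>gr_filtration W F k p. \<forall>y\<in>gr_filtration W F k (k - p + 1).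
        cplx_form (Q k) x y = 0) \<and>
     (\<forall>p q. \<forall>x\<in>hodge_component W F p q - WC W (p + q - 1).
        0 < Re (\<i> powi (p - q) * cplx_form (Q (p + q)) x (cnj_vec x)))"

definition classifying_space ::
    "(int \<Rightarrow> (real ^ 'n) set) \<Rightarrow> (int \<Rightarrow> real ^ 'n \<Rightarrow> real ^ 'n \<Rightarrow> real) \<Rightarrow>
     (int \<Rightarrow> int \<Rightarrow> nat) \<Rightarrow> (int \<Rightarrow> (complex ^ 'n) set) set" where
  "classifying_space W Q hn =
     {F. mixed_hodge_structure W F \<and> graded_polarized W Q F \<and>
         (\<forall>p q. vec.dim (hodge_component W F p q) = hn p q + vec.dim (WC W (p + q - 1)))}"

subsection \<open>Deligne bigrading and mixed Hodge metric\<close>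

definition is_decomposition :: "(int \<Rightarrow> int \<Rightarrow> (complex ^ 'n) set) \<Rightarrow> complex ^ 'n \<Rightarrow>
    (int \<Rightarrow> int \<Rightarrow> complex ^ 'n) \<Rightarrow> bool" where
  "is_decomposition I x c \<longleftrightarrow>
     (\<forall>p q. c p q \<in> I p q) \<and> finite {(p, q). c p q \<noteq> 0} \<and>
     x = (\<Sum>(p, q) \<in> {(p, q). c p q \<noteq> 0}. c p q)"

definition is_deligne_bigrading ::
    "(int \<Rightarrow> (real ^ 'n) set) \<Rightarrow> (int \<Rightarrow> (complex ^ 'n) set) \<Rightarrow>
     (int \<Rightarrow> int \<Rightarrow> (complex ^ 'n) set) \<Rightarrow> bool" where
  "is_deligne_bigrading W F I \<longleftrightarrow>
     (\<forall>p q. vec.subspace (I p q)) \<and>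
     (\<forall>x. \<exists>!c. is_decomposition I x c) \<and>
     (\<forall>p. F p = vec.span (\<Union>a\<in>{p..}. \<Union>b. I a b)) \<and>
     (\<forall>k. WC W k = vec.span (\<Union>(a, b)\<in>{(a, b). a + b \<le> k}. I a b)) \<and>
     (\<forall>p q. cnj_vec ` I p q + vec.span (\<Union>a\<in>{..<q}. \<Union>b\<in>{..<p}. I a b) =
            I q p + vec.span (\<Union>a\<in>{..<q}. \<Union>b\<in>{..<p}. I a b))"

definition deligne ::
    "(int \<Rightarrow> (real ^ 'n) set) \<Rightarrow> (int \<Rightarrow> (complex ^ 'n) set) \<Rightarrow> int \<Rightarrow> int \<Rightarrow> (complex ^ 'n) set" where
  "deligne W F = (THE I. is_deligne_bigrading W F I)"

definition deligne_part ::
    "(int \<Rightarrow> (real ^ 'n) set) \<Rightarrow> (int \<Rightarrow> (complex ^ 'n) set) \<Rightarrow> int \<Rightarrow> int \<Rightarrow>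
     complex ^ 'n \<Rightarrow> complex ^ 'n" where
  "deligne_part W F p q x = (THE c. is_decomposition (deligne W F) x c) p q"

definition hodge_U ::
    "(int \<Rightarrow> (real ^ 'n) set) \<Rightarrow> (int \<Rightarrow> (complex ^ 'n) set) \<Rightarrow> int \<Rightarrow> (complex ^ 'n) set" where
  "hodge_U W F p = vec.span (\<Union>q. deligne W F p q)"

text \<open>
  The mixed Hodge metric: the bigrading is orthogonal, and
  \<open>h u v = \<i>\<^sup>p\<^sup>-\<^sup>q Q\<^sub>p\<^sub>+\<^sub>q([u], [cnj v])\<close> for \<open>u, v\<close> in the summand of type \<open>(p, q)\<close>.
\<close>

definition hodge_metric ::
    "(int \<Rightarrow> (real ^ 'n) set) \<Rightarrow> (int \<Rightarrow> real ^ 'n \<Rightarrow> real ^ 'n \<Rightarrow> real) \<Rightarrow>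
     (int \<Rightarrow> (complex ^ 'n) set) \<Rightarrow> complex ^ 'n \<Rightarrow> complex ^ 'n \<Rightarrow> complex" where
  "hodge_metric W Q F x y =
     (\<Sum>(p, q) \<in> {(p, q). deligne W F p q \<noteq> {0}}.
        \<i> powi (p - q) *
        cplx_form (Q (p + q)) (deligne_part W F p q x) (cnj_vec (deligne_part W F p q y)))"

definition hodge_adjoint ::
    "(int \<Rightarrow> (real ^ 'n) set) \<Rightarrow> (int \<Rightarrow> real ^ 'n \<Rightarrow> real ^ 'n \<Rightarrow> real) \<Rightarrow>
     (int \<Rightarrow> (complex ^ 'n) set) \<Rightarrow> complex ^ 'n ^ 'n \<Rightarrow> complex ^ 'n ^ 'n" where
  "hodge_adjoint W Q F A =
     (THE B. \<forall>x y. hodge_metric W Q F (A *v x) y = hodge_metric W Q F x (B *v y))"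

definition hodge_proj ::
    "(int \<Rightarrow> (real ^ 'n) set) \<Rightarrow> (int \<Rightarrow> real ^ 'n \<Rightarrow> real ^ 'n \<Rightarrow> real) \<Rightarrow>
     (int \<Rightarrow> (complex ^ 'n) set) \<Rightarrow> int \<Rightarrow> complex ^ 'n \<Rightarrow> complex ^ 'n" where
  "hodge_proj W Q F p x =
     (THE y. y \<in> hodge_U W F p \<and> (\<forall>z\<in>hodge_U W F p. hodge_metric W Q F (x - y) z = 0))"

subsection \<open>The group, its Lie algebra and the induced bigrading\<close>

definition group_GC ::
    "(int \<Rightarrow> (real ^ 'n) set) \<Rightarrow> (int \<Rightarrow> real ^ 'n \<Rightarrow> real ^ 'n \<Rightarrow> real) \<Rightarrow> (complex ^ 'n ^ 'n) set" where
  "group_GC W Q =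
     {g. invertible g \<and> (\<forall>k. (*v) g ` WC W k = WC W k) \<and>
         (\<forall>k. \<forall>x\<in>WC W k. \<forall>y\<in>WC W k. cplx_form (Q k) (g *v x) (g *v y) = cplx_form (Q k) x y)}"

definition lie_gC ::
    "(int \<Rightarrow> (real ^ 'n) set) \<Rightarrow> (int \<Rightarrow> real ^ 'n \<Rightarrow> real ^ 'n \<Rightarrow> real) \<Rightarrow> (complex ^ 'n ^ 'n) set" where
  "lie_gC W Q = {X. \<forall>t::real. mexp (t *\<^sub>R X) \<in> group_GC W Q}"

definition lie_part ::
    "(int \<Rightarrow> (real ^ 'n) set) \<Rightarrow> (int \<Rightarrow> real ^ 'n \<Rightarrow> real ^ 'n \<Rightarrow> real) \<Rightarrow>
     (int \<Rightarrow> (complex ^ 'n) set) \<Rightarrow> int \<Rightarrow> int \<Rightarrow> (complex ^ 'n ^ 'n) set" where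
  "lie_part W Q F r s =
     {X \<in> lie_gC W Q. \<forall>p q. (*v) X ` deligne W F p q \<subseteq> deligne W F (p + r) (q + s)}"

text \<open>The \<open>lie_part\<close>s are complex subspaces, so real spans of their unions are complex spans.\<close>

definition lie_q ::
    "(int \<Rightarrow> (real ^ 'n) set) \<Rightarrow> (int \<Rightarrow> real ^ 'n \<Rightarrow> real ^ 'n \<Rightarrow> real) \<Rightarrow>
     (int \<Rightarrow> (complex ^ 'n) set) \<Rightarrow> (complex ^ 'n ^ 'n) set" where
  "lie_q W Q F = span (\<Union>r\<in>{..<0}. \<Union>s. lie_part W Q F r s)"

definition lie_Lambda ::
    "(int \<Rightarrow> (real ^ 'n) set) \<Rightarrow> (int \<Rightarrow> real ^ 'n \<Rightarrow> real ^ 'n \<Rightarrow> real) \<Rightarrow>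
     (int \<Rightarrow> (complex ^ 'n) set) \<Rightarrow> (complex ^ 'n ^ 'n) set" where
  "lie_Lambda W Q F = span (\<Union>r\<in>{..<0}. \<Union>s\<in>{..<0}. lie_part W Q F r s)"

definition lie_n_plus ::
    "(int \<Rightarrow> (real ^ 'n) set) \<Rightarrow> (int \<Rightarrow> real ^ 'n \<Rightarrow> real ^ 'n \<Rightarrow> real) \<Rightarrow>
     (int \<Rightarrow> (complex ^ 'n) set) \<Rightarrow> (complex ^ 'n ^ 'n) set" where
  "lie_n_plus W Q F = span (\<Union>a\<in>{0..}. \<Union>b\<in>{..<0}. lie_part W Q F a b)"

definition lie_n_minus ::
    "(int \<Rightarrow> (real ^ 'n) set) \<Rightarrow> (int \<Rightarrow> real ^ 'n \<Rightarrow> real ^ 'n \<Rightarrow> real) \<Rightarrow>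
     (int \<Rightarrow> (complex ^ 'n) set) \<Rightarrow> (complex ^ 'n ^ 'n) set" where
  "lie_n_minus W Q F = span (\<Union>a\<in>{..<0}. \<Union>b\<in>{0..}. lie_part W Q F a b)"

text \<open>
  Components of \<open>x \<in> lie_gC W Q\<close> with respect to the decomposition of the Lie algebra as
  \<open>lie_n_plus \<oplus> lie_part 0 0 \<oplus> lie_n_minus \<oplus> lie_Lambda\<close>.
\<close>

definition comp_plus ::
    "(int \<Rightarrow> (real ^ 'n) set) \<Rightarrow> (int \<Rightarrow> real ^ 'n \<Rightarrow> real ^ 'n \<Rightarrow> real) \<Rightarrow>
     (int \<Rightarrow> (complex ^ 'n) set) \<Rightarrow> complex ^ 'n ^ 'n \<Rightarrow> complex ^ 'n ^ 'n" where
  "comp_plus W Q F x =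
     (THE y. y \<in> lie_n_plus W Q F \<and>
             x - y \<in> lie_part W Q F 0 0 + lie_n_minus W Q F + lie_Lambda W Q F)"

definition comp_zero ::
    "(int \<Rightarrow> (real ^ 'n) set) \<Rightarrow> (int \<Rightarrow> real ^ 'n \<Rightarrow> real ^ 'n \<Rightarrow> real) \<Rightarrow>
     (int \<Rightarrow> (complex ^ 'n) set) \<Rightarrow> complex ^ 'n ^ 'n \<Rightarrow> complex ^ 'n ^ 'n" where
  "comp_zero W Q F x =
     (THE y. y \<in> lie_part W Q F 0 0 \<and>
             x - y \<in> lie_n_plus W Q F + lie_n_minus W Q F + lie_Lambda W Q F)"

subsection \<open>Chern curvature of the Hodge bundle\<close>

text \<open>
  \<open>w \<mapsto> e\<^sup>w \<cdot> F\<close> on a neighbourhood of \<open>0\<close> in \<open>lie_q W Q F\<close> is a holomorphic chart of the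
  classifying space around \<open>F\<close>; its differential at \<open>0\<close> is the identification of
  \<open>lie_q W Q F\<close> with the holomorphic tangent space at \<open>F\<close>.  Holomorphy and \<open>\<partial>\<close>, \<open>cnj \<partial>\<close> near
  \<open>F\<close> are expressed in this chart.
\<close>

definition chart :: "(int \<Rightarrow> (complex ^ 'n) set) \<Rightarrow> complex ^ 'n ^ 'n \<Rightarrow> int \<Rightarrow> (complex ^ 'n) set" where
  "chart F w = (\<lambda>p. (*v) (mexp w) ` F p)"

text \<open>Here \<open>S\<close> is meant to be relatively open in the complex subspace \<open>L\<close>.\<close>

definition holomorphic_in ::
    "(complex ^ 'n ^ 'n) set \<Rightarrow> (complex ^ 'n ^ 'n) set \<Rightarrow>
     (complex ^ 'n ^ 'n \<Rightarrow> complex ^ 'n) \<Rightarrow> bool" where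
  "holomorphic_in L S f \<longleftrightarrow>
     (\<forall>w\<in>S. \<exists>f'. (f has_derivative f') (at w within S) \<and>
                  (\<forall>x\<in>L. f' (scale_mat \<i> x) = \<i> *s f' x))"

text \<open>
  A local holomorphic frame of the quotient of tautological bundles \<open>F\<^sup>p / F\<^sup>p\<^sup>+\<^sup>1\<close> around \<open>F\<close>,
  in the chart above.  The sections of the quotient are given by holomorphic lifts \<open>s j\<close> to
  \<open>F\<^sup>p\<close>, for \<open>j < r\<close>.
\<close>

definition local_frame ::
    "(int \<Rightarrow> (real ^ 'n) set) \<Rightarrow> (int \<Rightarrow> real ^ 'n \<Rightarrow> real ^ 'n \<Rightarrow> real) \<Rightarrow> (int \<Rightarrow> int \<Rightarrow> nat) \<Rightarrow>
     (int \<Rightarrow> (complex ^ 'n) set) \<Rightarrow> int \<Rightarrow> nat \<Rightarrow> (nat \<Rightarrow> complex ^ 'n ^ 'n \<Rightarrow> complex ^ 'n) \<Rightarrow> bool" where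
  "local_frame W Q hn F p r s \<longleftrightarrow>
     (\<exists>N. open N \<and> 0 \<in> N \<and>
        (\<forall>j<r. holomorphic_in (lie_q W Q F) (N \<inter> lie_q W Q F) (s j)) \<and>
        (\<forall>w\<in>N \<inter> lie_q W Q F.
           chart F w \<in> classifying_space W Q hn \<and>
           (\<forall>j<r. s j w \<in> chart F w p) \<and>
           (\<forall>c. (\<Sum>j<r. c j *s s j w) \<in> chart F w (p + 1) \<longrightarrow> (\<forall>j<r. c j = 0)) \<and>
           chart F w p = vec.span ((\<lambda>j. s j w) ` {..<r}) + chart F w (p + 1)))"

text \<open>The isomorphism \<open>F\<^sup>p / F\<^sup>p\<^sup>+\<^sup>1 \<cong> U\<^sup>p\<close>, on representatives \<open>x \<in> F p\<close>.\<close>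

definition quot_rep ::
    "(int \<Rightarrow> (real ^ 'n) set) \<Rightarrow> (int \<Rightarrow> (complex ^ 'n) set) \<Rightarrow> int \<Rightarrow> complex ^ 'n \<Rightarrow> complex ^ 'n" where
  "quot_rep W F p x = (THE y. y \<in> hodge_U W F p \<and> x - y \<in> F (p + 1))"

text \<open>Transposed Gram matrix: the entry at \<open>(i, j)\<close> is the inner product of \<open>s j\<close> with \<open>s i\<close>.\<close>

definition frame_gram ::
    "(int \<Rightarrow> (real ^ 'n) set) \<Rightarrow> (int \<Rightarrow> real ^ 'n \<Rightarrow> real ^ 'n \<Rightarrow> real) \<Rightarrow>
     (int \<Rightarrow> (complex ^ 'n) set) \<Rightarrow> int \<Rightarrow> (nat \<Rightarrow> complex ^ 'n ^ 'n \<Rightarrow> complex ^ 'n) \<Rightarrow>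
     complex ^ 'n ^ 'n \<Rightarrow> nat \<Rightarrow> nat \<Rightarrow> complex" where
  "frame_gram W Q F p s w i j =
     hodge_metric W Q (chart F w)
       (quot_rep W (chart F w) p (s j w)) (quot_rep W (chart F w) p (s i w))"

text \<open>Inverse of an \<open>r \<times> r\<close> matrix indexed by \<open>{..<r}\<close>.\<close>

definition inv_mat :: "nat \<Rightarrow> (nat \<Rightarrow> nat \<Rightarrow> complex) \<Rightarrow> nat \<Rightarrow> nat \<Rightarrow> complex" where
  "inv_mat r A =
     (THE B. (\<forall>i j. i \<ge> r \<or> j \<ge> r \<longrightarrow> B i j = 0) \<and>
             (\<forall>i<r. \<forall>j<r. (\<Sum>k<r. A i k * B k j) = (if i = j then 1 else 0)))"

text \<open>The Wirtinger derivatives \<open>\<partial>\<^sub>u\<close> and \<open>cnj \<partial>\<^sub>u\<close> in the direction \<open>u\<close>.\<close>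

definition del :: "complex ^ 'n ^ 'n \<Rightarrow> (complex ^ 'n ^ 'n \<Rightarrow> complex) \<Rightarrow> complex ^ 'n ^ 'n \<Rightarrow> complex" where
  "del u f w =
     (vector_derivative (\<lambda>t::real. f (w + t *\<^sub>R u)) (at 0)
      - \<i> * vector_derivative (\<lambda>t::real. f (w + t *\<^sub>R scale_mat \<i> u)) (at 0)) / 2"

definition del_bar :: "complex ^ 'n ^ 'n \<Rightarrow> (complex ^ 'n ^ 'n \<Rightarrow> complex) \<Rightarrow> complex ^ 'n ^ 'n \<Rightarrow> complex" where
  "del_bar u f w =
     (vector_derivative (\<lambda>t::real. f (w + t *\<^sub>R u)) (at 0)
      + \<i> * vector_derivative (\<lambda>t::real. f (w + t *\<^sub>R scale_mat \<i> u)) (at 0)) / 2"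

text \<open>The connection matrix \<open>\<theta> = h\<^sup>-\<^sup>1 \<partial>h\<close>, evaluated on the constant coordinate field \<open>u\<close>.\<close>

definition frame_theta ::
    "(int \<Rightarrow> (real ^ 'n) set) \<Rightarrow> (int \<Rightarrow> real ^ 'n \<Rightarrow> real ^ 'n \<Rightarrow> real) \<Rightarrow>
     (int \<Rightarrow> (complex ^ 'n) set) \<Rightarrow> int \<Rightarrow> nat \<Rightarrow> (nat \<Rightarrow> complex ^ 'n ^ 'n \<Rightarrow> complex ^ 'n) \<Rightarrow>
     complex ^ 'n ^ 'n \<Rightarrow> complex ^ 'n ^ 'n \<Rightarrow> nat \<Rightarrow> nat \<Rightarrow> complex" where
  "frame_theta W Q F p r s u w i j =
     (\<Sum>k<r. inv_mat r (frame_gram W Q F p s w) i k * del u (\<lambda>w. frame_gram W Q F p s w k j) w)"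

text \<open>
  The matrix of \<open>(cnj \<partial> \<theta>)(u, cnj v)\<close> at \<open>F\<close>.  The sign comes from
  \<open>cnj \<partial> (a dz) = (cnj \<partial> a) \<and> dz\<close>, whose value on \<open>(u, cnj v)\<close> is \<open>- dz(u) \<cdot> cnj \<partial>\<^sub>v a\<close>.
\<close>

definition frame_curvature ::
    "(int \<Rightarrow> (real ^ 'n) set) \<Rightarrow> (int \<Rightarrow> real ^ 'n \<Rightarrow> real ^ 'n \<Rightarrow> real) \<Rightarrow>
     (int \<Rightarrow> (complex ^ 'n) set) \<Rightarrow> int \<Rightarrow> nat \<Rightarrow> (nat \<Rightarrow> complex ^ 'n ^ 'n \<Rightarrow> complex ^ 'n) \<Rightarrow>
     complex ^ 'n ^ 'n \<Rightarrow> complex ^ 'n ^ 'n \<Rightarrow> nat \<Rightarrow> nat \<Rightarrow> complex" where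
  "frame_curvature W Q F p r s u v i j =
     - del_bar v (\<lambda>w. frame_theta W Q F p r s u w i j) 0"

text \<open>
  \<open>hodge_curvature W Q hn F p u v\<close> is \<open>R(u, cnj v)\<close> at \<open>F\<close> as an endomorphism of \<open>U\<^sup>p\<close> (its values
  off \<open>U\<^sup>p\<close> are irrelevant): in every local holomorphic frame its matrix, with respect to the
  basis of \<open>U\<^sup>p\<close> given by the frame at \<open>F\<close>, is \<open>frame_curvature\<close>.
\<close>

definition hodge_curvature ::
    "(int \<Rightarrow> (real ^ 'n) set) \<Rightarrow> (int \<Rightarrow> real ^ 'n \<Rightarrow> real ^ 'n \<Rightarrow> real) \<Rightarrow> (int \<Rightarrow> int \<Rightarrow> nat) \<Rightarrow>
     (int \<Rightarrow> (complex ^ 'n) set) \<Rightarrow> int \<Rightarrow> complex ^ 'n ^ 'n \<Rightarrow> complex ^ 'n ^ 'n \<Rightarrow>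
     complex ^ 'n \<Rightarrow> complex ^ 'n" where
  "hodge_curvature W Q hn F p u v x =
     (THE y. \<forall>r s c. local_frame W Q hn F p r s \<longrightarrow>
               x = (\<Sum>j<r. c j *s quot_rep W F p (s j 0)) \<longrightarrow>
               y = (\<Sum>i<r. (\<Sum>j<r. frame_curvature W Q F p r s u v i j * c j)
                             *s quot_rep W F p (s i 0)))"

end

theory Submission
  imports Defs "HOL-Complex_Analysis.Complex_Analysis" "HOL-Real_Asymp.Real_Asymp"
begin

text \<open>
  For small \<open>w\<close> in \<open>\<qq>\<^sub>F\<close> put \<open>g = e\<^sup>-\<^sup>w e\<^sup>w'\<close> with \<open>w'\<close> the conjugate of \<open>w\<close>, and choose \<open>y\<close> in
  \<open>\<nn>\<^sub>+\<close> such that \<open>(1 + y) g\<close> has no component in \<open>\<nn>\<^sub>+\<close>; this linear equation is a small perturbation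
  of \<open>y = 0\<close>. Then \<open>\<gamma> = e\<^sup>w (1 + y)\<^sup>-\<^sup>1\<close> carries the Deligne bigrading of \<open>F\<close> to that of \<open>e\<^sup>w F\<close>: it
  preserves \<open>W\<close>, maps \<open>F\<close> to \<open>e\<^sup>w F\<close>, and \<open>\<gamma>\<^sup>-\<^sup>1\<close> times the conjugate of \<open>\<gamma>\<close> has only components of
  bidegree \<open>(0, 0)\<close> and in \<open>\<Lambda>\<close>. Hence in the frame \<open>e\<^sup>w b\<^sub>j\<close>, with \<open>b\<^sub>j\<close> a basis of \<open>U\<^sup>p\<close>, the metric
  of \<open>F\<^sup>p / F\<^sup>p\<^sup>+\<^sup>1\<close> is \<open>N = X\<^sup>* K\<^sup>* X\<close>, where \<open>X = 1 + \<Pi>' y \<Pi>'\<close> and \<open>K\<close> is the \<open>(0, 0)\<close> component of the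
  conjugate of the one of \<open>(1 + y) g\<close>. To second order \<open>y\<close> and \<open>K\<close> are given by \<open>w\<close>, \<open>w'\<close> and their bracket, and
  the curvature at \<open>w = 0\<close> is the product of the \<open>v\<close>-antiholomorphic and \<open>u\<close>-holomorphic derivatives of \<open>N\<close>
  minus the mixed derivative. The two terms in \<open>\<gg>\<^sup>0\<^sup>,\<^sup>0\<close> of the asserted expression are equal, because
  the adjoint acts there as minus the conjugation.
\<close>

subsection \<open>Complex conjugation, matrices and forms\<close>

text \<open>The obstacle is that e^w is not real: it moves F to the right place, but not the
  conjugate filtration, and g measures the defect. A factor 1 + y may be inserted because bidegrees
  (a, b) with a >= 0 and a + b <= 0 preserve both F and W. Writing 1 + y and not an exponential
  makes the equation for y linear, at the price that 1 + y is no isometry of the forms. On gr^W,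
  however, y strictly raises the first index, so the first Hodge-Riemann relation removes its
  contribution. Killing the n_+ component restricts only the first index of the bidegrees of gam^-1
  times the conjugate of gam; the second index is restricted because the inverse of this
  endomorphism is its own conjugate. The curvature is defined through arbitrary frames, whose
  holomorphy is only pointwise complex differentiability, so their mixed second derivatives come
  from Cauchy estimates. The implicitly defined y is differentiated to second order by hand, along
  pairs of real lines, and the Wirtinger coefficients are read off from the dependence on the
  directions.\<close>

lemma cnj_vec_add: "cnj_vec (x + y) = cnj_vec x + cnj_vec y"
  and cnj_vec_diff: "cnj_vec (x - y) = cnj_vec x - cnj_vec y"
  and cnj_vec_minus: "cnj_vec (- x) = - cnj_vec x"
  and cnj_vec_scale: "cnj_vec (c *s x) = cnj c *s cnj_vec x"
  by (simp_all add: cnj_vec_def vec_eq_iff)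

lemma cnj_vec_zero [simp]: "cnj_vec 0 = 0"
  by (simp add: cnj_vec_def vec_eq_iff)

lemma cnj_vec_cnj [simp]: "cnj_vec (cnj_vec x) = x"
  by (simp add: cnj_vec_def vec_eq_iff)

lemma cnj_vec_eq_iff [simp]: "cnj_vec x = cnj_vec y \<longleftrightarrow> x = y"
  by (metis cnj_vec_cnj)

lemma cnj_mat_mult_vec: "cnj_vec (A *v x) = cnj_mat A *v cnj_vec x"
  by (simp add: cnj_vec_def cnj_mat_def vec_eq_iff matrix_vector_mult_def)

lemma cnj_mat_mult: "cnj_mat (A ** B) = cnj_mat A ** cnj_mat B"
  by (simp add: cnj_mat_def vec_eq_iff matrix_matrix_mult_def)

lemma cnj_mat_cnj [simp]: "cnj_mat (cnj_mat A) = A"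
  by (simp add: cnj_mat_def vec_eq_iff)

lemma cnj_mat_add: "cnj_mat (A + B) = cnj_mat A + cnj_mat B"
  and cnj_mat_diff: "cnj_mat (A - B) = cnj_mat A - cnj_mat B"
  and cnj_mat_minus: "cnj_mat (- A) = - cnj_mat A"
  and cnj_mat_scale: "cnj_mat (scale_mat c A) = scale_mat (cnj c) (cnj_mat A)"
  and cnj_mat_scaleR: "cnj_mat (r *\<^sub>R A) = r *\<^sub>R cnj_mat A"
  by (simp_all add: cnj_mat_def scale_mat_def vec_eq_iff)

lemma cnj_mat_one [simp]: "cnj_mat (mat 1) = mat 1"
  and cnj_mat_zero [simp]: "cnj_mat 0 = 0"
  by (simp_all add: cnj_mat_def vec_eq_iff mat_def)

lemma cnj_mat_commutator: "cnj_mat (commutator A B) = commutator (cnj_mat A) (cnj_mat B)"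
  by (simp add: commutator_def cnj_mat_diff cnj_mat_mult)

lemma linear_cnj_mat: "linear cnj_mat"
  by (rule linearI) (simp_all add: cnj_mat_add cnj_mat_scaleR)

lemma matrix_add_rdistrib: "(A + B) ** C = A ** C + B ** (C::'a::ring_1^'n^'m)"
  by (vector matrix_matrix_mult_def sum.distrib algebra_simps)

lemma matrix_diff_ldistrib: "A ** (B - C) = A ** B - A ** (C::'a::ring_1^'n^'m)"
  by (vector matrix_matrix_mult_def sum_subtractf algebra_simps)

lemma matrix_diff_rdistrib: "(A - B) ** C = A ** C - B ** (C::'a::ring_1^'n^'m)"
  by (vector matrix_matrix_mult_def sum_subtractf algebra_simps)

lemma matrix_minus_left: "(- A) ** C = - (A ** (C::'a::ring_1^'n^'m))"
  and matrix_minus_right: "A ** (- C) = - (A ** C)"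
  by (vector matrix_matrix_mult_def sum_negf)+

lemma matrix_zero_right [simp]: "A ** 0 = (0::'a::ring_1^'n^'m)"
  by (vector matrix_matrix_mult_def)

lemma matrix_sum_left: "(\<Sum>i\<in>I. f i) ** C = (\<Sum>i\<in>I. f i ** (C::'a::ring_1^'n^'m))"
  by (induction I rule: infinite_finite_induct) (auto simp: matrix_add_rdistrib)

lemma matrix_sum_right: "A ** (\<Sum>i\<in>I. f i) = (\<Sum>i\<in>I. A ** (f i::'a::ring_1^'n^'m))"
  by (induction I rule: infinite_finite_induct) (auto simp: matrix_add_ldistrib)

lemma matrix_vector_sum_left: "(\<Sum>i\<in>I. f i) *v (x::'a::ring_1^'n) = (\<Sum>i\<in>I. f i *v x)"
  by (induction I rule: infinite_finite_induct) (auto simp: matrix_vector_mult_add_rdistrib)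

lemma matrix_vector_sum_right: "A *v (\<Sum>i\<in>I. f i) = (\<Sum>i\<in>I. A *v (f i::'a::ring_1^'n))"
  by (induction I rule: infinite_finite_induct) (auto simp: matrix_vector_right_distrib)

lemma matrix_vector_minus_left: "(- A) *v (x::'a::ring_1^'n) = - (A *v x)"
  and matrix_vector_minus_right: "A *v (- x) = - (A *v x)"
  by (vector matrix_vector_mult_def sum_negf)+

lemma matrix_vector_scale: "A *v (c *s x) = c *s (A *v (x::complex^'n))"
  by (vector matrix_vector_mult_def sum_distrib_left algebra_simps)

lemma matrix_eqI: "(\<And>x. A *v x = B *v (x::'a::semiring_1^'n)) \<Longrightarrow> A = B"
  by (simp add: matrix_eq)

lemma scale_mat_mult_vec: "scale_mat c A *v x = c *s (A *v x)"
  by (simp add: scale_mat_def vec_eq_iff matrix_vector_mult_def sum_distrib_left mult.assoc)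

lemma scale_mat_mult_left: "scale_mat c A ** B = scale_mat c (A ** B)"
  by (simp add: scale_mat_def vec_eq_iff matrix_matrix_mult_def sum_distrib_left mult.assoc)

lemma scale_mat_mult_right: "A ** scale_mat c B = scale_mat c (A ** B)"
  by (simp add: scale_mat_def vec_eq_iff matrix_matrix_mult_def sum_distrib_left algebra_simps)

lemma scale_mat_add: "scale_mat c (A + B) = scale_mat c A + scale_mat c B"
  and scale_mat_diff: "scale_mat c (A - B) = scale_mat c A - scale_mat c B"
  and scale_mat_minus: "scale_mat c (- A) = - scale_mat c A"
  and scale_mat_minus_left: "scale_mat (- c) A = - scale_mat c A"
  and scale_mat_add_left: "scale_mat (c + d) A = scale_mat c A + scale_mat d A"
  and scale_mat_scale: "scale_mat c (scale_mat d A) = scale_mat (c * d) A"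
  and scale_mat_scaleR: "scale_mat c (r *\<^sub>R A) = r *\<^sub>R scale_mat c A"
  and scale_mat_zero [simp]: "scale_mat c 0 = 0"
  and scale_mat_zero_left [simp]: "scale_mat 0 A = 0"
  and scale_mat_one [simp]: "scale_mat 1 A = A"
  by (simp_all add: scale_mat_def vec_eq_iff algebra_simps)

lemma scale_mat_of_real: "scale_mat (of_real r) A = r *\<^sub>R A"
  by (simp add: scale_mat_def vec_eq_iff) (simp add: scaleR_conv_of_real)

lemma scale_mat_sum: "scale_mat c (\<Sum>i\<in>A. f i) = (\<Sum>i\<in>A. scale_mat c (f i))"
  by (induction A rule: infinite_finite_induct) (auto simp: scale_mat_add)

lemma linear_scale_mat: "linear (scale_mat c)"
  by (rule linearI) (simp_all add: scale_mat_add scale_mat_scaleR)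

lemma scaleR_eq_scale: "r *\<^sub>R (x::complex^'n) = of_real r *s x"
  by (simp add: vec_eq_iff) (simp add: scaleR_conv_of_real)

lemma matrix_scaleR_left: "(r *\<^sub>R A) ** B = r *\<^sub>R (A ** (B::complex^'n^'n))"
  and matrix_scaleR_right: "A ** (r *\<^sub>R B) = r *\<^sub>R (A ** (B::complex^'n^'n))"
  for A B :: "complex^'n^'n"
  by (simp_all add: scale_mat_of_real[symmetric] scale_mat_mult_left scale_mat_mult_right)

lemma bounded_bilinear_matrix_mult: "bounded_bilinear ((**) :: complex^'n^'n \<Rightarrow> complex^'n^'n \<Rightarrow> complex^'n^'n)"
  unfolding bilinear_conv_bounded_bilinear[symmetric] bilinear_def
  by (auto intro!: linearI simp: matrix_add_ldistrib matrix_add_rdistrib matrix_scaleR_left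
      matrix_scaleR_right)

lemma bounded_bilinear_matrix_vector_mult:
  "bounded_bilinear ((*v) :: complex^'n^'n \<Rightarrow> complex^'n \<Rightarrow> complex^'n)"
  unfolding bilinear_conv_bounded_bilinear[symmetric] bilinear_def
  by (auto intro!: linearI simp: matrix_vector_right_distrib matrix_vector_mult_add_rdistrib
      scale_mat_of_real[symmetric] scale_mat_mult_vec scaleR_eq_scale matrix_vector_scale)

lemma cplx_form_add_left: "bilinear B \<Longrightarrow> cplx_form B (x + y) z = cplx_form B x z + cplx_form B y z"
  and cplx_form_add_right: "bilinear B \<Longrightarrow> cplx_form B z (x + y) = cplx_form B z x + cplx_form B z y"
proof -
  have *: "re_vec (x + y) = re_vec x + re_vec y" "im_vec (x + y) = im_vec x + im_vec y" for x y :: "complex^'n"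
    by (simp_all add: re_vec_def im_vec_def vec_eq_iff)
  show "bilinear B \<Longrightarrow> cplx_form B (x + y) z = cplx_form B x z + cplx_form B y z"
    "bilinear B \<Longrightarrow> cplx_form B z (x + y) = cplx_form B z x + cplx_form B z y"
    by (simp_all add: cplx_form_def complex_eq_iff * bilinear_ladd bilinear_radd)
qed

lemma cplx_form_scale_left: "bilinear B \<Longrightarrow> cplx_form B (c *s x) z = c * cplx_form B x z"
  and cplx_form_scale_right: "bilinear B \<Longrightarrow> cplx_form B z (c *s x) = c * cplx_form B z x"
proof -
  have *: "re_vec (c *s x) = Re c *\<^sub>R re_vec x - Im c *\<^sub>R im_vec x"
     "im_vec (c *s x) = Re c *\<^sub>R im_vec x + Im c *\<^sub>R re_vec x" for x :: "complex^'n"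
    by (simp_all add: re_vec_def im_vec_def vec_eq_iff)
  show "bilinear B \<Longrightarrow> cplx_form B (c *s x) z = c * cplx_form B x z"
    "bilinear B \<Longrightarrow> cplx_form B z (c *s x) = c * cplx_form B z x"
    by (simp_all add: cplx_form_def complex_eq_iff * bilinear_ladd bilinear_radd bilinear_lsub
      bilinear_rsub bilinear_lmul bilinear_rmul algebra_simps)
qed

lemma re_im_cnj: "re_vec (cnj_vec x) = re_vec x" "im_vec (cnj_vec x) = - im_vec x"
  by (simp_all add: re_vec_def im_vec_def cnj_vec_def vec_eq_iff)

lemma cplx_form_cnj: "bilinear B \<Longrightarrow> cplx_form B (cnj_vec x) (cnj_vec y) = cnj (cplx_form B x y)"
  by (simp add: cplx_form_def re_im_cnj complex_eq_iff bilinear_lneg bilinear_rneg)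

lemma cplx_form_zero_left [simp]: "bilinear B \<Longrightarrow> cplx_form B 0 z = 0"
  and cplx_form_zero_right [simp]: "bilinear B \<Longrightarrow> cplx_form B z 0 = 0"
  using cplx_form_scale_left[of B 0 0 z] cplx_form_scale_right[of B z 0 0] by simp_all

lemma cplx_form_diff_left: "bilinear B \<Longrightarrow> cplx_form B (x - y) z = cplx_form B x z - cplx_form B y z"
  using cplx_form_add_left[of B "x - y" y z] by simp

lemma cplx_form_diff_right: "bilinear B \<Longrightarrow> cplx_form B z (x - y) = cplx_form B z x - cplx_form B z y"
  using cplx_form_add_right[of B z "x - y" y] by simp

lemma cplx_form_sum_left: "bilinear B \<Longrightarrow> cplx_form B (\<Sum>i\<in>A. f i) z = (\<Sum>i\<in>A. cplx_form B (f i) z)"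
  by (induction A rule: infinite_finite_induct) (auto simp: cplx_form_add_left)

lemma cplx_form_sum_right: "bilinear B \<Longrightarrow> cplx_form B z (\<Sum>i\<in>A. f i) = (\<Sum>i\<in>A. cplx_form B z (f i))"
  by (induction A rule: infinite_finite_induct) (auto simp: cplx_form_add_right)

lemma bounded_bilinear_cplx_form:
  assumes "bilinear B" shows "bounded_bilinear (cplx_form B :: complex^'n \<Rightarrow> _)"
  unfolding bilinear_conv_bounded_bilinear[symmetric] bilinear_def
  using assms
  by (auto intro!: linearI simp: cplx_form_add_left cplx_form_add_right
      scaleR_eq_scale cplx_form_scale_left cplx_form_scale_right)  (simp_all add: scaleR_conv_of_real)

lemma cplx_space_subspace:
  assumes "subspace S" shows "vec.subspace (cplx_space S)"
proof -
  have *: "re_vec (x + y) = re_vec x + re_vec y" "im_vec (x + y) = im_vec x + im_vec y"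
    "re_vec (c *s x) = Re c *\<^sub>R re_vec x - Im c *\<^sub>R im_vec x"
     "im_vec (c *s x) = Re c *\<^sub>R im_vec x + Im c *\<^sub>R re_vec x"
     "re_vec 0 = (0::real^'n)" "im_vec 0 = (0::real^'n)" for x y :: "complex^'n" and c
    by (simp_all add: re_vec_def im_vec_def vec_eq_iff)
  show ?thesis using assms
    by (auto simp: vec.subspace_def cplx_space_def * subspace_0 intro: subspace_add subspace_diff subspace_scale)
qed

lemma cplx_space_cnj:
  assumes "subspace S" "x \<in> cplx_space S" shows "cnj_vec x \<in> cplx_space S"
  using assms by (auto simp: cplx_space_def re_im_cnj subspace_neg)

lemma vec_subspace_cnj:
  assumes "vec.subspace S" shows "vec.subspace (cnj_vec ` S)"
proof -
  have "\<exists>z\<in>S. c *s cnj_vec y = cnj_vec z" if "y \<in> S" for c y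
    by (rule bexI[of _ "cnj c *s y"]) (auto simp: cnj_vec_scale vec.subspace_scale assms that)
  then show ?thesis
    using assms unfolding vec.subspace_def
    by (auto simp: image_iff) (metis cnj_vec_zero, metis cnj_vec_add)
qed

lemma mem_cnj_image: "x \<in> cnj_vec ` S \<longleftrightarrow> cnj_vec x \<in> S"
  by (metis cnj_vec_cnj image_iff)

lemma vec_subspace_plus:
  assumes "vec.subspace S" "vec.subspace T" shows "vec.subspace (S + T :: ('a::field^'n) set)"
proof -
  have "S + T = {x + y |x y. x \<in> S \<and> y \<in> T}" by (auto simp: set_plus_def)
  then show ?thesis using vec.subspace_sums[OF assms] by simp
qed

lemma vec_span_union_plus:
  "vec.span (A \<union> B) = vec.span A + (vec.span B :: ('a::field^'n) set)"
  unfolding vec.span_Un by (auto simp: set_plus_def)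

subsection \<open>Existence of the Deligne bigrading\<close>

locale weights =
  fixes W :: "int \<Rightarrow> (real ^ 'n) set"
  assumes weight: "weight_filtration W"
begin

lemma W_subspace: "subspace (W k)"
  using weight by (simp add: weight_filtration_def)

lemma WC_subspace: "vec.subspace (WC W k)"
  by (rule cplx_space_subspace[OF W_subspace])

lemma WC_mono: "j \<le> k \<Longrightarrow> WC W j \<subseteq> WC W k"
  using weight by (auto simp: weight_filtration_def mono_def cplx_space_def)

lemma WC_cnj: "x \<in> WC W k \<Longrightarrow> cnj_vec x \<in> WC W k"
  by (rule cplx_space_cnj[OF W_subspace])

lemma WC_zero: "\<exists>a. \<forall>k\<le>a. WC W k = {0}"
proof -
  obtain a where a: "W a = {0}" using weight by (auto simp: weight_filtration_def)
  have "WC W a = {0}"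
  proof -
    have "x = 0" if "re_vec x = 0" "im_vec x = 0" for x :: "complex^'n"
      using that by (simp add: vec_eq_iff re_vec_def im_vec_def complex_eq_iff)
    moreover have "re_vec (0::complex^'n) = 0" "im_vec (0::complex^'n) = 0"
      by (simp_all add: vec_eq_iff re_vec_def im_vec_def)
    ultimately show ?thesis by (auto simp: cplx_space_def a)
  qed
  then show ?thesis using WC_mono vec.subspace_0[OF WC_subspace] by blast
qed

lemma WC_UNIV: "\<exists>b. WC W b = UNIV"
proof -
  obtain b where "W b = UNIV" using weight by (auto simp: weight_filtration_def)
  then have "WC W b = UNIV" by (auto simp: cplx_space_def)
  then show ?thesis by blast
qed

end

lemma set_plusI: "a \<in> A \<Longrightarrow> b \<in> B \<Longrightarrow> x = a + b \<Longrightarrow> x \<in> A + B"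
  by (simp add: set_plus_intro)

lemmas vsub = vec.subspace_add vec.subspace_diff vec.subspace_neg vec.subspace_0 vec.subspace_scale

text \<open>For k = p + q this is the bracket in Deligne's closed formula: I^{p,q} is the
  intersection of F^p, W_k and the sum of conj F^q cap W_k with all conj F^{q-j+1} cap W_{k-j}, j >=
  2. The sum is encoded as the span of a union.\<close>

definition deligne_co ::
    "(int \<Rightarrow> (real ^ 'n) set) \<Rightarrow> (int \<Rightarrow> (complex ^ 'n) set) \<Rightarrow> int \<Rightarrow> int \<Rightarrow> (complex ^ 'n) set" where
  "deligne_co W F q k = vec.span ((cnj_vec ` F q \<inter> WC W k) \<union>
     (\<Union>j\<in>{2..}. cnj_vec ` F (q - j + 1) \<inter> WC W (k - j)))"

definition deligne_formula ::
    "(int \<Rightarrow> (real ^ 'n) set) \<Rightarrow> (int \<Rightarrow> (complex ^ 'n) set) \<Rightarrow> int \<Rightarrow> int \<Rightarrow> (complex ^ 'n) set" where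
  "deligne_formula W F p q = F p \<inter> WC W (p + q) \<inter> deligne_co W F q (p + q)"

lemma cnj_image_swap: "A \<subseteq> cnj_vec ` B \<Longrightarrow> cnj_vec ` A \<subseteq> B"
  by auto

locale mhs = weights +
  fixes F :: "int \<Rightarrow> (complex ^ 'n) set"
  assumes mhs: "mixed_hodge_structure W F"
begin

abbreviation "I \<equiv> deligne_formula W F"
abbreviation "Z \<equiv> deligne_co W F"
abbreviation "G p \<equiv> cnj_vec ` F p"

lemma F_subspace: "vec.subspace (F p)"
  and F_anti: "p \<le> q \<Longrightarrow> F q \<subseteq> F p"
  and F_UNIV: "\<exists>a. F a = UNIV"
  and F_zero: "\<exists>b. \<forall>p\<ge>b. F p = {0}"
proof -
  have h: "hodge_filtration F" using mhs by (simp add: mixed_hodge_structure_def)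
  show sub: "vec.subspace (F p)" for p using h by (simp add: hodge_filtration_def)
  show anti: "p \<le> q \<Longrightarrow> F q \<subseteq> F p" for p q using h by (auto simp: hodge_filtration_def antimono_def)
  show "\<exists>a. F a = UNIV" using h by (auto simp: hodge_filtration_def)
  obtain b where "F b = {0}" using h by (auto simp: hodge_filtration_def)
  then show "\<exists>b. \<forall>p\<ge>b. F p = {0}" using anti vec.subspace_0[OF sub] by blast
qed

lemma G_subspace: "vec.subspace (G p)"
  by (rule vec_subspace_cnj[OF F_subspace])

lemma G_anti: "p \<le> q \<Longrightarrow> G q \<subseteq> G p"
  using F_anti by blast

text \<open>Opposedness of the two filtrations on gr_k, pulled back to representatives; the weight k
  - 1 errors of both summands are collected in w.\<close>

lemma gr_split:
  assumes "x \<in> WC W k"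
  shows "\<exists>f g w. f \<in> F p \<inter> WC W k \<and> g \<in> G (k - p + 1) \<inter> WC W k \<and> w \<in> WC W (k - 1) \<and> x = f + g + w"
proof -
  have "x \<in> gr_filtration W F k p + cnj_vec ` gr_filtration W F k (k - p + 1)"
    using assms mhs by (simp add: mixed_hodge_structure_def)
  then obtain f w g w' where *: "f \<in> F p \<inter> WC W k" "w \<in> WC W (k - 1)"
      "g \<in> F (k - p + 1) \<inter> WC W k" "w' \<in> WC W (k - 1)" "x = (f + w) + cnj_vec (g + w')"
    by (auto simp: gr_filtration_def set_plus_def)
  show ?thesis
    apply (rule exI[of _ f], rule exI[of _ "cnj_vec g"], rule exI[of _ "w + cnj_vec w'"])
    using * by (auto simp: cnj_vec_add intro!: vsub WC_subspace WC_cnj)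
qed

text \<open>In gr_m the spaces F^a and conj F^b meet in 0 as soon as a + b > m. The descents to
  lower weight below rest on this criterion.\<close>

lemma gr_inter:
  assumes x: "x \<in> WC W m" and f: "f \<in> F a" "x - f \<in> WC W (m - 1)"
    and g: "g \<in> G b" "x - g \<in> WC W (m - 1)" and ab: "a + b \<ge> m + 1"
  shows "x \<in> WC W (m - 1)"
proof -
  have sub: "WC W (m - 1) \<subseteq> WC W m" by (rule WC_mono) simp
  have "f = x - (x - f)" "g = x - (x - g)" by simp_all
  then have fm: "f \<in> WC W m" "g \<in> WC W m" using x f(2) g(2) sub vsub(2)[OF WC_subspace] by (metis subsetD)+
  have 1: "x \<in> gr_filtration W F m a"
    unfolding gr_filtration_def using f fm by (intro set_plusI[of f _ "x - f"]) auto
  have gF: "cnj_vec g \<in> F (m - a + 1)" using g(1) F_anti[of "m - a + 1" b] ab by auto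
  have "cnj_vec x \<in> gr_filtration W F m (m - a + 1)"
    unfolding gr_filtration_def using gF fm WC_cnj[OF fm(2)] WC_cnj[OF g(2)]
    by (intro set_plusI[of "cnj_vec g" _ "cnj_vec (x - g)"]) (auto simp: cnj_vec_diff)
  then have 2: "x \<in> cnj_vec ` gr_filtration W F m (m - a + 1)" by (simp add: mem_cnj_image)
  show ?thesis using 1 2 mhs unfolding mixed_hodge_structure_def by blast
qed

section \<open>Deligne's formula modulo lower weights\<close>

lemma Z_subspace: "vec.subspace (Z q k)"
  unfolding deligne_co_def by (rule vec.subspace_span)

lemma I_subspace: "vec.subspace (I p q)"
  unfolding deligne_formula_def by (intro vec.subspace_inter F_subspace WC_subspace Z_subspace)

text \<open>Modulo weight k - i - 1 the generators with j > i vanish, and those with j <= i lie in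
  conj F^{q-i+1}, since their index q - j + 1 is at least as large.\<close>

lemma Z_mod:
  assumes "z \<in> Z q k" "i \<ge> 1"
  shows "\<exists>g\<in>G (q - i + 1). z - g \<in> WC W (k - i - 1)"
proof -
  have "Z q k \<subseteq> G (q - i + 1) + WC W (k - i - 1)"
    unfolding deligne_co_def
  proof (rule vec.span_minimal)
    show "vec.subspace (G (q - i + 1) + WC W (k - i - 1))"
      by (intro vec_subspace_plus G_subspace WC_subspace)
    have g: "G a \<subseteq> G (q - i + 1) + WC W (k - i - 1)" if "a \<ge> q - i + 1" for a
      using G_anti[OF that] vsub(4)[OF WC_subspace] by (auto simp: set_plus_def) force
    have w: "WC W a \<subseteq> G (q - i + 1) + WC W (k - i - 1)" if "a \<le> k - i - 1" for a
      using WC_mono[OF that] vsub(4)[OF G_subspace] by (auto simp: set_plus_def) force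
    have "G (q - j + 1) \<inter> WC W (k - j) \<subseteq> G (q - i + 1) + WC W (k - i - 1)" for j
      using g[of "q - j + 1"] w[of "k - j"] by (cases "j \<le> i") auto
    then show "G q \<inter> WC W k \<union> (\<Union>j\<in>{2..}. G (q - j + 1) \<inter> WC W (k - j))
        \<subseteq> G (q - i + 1) + WC W (k - i - 1)"
      using g[of q] assms(2) by auto
  qed
  then have "z \<in> G (q - i + 1) + WC W (k - i - 1)" using assms(1) by (rule subsetD)
  then obtain g w where "g \<in> G (q - i + 1)" "w \<in> WC W (k - i - 1)" "z = g + w"
    by (rule set_plus_elim)
  then show ?thesis by (intro bexI[of _ g]) simp_all
qed

lemma Z_mod0:
  assumes "z \<in> Z q k" shows "\<exists>g\<in>G q. z - g \<in> WC W (k - 1)"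
  using Z_mod[OF assms, of 1] WC_mono[of "k - 2" "k - 1"] by auto

text \<open>This makes I^{p,q} inject into gr_{p+q}. An x in W_m with m = p + q - 1 - n lies in F^p
  and, modulo W_{m-1}, in conj F^{q-n}; as p + (q - n) = m + 1 is just enough for
  \<open>gr_inter\<close>, x falls into W_{m-1}, and finally into 0.\<close>

lemma I_meet_lower:
  assumes "x \<in> I p q" "x \<in> WC W (p + q - 1)" shows "x = 0"
proof -
  have step: "x \<in> WC W (p + q - 1 - int n)" for n
  proof (induction n)
    case (Suc n)
    define m where "m = p + q - 1 - int n"
    define i where "i = int n + 1"
    have "x \<in> Z q (p + q)" using assms by (simp add: deligne_formula_def)
    then obtain g where g: "g \<in> G (q - i + 1)" "x - g \<in> WC W (p + q - i - 1)"
      using Z_mod[of x q "p+q" i] by (auto simp: i_def)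
    have "x \<in> WC W (m - 1)"
    proof (rule gr_inter)
      show "x \<in> WC W m" using Suc by (simp add: m_def)
      show "x \<in> F p" using assms by (simp add: deligne_formula_def)
      show "x - x \<in> WC W (m - 1)" using vsub(4)[OF WC_subspace] by simp
      show "g \<in> G (q - i + 1)" by fact
      show "x - g \<in> WC W (m - 1)" using g by (simp add: m_def i_def algebra_simps)
    qed (simp add: m_def i_def)
    then show ?case by (simp add: m_def algebra_simps)
  qed (use assms in simp)
  obtain a where a: "\<forall>k\<le>a. WC W k = {0}" using WC_zero by blast
  have "x \<in> WC W (p + q - 1 - int (nat (p + q - 1 - a)))" by (rule step)
  moreover have "p + q - 1 - int (nat (p + q - 1 - a)) \<le> a" by simp
  ultimately show ?thesis using a by blast
qed

text \<open>Successive approximation: y in F^p and z in \<open>Z q k\<close> agree modulo ever lower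
  weight. The difference is split by opposedness; y absorbs the part in F^p and z the conjugate
  part, and the class in gr_k never changes.\<close>

lemma I_lift:
  assumes x: "x \<in> F p" "x \<in> WC W (p + q)" and g: "g \<in> G q" "x - g \<in> WC W (p + q - 1)"
  shows "\<exists>i\<in>I p q. x - i \<in> WC W (p + q - 1)"
proof -
  define k where "k = p + q"
  have mono: "WC W (k - 1) \<subseteq> WC W k" by (rule WC_mono) simp
  have step: "\<exists>y z. y \<in> F p \<and> z \<in> Z q k \<and> y - z \<in> WC W (k - 1 - int n) \<and> x - y \<in> WC W (k - 1)" for n
  proof (induction n)
    case 0
    have "g = x - (x - g)" by simp
    then have "g \<in> WC W k" using x g mono vsub(2)[OF WC_subspace] unfolding k_def by (metis subsetD)
    then have "g \<in> Z q k" unfolding deligne_co_def using g by (intro vec.span_base) auto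
    then show ?case using x g vsub(4)[OF WC_subspace] by (intro exI[of _ x] exI[of _ g]) (auto simp: k_def)
  next
    case (Suc n)
    then obtain y z where yz: "y \<in> F p" "z \<in> Z q k" "y - z \<in> WC W (k - 1 - int n)" "x - y \<in> WC W (k - 1)"
      by blast
    obtain a b w where abw: "a \<in> F p \<inter> WC W (k - 1 - int n)"
      "b \<in> G (k - 1 - int n - p + 1) \<inter> WC W (k - 1 - int n)" "w \<in> WC W (k - 1 - int n - 1)"
      "y - z = a + b + w"
      using gr_split[OF yz(3), of p] by blast
    \<comment> \<open>At n = 0 the correction lies in conj F^q and is a generator of the first kind;
      for n >= 1 it is one with j = n + 1. Hence the range j >= 2 in the formula.\<close>
    have b: "b \<in> Z q k"
    proof (cases "n = 0")
      case True
      then have "b \<in> G q \<inter> WC W k" using abw(2) mono by (auto simp: k_def)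
      then show ?thesis unfolding deligne_co_def by (intro vec.span_base) auto
    next
      case False
      have "b \<in> G (q - (int n + 1) + 1) \<inter> WC W (k - (int n + 1))" using abw(2) by (simp add: k_def algebra_simps)
      then show ?thesis unfolding deligne_co_def using False
        by (intro vec.span_base) (auto intro!: bexI[of _ "int n + 1"])
    qed
    have "WC W (k - 1 - int n) \<subseteq> WC W (k - 1)" by (rule WC_mono) simp
    then have a: "a \<in> WC W (k - 1)" using abw by auto
    have "y - a \<in> F p" "z + b \<in> Z q k" using yz abw b by (auto intro!: vsub F_subspace Z_subspace)
    moreover have "(y - a) - (z + b) = w" using abw(4) by (simp add: algebra_simps)
    moreover have "x - (y - a) = (x - y) + a" by simp
    then have "x - (y - a) \<in> WC W (k - 1)" using yz a vsub(1)[OF WC_subspace] by metis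
    ultimately show ?case using abw(3) by (intro exI[of _ "y - a"] exI[of _ "z + b"]) (simp add: algebra_simps)
  qed
  obtain c where c: "\<forall>k\<le>c. WC W k = {0}" using WC_zero by blast
  obtain y z where yz: "y \<in> F p" "z \<in> Z q k" "y - z \<in> WC W (k - 1 - int (nat (k - 1 - c)))" "x - y \<in> WC W (k - 1)"
    using step by blast
  have "k - 1 - int (nat (k - 1 - c)) \<le> c" by simp
  then have "y = z" using yz(3) c by auto
  have "y = x - (x - y)" by simp
  then have "y \<in> WC W k" using x yz(4) mono vsub(2)[OF WC_subspace] unfolding k_def by (metis subsetD)
  then have "y \<in> I p q" using yz \<open>y = z\<close> by (simp add: deligne_formula_def k_def)
  then show ?thesis using yz(4) by (auto simp: k_def)
qed

section \<open>The filtrations as direct sums of the spaces \<open>I a b\<close>\<close>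

definition Isum :: "(int \<times> int) set \<Rightarrow> (complex^'n) set" where
  "Isum R = vec.span (\<Union>(a, b)\<in>R. I a b)"

lemma Isum_subspace: "vec.subspace (Isum R)"
  by (simp add: Isum_def)

lemma Isum_base: "(a, b) \<in> R \<Longrightarrow> x \<in> I a b \<Longrightarrow> x \<in> Isum R"
  unfolding Isum_def by (rule vec.span_base) auto

lemma Isum_mono: "R \<subseteq> R' \<Longrightarrow> Isum R \<subseteq> Isum R'"
  unfolding Isum_def by (rule vec.span_mono) auto

lemma Isum_least:
  assumes "\<And>a b. (a, b) \<in> R \<Longrightarrow> I a b \<subseteq> S" "vec.subspace S" shows "Isum R \<subseteq> S"
  unfolding Isum_def using assms by (intro vec.span_minimal) auto

text \<open>Induction on k upwards from the vanishing of W and, inside it, on p downwards from the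
  vanishing of F. Splitting gr_k with index p + 1 leaves, besides a part in F^{p+1}, a class in F^p
  and conj F^{k-p}; \<open>I_lift\<close> represents it in I^{p,k-p}, and the remainder has lower
  weight.\<close>

lemma FW_subset: "F p \<inter> WC W k \<subseteq> Isum {(a, b). a \<ge> p \<and> a + b \<le> k}"
proof -
  obtain c where c: "\<forall>k\<le>c. WC W k = {0}" using WC_zero by blast
  obtain b where b: "\<forall>p\<ge>b. F p = {0}" using F_zero by blast
  have "\<forall>p. F p \<inter> WC W k \<subseteq> Isum {(a, b). a \<ge> p \<and> a + b \<le> k}"
  proof (induction "nat (k - c)" arbitrary: k rule: less_induct)
    case (less k)
    show ?case
    proof (cases "k \<le> c")
      case True
      then show ?thesis using c vsub(4)[OF Isum_subspace] by auto
    next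
      case False
      have IH: "F p \<inter> WC W (k - 1) \<subseteq> Isum {(a, b). a \<ge> p \<and> a + b \<le> k - 1}" for p
        using less[of "k - 1"] False by auto
      have "F p \<inter> WC W k \<subseteq> Isum {(a, b). a \<ge> p \<and> a + b \<le> k}" for p
      proof (induction "nat (b - p)" arbitrary: p rule: less_induct)
        case (less p)
        show ?case
        proof (cases "p \<ge> b")
          case True
          then show ?thesis using b vsub(4)[OF Isum_subspace] by auto
        next
          case False
          have IH2: "F (p + 1) \<inter> WC W k \<subseteq> Isum {(a, b). a \<ge> p + 1 \<and> a + b \<le> k}"
            using less[of "p + 1"] False by auto
          show ?thesis
          proof
            fix x assume x: "x \<in> F p \<inter> WC W k"
            then obtain f g w where fgw: "f \<in> F (p + 1) \<inter> WC W k" "g \<in> G (k - (p + 1) + 1) \<inter> WC W k"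
              "w \<in> WC W (k - 1)" "x = f + g + w" using gr_split[of x k "p + 1"] by blast
            have f: "f \<in> F p" using fgw F_anti[of p "p + 1"] by auto
            have xf: "x - f \<in> F p" "x - f \<in> WC W k"
              using x f fgw(1) vsub(2)[OF F_subspace] vsub(2)[OF WC_subspace] by blast+
            have "\<exists>i\<in>I p (k - p). (x - f) - i \<in> WC W (p + (k - p) - 1)"
            proof (rule I_lift)
              show "x - f \<in> F p" "x - f \<in> WC W (p + (k - p))" using xf by simp_all
              show "g \<in> G (k - p)" using fgw by simp
              show "x - f - g \<in> WC W (p + (k - p) - 1)" using fgw by simp
            qed
            then obtain i where i: "i \<in> I p (k - p)" "x - f - i \<in> WC W (k - 1)" by auto
            have "x - f - i \<in> F p" using x f i by (auto simp: deligne_formula_def intro!: vsub(2)[OF F_subspace])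
            then have "x - f - i \<in> Isum {(a, b). a \<ge> p \<and> a + b \<le> k}"
              using IH[of p] i(2) Isum_mono[of "{(a, b). a \<ge> p \<and> a + b \<le> k - 1}" "{(a, b). a \<ge> p \<and> a + b \<le> k}"]
              by fastforce
            moreover have "f \<in> Isum {(a, b). a \<ge> p \<and> a + b \<le> k}"
              using IH2 fgw(1) Isum_mono[of "{(a, b). a \<ge> p + 1 \<and> a + b \<le> k}" "{(a, b). a \<ge> p \<and> a + b \<le> k}"] by fastforce
            moreover have "i \<in> Isum {(a, b). a \<ge> p \<and> a + b \<le> k}"
              by (rule Isum_base[OF _ i(1)]) simp
            ultimately have "(x - f - i) + f + i \<in> Isum {(a, b). a \<ge> p \<and> a + b \<le> k}"
              by (meson vsub(1) Isum_subspace)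
            then show "x \<in> Isum {(a, b). a \<ge> p \<and> a + b \<le> k}" by simp
          qed
        qed
      qed
      then show ?thesis by blast
    qed
  qed
  then show ?thesis by blast
qed

lemma FW_eq: "F p \<inter> WC W k = Isum {(a, b). a \<ge> p \<and> a + b \<le> k}"
proof
  show "Isum {(a, b). a \<ge> p \<and> a + b \<le> k} \<subseteq> F p \<inter> WC W k"
    by (rule Isum_least)
      (auto simp: deligne_formula_def intro: F_anti[THEN subsetD] WC_mono[THEN subsetD] vec.subspace_inter F_subspace WC_subspace)
qed (rule FW_subset)

lemma F_eq: "F p = Isum {(a, b). a \<ge> p}"
proof
  obtain k where "WC W k = UNIV" using WC_UNIV by blast
  then show "F p \<subseteq> Isum {(a, b). a \<ge> p}"
    using FW_subset[of p k] Isum_mono[of "{(a, b). a \<ge> p \<and> a + b \<le> k}" "{(a, b). a \<ge> p}"] by auto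
  show "Isum {(a, b). a \<ge> p} \<subseteq> F p"
    by (rule Isum_least) (use F_anti in \<open>auto simp: deligne_formula_def intro!: F_subspace\<close>)
qed

lemma W_eq: "WC W k = Isum {(a, b). a + b \<le> k}"
proof
  obtain p where "F p = UNIV" using F_UNIV by blast
  then show "WC W k \<subseteq> Isum {(a, b). a + b \<le> k}"
    using FW_subset[of p k] Isum_mono[of "{(a, b). a \<ge> p \<and> a + b \<le> k}" "{(a, b). a + b \<le> k}"] by auto
  show "Isum {(a, b). a + b \<le> k} \<subseteq> WC W k"
    by (rule Isum_least) (use WC_mono in \<open>auto simp: deligne_formula_def intro!: WC_subspace\<close>)
qed

lemma Isum_UNIV: "Isum UNIV = UNIV"
proof -
  obtain p where "F p = UNIV" using F_UNIV by blast
  then show ?thesis using F_eq[of p] Isum_mono[of "{(a, b). a \<ge> p}" UNIV] by auto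
qed

text \<open>In a vanishing sum take the largest weight k and, within it, the smallest first index m.
  The other terms lie in F^{m+1} + W_{k-1}, while the chosen term lies in conj F^{k-m} modulo
  W_{k-1}. Opposedness gives it lower weight, so it is 0.\<close>

lemma I_independent:
  assumes fin: "finite A" and c: "\<And>a b. (a, b) \<in> A \<Longrightarrow> c a b \<in> I a b"
    and s: "(\<Sum>(a, b)\<in>A. c a b) = 0" and ab: "(a, b) \<in> A"
  shows "c a b = 0"
proof (rule ccontr)
  assume ne: "c a b \<noteq> 0"
  define B where "B = {(a, b)\<in>A. c a b \<noteq> 0}"
  have finB: "finite B" unfolding B_def by (rule finite_subset[OF _ fin]) auto
  have "(\<Sum>(a, b)\<in>B. c a b) = (\<Sum>(a, b)\<in>A. c a b)"
    unfolding B_def by (rule sum.mono_neutral_left) (auto simp: fin)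
  then have sB: "(\<Sum>(a, b)\<in>B. c a b) = 0" using s by simp
  have neB: "B \<noteq> {}" using ne ab by (auto simp: B_def)
  define k where "k = Max ((\<lambda>(a, b). a + b) ` B)"
  have kmax: "a' + b' \<le> k" if "(a', b') \<in> B" for a' b'
    unfolding k_def by (rule Max_ge) (use that finB in \<open>auto simp: image_iff intro!: bexI[of _ "(a', b')"]\<close>)
  define Bk where "Bk = {a. (a, k - a) \<in> B}"
  have "k \<in> (\<lambda>(a, b). a + b) ` B" unfolding k_def using finB neB by (intro Max_in) auto
  then have neBk: "Bk \<noteq> {}" by (auto simp: Bk_def image_iff) (metis add_diff_cancel_left')
  have "Bk \<subseteq> fst ` B" by (force simp: Bk_def image_iff)
  then have finBk: "finite Bk" using finB by (meson finite_imageI finite_subset)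
  define m where "m = Min Bk"
  have mB: "(m, k - m) \<in> B" using Min_in[OF finBk neBk] by (auto simp: m_def Bk_def)
  have mmin: "m \<le> a'" if "(a', k - a') \<in> B" for a' unfolding m_def using finBk that by (intro Min_le) (auto simp: Bk_def)
  define x where "x = c m (k - m)"
  have xI: "x \<in> I m (k - m)" using mB c by (auto simp: x_def B_def)
  define B1 where "B1 = {(a, b)\<in>B. a + b = k \<and> a > m}"
  define B2 where "B2 = {(a, b)\<in>B. a + b < k}"
  have "(a, b) = (m, k - m) \<or> a + b = k \<and> a > m \<or> a + b < k" if "(a, b) \<in> B" for a b
    using kmax[OF that] mmin[of a] that by (cases "b = k - a") auto
  then have "B = insert (m, k - m) (B1 \<union> B2)" using mB
    unfolding B1_def B2_def by blast
  moreover have "(m, k - m) \<notin> B1 \<union> B2" "B1 \<inter> B2 = {}" by (auto simp: B1_def B2_def)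
  moreover have "finite B1" "finite B2" using finB by (auto simp: B1_def B2_def intro: finite_subset[of _ B])
  ultimately have *: "x + ((\<Sum>(a, b)\<in>B1. c a b) + (\<Sum>(a, b)\<in>B2. c a b)) = 0"
    using sB by (simp add: x_def sum.union_disjoint)
  have 1: "(\<Sum>(a, b)\<in>B1. c a b) \<in> F (m + 1)"
  proof (rule vec.subspace_sum[OF F_subspace])
    fix ab assume "ab \<in> B1"
    then obtain a b where ab: "ab = (a, b)" "(a, b) \<in> A" "m + 1 \<le> a" by (auto simp: B1_def B_def)
    then have "c a b \<in> F a" using c by (auto simp: deligne_formula_def)
    then show "(case ab of (a, b) \<Rightarrow> c a b) \<in> F (m + 1)" using F_anti[OF ab(3)] ab(1) by auto
  qed
  have 2: "(\<Sum>(a, b)\<in>B2. c a b) \<in> WC W (k - 1)"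
  proof (rule vec.subspace_sum[OF WC_subspace])
    fix ab assume "ab \<in> B2"
    then obtain a b where ab: "ab = (a, b)" "(a, b) \<in> A" "a + b \<le> k - 1" by (auto simp: B2_def B_def)
    then have "c a b \<in> WC W (a + b)" using c by (auto simp: deligne_formula_def)
    then show "(case ab of (a, b) \<Rightarrow> c a b) \<in> WC W (k - 1)" using WC_mono[OF ab(3)] ab(1) by auto
  qed
  have "x \<in> WC W (k - 1)"
  proof -
    have zx: "x \<in> Z (k - m) k" and xk: "x \<in> WC W k" using xI by (auto simp: deligne_formula_def)
    obtain g where g: "g \<in> G (k - m)" "x - g \<in> WC W (k - 1)" using Z_mod0[OF zx] by blast
    show ?thesis
    proof (rule gr_inter[OF xk _ _ g])
      show "- (\<Sum>(a, b)\<in>B1. c a b) \<in> F (m + 1)" using 1 by (rule vsub(3)[OF F_subspace])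
      have "x - - (\<Sum>(a, b)\<in>B1. c a b) = - (\<Sum>(a, b)\<in>B2. c a b)" using * by (simp add: eq_neg_iff_add_eq_0 algebra_simps)
      then show "x - - (\<Sum>(a, b)\<in>B1. c a b) \<in> WC W (k - 1)" using vsub(3)[OF WC_subspace 2] by simp
    qed simp
  qed
  then have "x = 0" using I_meet_lower[OF xI] by simp
  then show False using mB by (auto simp: x_def B_def)
qed

lemma I_span_sum:
  assumes "x \<in> Isum R"
  shows "\<exists>A c. finite A \<and> A \<subseteq> R \<and> (\<forall>a b. c a b \<in> I a b) \<and> x = (\<Sum>(a, b)\<in>A. c a b)"
proof -
  \<comment> \<open>Vanishing off \<open>A\<close> is demanded so that two families can be added
    over the union of their index sets.\<close>
  define T where "T = {x. \<exists>A c. finite A \<and> A \<subseteq> R \<and> (\<forall>a b. c a b \<in> I a b \<and> ((a, b) \<notin> A \<longrightarrow> c a b = 0)) \<and> x = (\<Sum>(a, b)\<in>A. c a b)}"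
  have "Isum R \<subseteq> T"
  proof (rule Isum_least)
    fix a b assume ab: "(a, b) \<in> R"
    show "I a b \<subseteq> T"
    proof
      fix x assume "x \<in> I a b"
      then show "x \<in> T" unfolding T_def mem_Collect_eq using ab vsub(4)[OF I_subspace]
        by (intro exI[of _ "{(a, b)}"] exI[of _ "\<lambda>a' b'. if (a', b') = (a, b) then x else 0"]) auto
    qed
  next
    show "vec.subspace T"
    proof (rule vec.subspaceI)
      show "0 \<in> T" unfolding T_def mem_Collect_eq using vsub(4)[OF I_subspace]
        by (intro exI[of _ "{}"] exI[of _ "\<lambda>a b. 0"]) auto
      fix x y assume "x \<in> T" "y \<in> T"
      obtain A c where 1: "finite A" "A \<subseteq> R" "\<And>a b. c a b \<in> I a b" "\<And>a b. (a, b) \<notin> A \<Longrightarrow> c a b = 0" "x = (\<Sum>(a, b)\<in>A. c a b)"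
        using \<open>x \<in> T\<close> unfolding T_def by blast
      obtain A' c' where 2: "finite A'" "A' \<subseteq> R" "\<And>a b. c' a b \<in> I a b" "\<And>a b. (a, b) \<notin> A' \<Longrightarrow> c' a b = 0" "y = (\<Sum>(a, b)\<in>A'. c' a b)"
        using \<open>y \<in> T\<close> unfolding T_def by blast
      have x: "x = (\<Sum>(a, b)\<in>A \<union> A'. c a b)" unfolding 1(5) using 1 2(1) by (intro sum.mono_neutral_left) auto
      have y: "y = (\<Sum>(a, b)\<in>A \<union> A'. c' a b)" unfolding 2(5) using 2 1(1) by (intro sum.mono_neutral_left) auto
      show "x + y \<in> T" unfolding T_def mem_Collect_eq
        apply (rule exI[of _ "A \<union> A'"], rule exI[of _ "\<lambda>a b. c a b + c' a b"])
        using 1(1-4) 2(1-4) by (auto simp: x y sum.distrib case_prod_unfold intro!: vsub I_subspace)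
    next
      fix r x assume "x \<in> T"
      then obtain A c where *: "finite A" "A \<subseteq> R" "\<And>a b. c a b \<in> I a b" "\<And>a b. (a, b) \<notin> A \<Longrightarrow> c a b = 0" "x = (\<Sum>(a, b)\<in>A. c a b)"
        unfolding T_def by blast
      show "r *s x \<in> T" unfolding T_def mem_Collect_eq
        apply (rule exI[of _ A], rule exI[of _ "\<lambda>a b. r *s c a b"])
        using * by (auto simp: vec.scale_sum_right case_prod_unfold intro!: vsub I_subspace)
    qed
  qed
  then have "x \<in> T" using assms by blast
  then show ?thesis unfolding T_def by blast
qed

lemma I_decomposition: "\<exists>!c. is_decomposition I x c"
proof -
  have "x \<in> Isum UNIV" using Isum_UNIV by simp
  then obtain A c0 where A: "finite A" "\<And>a b. c0 a b \<in> I a b" "x = (\<Sum>(a, b)\<in>A. c0 a b)"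
    using I_span_sum[of x UNIV] by blast
  define c where "c a b = (if (a, b) \<in> A then c0 a b else 0)" for a b
  have sub: "{(a, b). c a b \<noteq> 0} \<subseteq> A" by (auto simp: c_def)
  have "x = (\<Sum>(a, b)\<in>A. c a b)" unfolding A(3) by (rule sum.cong) (auto simp: c_def)
  also have "\<dots> = (\<Sum>(a, b)\<in>{(a, b). c a b \<noteq> 0}. c a b)"
    by (rule sum.mono_neutral_right) (use sub A in auto)
  finally have "is_decomposition I x c"
    using finite_subset[OF sub A(1)] A(2) vsub(4)[OF I_subspace] by (auto simp: is_decomposition_def c_def)
  moreover have "c = d" if c: "is_decomposition I x c" and d: "is_decomposition I x d" for c d
  proof (rule ccontr)
    assume "c \<noteq> d"
    then obtain a b where ab: "c a b \<noteq> d a b" by (meson ext)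
    define B where "B = {(a, b). c a b \<noteq> 0} \<union> {(a, b). d a b \<noteq> 0}"
    have finB: "finite B" using c d by (auto simp: B_def is_decomposition_def)
    have 1: "x = (\<Sum>(a, b)\<in>B. c a b)"
      using c finB unfolding is_decomposition_def by (auto simp: B_def intro!: sum.mono_neutral_left)
    have 2: "x = (\<Sum>(a, b)\<in>B. d a b)"
      using d finB unfolding is_decomposition_def by (auto simp: B_def intro!: sum.mono_neutral_left)
    have "(\<Sum>(a, b)\<in>B. c a b - d a b) = 0" using 1 2 by (simp add: case_prod_unfold sum_subtractf)
    moreover have "(a, b) \<in> B" using ab by (auto simp: B_def)
    ultimately have "c a b - d a b = 0"
      using I_independent[of B "\<lambda>a b. c a b - d a b" a b] finB c d
      by (auto simp: is_decomposition_def intro!: vsub I_subspace)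
    then show False using ab by simp
  qed
  ultimately show ?thesis by blast
qed

section \<open>Complex conjugation of the bigrading\<close>

lemma Isum_Un: "Isum (R \<union> R') = Isum R + Isum R'"
  unfolding Isum_def UN_Un by (rule vec_span_union_plus)

lemma Isum_single: "Isum {(a, b)} = I a b"
  unfolding Isum_def by (simp add: vec.span_eq_iff[THEN iffD2] I_subspace)

text \<open>The conjugated generators lie in F^q cap W_{p+q} or in F^{q-j+1} cap W_{p+q-j}. In the
  second case a >= q - j + 1 and a + b <= p + q - j together force b < p.\<close>

lemma cnj_Z_subset: "cnj_vec ` Z q (p + q) \<subseteq> Isum {(a, b). a \<ge> q \<and> a + b \<le> p + q \<or> a < q \<and> b < p}"
proof -
  let ?R = "{(a, b). a \<ge> q \<and> a + b \<le> p + q \<or> a < q \<and> b < p}"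
  have "Z q (p + q) \<subseteq> cnj_vec ` Isum ?R"
    unfolding deligne_co_def
  proof (rule vec.span_minimal)
    show "vec.subspace (cnj_vec ` Isum ?R)" by (rule vec_subspace_cnj[OF Isum_subspace])
    have *: "F a \<inter> WC W m \<subseteq> Isum ?R" if "{(c, b). a \<le> c \<and> c + b \<le> m} \<subseteq> ?R" for a m
      using FW_subset[of a m] Isum_mono[OF that] by blast
    have 1: "F q \<inter> WC W (p + q) \<subseteq> Isum ?R" by (rule *) auto
    have 2: "F (q - j + 1) \<inter> WC W (p + q - j) \<subseteq> Isum ?R" if "j \<ge> 2" for j
      by (rule *) (use that in auto)
    show "G q \<inter> WC W (p + q) \<union> (\<Union>j\<in>{2..}. G (q - j + 1) \<inter> WC W (p + q - j)) \<subseteq> cnj_vec ` Isum ?R"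
    proof -
      have c: "G a \<inter> WC W m \<subseteq> cnj_vec ` Isum ?R" if "F a \<inter> WC W m \<subseteq> Isum ?R" for a m
      proof
        fix x assume "x \<in> G a \<inter> WC W m"
        then have "cnj_vec x \<in> F a \<inter> WC W m" using WC_cnj by (auto simp: mem_cnj_image)
        then show "x \<in> cnj_vec ` Isum ?R" using that unfolding mem_cnj_image by (rule rev_subsetD)
      qed
      show ?thesis
        by (intro Un_least UN_least c 1 2) simp
    qed
  qed
  then show ?thesis by (rule cnj_image_swap)
qed

abbreviation "lower q p \<equiv> {(a, b). a < q \<and> b < p} :: (int \<times> int) set"

text \<open>By \<open>cnj_Z_subset\<close> the conjugate of x is z + l + r, where r collects the
  unwanted types in \<open>R2\<close>. A descent shows r = 0: it lies in F^q and, being cnj x - z -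
  l, is congruent in each weight to an element of conj F^d with d large enough for
  \<open>gr_inter\<close>.\<close>

lemma I_cnj:
  assumes x: "x \<in> I p q"
  shows "cnj_vec x \<in> I q p + Isum (lower q p)"
proof -
  define k where "k = p + q"
  define R2 where "R2 = {(a, b). a \<ge> q \<and> b < p \<and> a + b \<le> k}"
  have "cnj_vec x \<in> Isum {(a, b). a \<ge> q \<and> a + b \<le> p + q \<or> a < q \<and> b < p}"
    using cnj_Z_subset[of q p] x by (auto simp: deligne_formula_def)
  also have "{(a, b). a \<ge> q \<and> a + b \<le> p + q \<or> a < q \<and> b < p} = {(q, p)} \<union> lower q p \<union> R2"
    by (auto simp: R2_def k_def)
  also have "Isum \<dots> = I q p + Isum (lower q p) + Isum R2"
    by (simp only: Isum_Un Isum_single)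
  finally obtain z l r where zlr: "z \<in> I q p" "l \<in> Isum (lower q p)" "r \<in> Isum R2" "cnj_vec x = z + l + r"
    by (elim set_plus_elim) blast
  have rFq: "r \<in> F q" and rW: "r \<in> WC W k"
    using zlr(3) FW_eq[of q k] Isum_mono[of R2 "{(a, b). a \<ge> q \<and> a + b \<le> k}"] by (auto simp: R2_def)
  have xG: "cnj_vec x \<in> G p" using x by (auto simp: deligne_formula_def)
  have zZ: "z \<in> Z p k" using zlr(1) by (simp add: deligne_formula_def k_def add.commute)
  \<comment> \<open>In weight m an element of type (a, b) is congruent to one of conj F^{m-a}, and a
    < q puts this inside conj F^{m-q+1}.\<close>
  have lG: "\<exists>g\<in>G (m - q + 1). l - g \<in> WC W (m - 1)" for m
  proof -
    have "Isum (lower q p) \<subseteq> G (m - q + 1) + WC W (m - 1)"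
    proof (rule Isum_least)
      fix a b assume ab: "(a, b) \<in> lower q p"
      show "I a b \<subseteq> G (m - q + 1) + WC W (m - 1)"
      proof
        fix y assume y: "y \<in> I a b"
        show "y \<in> G (m - q + 1) + WC W (m - 1)"
        proof (cases "a + b \<le> m - 1")
          case True
          then have "y \<in> WC W (m - 1)" using y WC_mono[OF True] by (auto simp: deligne_formula_def)
          then show ?thesis by (intro set_plusI[of 0 _ y] vsub(4)[OF G_subspace]) auto
        next
          case False
          have "y \<in> Z b (a + b)" using y by (simp add: deligne_formula_def)
          then obtain g where g: "g \<in> G (b - (a + b - m + 1) + 1)" "y - g \<in> WC W (a + b - (a + b - m + 1) - 1)"
            using Z_mod[of y b "a + b" "a + b - m + 1"] False by auto
          have "g \<in> G (m - q + 1)" using G_anti[of "m - q + 1" "b - (a + b - m + 1) + 1"] g(1) ab by auto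
          moreover have "y - g \<in> WC W (m - 1)"
            using WC_mono[of "a + b - (a + b - m + 1) - 1" "m - 1"] g(2) by auto
          ultimately show ?thesis by (intro set_plusI[of g _ "y - g"]) auto
        qed
      qed
    qed (intro vec_subspace_plus G_subspace WC_subspace)
    then have "l \<in> G (m - q + 1) + WC W (m - 1)" using zlr(2) by (rule subsetD)
    then obtain g w where "g \<in> G (m - q + 1)" "w \<in> WC W (m - 1)" "l = g + w"
      by (rule set_plus_elim)
    then show ?thesis by (intro bexI[of _ g]) simp_all
  qed
  have key: "r \<in> WC W (m - 1)"
    if rm: "r \<in> WC W m" and f: "f \<in> F c" "r - f \<in> WC W (m - 1)" and i: "d \<le> p" "d \<le> m - q + 1" "c + d \<ge> m + 1"
      and z: "\<exists>g\<in>G d. z - g \<in> WC W (m - 1)" for m f c d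
  proof -
    obtain gz where gz: "gz \<in> G d" "z - gz \<in> WC W (m - 1)" using z by blast
    obtain gl where gl: "gl \<in> G (m - q + 1)" "l - gl \<in> WC W (m - 1)" using lG by blast
    have "cnj_vec x \<in> G d" "gl \<in> G d" using xG gl(1) G_anti[OF i(1)] G_anti[OF i(2)] by blast+
    then have g: "cnj_vec x - gz - gl \<in> G d" using gz(1) by (intro vsub(2)[OF G_subspace])
    have "r - (cnj_vec x - gz - gl) = - ((z - gz) + (l - gl))" using zlr(4) by (simp add: algebra_simps)
    moreover have "- ((z - gz) + (l - gl)) \<in> WC W (m - 1)"
      by (rule vsub(3)[OF WC_subspace vsub(1)[OF WC_subspace gz(2) gl(2)]])
    ultimately have w: "r - (cnj_vec x - gz - gl) \<in> WC W (m - 1)" by metis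
    show ?thesis by (rule gr_inter[OF rm f g w i(3)])
  qed
  have step: "r \<in> WC W (k - 1 - int n)" for n
  proof (induction n)
    case 0
    \<comment> \<open>The start needs F^{q+1} in place of F^q, because the conjugate side only
      offers the index p and the sum has to reach k + 1. It is available since types in
      \<open>R2\<close> with first index q have weight below k.\<close>
    have "R2 \<subseteq> {(a, b). a \<ge> q + 1} \<union> {(a, b). a + b \<le> k - 1}" by (auto simp: R2_def k_def)
    then have "r \<in> Isum ({(a, b). a \<ge> q + 1} \<union> {(a, b). a + b \<le> k - 1})"
      using zlr(3) by (rule subsetD[OF Isum_mono])
    then have "r \<in> F (q + 1) + WC W (k - 1)"
      by (simp only: F_eq W_eq Isum_Un)
    then obtain f w where fw: "f \<in> F (q + 1)" "w \<in> WC W (k - 1)" "r = f + w" by (rule set_plus_elim)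
    have "r \<in> WC W (k - 1)"
      by (rule key[of k f "q + 1" p]) (use rW fw Z_mod0[OF zZ] in \<open>auto simp: k_def\<close>)
    then show ?case by simp
  next
    case (Suc n)
    have "r \<in> WC W (k - 1 - int n - 1)"
    proof (rule key[of _ r q "p - int n"])
      show "\<exists>g\<in>G (p - int n). z - g \<in> WC W (k - 1 - int n - 1)"
        using Z_mod[OF zZ, of "int n + 1"] by (simp add: algebra_simps)
    qed (use Suc rFq vsub(4)[OF WC_subspace] in \<open>auto simp: k_def\<close>)
    then show ?case by (simp add: algebra_simps)
  qed
  obtain a where a: "\<forall>k\<le>a. WC W k = {0}" using WC_zero by blast
  have "r \<in> WC W (k - 1 - int (nat (k - 1 - a)))" by (rule step)
  moreover have "k - 1 - int (nat (k - 1 - a)) \<le> a" by simp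
  ultimately have "r = 0" using a by blast
  then show ?thesis using zlr by (auto intro: set_plusI)
qed

lemma lower_cnj: "cnj_vec ` Isum (lower p q) \<subseteq> Isum (lower q p)"
proof -
  have "Isum (lower p q) \<subseteq> cnj_vec ` Isum (lower q p)"
  proof (rule Isum_least)
    fix a b assume ab: "(a, b) \<in> lower p q"
    have "{(b, a)} \<union> lower b a \<subseteq> lower q p" using ab by auto
    then have "I b a + Isum (lower b a) \<subseteq> Isum (lower q p)"
      unfolding Isum_single[symmetric] Isum_Un[symmetric] by (rule Isum_mono)
    then have "cnj_vec x \<in> Isum (lower q p)" if "x \<in> I a b" for x
      using I_cnj[OF that] by (rule subsetD)
    then show "I a b \<subseteq> cnj_vec ` Isum (lower q p)"
      by (intro subsetI) (simp only: mem_cnj_image)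
  qed (rule vec_subspace_cnj[OF Isum_subspace])
  then show ?thesis by (rule cnj_image_swap)
qed

lemma I_cnj_eq: "cnj_vec ` I p q + Isum (lower q p) = I q p + Isum (lower q p)"
proof
  have a: "x + y \<in> A + Isum (lower q p)" if xy: "x \<in> A + Isum (lower q p)" "y \<in> Isum (lower q p)" for x y A
  proof -
    obtain u v where "u \<in> A" "v \<in> Isum (lower q p)" "x = u + v" using xy(1) by (elim set_plus_elim) blast
    then show ?thesis using xy(2) vsub(1)[OF Isum_subspace] by (intro set_plusI[of u _ "v + y"]) auto
  qed
  have b: "A + Isum (lower q p) \<subseteq> B + Isum (lower q p)" if "\<And>x. x \<in> A \<Longrightarrow> x \<in> B + Isum (lower q p)" for A B
  proof
    fix x assume "x \<in> A + Isum (lower q p)"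
    then obtain u v where uv: "u \<in> A" "v \<in> Isum (lower q p)" "x = u + v" by (rule set_plus_elim)
    then show "x \<in> B + Isum (lower q p)" using a[OF _ uv(2)] that by simp
  qed
  show "cnj_vec ` I p q + Isum (lower q p) \<subseteq> I q p + Isum (lower q p)"
    by (rule b) (use I_cnj in auto)
  have "z \<in> cnj_vec ` I p q + Isum (lower q p)" if z: "z \<in> I q p" for z
  proof -
    obtain i l where il: "i \<in> I p q" "l \<in> Isum (lower p q)" "cnj_vec z = i + l"
      using I_cnj[OF z] by (elim set_plus_elim) blast
    have "z = cnj_vec i + cnj_vec l" using il(3) by (metis cnj_vec_add cnj_vec_cnj)
    then show ?thesis using il lower_cnj by (intro set_plusI[of "cnj_vec i" _ "cnj_vec l"]) blast+
  qed
  then show "I q p + Isum (lower q p) \<subseteq> cnj_vec ` I p q + Isum (lower q p)"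
    by (rule b)
qed

lemma I_deligne: "is_deligne_bigrading W F I"
  unfolding is_deligne_bigrading_def
proof (intro conjI allI)
  show "F p = vec.span (\<Union>a\<in>{p..}. \<Union>b. I a b)" for p
  proof -
    have "(\<Union>a\<in>{p..}. \<Union>b. I a b) = (\<Union>(a, b)\<in>{(a, b). a \<ge> p}. I a b)" by auto
    then show ?thesis using F_eq[of p] by (simp add: Isum_def)
  qed
  show "WC W k = vec.span (\<Union>(a, b)\<in>{(a, b). a + b \<le> k}. I a b)" for k
    using W_eq[of k] by (simp add: Isum_def)
  show "cnj_vec ` I p q + vec.span (\<Union>a\<in>{..<q}. \<Union>b\<in>{..<p}. I a b) =
    I q p + vec.span (\<Union>a\<in>{..<q}. \<Union>b\<in>{..<p}. I a b)" for p q
  proof -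
    have "(\<Union>a\<in>{..<q}. \<Union>b\<in>{..<p}. I a b) = (\<Union>(a, b)\<in>lower q p. I a b)" by auto
    then show ?thesis using I_cnj_eq[of p q] by (simp add: Isum_def)
  qed
qed (rule I_subspace I_decomposition)+

section \<open>Uniqueness of the bigrading\<close>

lemma deligne_subset_formula:
  assumes J: "is_deligne_bigrading W F J"
  shows "J p q \<subseteq> I p q"
proof
  fix x assume x: "x \<in> J p q"
  have JF: "J a b \<subseteq> F a" and JW: "J a b \<subseteq> WC W (a + b)" for a b
  proof -
    have "F a = vec.span (\<Union>a\<in>{a..}. \<Union>b. J a b)" using J by (simp add: is_deligne_bigrading_def)
    moreover have "J a b \<subseteq> (\<Union>a\<in>{a..}. \<Union>b. J a b)" by auto
    ultimately show "J a b \<subseteq> F a" using vec.span_superset by blast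
    have "WC W (a + b) = vec.span (\<Union>(a', b')\<in>{(a', b'). a' + b' \<le> a + b}. J a' b')"
      using J by (simp add: is_deligne_bigrading_def)
    moreover have "J a b \<subseteq> (\<Union>(a', b')\<in>{(a', b'). a' + b' \<le> a + b}. J a' b')" by auto
    ultimately show "J a b \<subseteq> WC W (a + b)" using vec.span_superset by blast
  qed
  let ?L = "vec.span (\<Union>a\<in>{..<q}. \<Union>b\<in>{..<p}. J a b)"
  have "cnj_vec x + 0 \<in> cnj_vec ` J p q + ?L"
    using x vec.span_zero by (intro set_plus_intro) auto
  also have "\<dots> = J q p + ?L" using J by (simp add: is_deligne_bigrading_def)
  finally obtain z l where zl: "z \<in> J q p" "l \<in> ?L" "cnj_vec x = z + l"
    by (auto elim: set_plus_elim)
  \<comment> \<open>Conjugation turns z into a generator of the first kind of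
    \<open>Z q (p + q)\<close>, and a lower term of type (a, b) into one with j = q - a + 1, which
    is at least 2 because a < q; its weight a + b is small enough because b < p.\<close>
  have "z \<in> F q \<inter> WC W (p + q)" using zl(1) JF JW by (fastforce simp: add.commute)
  then have 1: "cnj_vec z \<in> Z q (p + q)"
    unfolding deligne_co_def using WC_cnj by (intro vec.span_base) auto
  have "?L \<subseteq> cnj_vec ` Z q (p + q)"
  proof (rule vec.span_minimal)
    show "vec.subspace (cnj_vec ` Z q (p + q))" by (rule vec_subspace_cnj[OF Z_subspace])
    show "(\<Union>a\<in>{..<q}. \<Union>b\<in>{..<p}. J a b) \<subseteq> cnj_vec ` Z q (p + q)"
    proof clarify
      fix a b y assume ab: "a < q" "b < p" "y \<in> J a b"
      have "y \<in> F a" "y \<in> WC W (a + b)" using ab JF JW by blast+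
      moreover have "a + b \<le> p + q - (q - a + 1)" using ab by simp
      ultimately have "cnj_vec y \<in> G (q - (q - a + 1) + 1) \<inter> WC W (p + q - (q - a + 1))"
        using WC_cnj WC_mono by (fastforce simp: mem_cnj_image)
      then have "cnj_vec y \<in> Z q (p + q)" unfolding deligne_co_def using ab
        by (intro vec.span_base UnI2 UN_I[of "q - a + 1"]) auto
      then show "y \<in> cnj_vec ` Z q (p + q)" by (simp add: mem_cnj_image)
    qed
  qed
  then have 2: "cnj_vec l \<in> Z q (p + q)" using zl(2) by (auto simp: mem_cnj_image)
  have "x = cnj_vec z + cnj_vec l" using zl(3) by (metis cnj_vec_add cnj_vec_cnj)
  then have "x \<in> Z q (p + q)" using vsub(1)[OF Z_subspace 1 2] by simp
  then show "x \<in> I p q" using x JF JW unfolding deligne_formula_def by blast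
qed

text \<open>One inclusion suffices: a decomposition in J is one in I, and decompositions in I are
  unique, so an element of I^{p,q} is its own component in J^{p,q}.\<close>

lemma deligne_unique:
  assumes J: "is_deligne_bigrading W F J"
  shows "J = I"
proof (intro ext set_eqI iffI)
  fix p q x assume "x \<in> J p q" then show "x \<in> I p q" using deligne_subset_formula[OF J] by blast
next
  fix p q x assume x: "x \<in> I p q"
  obtain c where c: "is_decomposition J x c" using J unfolding is_deligne_bigrading_def by blast
  then have "is_decomposition I x c"
    using deligne_subset_formula[OF J] unfolding is_decomposition_def by blast
  moreover define d where "d a b = (if (a, b) = (p, q) then x else 0)" for a b
  have sub: "{(a, b). d a b \<noteq> 0} \<subseteq> {(p, q)}" by (auto simp: d_def)
  have "(\<Sum>(a, b)\<in>{(a, b). d a b \<noteq> 0}. d a b) = (\<Sum>(a, b)\<in>{(p, q)}. d a b)"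
    by (rule sum.mono_neutral_left) (use sub in auto)
  then have "is_decomposition I x d"
    using x vsub(4)[OF I_subspace] finite_subset[OF sub] by (auto simp: is_decomposition_def d_def)
  ultimately have "c = d" using I_decomposition[of x] by blast
  then show "x \<in> J p q" using c by (auto simp: is_decomposition_def d_def split: if_splits)
qed

lemma deligne_eq: "deligne W F = I"
  unfolding deligne_def by (rule the_equality) (rule I_deligne, rule deligne_unique)

lemma deligne_bigrading: "is_deligne_bigrading W F (deligne W F)"
  unfolding deligne_eq by (rule I_deligne)

lemma deligne_eqI: "is_deligne_bigrading W F J \<Longrightarrow> deligne W F = J"
  unfolding deligne_eq by (rule deligne_unique[symmetric])

end

subsection \<open>Projections and graded endomorphisms\<close>

text \<open>Bidegrees are treated as elements of the group \<open>int \<times> int\<close>.\<close>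

declare split_paired_All [simp del] split_paired_Ex [simp del]

locale bigrading =
  fixes I :: "int \<Rightarrow> int \<Rightarrow> (complex ^ 'n) set"
  assumes I_sub: "vec.subspace (I p q)" and I_dec: "\<exists>!c. is_decomposition I x c"
begin

definition J :: "int \<times> int \<Rightarrow> (complex ^ 'n) set" where "J i = I (fst i) (snd i)"

lemma J_sub: "vec.subspace (J i)"
  by (simp add: J_def I_sub)

definition part :: "complex ^ 'n \<Rightarrow> int \<times> int \<Rightarrow> complex ^ 'n" where
  "part x i = (THE c. is_decomposition I x c) (fst i) (snd i)"

lemma partI:
  assumes "finite A" "\<And>i. c i \<in> J i" "\<And>i. i \<notin> A \<Longrightarrow> c i = 0" "x = (\<Sum>i\<in>A. c i)"
  shows "part x = c"
proof -
  have sub: "{(p, q). c (p, q) \<noteq> 0} \<subseteq> A" using assms by auto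
  have "x = (\<Sum>(p, q)\<in>A. c (p, q))" unfolding assms(4) by (rule sum.cong) auto
  also have "\<dots> = (\<Sum>(p, q)\<in>{(p, q). c (p, q) \<noteq> 0}. c (p, q))"
    by (rule sum.mono_neutral_right) (use sub assms in auto)
  finally have "x = (\<Sum>(p, q)\<in>{(p, q). c (p, q) \<noteq> 0}. c (p, q))" .
  moreover have "c (p, q) \<in> I p q" for p q using assms(2)[of "(p, q)"] by (simp add: J_def)
  ultimately have "is_decomposition I x (\<lambda>p q. c (p, q))"
    using finite_subset[OF sub assms(1)] unfolding is_decomposition_def by blast
  then have "(THE c. is_decomposition I x c) = (\<lambda>p q. c (p, q))" using I_dec[of x] by (rule the1_equality[rotated])
  then show ?thesis by (auto simp: part_def)
qed

lemma part_dec: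
  shows part_mem: "part x i \<in> J i" and part_finite: "finite {i. part x i \<noteq> 0}"
    and part_sum: "x = (\<Sum>i\<in>{i. part x i \<noteq> 0}. part x i)"
proof -
  have d: "is_decomposition I x (THE c. is_decomposition I x c)" by (rule theI'[OF I_dec])
  have e: "{i. part x i \<noteq> 0} = {(p, q). (THE c. is_decomposition I x c) p q \<noteq> 0}" by (auto simp: part_def)
  show "part x i \<in> J i" using d by (simp add: is_decomposition_def part_def J_def)
  show "finite {i. part x i \<noteq> 0}" using d unfolding e is_decomposition_def by blast
  have "x = (\<Sum>(p, q)\<in>{(p, q). (THE c. is_decomposition I x c) p q \<noteq> 0}. (THE c. is_decomposition I x c) p q)"
    using d unfolding is_decomposition_def by blast
  then show "x = (\<Sum>i\<in>{i. part x i \<noteq> 0}. part x i)" unfolding e by (simp add: part_def case_prod_unfold)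
qed

lemma part_sum': "finite A \<Longrightarrow> {i. part x i \<noteq> 0} \<subseteq> A \<Longrightarrow> x = (\<Sum>i\<in>A. part x i)"
  by (subst part_sum) (rule sum.mono_neutral_left, auto)

lemma part_add: "part (x + y) i = part x i + part y i"
proof -
  let ?A = "{i. part x i \<noteq> 0} \<union> {i. part y i \<noteq> 0}"
  have "part (x + y) = (\<lambda>i. part x i + part y i)"
  proof (rule partI)
    show "finite ?A" using part_finite by auto
    show "x + y = (\<Sum>i\<in>?A. part x i + part y i)"
      unfolding sum.distrib using part_sum'[of ?A x] part_sum'[of ?A y] part_finite by auto
  qed (auto intro: vsub(1)[OF J_sub] part_mem)
  then show ?thesis by simp
qed

lemma part_scale: "part (r *s x) i = r *s part x i"
proof -
  have "part (r *s x) = (\<lambda>i. r *s part x i)"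
  proof (rule partI)
    show "finite {i. part x i \<noteq> 0}" using part_finite by auto
    show "r *s x = (\<Sum>i\<in>{i. part x i \<noteq> 0}. r *s part x i)"
      by (subst part_sum) (simp add: vec.scale_sum_right)
  qed (auto intro: vsub(5)[OF J_sub] part_mem)
  then show ?thesis by simp
qed

definition Pm :: "int \<times> int \<Rightarrow> complex ^ 'n ^ 'n" where
  "Pm i = matrix (\<lambda>x. part x i)"

lemma Pm_part: "Pm i *v x = part x i"
  unfolding Pm_def by (rule matrix_works) (unfold_locales, auto simp: part_add part_scale vec.scale_right_distrib vec.scale_left_distrib)

lemma Pm_mem: "Pm i *v x \<in> J i"
  by (simp add: Pm_part part_mem)

lemma part_J: assumes "x \<in> J i" shows "part x = (\<lambda>j. if j = i then x else 0)"
  by (rule partI[of "{i}"]) (use assms vsub(4)[OF J_sub] in auto)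

lemma Pm_J: "x \<in> J j \<Longrightarrow> Pm i *v x = (if i = j then x else 0)"
  by (simp add: Pm_part part_J)

lemma Pm_mult: "Pm i ** Pm j = (if i = j then Pm j else 0)"
  by (rule matrix_eqI) (auto simp: matrix_vector_mul_assoc[symmetric] Pm_J[OF Pm_mem])

definition S :: "(int \<times> int) set" where "S = {i. J i \<noteq> {0}}"

lemma Pm_notin_S: "i \<notin> S \<Longrightarrow> Pm i = 0"
  using Pm_mem[of i] by (intro matrix_eqI) (auto simp: S_def)

text \<open>A nonzero summand must show up among the components of some standard basis vector, and
  each of these has finitely many.\<close>

lemma finite_S: "finite S"
proof -
  let ?A = "\<Union>j\<in>UNIV. {i. part (axis j 1) i \<noteq> 0}"
  have "S \<subseteq> ?A"
  proof
    fix i assume "i \<in> S"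
    then obtain x where x: "x \<in> J i" "x \<noteq> 0" using vsub(4)[OF J_sub, of i] unfolding S_def by blast
    have "x = Pm i *v x" using x by (simp add: Pm_J)
    also have "\<dots> = Pm i *v (\<Sum>j\<in>UNIV. x $ j *s axis j 1)" by (simp add: basis_expansion)
    also have "\<dots> = (\<Sum>j\<in>UNIV. x $ j *s part (axis j 1) i)"
      by (simp add: matrix_vector_sum_right matrix_vector_scale Pm_part)
    finally have "\<exists>j. part (axis j 1) i \<noteq> 0" using x(2) by (metis (mono_tags, lifting) sum.neutral vec.scale_zero_right)
    then show "i \<in> ?A" by auto
  qed
  moreover have "finite ?A" using part_finite by auto
  ultimately show ?thesis by (rule finite_subset)
qed

lemma Pm_sum: "(\<Sum>i\<in>S. Pm i) = mat 1"
proof (rule matrix_eqI)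
  fix x
  have "{i. part x i \<noteq> 0} \<subseteq> S" using Pm_notin_S by (force simp: Pm_part[symmetric])
  then show "(\<Sum>i\<in>S. Pm i) *v x = mat 1 *v x"
    using part_sum'[OF finite_S] by (simp add: matrix_vector_sum_left Pm_part)
qed

lemma vec_expand: "x = (\<Sum>i\<in>S. Pm i *v x)"
  using arg_cong[OF Pm_sum, of "\<lambda>A. A *v x"] by (simp add: matrix_vector_sum_left)

definition PP :: "(int \<times> int) set \<Rightarrow> complex ^ 'n ^ 'n" where "PP R = (\<Sum>i\<in>S \<inter> R. Pm i)"

lemma PP_Pm: "PP R ** Pm j = (if j \<in> R then Pm j else 0)"
proof -
  have "PP R ** Pm j = (\<Sum>i\<in>S \<inter> R. if i = j then Pm j else 0)"
    unfolding PP_def matrix_sum_left by (rule sum.cong) (auto simp: Pm_mult)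
  also have "\<dots> = (if j \<in> S \<inter> R then Pm j else 0)" using finite_S by (simp add: sum.delta)
  finally show ?thesis using Pm_notin_S by auto
qed

lemma Pm_PP: "Pm j ** PP R = (if j \<in> R then Pm j else 0)"
proof -
  have "Pm j ** PP R = (\<Sum>i\<in>S \<inter> R. if j = i then Pm j else 0)"
    unfolding PP_def matrix_sum_right by (rule sum.cong) (auto simp: Pm_mult)
  also have "\<dots> = (if j \<in> S \<inter> R then Pm j else 0)" using finite_S by (simp add: sum.delta')
  finally show ?thesis using Pm_notin_S by auto
qed

lemma mat_eq_Pm:
  assumes "\<And>i j. i \<in> S \<Longrightarrow> j \<in> S \<Longrightarrow> Pm i ** A ** Pm j = Pm i ** B ** Pm j" shows "A = B"
proof -
  have e: "X = (\<Sum>i\<in>S. \<Sum>j\<in>S. Pm i ** X ** Pm j)" for X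
    by (simp add: matrix_sum_right[symmetric] matrix_sum_left[symmetric] Pm_sum)
  show ?thesis by (subst e[of A], subst e[of B]) (intro sum.cong refl assms)
qed

lemma PP_mult: "PP R ** PP R' = PP (R \<inter> R')"
proof (rule mat_eq_Pm)
  fix i j
  have "Pm i ** (PP R ** PP R') ** Pm j = (Pm i ** PP R) ** (PP R' ** Pm j)" by (simp add: matrix_mul_assoc)
  then show "Pm i ** (PP R ** PP R') ** Pm j = Pm i ** PP (R \<inter> R') ** Pm j"
    by (auto simp: Pm_PP PP_Pm Pm_mult)
qed

lemma mem_PP_iff: "PP R *v x = x \<longleftrightarrow> (\<forall>i. i \<notin> R \<longrightarrow> Pm i *v x = 0)"
proof
  assume x: "PP R *v x = x"
  show "\<forall>i. i \<notin> R \<longrightarrow> Pm i *v x = 0"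
  proof (intro allI impI)
    fix i assume "i \<notin> R"
    have "Pm i *v x = Pm i *v (PP R *v x)" by (simp add: x)
    then show "Pm i *v x = 0" using \<open>i \<notin> R\<close> by (simp add: matrix_vector_mul_assoc Pm_PP)
  qed
next
  assume *: "\<forall>i. i \<notin> R \<longrightarrow> Pm i *v x = 0"
  have "PP R *v x = (\<Sum>i\<in>S \<inter> R. Pm i *v x)" by (simp add: PP_def matrix_vector_sum_left)
  also have "\<dots> = (\<Sum>i\<in>S. Pm i *v x)" by (rule sum.mono_neutral_left) (use * finite_S in auto)
  finally show "PP R *v x = x" using vec_expand by simp
qed

definition VV :: "(int \<times> int) set \<Rightarrow> (complex ^ 'n) set" where "VV R = {x. PP R *v x = x}"

lemma VV_sub: "vec.subspace (VV R)"
  by (auto simp: VV_def vec.subspace_def matrix_vector_right_distrib matrix_vector_scale)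

lemma VV_iff: "x \<in> VV R \<longleftrightarrow> (\<forall>i. i \<notin> R \<longrightarrow> Pm i *v x = 0)"
  by (simp add: VV_def mem_PP_iff)

lemma J_VV: "i \<in> R \<Longrightarrow> J i \<subseteq> VV R"
  by (auto simp: VV_iff Pm_J)

lemma PP_VV: "PP R *v x \<in> VV R"
  by (simp add: VV_def matrix_vector_mul_assoc PP_mult)

lemma PP_VV_id: "x \<in> VV R \<Longrightarrow> PP R *v x = x"
  by (simp add: VV_def)

lemma VV_mono: "R \<subseteq> R' \<Longrightarrow> VV R \<subseteq> VV R'"
  unfolding subset_iff VV_iff by blast

lemma span_J: "vec.span (\<Union>i\<in>R. J i) = VV R"
proof
  show "vec.span (\<Union>i\<in>R. J i) \<subseteq> VV R"
    using J_VV by (intro vec.span_minimal VV_sub) auto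
  show "VV R \<subseteq> vec.span (\<Union>i\<in>R. J i)"
  proof
    fix x assume "x \<in> VV R"
    then have x: "x = PP R *v x" by (simp add: VV_def)
    have "PP R *v x \<in> vec.span (\<Union>i\<in>R. J i)"
      unfolding PP_def matrix_vector_sum_left using Pm_mem by (intro vec.span_sum vec.span_base) auto
    then show "x \<in> vec.span (\<Union>i\<in>R. J i)" using x by simp
  qed
qed

lemma VV_induct:
  assumes "\<And>i y. i \<in> R \<Longrightarrow> y \<in> J i \<Longrightarrow> y \<in> T" "vec.subspace T" "x \<in> VV R"
  shows "x \<in> T"
proof -
  have "vec.span (\<Union>i\<in>R. J i) \<subseteq> T" using assms(1,2) by (intro vec.span_minimal) auto
  then show ?thesis using assms(3) span_J by auto
qed

section \<open>Bidegrees of endomorphisms\<close>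

definition supp :: "(int \<times> int) set \<Rightarrow> complex ^ 'n ^ 'n \<Rightarrow> bool" where
  "supp R X \<longleftrightarrow> (\<forall>i j. i - j \<notin> R \<longrightarrow> Pm i ** X ** Pm j = 0)"

text \<open>The block from \<open>J j\<close> to \<open>J i\<close> has bidegree i - j, so R is a
  set of bidegrees and the pieces of the Lie algebra turn into such sets. Summing over
  \<open>S\<close> suffices, as the other projectors are 0.\<close>

definition cmp :: "(int \<times> int) set \<Rightarrow> complex ^ 'n ^ 'n \<Rightarrow> complex ^ 'n ^ 'n" where
  "cmp R X = (\<Sum>(i, j)\<in>{(i, j). i \<in> S \<and> j \<in> S \<and> i - j \<in> R}. Pm i ** X ** Pm j)"

lemma finite_SS: "finite {(i, j). i \<in> S \<and> j \<in> S \<and> i - j \<in> R}"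
  by (rule finite_subset[of _ "S \<times> S"]) (auto simp: finite_S)

lemma Pm_cmp: "Pm i ** cmp R X ** Pm j = (if i - j \<in> R then Pm i ** X ** Pm j else 0)"
proof -
  have "Pm i ** cmp R X ** Pm j =
     (\<Sum>(k, l)\<in>{(i, j). i \<in> S \<and> j \<in> S \<and> i - j \<in> R}. (Pm i ** Pm k) ** X ** (Pm l ** Pm j))"
    unfolding cmp_def matrix_sum_right matrix_sum_left by (rule sum.cong) (auto simp: matrix_mul_assoc)
  also have "\<dots> = (\<Sum>kl\<in>{(i, j). i \<in> S \<and> j \<in> S \<and> i - j \<in> R}. if kl = (i, j) then Pm i ** X ** Pm j else 0)"
  proof (rule sum.cong[OF refl])
    fix kl
    show "(case kl of (k, l) \<Rightarrow> (Pm i ** Pm k) ** X ** (Pm l ** Pm j)) = (if kl = (i, j) then Pm i ** X ** Pm j else 0)"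
      by (cases kl; cases "fst kl = i"; cases "snd kl = j") (simp_all add: Pm_mult)
  qed
  also have "\<dots> = (if i \<in> S \<and> j \<in> S \<and> i - j \<in> R then Pm i ** X ** Pm j else 0)"
    using finite_SS by (simp add: sum.delta)
  finally show ?thesis using Pm_notin_S[of i] Pm_notin_S[of j] by auto
qed

lemma supp_cmp: "supp R (cmp R X)"
  by (simp add: supp_def Pm_cmp)

lemma supp_cmp': "supp R X \<Longrightarrow> supp (R \<inter> R') (cmp R' X)"
  by (auto simp: supp_def Pm_cmp)

lemma supp_mono: "supp R X \<Longrightarrow> R \<subseteq> R' \<Longrightarrow> supp R' X"
  unfolding supp_def by blast

lemma cmp_id: "supp R X \<Longrightarrow> cmp R X = X"
  by (rule mat_eq_Pm) (auto simp: Pm_cmp supp_def)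

lemma cmp_0: "supp (- R) X \<Longrightarrow> cmp R X = 0"
  by (rule mat_eq_Pm) (auto simp: Pm_cmp supp_def)

lemma cmp_disjoint: "supp R X \<Longrightarrow> R \<inter> R' = {} \<Longrightarrow> cmp R' X = 0"
  by (rule cmp_0, erule supp_mono) auto

lemma cmp_cmp: "cmp R (cmp R' X) = cmp (R \<inter> R') X"
  by (rule mat_eq_Pm) (auto simp: Pm_cmp)

lemma cmp_Un: "R \<inter> R' = {} \<Longrightarrow> cmp (R \<union> R') X = cmp R X + cmp R' X"
  by (rule mat_eq_Pm) (auto simp: Pm_cmp matrix_add_ldistrib matrix_add_rdistrib)

lemma cmp_compl: "cmp (- R) X = X - cmp R X"
  by (rule mat_eq_Pm) (auto simp: Pm_cmp matrix_diff_ldistrib matrix_diff_rdistrib)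

lemma supp_cmp_eq: "supp R X \<Longrightarrow> R \<inter> R' = R \<inter> R'' \<Longrightarrow> cmp R' X = cmp R'' X"
  by (rule mat_eq_Pm) (metis (no_types, lifting) IntD1 IntD2 IntI Pm_cmp supp_def)

lemma cmp_add: "cmp R (X + Y) = cmp R X + cmp R Y"
  and cmp_diff: "cmp R (X - Y) = cmp R X - cmp R Y"
  and cmp_minus: "cmp R (- X) = - cmp R X"
  and cmp_scale: "cmp R (scale_mat c X) = scale_mat c (cmp R X)"
  and cmp_zero: "cmp R 0 = 0"
  by (rule mat_eq_Pm; auto simp: Pm_cmp matrix_add_ldistrib matrix_add_rdistrib matrix_diff_ldistrib
      matrix_diff_rdistrib matrix_minus_left matrix_minus_right scale_mat_mult_left scale_mat_mult_right)+

lemma cmp_scaleR: "cmp R (r *\<^sub>R X) = r *\<^sub>R cmp R X"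
  by (simp add: scale_mat_of_real[symmetric] cmp_scale)

lemma linear_cmp: "linear (cmp R)"
  by (rule linearI) (simp_all add: cmp_add cmp_scaleR)

lemma supp_add: "supp R X \<Longrightarrow> supp R Y \<Longrightarrow> supp R (X + Y)"
  and supp_diff: "supp R X \<Longrightarrow> supp R Y \<Longrightarrow> supp R (X - Y)"
  and supp_minus: "supp R X \<Longrightarrow> supp R (- X)"
  and supp_scale: "supp R X \<Longrightarrow> supp R (scale_mat c X)"
  and supp_zero: "supp R 0"
  by (auto simp: supp_def matrix_add_ldistrib matrix_add_rdistrib matrix_diff_ldistrib
      matrix_diff_rdistrib matrix_minus_left matrix_minus_right scale_mat_mult_left scale_mat_mult_right)

lemma supp_scaleR: "supp R X \<Longrightarrow> supp R (r *\<^sub>R X)"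
  by (simp add: scale_mat_of_real[symmetric] supp_scale)

lemma subspace_supp: "subspace {X. supp R X}"
  by (auto simp: subspace_def supp_add supp_zero supp_scaleR)

lemma supp_one: "0 \<in> R \<Longrightarrow> supp R (mat 1)"
  by (metis (no_types, lifting) supp_def Pm_mult cancel_comm_monoid_add_class.diff_cancel matrix_mul_rid)

lemma supp_Int: "supp R X \<Longrightarrow> supp R' X \<Longrightarrow> supp (R \<inter> R') X"
  by (auto simp: supp_def)

lemma Pm_prod: "Pm i ** (X ** Y) ** Pm j = (\<Sum>k\<in>S. (Pm i ** X ** Pm k) ** (Pm k ** Y ** Pm j))"
proof -
  have "X ** Y = X ** (\<Sum>k\<in>S. Pm k) ** Y" by (simp add: Pm_sum)
  also have "\<dots> = (\<Sum>k\<in>S. X ** (Pm k ** Pm k) ** Y)"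
    by (simp add: matrix_sum_right matrix_sum_left Pm_mult)
  finally show ?thesis by (simp add: matrix_sum_right matrix_sum_left matrix_mul_assoc)
qed

lemma supp_mult:
  assumes "supp R X" "supp R' Y" "\<And>r s. r \<in> R \<Longrightarrow> s \<in> R' \<Longrightarrow> r + s \<in> T"
  shows "supp T (X ** Y)"
  unfolding supp_def
proof (intro allI impI)
  fix i j assume ij: "i - j \<notin> T"
  have "(Pm i ** X ** Pm k) ** (Pm k ** Y ** Pm j) = 0" for k
  proof (cases "i - k \<in> R \<and> k - j \<in> R'")
    case True
    then have "(i - k) + (k - j) \<in> T" using assms(3) by blast
    then show ?thesis using ij by simp
  next
    case False
    then have "Pm i ** X ** Pm k = 0 \<or> Pm k ** Y ** Pm j = 0" using assms unfolding supp_def by blast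
    then show ?thesis by auto
  qed
  then show "Pm i ** (X ** Y) ** Pm j = 0" by (simp add: Pm_prod)
qed

text \<open>The last hypothesis says that r + s lies in R exactly when r and s lie in R' and R''.
  For R = {0} and cones in which 0 arises only as 0 + 0, it makes the (0, 0) component
  multiplicative.\<close>

lemma cmp_mult:
  assumes "supp A X" "supp B Y"
    and "\<And>r s. r \<in> A \<Longrightarrow> s \<in> B \<Longrightarrow> r + s \<in> R \<longleftrightarrow> r \<in> R' \<and> s \<in> R''"
  shows "cmp R (X ** Y) = cmp R' X ** cmp R'' Y"
proof (rule mat_eq_Pm)
  fix i j
  have "(Pm i ** cmp R' X ** Pm k) ** (Pm k ** cmp R'' Y ** Pm j) =
        (if i - j \<in> R then (Pm i ** X ** Pm k) ** (Pm k ** Y ** Pm j) else 0)" for k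
  proof (cases "i - k \<in> A \<and> k - j \<in> B")
    case True
    then show ?thesis using assms(3)[of "i - k" "k - j"] by (auto simp: Pm_cmp)
  next
    case False
    then have "Pm i ** X ** Pm k = 0 \<or> Pm k ** Y ** Pm j = 0" using assms unfolding supp_def by blast
    then show ?thesis by (auto simp: Pm_cmp)
  qed
  then show "Pm i ** cmp R (X ** Y) ** Pm j = Pm i ** (cmp R' X ** cmp R'' Y) ** Pm j"
    unfolding Pm_prod Pm_cmp[of i R "X ** Y"] by auto
qed

text \<open>For additively closed R containing 0 the endomorphisms supported in R form a
  finite-dimensional algebra. Left multiplication by X is injective on it, hence surjective, so 1 =
  X Z with Z in the algebra.\<close>

lemma supp_inverse:
  assumes X: "supp R X" and inv: "X ** Y = mat 1" and R: "\<And>r s. r \<in> R \<Longrightarrow> s \<in> R \<Longrightarrow> r + s \<in> R" "0 \<in> R"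
  shows "supp R Y"
proof -
  let ?A = "{Z. supp R Z}"
  let ?f = "\<lambda>Z :: complex^'n^'n. X ** Z"
  have lin: "linear ?f"
    by (rule bounded_linear.linear[OF bounded_bilinear.bounded_linear_right[OF bounded_bilinear_matrix_mult]])
  have YX: "Y ** X = mat 1" using inv by (metis matrix_left_right_inverse)
  have inj: "inj_on ?f (span ?A)"
    by (rule inj_onI) (metis YX matrix_mul_assoc matrix_mul_lid)
  have "?f ` ?A \<subseteq> ?A" using supp_mult[OF X] R by auto
  moreover have "dim (?f ` ?A) = dim ?A" by (rule dim_image_eq[OF lin inj])
  ultimately have "?f ` ?A = ?A"
    using linear_subspace_image[OF lin subspace_supp] subspace_supp by (intro subspace_dim_equal) auto
  moreover have "mat 1 \<in> ?A" using supp_one[OF R(2)] by simp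
  ultimately obtain Z where Z: "supp R Z" "mat 1 = X ** Z" by (metis (no_types, lifting) imageE mem_Collect_eq)
  have "Y = Y ** (X ** Z)" by (simp add: Z(2)[symmetric])
  also have "\<dots> = Z" by (simp add: matrix_mul_assoc YX)
  finally show ?thesis using Z by simp
qed

lemma supp_J:
  assumes "supp R X" "x \<in> J j" shows "X *v x \<in> VV ((\<lambda>r. r + j) ` R)"
  unfolding VV_iff
proof (intro allI impI)
  fix i assume i: "i \<notin> (\<lambda>r. r + j) ` R"
  have "i - j \<notin> R" using i by (metis diff_add_cancel image_eqI)
  then have "Pm i ** X ** Pm j = 0" using assms unfolding supp_def by blast
  moreover have "Pm i *v (X *v x) = (Pm i ** X ** Pm j) *v x"
    using assms(2) by (simp add: matrix_vector_mul_assoc[symmetric] Pm_J)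
  ultimately show "Pm i *v (X *v x) = 0" by simp
qed

lemma supp_VV:
  assumes "supp R X" "x \<in> VV A" "\<And>r a. r \<in> R \<Longrightarrow> a \<in> A \<Longrightarrow> r + a \<in> B" shows "X *v x \<in> VV B"
proof -
  have "x \<in> {x. X *v x \<in> VV B}"
  proof (rule VV_induct[OF _ _ assms(2)])
    fix i y assume "i \<in> A" "y \<in> J i"
    then show "y \<in> {x. X *v x \<in> VV B}"
      using supp_J[OF assms(1)] VV_mono[of "(\<lambda>r. r + i) ` R" B] assms(3) by blast
  next
    show "vec.subspace {x. X *v x \<in> VV B}"
      using VV_sub by (auto simp: vec.subspace_def matrix_vector_right_distrib matrix_vector_scale)
  qed
  then show ?thesis by simp
qed

lemma suppI:
  assumes "\<And>j x. x \<in> J j \<Longrightarrow> X *v x \<in> VV ((\<lambda>r. r + j) ` R)" shows "supp R X"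
  unfolding supp_def
proof (intro allI impI)
  fix i j assume ij: "i - j \<notin> R"
  show "Pm i ** X ** Pm j = 0"
  proof (rule matrix_eqI)
    fix x
    have "X *v (Pm j *v x) \<in> VV ((\<lambda>r. r + j) ` R)" by (rule assms[OF Pm_mem])
    moreover have "i \<notin> (\<lambda>r. r + j) ` R" using ij by auto
    ultimately have "Pm i *v (X *v (Pm j *v x)) = 0" unfolding VV_iff by blast
    then show "(Pm i ** X ** Pm j) *v x = 0 *v x" by (simp add: matrix_vector_mul_assoc matrix_mul_assoc)
  qed
qed

end

subsection \<open>The matrix exponential\<close>

definition mpow :: "complex ^ 'n ^ 'n \<Rightarrow> nat \<Rightarrow> complex ^ 'n ^ 'n" where
  "mpow A n = ((**) A ^^ n) (mat 1)"

lemma mpow_0 [simp]: "mpow A 0 = mat 1" and mpow_Suc [simp]: "mpow A (Suc n) = A ** mpow A n"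
  by (simp_all add: mpow_def)

text \<open>The differential of \<open>w \<mapsto> mpow w n\<close>.\<close>

primrec dpow :: "complex ^ 'n ^ 'n \<Rightarrow> nat \<Rightarrow> complex ^ 'n ^ 'n \<Rightarrow> complex ^ 'n ^ 'n" where
  "dpow w 0 h = 0"
| "dpow w (Suc n) h = h ** mpow w n + w ** dpow w n h"

lemma matrix_mult_bound:
  "\<exists>K\<ge>1. \<forall>(A :: complex^'n^'n) (B :: complex^'n^'n). norm (A ** B) \<le> K * norm A * norm B"
proof -
  obtain K where K: "\<And>(A :: complex^'n^'n) (B :: complex^'n^'n). norm (A ** B) \<le> norm A * norm B * K"
    using bounded_bilinear.bounded[OF bounded_bilinear_matrix_mult] by blast
  show ?thesis
  proof (intro exI[of _ "max 1 K"] conjI allI)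
    fix A B :: "complex^'n^'n"
    have "norm A * norm B * K \<le> norm A * norm B * max 1 K" by (intro mult_left_mono) auto
    then show "norm (A ** B) \<le> max 1 K * norm A * norm B" using K[of A B] by (simp add: algebra_simps)
  qed simp
qed

lemma bounded_linear_matrix_left: "bounded_linear (\<lambda>A :: complex^'n^'n. A ** (B :: complex^'n^'n))"
  by (rule bounded_bilinear.bounded_linear_left[OF bounded_bilinear_matrix_mult])

lemma bounded_linear_matrix_right: "bounded_linear (\<lambda>A :: complex^'n^'n. (B :: complex^'n^'n) ** A)"
  by (rule bounded_bilinear.bounded_linear_right[OF bounded_bilinear_matrix_mult])

lemma bounded_linear_scale_mat: "bounded_linear (scale_mat c :: complex^'n^'n \<Rightarrow> _)"
  using linear_scale_mat linear_conv_bounded_linear by blast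

lemma bounded_linear_cnj_mat: "bounded_linear (cnj_mat :: complex^'n^'n \<Rightarrow> _)"
  using linear_cnj_mat linear_conv_bounded_linear by blast

lemma dpow_scale: "dpow w n (scale_mat c h) = scale_mat c (dpow w n h)"
  by (induction n) (simp_all add: scale_mat_mult_left scale_mat_mult_right scale_mat_add)

lemma dpow_commute:
  assumes "h ** w = w ** h"
  shows "dpow w (Suc n) h = real (Suc n) *\<^sub>R (h ** mpow w n)"
proof (induction n)
  case (Suc n)
  have "w ** (h ** mpow w n) = h ** (w ** mpow w n)" by (simp add: matrix_mul_assoc assms)
  then show ?case using Suc by (simp add: matrix_scaleR_right scaleR_add_left matrix_add_ldistrib scaleR_2)
qed simp

lemma mpow_has_derivative: "((\<lambda>w. mpow w n) has_derivative (\<lambda>h. dpow w n h)) (at w within S)"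
proof (induction n)
  case (Suc n)
  show ?case using bounded_bilinear.FDERIV[OF bounded_bilinear_matrix_mult has_derivative_ident Suc]
    by (simp add: add.commute)
qed simp

context
  fixes K :: real
  assumes K1: "K \<ge> 1" and K: "\<And>(A :: complex^'n^'n) (B :: complex^'n^'n). norm (A ** B) \<le> K * norm A * norm B"
begin

lemma mpow_bound: "norm (mpow (w :: complex^'n^'n) n) \<le> norm (mat 1 :: complex^'n^'n) * (K * norm w) ^ n"
proof (induction n)
  case (Suc n)
  have "norm (w ** mpow w n) \<le> K * norm w * norm (mpow w n)" by (rule K)
  also have "\<dots> \<le> K * norm w * (norm (mat 1 :: complex^'n^'n) * (K * norm w) ^ n)"
    using Suc K1 by (intro mult_left_mono) auto
  finally show ?case by (simp add: algebra_simps)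
qed simp

lemma dpow_bound: "norm (dpow (w :: complex^'n^'n) n h) \<le> real n * (norm (mat 1 :: complex^'n^'n) * K ^ n * norm w ^ (n - 1) * norm h)"
proof (induction n)
  case (Suc n)
  have "norm (h ** mpow w n) \<le> K * norm h * norm (mpow w n)" by (rule K)
  also have "\<dots> \<le> K * norm h * (norm (mat 1 :: complex^'n^'n) * (K * norm w) ^ n)"
    using mpow_bound K1 by (intro mult_left_mono) auto
  finally have 1: "norm (h ** mpow w n) \<le> norm (mat 1 :: complex^'n^'n) * K ^ Suc n * norm w ^ n * norm h"
    by (simp add: power_mult_distrib algebra_simps)
  have "norm (w ** dpow w n h) \<le> K * norm w * norm (dpow w n h)" by (rule K)
  also have "\<dots> \<le> K * norm w * (real n * (norm (mat 1 :: complex^'n^'n) * K ^ n * norm w ^ (n - 1) * norm h))"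
    using Suc K1 by (intro mult_left_mono) auto
  also have "\<dots> = real n * (norm (mat 1 :: complex^'n^'n) * K ^ Suc n * norm w ^ n * norm h)"
    by (cases n) (simp_all add: algebra_simps)
  finally have "norm (w ** dpow w n h) \<le> real n * (norm (mat 1 :: complex^'n^'n) * K ^ Suc n * norm w ^ n * norm h)" .
  with 1 show ?case using norm_triangle_ineq[of "h ** mpow w n" "w ** dpow w n h"]
    by (simp add: algebra_simps)
qed simp

text \<open>The factor n from differentiation is absorbed by n <= 2^n, and R >= 1 allows the
  exponent n - 1 to be raised to n. After division by n! the bound is a term of an exponential
  series.\<close>

lemma dpow_bound_R:
  assumes "norm w \<le> R" "R \<ge> 1"
  shows "norm (dpow (w :: complex^'n^'n) n h) \<le> norm (mat 1 :: complex^'n^'n) * (2 * K * R) ^ n * norm h"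
proof -
  have "norm (dpow w n h) \<le> real n * (norm (mat 1 :: complex^'n^'n) * K ^ n * norm w ^ (n - 1) * norm h)" by (rule dpow_bound)
  also have "\<dots> \<le> 2 ^ n * (norm (mat 1 :: complex^'n^'n) * K ^ n * R ^ n * norm h)"
  proof (rule mult_mono)
    show "real n \<le> 2 ^ n" using of_nat_less_two_power[of n, where 'a=real] by simp
    have "norm w ^ (n - 1) \<le> R ^ (n - 1)" using assms by (intro power_mono) auto
    also have "\<dots> \<le> R ^ n" using assms by (intro power_increasing) auto
    finally show "norm (mat 1 :: complex^'n^'n) * K ^ n * norm w ^ (n - 1) * norm h \<le> norm (mat 1 :: complex^'n^'n) * K ^ n * R ^ n * norm h"
      using K1 by (intro mult_right_mono mult_left_mono) auto
  qed (use K1 in auto)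
  finally show ?thesis by (simp add: power_mult_distrib algebra_simps)
qed

end

section \<open>The differential of the exponential\<close>

definition dexp :: "complex ^ 'n ^ 'n \<Rightarrow> complex ^ 'n ^ 'n \<Rightarrow> complex ^ 'n ^ 'n" where
  "dexp w h = (\<Sum>n. (1 / fact n) *\<^sub>R dpow w n h)"

lemma exp_summable: "summable (\<lambda>n. c * x ^ n / fact n :: real)"
  using summable_mult[OF summable_exp[of x], of c] by (simp add: field_simps)

lemma summable_mpow: "summable (\<lambda>n. (1 / fact n) *\<^sub>R mpow (w :: complex^'n^'n) n)"
proof -
  obtain K where K: "K \<ge> 1" "\<And>(A :: complex^'n^'n) (B :: complex^'n^'n). norm (A ** B) \<le> K * norm A * norm B"
    using matrix_mult_bound by blast
  show ?thesis
    by (rule summable_comparison_test'[OF exp_summable[of "norm (mat 1 :: complex^'n^'n)" "K * norm w"]])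
      (use mpow_bound[OF K, of w] in \<open>simp add: divide_right_mono\<close>)
qed

lemma mexp_sums: "(\<lambda>n. (1 / fact n) *\<^sub>R mpow w n) sums mexp w"
  using summable_sums[OF summable_mpow] by (simp add: mexp_def mpow_def)

lemma summable_dpow: "summable (\<lambda>n. (1 / fact n) *\<^sub>R dpow (w :: complex^'n^'n) n h)"
proof -
  obtain K where K: "K \<ge> 1" "\<And>(A :: complex^'n^'n) (B :: complex^'n^'n). norm (A ** B) \<le> K * norm A * norm B"
    using matrix_mult_bound by blast
  have *: "norm w \<le> norm w + 1" "norm w + 1 \<ge> 1" by auto
  show ?thesis
    by (rule summable_comparison_test'[OF exp_summable[of "norm (mat 1 :: complex^'n^'n) * norm h" "2 * K * (norm w + 1)"]])
      (use dpow_bound_R[OF K *] in \<open>simp add: divide_right_mono mult_ac\<close>)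
qed

text \<open>Termwise differentiation on the ball of radius norm w + 1, where a single exponential
  series dominates the tails of all derived series.\<close>

lemma mexp_has_derivative: "(mexp has_derivative dexp w) (at (w :: complex^'n^'n))"
proof -
  obtain K where K: "K \<ge> 1" "\<And>(A :: complex^'n^'n) (B :: complex^'n^'n). norm (A ** B) \<le> K * norm A * norm B"
    using matrix_mult_bound by blast
  define R where "R = norm w + 1"
  have R: "R \<ge> 1" by (simp add: R_def)
  define a where "a n = norm (mat 1 :: complex^'n^'n) * (2 * K * R) ^ n / fact n" for n
  have sa: "summable a" unfolding a_def by (rule exp_summable)
  have bd: "norm ((1 / fact n) *\<^sub>R dpow x n h) \<le> a n * norm h" if "x \<in> ball 0 R" for n h and x :: "complex^'n^'n"
    using dpow_bound_R[OF K _ R, of x n h] that by (simp add: a_def field_simps)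
  have "\<exists>g. \<forall>x\<in>ball (0 :: complex^'n^'n) R. (\<lambda>n. (1 / fact n) *\<^sub>R mpow x n) sums g x \<and> (g has_derivative dexp x) (at x within ball 0 R)"
  proof (rule has_derivative_series[where f' = "\<lambda>n x h. (1 / fact n) *\<^sub>R dpow x n h"])
    fix e :: real assume "e > 0"
    have "(\<lambda>n. suminf a - sum a {..<n}) \<longlonglongrightarrow> suminf a - suminf a"
      by (intro tendsto_intros summable_LIMSEQ sa)
    then have "\<forall>\<^sub>F n in sequentially. suminf a - sum a {..<n} < e"
      using \<open>e > 0\<close> by (intro order_tendstoD(2)) auto
    then show "\<forall>\<^sub>F n in sequentially. \<forall>x\<in>ball (0 :: complex^'n^'n) R. \<forall>h. norm ((\<Sum>i<n. (1 / fact i) *\<^sub>R dpow x i h) - dexp x h) \<le> e * norm h"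
    proof eventually_elim
      case (elim n)
      show ?case
      proof (intro ballI allI)
        fix x h :: "complex^'n^'n" assume x: "x \<in> ball 0 R"
        let ?f = "\<lambda>n. (1 / fact n) *\<^sub>R dpow x n h"
        have s1: "summable (\<lambda>i. a (i + n) * norm h)" using sa by (intro summable_mult2 summable_ignore_initial_segment)
        have "norm ((\<Sum>i<n. ?f i) - dexp x h) = norm (\<Sum>i. ?f (i + n))"
          using suminf_minus_initial_segment[OF summable_dpow[of x h], of n] by (simp add: dexp_def norm_minus_commute)
        also have "\<dots> \<le> (\<Sum>i. a (i + n) * norm h)"
          using bd[OF x] by (intro norm_suminf_le s1)
        also have "\<dots> = (suminf a - sum a {..<n}) * norm h"
          using suminf_minus_initial_segment[OF sa, of n] suminf_mult2[OF summable_ignore_initial_segment[OF sa], of n "norm h"] by simp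
        also have "\<dots> \<le> e * norm h" using elim by (intro mult_right_mono) auto
        finally show "norm ((\<Sum>i<n. ?f i) - dexp x h) \<le> e * norm h" .
      qed
    qed
  qed (use R mexp_sums[of "0 :: complex^'n^'n"] in \<open>auto intro!: derivative_intros mpow_has_derivative\<close>)
  then obtain g :: "complex^'n^'n \<Rightarrow> complex^'n^'n" where g: "\<And>x. x \<in> ball 0 R \<Longrightarrow> (\<lambda>n. (1 / fact n) *\<^sub>R mpow x n) sums g x"
     "\<And>x. x \<in> ball 0 R \<Longrightarrow> (g has_derivative dexp x) (at x within ball 0 R)" by blast
  have eq: "g x = mexp x" if "x \<in> ball 0 R" for x using g(1)[OF that] mexp_sums sums_unique2 by blast
  have w: "w \<in> ball 0 R" by (simp add: R_def)
  have "(g has_derivative dexp w) (at w)" using g(2)[OF w] at_within_open[OF w] by simp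
  then show ?thesis
    by (rule has_derivative_transform_within_open[OF _ open_ball w]) (use eq in auto)
qed

lemma dexp_scale: "dexp w (scale_mat c h) = scale_mat c (dexp w h)"
  unfolding dexp_def dpow_scale scale_mat_scaleR[symmetric]
  by (rule bounded_linear.suminf[OF bounded_linear_scale_mat summable_dpow, symmetric])

lemma dexp_commute:
  assumes "h ** w = w ** h" shows "dexp w h = h ** mexp w"
proof -
  have "dexp w h = (\<Sum>n. (1 / fact (Suc n)) *\<^sub>R dpow w (Suc n) h)"
    using suminf_split_head[OF summable_dpow[of w h]] by (simp add: dexp_def)
  also have "\<dots> = (\<Sum>n. h ** ((1 / fact n) *\<^sub>R mpow w n))"
  proof (rule suminf_cong)
    fix n
    have "(1 / fact (Suc n)) *\<^sub>R dpow w (Suc n) h = (1 / fact n) *\<^sub>R (h ** mpow w n)"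
      unfolding dpow_commute[OF assms] by (simp del: dpow.simps of_nat_Suc)
    then show "(1 / fact (Suc n)) *\<^sub>R dpow w (Suc n) h = h ** ((1 / fact n) *\<^sub>R mpow w n)"
      by (simp add: matrix_scaleR_right)
  qed
  also have "\<dots> = h ** mexp w"
    using bounded_linear.suminf[OF bounded_linear_matrix_right summable_mpow, of h w] sums_unique[OF mexp_sums, of w]
    by simp
  finally show ?thesis .
qed

lemma mexp_0 [simp]: "mexp (0 :: complex^'n^'n) = mat 1"
proof -
  have "(1 / fact n) *\<^sub>R mpow (0 :: complex^'n^'n) n = (if n = 0 then mat 1 else 0)" for n by (cases n) auto
  then have "(\<lambda>n. if n = 0 then mat 1 else 0) sums mexp (0 :: complex^'n^'n)" using mexp_sums[of "0 :: complex^'n^'n"] by simp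
  moreover have "(\<lambda>n. if n = 0 then mat 1 else 0) sums (mat 1 :: complex^'n^'n)"
    using sums_single[of 0 "\<lambda>_. mat 1 :: complex^'n^'n"] by simp
  ultimately show ?thesis by (rule sums_unique2)
qed

lemma mexp_line: "((\<lambda>t. mexp (t *\<^sub>R X)) has_vector_derivative (X ** mexp (t *\<^sub>R X))) (at t within S)"
proof -
  have 1: "((\<lambda>t. t *\<^sub>R X) has_derivative (\<lambda>h. h *\<^sub>R X)) (at t within S)" by (auto intro!: derivative_eq_intros)
  have 2: "dexp (t *\<^sub>R X) (h *\<^sub>R X) = h *\<^sub>R (X ** mexp (t *\<^sub>R X))" for h
    by (subst dexp_commute) (simp_all add: matrix_scaleR_left matrix_scaleR_right)
  show ?thesis
    using has_derivative_compose[OF 1 mexp_has_derivative] unfolding has_vector_derivative_def 2 by simp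
qed

text \<open>The product of e^{tX} and e^{-tX} has derivative 0, because X commutes with its
  exponentials.\<close>

lemma mexp_inverse: "mexp (X :: complex^'n^'n) ** mexp (- X) = mat 1"
proof -
  define f where "f t = mexp (t *\<^sub>R X) ** mexp (t *\<^sub>R (- X))" for t
  have comm: "X ** mexp (t *\<^sub>R X) = mexp (t *\<^sub>R X) ** X" for t
  proof -
    have c: "X ** mpow (t *\<^sub>R X) n = mpow (t *\<^sub>R X) n ** X" for n
    proof (induction n)
      case (Suc n)
      have "X ** mpow (t *\<^sub>R X) (Suc n) = t *\<^sub>R (X ** (X ** mpow (t *\<^sub>R X) n))"
        by (simp add: matrix_scaleR_left matrix_scaleR_right)
      also have "\<dots> = mpow (t *\<^sub>R X) (Suc n) ** X"
        by (simp add: Suc matrix_scaleR_left matrix_scaleR_right matrix_mul_assoc)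
      finally show ?case .
    qed simp
    have "(\<lambda>n. X ** ((1 / fact n) *\<^sub>R mpow (t *\<^sub>R X) n)) sums (X ** mexp (t *\<^sub>R X))"
      by (rule bounded_linear.sums[OF bounded_linear_matrix_right mexp_sums])
    moreover have "(\<lambda>n. ((1 / fact n) *\<^sub>R mpow (t *\<^sub>R X) n) ** X) sums (mexp (t *\<^sub>R X) ** X)"
      by (rule bounded_linear.sums[OF bounded_linear_matrix_left mexp_sums])
    ultimately show ?thesis by (simp add: matrix_scaleR_left matrix_scaleR_right c sums_unique2)
  qed
  have "(f has_derivative (\<lambda>h. 0)) (at t within UNIV)" for t
  proof -
    have "(f has_vector_derivative (mexp (t *\<^sub>R X) ** (- X ** mexp (t *\<^sub>R (- X))) +
       (X ** mexp (t *\<^sub>R X)) ** mexp (t *\<^sub>R (- X)))) (at t)"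
      unfolding f_def
      by (rule bounded_bilinear.has_vector_derivative[OF bounded_bilinear_matrix_mult mexp_line mexp_line])
    moreover have "mexp (t *\<^sub>R X) ** (- X ** mexp (t *\<^sub>R (- X))) + (X ** mexp (t *\<^sub>R X)) ** mexp (t *\<^sub>R (- X)) = 0"
      by (simp add: comm matrix_minus_left matrix_minus_right matrix_mul_assoc)
    ultimately show ?thesis by (simp add: has_vector_derivative_def)
  qed
  then have "f 1 = f 0"
    using has_derivative_zero_constant[of UNIV f] by (metis UNIV_I convex_UNIV)
  then show ?thesis by (simp add: f_def)
qed

lemma mexp_inverse': "mexp (- X) ** mexp X = mat 1"
  using mexp_inverse[of "- X"] by simp

lemma cnj_mat_mexp: "cnj_mat (mexp X) = mexp (cnj_mat X)"
proof -
  have c: "cnj_mat (mpow X n) = mpow (cnj_mat X) n" for n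
    by (induction n) (simp_all add: cnj_mat_mult)
  have "(\<lambda>n. cnj_mat ((1 / fact n) *\<^sub>R mpow X n)) sums cnj_mat (mexp X)"
    by (rule bounded_linear.sums[OF bounded_linear_cnj_mat mexp_sums])
  then show ?thesis using mexp_sums[of "cnj_mat X"] by (simp add: cnj_mat_scaleR c sums_unique2)
qed

text \<open>The symmetric second differential of the exponential at 0. The series terms with n <= 2
  contain the part of order at most 1 in t, and those with n >= 3 carry a factor t^2.\<close>

lemma dexp_line_derivative:
  "((\<lambda>t. dexp (t *\<^sub>R B) A) has_vector_derivative (1 / 2) *\<^sub>R (A ** B + B ** A)) (at 0)"
  for A B :: "complex^'n^'n"
proof -
  obtain K where K: "K \<ge> 1" "\<And>(A :: complex^'n^'n) (B :: complex^'n^'n). norm (A ** B) \<le> K * norm A * norm B"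
    using matrix_mult_bound by blast
  define C where "C = (\<Sum>n. (norm (mat 1 :: complex^'n^'n) * norm A) * (2 * K * (norm B + 1)) ^ n / fact n)"
  have bound: "norm (dexp (t *\<^sub>R B) A - dexp (0 *\<^sub>R B) A - t *\<^sub>R ((1 / 2) *\<^sub>R (A ** B + B ** A))) \<le> C * t\<^sup>2"
    if t: "\<bar>t\<bar> \<le> 1" for t
  proof -
    let ?f = "\<lambda>n. (1 / fact n) *\<^sub>R dpow (t *\<^sub>R B) n A"
    have d0: "dexp (0 *\<^sub>R B) A = A" using dexp_commute[of A "0 *\<^sub>R B"] by simp
    have s: "(\<Sum>n<3. ?f n) = A + t *\<^sub>R ((1 / 2) *\<^sub>R (A ** B + B ** A))"
      by (simp add: numeral_3_eq_3 matrix_scaleR_left matrix_scaleR_right fact_numeral scaleR_add_right)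
    have "dexp (t *\<^sub>R B) A - dexp (0 *\<^sub>R B) A - t *\<^sub>R ((1 / 2) *\<^sub>R (A ** B + B ** A)) = (\<Sum>n. ?f (n + 3))"
      unfolding suminf_minus_initial_segment[OF summable_dpow[of "t *\<^sub>R B" A], of 3] s d0
      by (simp add: dexp_def)
    also have "norm \<dots> \<le> (\<Sum>n. (norm (mat 1 :: complex^'n^'n) * norm A) * (2 * K * (norm B + 1)) ^ (n + 3) / fact (n + 3) * t\<^sup>2)"
    proof (rule norm_suminf_le)
      fix n
      have 1: "norm (dpow (t *\<^sub>R B) (n + 3) A) \<le> real (n + 3) * (norm (mat 1 :: complex^'n^'n) * K ^ (n + 3) * norm (t *\<^sub>R B) ^ (n + 2) * norm A)"
        using dpow_bound[OF K, of "t *\<^sub>R B" "n + 3" A] by simp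
      have "norm (t *\<^sub>R B) ^ (n + 2) = \<bar>t\<bar> ^ (n + 2) * norm B ^ (n + 2)" by (simp add: power_mult_distrib)
      also have "\<dots> \<le> t\<^sup>2 * (norm B + 1) ^ (n + 3)"
      proof (rule mult_mono)
        have "\<bar>t\<bar> ^ (n + 2) \<le> \<bar>t\<bar> ^ 2" using t by (intro power_decreasing) auto
        then show "\<bar>t\<bar> ^ (n + 2) \<le> t\<^sup>2" by simp
        have "norm B ^ (n + 2) \<le> (norm B + 1) ^ (n + 2)" by (intro power_mono) auto
        also have "\<dots> \<le> (norm B + 1) ^ (n + 3)" by (intro power_increasing) auto
        finally show "norm B ^ (n + 2) \<le> (norm B + 1) ^ (n + 3)" .
      qed auto
      finally have 2: "norm (t *\<^sub>R B) ^ (n + 2) \<le> t\<^sup>2 * (norm B + 1) ^ (n + 3)" .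
      have "real (n + 3) \<le> 2 ^ (n + 3)" using of_nat_less_two_power[of "n + 3", where 'a=real] by linarith
      then have "real (n + 3) * (norm (mat 1 :: complex^'n^'n) * K ^ (n + 3) * norm (t *\<^sub>R B) ^ (n + 2) * norm A)
        \<le> 2 ^ (n + 3) * (norm (mat 1 :: complex^'n^'n) * K ^ (n + 3) * (t\<^sup>2 * (norm B + 1) ^ (n + 3)) * norm A)"
        using 2 K(1) by (intro mult_mono mult_right_mono mult_left_mono) auto
      also have "\<dots> = (norm (mat 1 :: complex^'n^'n) * norm A) * (2 * K * (norm B + 1)) ^ (n + 3) * t\<^sup>2"
        by (simp only: power_mult_distrib mult_ac)
      finally have "norm (dpow (t *\<^sub>R B) (n + 3) A) \<le> (norm (mat 1 :: complex^'n^'n) * norm A) * (2 * K * (norm B + 1)) ^ (n + 3) * t\<^sup>2"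
        using 1 by linarith
      then show "norm (?f (n + 3)) \<le> (norm (mat 1 :: complex^'n^'n) * norm A) * (2 * K * (norm B + 1)) ^ (n + 3) / fact (n + 3) * t\<^sup>2"
        by (simp add: divide_right_mono)
    next
      show "summable (\<lambda>n. (norm (mat 1 :: complex^'n^'n) * norm A) * (2 * K * (norm B + 1)) ^ (n + 3) / fact (n + 3) * t\<^sup>2)"
        by (intro summable_mult2 summable_ignore_initial_segment[OF exp_summable])
    qed
    also have "\<dots> = (\<Sum>n. (norm (mat 1 :: complex^'n^'n) * norm A) * (2 * K * (norm B + 1)) ^ (n + 3) / fact (n + 3)) * t\<^sup>2"
      by (rule suminf_mult2[symmetric]) (intro summable_ignore_initial_segment[OF exp_summable])
    also have "\<dots> \<le> C * t\<^sup>2"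
    proof (rule mult_right_mono)
      let ?a = "\<lambda>n. (norm (mat 1 :: complex^'n^'n) * norm A) * (2 * K * (norm B + 1)) ^ n / fact n"
      have "0 \<le> sum ?a {..<3}" using K(1) by (intro sum_nonneg) auto
      then show "(\<Sum>n. ?a (n + 3)) \<le> C"
        using suminf_minus_initial_segment[OF exp_summable[of "norm (mat 1 :: complex^'n^'n) * norm A" "2 * K * (norm B + 1)"], of 3]
        unfolding C_def by simp
    qed simp
    finally show ?thesis .
  qed
  show ?thesis
    unfolding has_vector_derivative_def has_derivative_at_alt
  proof (intro conjI allI impI bounded_linear_scaleR_left)
    fix e :: real assume e: "e > 0"
    have C0: "C \<ge> 0" using order_trans[OF norm_ge_zero bound[of 1]] by simp
    show "\<exists>d>0. \<forall>y. norm (y - 0) < d \<longrightarrow> norm (dexp (y *\<^sub>R B) A - dexp (0 *\<^sub>R B) A - (y - 0) *\<^sub>R ((1 / 2) *\<^sub>R (A ** B + B ** A))) \<le> e * norm (y - 0)"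
    proof (intro exI[of _ "min 1 (e / (C + 1))"] conjI allI impI)
      show "0 < min 1 (e / (C + 1))" using e C0 by simp
      fix y :: real assume y: "norm (y - 0) < min 1 (e / (C + 1))"
      have "norm (dexp (y *\<^sub>R B) A - dexp (0 *\<^sub>R B) A - (y - 0) *\<^sub>R ((1 / 2) *\<^sub>R (A ** B + B ** A))) \<le> C * y\<^sup>2"
        using bound[of y] y by simp
      also have "\<dots> = (C * \<bar>y\<bar>) * \<bar>y\<bar>" by (simp add: power2_eq_square)
      also have "\<dots> \<le> e * \<bar>y\<bar>"
      proof (rule mult_right_mono)
        have "(C + 1) * \<bar>y\<bar> \<le> e" using y C0 by (simp add: field_simps)
        then show "C * \<bar>y\<bar> \<le> e" by (simp add: algebra_simps)
      qed simp
      finally show "norm (dexp (y *\<^sub>R B) A - dexp (0 *\<^sub>R B) A - (y - 0) *\<^sub>R ((1 / 2) *\<^sub>R (A ** B + B ** A))) \<le> e * norm (y - 0)" by simp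
    qed
  qed
qed

subsection \<open>Second-order jets of functions of two parameters\<close>

text \<open>\<open>jet f f0 fs ft fm\<close>: value, first derivatives and mixed second derivative of \<open>f\<close> at the origin,
  where the derivative in the first parameter exists along the whole axis of the second one.\<close>

definition jet :: "(real \<Rightarrow> real \<Rightarrow> 'a::real_normed_vector) \<Rightarrow> 'a \<Rightarrow> 'a \<Rightarrow> 'a \<Rightarrow> 'a \<Rightarrow> bool" where
  "jet f f0 fs ft fm \<longleftrightarrow>
     (\<exists>g. (\<forall>\<^sub>F t in nhds 0. ((\<lambda>s. f s t) has_vector_derivative g t) (at 0)) \<and>
          f 0 0 = f0 \<and> g 0 = fs \<and> ((\<lambda>t. f 0 t) has_vector_derivative ft) (at 0) \<and>
          (g has_vector_derivative fm) (at 0))"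

lemma jetI:
  assumes "\<forall>\<^sub>F t in nhds 0. ((\<lambda>s. f s t) has_vector_derivative g t) (at 0)"
    "f 0 0 = f0" "g 0 = fs" "((\<lambda>t. f 0 t) has_vector_derivative ft) (at 0)" "(g has_vector_derivative fm) (at 0)"
  shows "jet f f0 fs ft fm"
  using assms unfolding jet_def by blast

lemma jetE:
  assumes "jet f f0 fs ft fm"
  obtains g where "\<forall>\<^sub>F t in nhds 0. ((\<lambda>s. f s t) has_vector_derivative g t) (at 0)"
    "f 0 0 = f0" "g 0 = fs" "((\<lambda>t. f 0 t) has_vector_derivative ft) (at 0)" "(g has_vector_derivative fm) (at 0)"
  using assms unfolding jet_def by blast

lemma jet_const: "jet (\<lambda>s t. c) c 0 0 0"
  by (rule jetI[where g = "\<lambda>_. 0"]) (auto intro!: derivative_eq_intros)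

lemma jet_linear:
  assumes L: "bounded_linear L" and f: "jet f f0 fs ft fm"
  shows "jet (\<lambda>s t. L (f s t)) (L f0) (L fs) (L ft) (L fm)"
proof -
  obtain g where g: "\<forall>\<^sub>F t in nhds 0. ((\<lambda>s. f s t) has_vector_derivative g t) (at 0)"
    "f 0 0 = f0" "g 0 = fs" "((\<lambda>t. f 0 t) has_vector_derivative ft) (at 0)" "(g has_vector_derivative fm) (at 0)"
    using f by (rule jetE)
  note D = bounded_linear.has_vector_derivative[OF L]
  show ?thesis
    by (rule jetI[where g = "\<lambda>t. L (g t)"]) (use g D in \<open>auto elim: eventually_mono\<close>)
qed

lemma jet_bilinear:
  assumes B: "bounded_bilinear B" and f: "jet f f0 fs ft fm" and h: "jet h h0 hs ht hm"
  shows "jet (\<lambda>s t. B (f s t) (h s t)) (B f0 h0) (B f0 hs + B fs h0) (B f0 ht + B ft h0)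
     (B f0 hm + B ft hs + (B fs ht + B fm h0))"
proof -
  obtain g where g: "\<forall>\<^sub>F t in nhds 0. ((\<lambda>s. f s t) has_vector_derivative g t) (at 0)"
    "f 0 0 = f0" "g 0 = fs" "((\<lambda>t. f 0 t) has_vector_derivative ft) (at 0)" "(g has_vector_derivative fm) (at 0)"
    using f by (rule jetE)
  obtain k where k: "\<forall>\<^sub>F t in nhds 0. ((\<lambda>s. h s t) has_vector_derivative k t) (at 0)"
    "h 0 0 = h0" "k 0 = hs" "((\<lambda>t. h 0 t) has_vector_derivative ht) (at 0)" "(k has_vector_derivative hm) (at 0)"
    using h by (rule jetE)
  note D = bounded_bilinear.has_vector_derivative[OF B]
  show ?thesis
  proof (rule jetI[where g = "\<lambda>t. B (f 0 t) (k t) + B (g t) (h 0 t)"])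
    show "\<forall>\<^sub>F t in nhds 0. ((\<lambda>s. B (f s t) (h s t)) has_vector_derivative B (f 0 t) (k t) + B (g t) (h 0 t)) (at 0)"
      using g(1) k(1) by eventually_elim (rule D)
    show "((\<lambda>t. B (f 0 t) (h 0 t)) has_vector_derivative B f0 ht + B ft h0) (at 0)"
      using D[OF g(4) k(4)] by (simp add: g k)
    show "((\<lambda>t. B (f 0 t) (k t) + B (g t) (h 0 t)) has_vector_derivative B f0 hm + B ft hs + (B fs ht + B fm h0)) (at 0)"
      using has_vector_derivative_add[OF D[OF g(4) k(5)] D[OF g(5) k(4)]] by (simp add: g k)
  qed (simp_all add: g k)
qed

lemma jet_add:
  assumes "jet f f0 fs ft fm" "jet h h0 hs ht hm"
  shows "jet (\<lambda>s t. f s t + h s t) (f0 + h0) (fs + hs) (ft + ht) (fm + hm)"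
proof -
  obtain g where g: "\<forall>\<^sub>F t in nhds 0. ((\<lambda>s. f s t) has_vector_derivative g t) (at 0)"
    "f 0 0 = f0" "g 0 = fs" "((\<lambda>t. f 0 t) has_vector_derivative ft) (at 0)" "(g has_vector_derivative fm) (at 0)"
    using assms(1) by (rule jetE)
  obtain k where k: "\<forall>\<^sub>F t in nhds 0. ((\<lambda>s. h s t) has_vector_derivative k t) (at 0)"
    "h 0 0 = h0" "k 0 = hs" "((\<lambda>t. h 0 t) has_vector_derivative ht) (at 0)" "(k has_vector_derivative hm) (at 0)"
    using assms(2) by (rule jetE)
  show ?thesis
    by (rule jetI[where g = "\<lambda>t. g t + k t"])
      (use g k in \<open>auto intro: has_vector_derivative_add elim: eventually_elim2\<close>)
qed

text \<open>Implicit differentiation without assuming z differentiable. The remainder v of z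
  satisfies (1 + B (A x)) v = r x, where r is built from differentiable data and has derivative 0 at
  0; the smallness bound then gives norm v <= 2 norm (r x).\<close>

lemma solve_derivative:
  fixes b z :: "real \<Rightarrow> 'a::real_normed_vector"
  assumes B: "bounded_bilinear B" and A: "(A has_vector_derivative A') (at 0)"
    and b: "(b has_vector_derivative b') (at 0)" and e: "e > 0"
    and small: "\<And>x y. \<bar>x\<bar> < e \<Longrightarrow> norm (B (A x) y) \<le> norm y / 2"
    and eq: "\<And>x. \<bar>x\<bar> < e \<Longrightarrow> z x + B (A x) (z x) = b x"
    and z': "z' + B (A 0) z' = b' - B A' (z 0)"
  shows "(z has_vector_derivative z') (at 0)"
proof -
  interpret bounded_bilinear B by (rule B)
  define r where "r x = (b x - b 0 - B (A x - A 0) (z 0)) - x *\<^sub>R (z' + B (A x) z')" for x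
  have rd: "(r has_vector_derivative 0) (at 0)"
  proof -
    have 1: "((\<lambda>x. B (A x - A 0) (z 0)) has_vector_derivative B A' (z 0)) (at 0)"
      using has_vector_derivative[OF has_vector_derivative_diff[OF A has_vector_derivative_const] has_vector_derivative_const[of "z 0"], of "A 0"]
      by (simp add: zero_right)
    have 2: "((\<lambda>x. z' + B (A x) z') has_vector_derivative B A' z') (at 0)"
      using has_vector_derivative_add[OF has_vector_derivative_const[of z'] has_vector_derivative[OF A has_vector_derivative_const[of z']]]
      by (simp add: zero_right)
    have 3: "((\<lambda>x. x *\<^sub>R (z' + B (A x) z')) has_vector_derivative (z' + B (A 0) z')) (at 0)"
      using has_vector_derivative_scaleR[OF DERIV_ident 2] by simp
    have "((\<lambda>x. (b x - b 0 - B (A x - A 0) (z 0)) - x *\<^sub>R (z' + B (A x) z')) has_vector_derivative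
        ((b' - 0 - B A' (z 0)) - (z' + B (A 0) z'))) (at 0)"
      by (intro has_vector_derivative_diff b 1 3 has_vector_derivative_const)
    then show ?thesis unfolding r_def[abs_def] using z' by simp
  qed
  have r0: "r 0 = 0" by (simp add: r_def zero_left)
  have bound: "norm (z x - z 0 - x *\<^sub>R z') \<le> 2 * norm (r x)" if x: "\<bar>x\<bar> < e" for x
  proof -
    define v where "v = z x - z 0 - x *\<^sub>R z'"
    have "v + B (A x) v = r x"
      using eq[OF x] eq[of 0] e unfolding v_def r_def
      by (simp add: diff_left diff_right add_right scaleR_right scaleR_add_right algebra_simps)
    then have "norm v \<le> norm (r x) + norm (B (A x) v)" by (metis add_diff_cancel_right' norm_triangle_ineq4)
    then show ?thesis using small[OF x, of v] by (simp add: v_def)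
  qed
  show ?thesis
    unfolding has_vector_derivative_def has_derivative_at_alt
  proof (intro conjI allI impI bounded_linear_scaleR_left)
    fix d :: real assume d: "d > 0"
    from rd[unfolded has_vector_derivative_def has_derivative_at_alt] obtain c where c: "c > 0"
      "\<And>y. norm (y - 0) < c \<Longrightarrow> norm (r y - r 0 - (y - 0) *\<^sub>R 0) \<le> d / 2 * norm (y - 0)"
      using d by (metis half_gt_zero)
    show "\<exists>c>0. \<forall>y. norm (y - 0) < c \<longrightarrow> norm (z y - z 0 - (y - 0) *\<^sub>R z') \<le> d * norm (y - 0)"
    proof (intro exI[of _ "min c e"] conjI allI impI)
      fix y :: real assume y: "norm (y - 0) < min c e"
      then show "norm (z y - z 0 - (y - 0) *\<^sub>R z') \<le> d * norm (y - 0)"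
        using bound[of y] c(2)[of y] r0 by simp
    qed (use c e in auto)
  qed
qed

text \<open>The bound makes 1 + T injective; in finite dimension it is then onto.\<close>

lemma perturbed_identity_solve:
  fixes c :: "'a::euclidean_space"
  assumes B: "bounded_linear T" and small: "\<And>y. norm (T y) \<le> norm y / 2"
  shows "\<exists>z. z + T z = c"
proof -
  have lin: "linear (\<lambda>y. y + T y)"
    using B by (intro linear_compose_add linear_ident) (auto dest: bounded_linear.linear)
  have "y = 0" if "y + T y = 0" for y
  proof -
    have "norm y = norm (T y)" using that by (metis add.inverse_unique norm_minus_cancel)
    then show ?thesis using small[of y] by simp
  qed
  then have "inj (\<lambda>y. y + T y)" using linear_injective_0[OF lin] by blast
  then have "surj (\<lambda>y. y + T y)" using linear_injective_imp_surjective[OF lin] by blast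
  then show ?thesis by (metis surjD)
qed

text \<open>The function q is defined as a solution of the equation differentiated in s.
  \<open>solve_derivative\<close> identifies it with the s-derivative of z for every small t, gives
  the t-derivative of z on the axis, and finally differentiates q itself in t.\<close>

lemma jet_solve:
  fixes b z :: "real \<Rightarrow> real \<Rightarrow> 'a::euclidean_space"
  assumes B: "bounded_bilinear B" and A: "jet A 0 As At Am" and b: "jet b b0 bs bt bm" and e: "e > 0"
    and small: "\<And>s t y. \<bar>s\<bar> < e \<Longrightarrow> \<bar>t\<bar> < e \<Longrightarrow> norm (B (A s t) y) \<le> norm y / 2"
    and eq: "\<And>s t. \<bar>s\<bar> < e \<Longrightarrow> \<bar>t\<bar> < e \<Longrightarrow> z s t + B (A s t) (z s t) = b s t"
    and zs: "zs = bs - B As b0" and zt: "zt = bt - B At b0"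
  shows "jet z b0 zs zt (bm - B At zs - (B As zt + B Am b0))"
proof -
  interpret bounded_bilinear B by (rule B)
  obtain g where g: "\<forall>\<^sub>F t in nhds 0. ((\<lambda>s. A s t) has_vector_derivative g t) (at 0)"
    "A 0 0 = 0" "g 0 = As" "((\<lambda>t. A 0 t) has_vector_derivative At) (at 0)" "(g has_vector_derivative Am) (at 0)"
    using A by (rule jetE)
  obtain k where k: "\<forall>\<^sub>F t in nhds 0. ((\<lambda>s. b s t) has_vector_derivative k t) (at 0)"
    "b 0 0 = b0" "k 0 = bs" "((\<lambda>t. b 0 t) has_vector_derivative bt) (at 0)" "(k has_vector_derivative bm) (at 0)"
    using b by (rule jetE)
  define q where "q t = (SOME w. w + B (A 0 t) w = k t - B (g t) (z 0 t))" for t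
  have q: "q t + B (A 0 t) (q t) = k t - B (g t) (z 0 t)" if "\<bar>t\<bar> < e" for t
    unfolding q_def
    by (rule someI_ex, rule perturbed_identity_solve[OF bounded_linear_right])
      (use small[of 0 t] e that in auto)
  have z0: "z 0 0 = b0" using eq[of 0 0] e g(2) k(2) by (simp add: zero_left)
  have z_t: "((\<lambda>t. z 0 t) has_vector_derivative zt) (at 0)"
    by (rule solve_derivative[OF B g(4) k(4) e]) (use small eq e in \<open>auto simp: g(2) zero_left z0 zt\<close>)
  show ?thesis
  proof (rule jetI[where g = q])
    have "\<forall>\<^sub>F t in nhds 0. t \<in> {-e<..<e}" using e by (intro eventually_nhds_in_open) auto
    then show "\<forall>\<^sub>F t in nhds 0. ((\<lambda>s. z s t) has_vector_derivative q t) (at 0)"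
      using g(1) k(1)
    proof eventually_elim
      case (elim t)
      then show ?case
        by (intro solve_derivative[OF B elim(2) elim(3) e]) (use small eq q in auto)
    qed
    show "z 0 0 = b0" by (rule z0)
    show q0: "q 0 = zs" using q[of 0] e by (simp add: g k z0 zs zero_left)
    show "((\<lambda>t. z 0 t) has_vector_derivative zt) (at 0)" by (rule z_t)
    have d: "((\<lambda>t. k t - B (g t) (z 0 t)) has_vector_derivative (bm - (B As zt + B Am b0))) (at 0)"
      using has_vector_derivative_diff[OF k(5) has_vector_derivative[OF g(5) z_t]] by (simp add: g z0)
    show "(q has_vector_derivative (bm - B At zs - (B As zt + B Am b0))) (at 0)"
      by (rule solve_derivative[OF B g(4) d e]) (use small q e in \<open>auto simp: g(2) zero_left q0\<close>)
  qed
qed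

subsection \<open>Partial derivatives of holomorphic functions of two variables\<close>

lemma holomorphic_onI_derivative:
  assumes "\<And>z. z \<in> S \<Longrightarrow> \<exists>D. (f has_field_derivative D) (at z)" shows "f holomorphic_on S"
  unfolding holomorphic_on_def field_differentiable_def using assms has_field_derivative_at_within by blast

text \<open>Since only pointwise complex differentiability is given, the z-derivative at 0 is not
  known in advance to be regular in t. It is a uniform limit of difference quotients, which are
  holomorphic in t; the uniformity comes from Cauchy's estimate for the second z-derivative.\<close>

lemma holomorphic_two_partial:
  fixes f :: "complex \<times> complex \<Rightarrow> complex"
  assumes e: "e > 0"
    and f: "\<And>z. z \<in> ball 0 e \<Longrightarrow> \<exists>f'. (f has_derivative f') (at z) \<and> (\<forall>c a b. f' (c * a, c * b) = c * f' (a, b))"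
  shows "\<exists>q r. r > 0 \<and> q holomorphic_on ball 0 r \<and> (\<forall>t\<in>ball 0 r. ((\<lambda>z. f (z, t)) has_field_derivative q t) (at 0))"
proof -
  \<comment> \<open>The closed polydisc of this radius has norm at most e / 2, so it lies in the
    ball of radius e.\<close>
  define r where "r = e / 4"
  have r: "r > 0" using e by (simp add: r_def)
  have inball: "(a, b) \<in> ball 0 e" if "norm a \<le> r" "norm b \<le> r" for a b :: complex
  proof -
    have "norm (a, b) \<le> norm a + norm b" by (rule norm_Pair_le)
    then show ?thesis using that e by (simp add: r_def)
  qed
  have d1: "\<exists>D. ((\<lambda>z. f (z, b)) has_field_derivative D) (at a)" and d2: "\<exists>D. ((\<lambda>z. f (a, z)) has_field_derivative D) (at b)"
    if ab: "norm a \<le> r" "norm b \<le> r" for a b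
  proof -
    obtain f' where f': "(f has_derivative f') (at (a, b))" "\<And>c a b. f' (c * a, c * b) = c * f' (a, b)"
      using f[OF inball[OF ab]] by blast
    have "((\<lambda>z. f (z, b)) has_derivative (\<lambda>h. f' (h, 0))) (at a)"
      by (rule has_derivative_compose[where f = "\<lambda>z. (z, b)", OF _ f'(1)]) (auto intro!: derivative_eq_intros)
    moreover have "(\<lambda>h. f' (h, 0)) = (*) (f' (1, 0))"
      by (rule ext) (metis f'(2) mult.commute mult.right_neutral mult_zero_right)
    ultimately have "((\<lambda>z. f (z, b)) has_field_derivative f' (1, 0)) (at a)"
      unfolding has_field_derivative_def by (simp only:)
    then show "\<exists>D. ((\<lambda>z. f (z, b)) has_field_derivative D) (at a)" by blast
    have "((\<lambda>z. f (a, z)) has_derivative (\<lambda>h. f' (0, h))) (at b)"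
      by (rule has_derivative_compose[where f = "\<lambda>z. (a, z)", OF _ f'(1)]) (auto intro!: derivative_eq_intros)
    moreover have "(\<lambda>h. f' (0, h)) = (*) (f' (0, 1))"
      by (rule ext) (metis f'(2) mult.commute mult.right_neutral mult_zero_right)
    ultimately have "((\<lambda>z. f (a, z)) has_field_derivative f' (0, 1)) (at b)"
      unfolding has_field_derivative_def by (simp only:)
    then show "\<exists>D. ((\<lambda>z. f (a, z)) has_field_derivative D) (at b)" by blast
  qed
  have hol1: "(\<lambda>z. f (z, t)) holomorphic_on ball 0 r" if "norm t \<le> r" for t
  proof (rule holomorphic_onI_derivative)
    fix z :: complex assume "z \<in> ball 0 r"
    then show "\<exists>D. ((\<lambda>z. f (z, t)) has_field_derivative D) (at z)" using d1[of z t] that by simp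
  qed
  have hol2: "(\<lambda>t. f (z, t)) holomorphic_on ball 0 r" if "norm z \<le> r" for z
  proof (rule holomorphic_onI_derivative)
    fix t :: complex assume "t \<in> ball 0 r"
    then show "\<exists>D. ((\<lambda>t. f (z, t)) has_field_derivative D) (at t)" using d2[of z t] that by simp
  qed
  have "continuous_on (cball 0 r \<times> cball 0 r) f"
    by (rule continuous_at_imp_continuous_on) (use f inball in \<open>force intro: has_derivative_continuous\<close>)
  then have "bounded (f ` (cball 0 r \<times> cball 0 r))"
    by (intro compact_imp_bounded compact_continuous_image compact_Times) auto
  then obtain B0 where B0: "\<And>a b. norm a \<le> r \<Longrightarrow> norm b \<le> r \<Longrightarrow> norm (f (a, b)) \<le> B0"
    unfolding bounded_iff by force
  \<comment> \<open>The extra 1 yields the open ball required by the Cauchy bound; C is that bound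
    for a second derivative on discs of radius r / 2.\<close>
  define B where "B = B0 + 1"
  define C where "C = 2 * B / (r / 2) ^ 2"
  define q where "q t = deriv (\<lambda>z. f (z, t)) 0" for t
  have qd: "((\<lambda>z. f (z, t)) has_field_derivative q t) (at 0)" if "norm t \<le> r" for t
    unfolding q_def using holomorphic_derivI[OF hol1[OF that] open_ball, of 0] r by simp
  have est: "norm (f (z, t) - f (0, t) - q t * z) \<le> C * norm z ^ 2" if z: "norm z < r / 2" and t: "norm t \<le> r" for z t
  proof -
    let ?h = "\<lambda>i. (deriv ^^ i) (\<lambda>z. f (z, t))"
    have "norm (?h 0 z - (\<Sum>i\<le>1. ?h i 0 * (z - 0) ^ i / fact i)) \<le> C * norm (z - 0) ^ Suc 1 / fact 1"
    proof (rule complex_Taylor[where S = "ball 0 (r / 2)"])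
      show "(?h i has_field_derivative ?h (Suc i) x) (at x within ball 0 (r / 2))" if "x \<in> ball 0 (r / 2)" for i x
        by (rule has_field_derivative_at_within, rule has_field_derivative_higher_deriv[OF hol1[OF t]]) (use that r in auto)
      show "norm (?h (Suc 1) x) \<le> C" if x: "x \<in> ball 0 (r / 2)" for x
      proof -
        have sub: "norm y \<le> r" if "y \<in> cball x (r / 2)" for y
        proof -
          have "norm y \<le> norm x + dist x y" by (metis dist_norm norm_triangle_sub norm_minus_commute)
          then show ?thesis using x that by simp
        qed
        have "norm ((deriv ^^ 2) (\<lambda>z. f (z, t)) x) \<le> fact 2 * B / (r / 2) ^ 2"
        proof (rule Cauchy_higher_deriv_bound[where y = 0])
          have bs: "ball x (r / 2) \<subseteq> ball 0 r"
          proof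
            fix y assume y: "y \<in> ball x (r / 2)"
            have "norm y \<le> norm x + dist x y" by (metis dist_norm norm_triangle_sub norm_minus_commute)
            then show "y \<in> ball 0 r" using x y by simp
          qed
          show "(\<lambda>z. f (z, t)) holomorphic_on ball x (r / 2)"
            by (rule holomorphic_on_subset[OF hol1[OF t] bs])
          show "continuous_on (cball x (r / 2)) (\<lambda>z. f (z, t))"
            by (rule continuous_at_imp_continuous_on) (use d1[OF sub t] DERIV_isCont in blast)
          show "f (w, t) \<in> ball 0 B" if "w \<in> ball x (r / 2)" for w
            using B0[OF sub t, of w] that by (simp add: B_def)
        qed (use r in auto)
        then show ?thesis by (simp add: C_def numeral_2_eq_2)
      qed
    qed (use z r in auto)
    then show ?thesis by (simp add: q_def algebra_simps power2_eq_square)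
  qed
  \<comment> \<open>Nonzero increments tending to 0, of modulus at most r / 4, so that the Taylor
    estimate \<open>est\<close> applies to all of them.\<close>
  define hh where "hh n = complex_of_real (r / (2 * (real n + 2)))" for n
  have hn1: "norm (hh n) = r / (2 * (real n + 2))" for n
    unfolding hh_def norm_of_real using r by simp
  have hn2: "hh n \<noteq> 0" for n using hn1[of n] r by (metis add_nonneg_pos divide_pos_pos less_irrefl mult_pos_pos norm_zero of_nat_0_le_iff zero_less_numeral)
  note hn = hn1 hn2
  have hr: "norm (hh n) < r / 2" for n unfolding hn1 using r by (simp add: field_simps add_pos_nonneg)
  have hr2: "norm (hh n) \<le> r" for n using hr[of n] r by linarith
  have "q holomorphic_on ball 0 r"
  proof (rule holomorphic_uniform_sequence[OF open_ball])
    fix n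
    show "(\<lambda>t. (f (hh n, t) - f (0, t)) / hh n) holomorphic_on ball 0 r"
      by (intro holomorphic_intros hol2 hr2 hn2) (use r in auto)
  next
    fix t :: complex assume t: "t \<in> ball 0 r"
    then obtain d where d: "d > 0" "cball t d \<subseteq> ball 0 r" using open_contains_cball open_ball by blast
    have "uniform_limit (ball 0 r) (\<lambda>n t. (f (hh n, t) - f (0, t)) / hh n) q sequentially"
    proof (rule uniform_limitI)
      fix d :: real assume d: "d > 0"
      have "(\<lambda>n. C * (r / (2 * (real n + 2)))) \<longlonglongrightarrow> C * 0"
        by (intro tendsto_mult tendsto_const) real_asymp
      then have "\<forall>\<^sub>F n in sequentially. C * (r / (2 * (real n + 2))) < d" using d by (intro order_tendstoD(2)) auto
      then show "\<forall>\<^sub>F n in sequentially. \<forall>x\<in>ball 0 r. dist ((f (hh n, x) - f (0, x)) / hh n) (q x) < d"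
      proof eventually_elim
        case (elim n)
        show ?case
        proof
          fix x :: complex assume x: "x \<in> ball 0 r"
          have "(f (hh n, x) - f (0, x)) / hh n - q x = (f (hh n, x) - f (0, x) - q x * hh n) / hh n"
            using hn(2)[of n] by (simp add: field_simps)
          then have "dist ((f (hh n, x) - f (0, x)) / hh n) (q x) = norm (f (hh n, x) - f (0, x) - q x * hh n) / norm (hh n)"
            by (simp add: dist_norm norm_divide)
          also have "\<dots> \<le> C * norm (hh n) ^ 2 / norm (hh n)"
            using est[OF hr[of n], of x] x by (intro divide_right_mono) auto
          also have "\<dots> = C * norm (hh n)" using hn(2)[of n] by (simp add: power2_eq_square)
          also have "\<dots> < d" using elim by (simp add: hn)
          finally show "dist ((f (hh n, x) - f (0, x)) / hh n) (q x) < d" .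
        qed
      qed
    qed
    then show "\<exists>d>0. cball t d \<subseteq> ball 0 r \<and> uniform_limit (cball t d) (\<lambda>n t. (f (hh n, t) - f (0, t)) / hh n) q sequentially"
      using d uniform_limit_on_subset by blast
  qed
  then show ?thesis using r qd by (intro exI[of _ q] exI[of _ r]) auto
qed

subsection \<open>Wirtinger jets\<close>

lemma jet_sum:
  assumes "finite A" "\<And>a. a \<in> A \<Longrightarrow> jet (f a) (f0 a) (fs a) (ft a) (fm a)"
  shows "jet (\<lambda>s t. \<Sum>a\<in>A. f a s t) (\<Sum>a\<in>A. f0 a) (\<Sum>a\<in>A. fs a) (\<Sum>a\<in>A. ft a) (\<Sum>a\<in>A. fm a)"
  using assms
proof (induction A)
  case empty then show ?case using jet_const[of 0] by simp
next
  case (insert a A) then show ?case using jet_add by (simp add: jet_add)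
qed

text \<open>In \<open>wjet f f0 fu fu' fv fv' fm fm'\<close> the primed values are derivatives with respect to the
  conjugate variables; \<open>fm\<close> and \<open>fm'\<close> belong to \<open>u, cnj v\<close> and to \<open>cnj u, v\<close>.\<close>

definition wjet :: "(complex \<Rightarrow> complex \<Rightarrow> complex ^ 'n ^ 'n) \<Rightarrow> complex ^ 'n ^ 'n \<Rightarrow>
    complex ^ 'n ^ 'n \<Rightarrow> complex ^ 'n ^ 'n \<Rightarrow> complex ^ 'n ^ 'n \<Rightarrow> complex ^ 'n ^ 'n \<Rightarrow>
    complex ^ 'n ^ 'n \<Rightarrow> complex ^ 'n ^ 'n \<Rightarrow> bool" where
  "wjet f f0 fu fu' fv fv' fm fm' \<longleftrightarrow> (\<exists>g g'. \<forall>d e.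
     jet (\<lambda>s t. f (of_real s * d) (of_real t * e)) f0
       (scale_mat d fu + scale_mat (cnj d) fu') (scale_mat e fv + scale_mat (cnj e) fv')
       (scale_mat (d * e) g + scale_mat (d * cnj e) fm + scale_mat (cnj d * e) fm' + scale_mat (cnj d * cnj e) g'))"

lemma wjetI:
  assumes "\<And>d e. jet (\<lambda>s t. f (of_real s * d) (of_real t * e)) f0
       (scale_mat d fu + scale_mat (cnj d) fu') (scale_mat e fv + scale_mat (cnj e) fv')
       (scale_mat (d * e) g + scale_mat (d * cnj e) fm + scale_mat (cnj d * e) fm' + scale_mat (cnj d * cnj e) g')"
  shows "wjet f f0 fu fu' fv fv' fm fm'"
  using assms unfolding wjet_def by blast

lemma jet_eqI: "jet f f0 fs ft fm \<Longrightarrow> f0 = f0' \<Longrightarrow> fs = fs' \<Longrightarrow> ft = ft' \<Longrightarrow> fm = fm' \<Longrightarrow> jet f f0' fs' ft' fm'"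
  by simp

lemma wjet_const: "wjet (\<lambda>z w. c) c 0 0 0 0 0 0"
  by (rule wjetI[where g = 0 and g' = 0]) (simp add: jet_const)

lemma wjet_linear:
  assumes L: "bounded_linear L" "\<And>c X. L (scale_mat c X) = scale_mat c (L X)"
    and f: "wjet f f0 fu fu' fv fv' fm fm'"
  shows "wjet (\<lambda>z w. L (f z w)) (L f0) (L fu) (L fu') (L fv) (L fv') (L fm) (L fm')"
proof -
  obtain g g' where *: "\<And>d e. jet (\<lambda>s t. f (of_real s * d) (of_real t * e)) f0
       (scale_mat d fu + scale_mat (cnj d) fu') (scale_mat e fv + scale_mat (cnj e) fv')
       (scale_mat (d * e) g + scale_mat (d * cnj e) fm + scale_mat (cnj d * e) fm' + scale_mat (cnj d * cnj e) g')"
    using f unfolding wjet_def by blast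
  interpret bounded_linear L by fact
  show ?thesis
    by (rule wjetI[where g = "L g" and g' = "L g'"], rule jet_eqI[OF jet_linear[OF L(1) *]]) (simp_all add: add L(2))
qed

text \<open>A conjugate-linear map exchanges each parameter with its conjugate; in second order it
  exchanges the coefficients of u, cnj v and cnj u, v.\<close>

lemma wjet_antilinear:
  assumes L: "bounded_linear L" "\<And>c X. L (scale_mat c X) = scale_mat (cnj c) (L X)"
    and f: "wjet f f0 fu fu' fv fv' fm fm'"
  shows "wjet (\<lambda>z w. L (f z w)) (L f0) (L fu') (L fu) (L fv') (L fv) (L fm') (L fm)"
proof -
  obtain g g' where *: "\<And>d e. jet (\<lambda>s t. f (of_real s * d) (of_real t * e)) f0
       (scale_mat d fu + scale_mat (cnj d) fu') (scale_mat e fv + scale_mat (cnj e) fv')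
       (scale_mat (d * e) g + scale_mat (d * cnj e) fm + scale_mat (cnj d * e) fm' + scale_mat (cnj d * cnj e) g')"
    using f unfolding wjet_def by blast
  interpret bounded_linear L by fact
  show ?thesis
    by (rule wjetI[where g = "L g'" and g' = "L g"], rule jet_eqI[OF jet_linear[OF L(1) *]]) (simp_all add: add L(2) ac_simps)
qed

lemma wjet_add:
  assumes f: "wjet f f0 fu fu' fv fv' fm fm'" and h: "wjet h h0 hu hu' hv hv' hm hm'"
  shows "wjet (\<lambda>z w. f z w + h z w) (f0 + h0) (fu + hu) (fu' + hu') (fv + hv) (fv' + hv') (fm + hm) (fm' + hm')"
proof -
  obtain g g' where *: "\<And>d e. jet (\<lambda>s t. f (of_real s * d) (of_real t * e)) f0
       (scale_mat d fu + scale_mat (cnj d) fu') (scale_mat e fv + scale_mat (cnj e) fv')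
       (scale_mat (d * e) g + scale_mat (d * cnj e) fm + scale_mat (cnj d * e) fm' + scale_mat (cnj d * cnj e) g')"
    using f unfolding wjet_def by blast
  obtain k k' where **: "\<And>d e. jet (\<lambda>s t. h (of_real s * d) (of_real t * e)) h0
       (scale_mat d hu + scale_mat (cnj d) hu') (scale_mat e hv + scale_mat (cnj e) hv')
       (scale_mat (d * e) k + scale_mat (d * cnj e) hm + scale_mat (cnj d * e) hm' + scale_mat (cnj d * cnj e) k')"
    using h unfolding wjet_def by blast
  show ?thesis
    by (rule wjetI[where g = "g + k" and g' = "g' + k'"], rule jet_eqI[OF jet_add[OF * **]])
      (simp_all add: scale_mat_add ac_simps)
qed

lemma wjet_bilinear:
  assumes B: "bounded_bilinear B" and Bl: "\<And>c X Y. B (scale_mat c X) Y = scale_mat c (B X Y)"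
    and Br: "\<And>c X Y. B X (scale_mat c Y) = scale_mat c (B X Y)"
    and f: "wjet f f0 fu fu' fv fv' fm fm'" and h: "wjet h h0 hu hu' hv hv' hm hm'"
  shows "wjet (\<lambda>z w. B (f z w) (h z w)) (B f0 h0) (B f0 hu + B fu h0) (B f0 hu' + B fu' h0)
     (B f0 hv + B fv h0) (B f0 hv' + B fv' h0)
     (B f0 hm + B fv' hu + (B fu hv' + B fm h0))
     (B f0 hm' + B fv hu' + (B fu' hv + B fm' h0))"
proof -
  obtain g g' where *: "\<And>d e. jet (\<lambda>s t. f (of_real s * d) (of_real t * e)) f0
       (scale_mat d fu + scale_mat (cnj d) fu') (scale_mat e fv + scale_mat (cnj e) fv')
       (scale_mat (d * e) g + scale_mat (d * cnj e) fm + scale_mat (cnj d * e) fm' + scale_mat (cnj d * cnj e) g')"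
    using f unfolding wjet_def by blast
  obtain k k' where **: "\<And>d e. jet (\<lambda>s t. h (of_real s * d) (of_real t * e)) h0
       (scale_mat d hu + scale_mat (cnj d) hu') (scale_mat e hv + scale_mat (cnj e) hv')
       (scale_mat (d * e) k + scale_mat (d * cnj e) hm + scale_mat (cnj d * e) hm' + scale_mat (cnj d * cnj e) k')"
    using h unfolding wjet_def by blast
  interpret bounded_bilinear B by fact
  show ?thesis
    by (rule wjetI[where g = "B f0 k + B fv hu + (B fu hv + B g h0)" and g' = "B f0 k' + B fv' hu' + (B fu' hv' + B g' h0)"],
        rule jet_eqI[OF jet_bilinear[OF B * **]])
      (simp_all add: add_left add_right scale_mat_add Bl Br scale_mat_scale ac_simps)
qed

lemmas wjet_mult = wjet_bilinear[OF bounded_bilinear_matrix_mult scale_mat_mult_left scale_mat_mult_right]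

lemma polydisc_line:
  fixes d e :: complex
  assumes "\<epsilon> > 0"
  shows "\<exists>\<delta>>0. \<forall>s. \<bar>s\<bar> < \<delta> \<longrightarrow> norm (of_real s * d) < \<epsilon> \<and> norm (of_real s * e) < \<epsilon>"
proof (intro exI[of _ "\<epsilon> / (norm d + norm e + 1)"] conjI allI impI)
  have p: "norm d + norm e + 1 > 0" by (simp add: add_nonneg_pos)
  show "\<epsilon> / (norm d + norm e + 1) > 0" using assms p by simp
  fix s :: real assume s: "\<bar>s\<bar> < \<epsilon> / (norm d + norm e + 1)"
  have *: "\<bar>s\<bar> * (norm d + norm e + 1) < \<epsilon>" using s p by (simp add: field_simps)
  have "\<bar>s\<bar> * norm d \<le> \<bar>s\<bar> * (norm d + norm e + 1)" "\<bar>s\<bar> * norm e \<le> \<bar>s\<bar> * (norm d + norm e + 1)"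
    by (intro mult_left_mono; simp)+
  then show "norm (of_real s * d) < \<epsilon>" "norm (of_real s * e) < \<epsilon>" using * by (simp_all add: norm_mult)
qed

text \<open>\<open>jet_solve\<close> is applied along each pair of real lines with directions d and
  e, on a radius that depends on d and e. The four mixed coefficients of the solution belong to the
  four monomials in d, e and their conjugates.\<close>

lemma wjet_solve:
  assumes B: "bounded_bilinear B" and Bl: "\<And>c X Y. B (scale_mat c X) Y = scale_mat c (B X Y)"
    and Br: "\<And>c X Y. B X (scale_mat c Y) = scale_mat c (B X Y)"
    and A: "wjet A 0 Au Au' Av Av' Am Am'" and b: "wjet b b0 bu bu' bv bv' bm bm'" and e: "\<epsilon> > 0"
    and small: "\<And>z w y. norm z < \<epsilon> \<Longrightarrow> norm w < \<epsilon> \<Longrightarrow> norm (B (A z w) y) \<le> norm y / 2"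
    and eq: "\<And>z w. norm z < \<epsilon> \<Longrightarrow> norm w < \<epsilon> \<Longrightarrow> y z w + B (A z w) (y z w) = b z w"
    and yu: "yu = bu - B Au b0" "yu' = bu' - B Au' b0" "yv = bv - B Av b0" "yv' = bv' - B Av' b0"
  shows "wjet y b0 yu yu' yv yv' (bm - B Av' yu - (B Au yv' + B Am b0)) (bm' - B Av yu' - (B Au' yv + B Am' b0))"
proof -
  obtain g g' where *: "\<And>d e. jet (\<lambda>s t. A (of_real s * d) (of_real t * e)) 0
       (scale_mat d Au + scale_mat (cnj d) Au') (scale_mat e Av + scale_mat (cnj e) Av')
       (scale_mat (d * e) g + scale_mat (d * cnj e) Am + scale_mat (cnj d * e) Am' + scale_mat (cnj d * cnj e) g')"
    using A unfolding wjet_def by blast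
  obtain k k' where **: "\<And>d e. jet (\<lambda>s t. b (of_real s * d) (of_real t * e)) b0
       (scale_mat d bu + scale_mat (cnj d) bu') (scale_mat e bv + scale_mat (cnj e) bv')
       (scale_mat (d * e) k + scale_mat (d * cnj e) bm + scale_mat (cnj d * e) bm' + scale_mat (cnj d * cnj e) k')"
    using b unfolding wjet_def by blast
  interpret bounded_bilinear B by fact
  show ?thesis
  proof (rule wjetI[where g = "k - B Av yu - (B Au yv + B g b0)" and g' = "k' - B Av' yu' - (B Au' yv' + B g' b0)"])
    fix d e :: complex
    obtain \<delta> where \<delta>: "\<delta> > 0" "\<And>s. \<bar>s\<bar> < \<delta> \<Longrightarrow> norm (of_real s * d) < \<epsilon> \<and> norm (of_real s * e) < \<epsilon>"
      using polydisc_line[OF \<open>\<epsilon> > 0\<close>, of d e] by blast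
    show "jet (\<lambda>s t. y (of_real s * d) (of_real t * e)) b0 (scale_mat d yu + scale_mat (cnj d) yu') (scale_mat e yv + scale_mat (cnj e) yv')
       (scale_mat (d * e) (k - B Av yu - (B Au yv + B g b0)) + scale_mat (d * cnj e) (bm - B Av' yu - (B Au yv' + B Am b0)) +
        scale_mat (cnj d * e) (bm' - B Av yu' - (B Au' yv + B Am' b0)) + scale_mat (cnj d * cnj e) (k' - B Av' yu' - (B Au' yv' + B g' b0)))"
      by (rule jet_eqI[OF jet_solve[OF B * ** \<delta>(1) _ _ refl refl]])
        (use small eq \<delta>(2) in \<open>simp_all add: yu add_left add_right diff_left diff_right scale_mat_add scale_mat_diff Bl Br scale_mat_scale algebra_simps\<close>,
         simp add: mult.commute[of e d] mult.commute[of "cnj e" "cnj d"] add.commute add.left_commute)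
  qed
qed

text \<open>Holomorphy leaves a single mixed second derivative, the one in z and t, which is
  supplied as the witness g.\<close>

lemma wjet_mexp:
  "wjet (\<lambda>z w. mexp (- (scale_mat z u + scale_mat w v))) (mat 1) (- u) 0 (- v) 0 0 0"
  for u v :: "complex^'n^'n"
proof (rule wjetI[where g = "(1 / 2) *\<^sub>R (u ** v + v ** u)" and g' = 0])
  fix d e :: complex
  define A where "A = - scale_mat d u"
  define B where "B = - scale_mat e v"
  have e: "- (scale_mat (of_real s * d) u + scale_mat (of_real t * e) v) = s *\<^sub>R A + t *\<^sub>R B" for s t
    by (simp add: A_def B_def scale_mat_scale[symmetric] scale_mat_of_real)
  show "jet (\<lambda>s t. mexp (- (scale_mat (of_real s * d) u + scale_mat (of_real t * e) v))) (mat 1)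
        (scale_mat d (- u) + scale_mat (cnj d) 0) (scale_mat e (- v) + scale_mat (cnj e) 0)
        (scale_mat (d * e) ((1 / 2) *\<^sub>R (u ** v + v ** u)) + scale_mat (d * cnj e) 0 + scale_mat (cnj d * e) 0 + scale_mat (cnj d * cnj e) 0)"
    unfolding e
  proof (rule jetI[where g = "\<lambda>t. dexp (t *\<^sub>R B) A"])
    have "((\<lambda>s. mexp (s *\<^sub>R A + t *\<^sub>R B)) has_vector_derivative dexp (t *\<^sub>R B) A) (at 0)" for t
    proof -
      have 1: "((\<lambda>s. s *\<^sub>R A + t *\<^sub>R B) has_derivative (\<lambda>h. h *\<^sub>R A)) (at 0)" by (auto intro!: derivative_eq_intros)
      have 2: "(mexp has_derivative dexp (t *\<^sub>R B)) (at (0 *\<^sub>R A + t *\<^sub>R B))" using mexp_has_derivative[of "t *\<^sub>R B"] by simp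
      have 3: "dexp (t *\<^sub>R B) (h *\<^sub>R A) = h *\<^sub>R dexp (t *\<^sub>R B) A" for h
        using dexp_scale[of "t *\<^sub>R B" "of_real h" A] by (simp add: scale_mat_of_real)
      show ?thesis
        using has_derivative_compose[OF 1 2] unfolding has_vector_derivative_def 3 .
    qed
    then show "\<forall>\<^sub>F t in nhds 0. ((\<lambda>s. mexp (s *\<^sub>R A + t *\<^sub>R B)) has_vector_derivative dexp (t *\<^sub>R B) A) (at 0)" by simp
    show "mexp (0 *\<^sub>R A + 0 *\<^sub>R B) = mat 1" by simp
    show "dexp (0 *\<^sub>R B) A = scale_mat d (- u) + scale_mat (cnj d) 0"
      using dexp_commute[of A "0 *\<^sub>R B"] by (simp add: A_def scale_mat_minus)
    show "((\<lambda>t. mexp (0 *\<^sub>R A + t *\<^sub>R B)) has_vector_derivative (scale_mat e (- v) + scale_mat (cnj e) 0)) (at 0)"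
      using mexp_line[of B 0 UNIV] by (simp add: B_def scale_mat_minus)
    show "((\<lambda>t. dexp (t *\<^sub>R B) A) has_vector_derivative scale_mat (d * e) ((1 / 2) *\<^sub>R (u ** v + v ** u)) +
         scale_mat (d * cnj e) 0 + scale_mat (cnj d * e) 0 + scale_mat (cnj d * cnj e) 0) (at 0)"
      using dexp_line_derivative[of B A]
      by (simp add: A_def B_def matrix_minus_left matrix_minus_right scale_mat_mult_left scale_mat_mult_right
          scale_mat_scale scale_mat_add scale_mat_minus scale_mat_scaleR mult.commute)
  qed
qed

definition Eij :: "'n \<Rightarrow> 'n \<Rightarrow> complex ^ 'n ^ 'n" where
  "Eij i j = (\<chi> a b. if a = i \<and> b = j then 1 else 0)"

lemma mat_Eij: "A = (\<Sum>(i, j)\<in>UNIV. scale_mat (A $ i $ j) (Eij i j))"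
proof -
  have "(\<Sum>(i, j)\<in>UNIV. scale_mat (A $ i $ j) (Eij i j)) $ a $ b = A $ a $ b" for a b
  proof -
    have "(\<Sum>(i, j)\<in>UNIV. scale_mat (A $ i $ j) (Eij i j)) $ a $ b =
        (\<Sum>p\<in>UNIV. if p = (a, b) then A $ a $ b else 0)"
      unfolding sum_component by (rule sum.cong) (auto simp: scale_mat_def Eij_def split: if_splits)
    then show ?thesis by (simp add: sum.delta)
  qed
  then show ?thesis by (simp add: vec_eq_iff)
qed

text \<open>Entrywise from \<open>holomorphic_two_partial\<close>: complex linearity of the
  derivative leaves no terms in the conjugate parameters, and holomorphy of the partial derivative
  provides the second order.\<close>

lemma wjet_holomorphic:
  fixes f :: "complex \<Rightarrow> complex \<Rightarrow> complex ^ 'n ^ 'n"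
  assumes e: "e > 0"
    and f: "\<And>z. z \<in> ball 0 e \<Longrightarrow> \<exists>f'. ((\<lambda>z. f (fst z) (snd z)) has_derivative f') (at z) \<and>
       (\<forall>c a b. f' (c * a, c * b) = scale_mat c (f' (a, b)))"
  shows "\<exists>fu fv. wjet f (f 0 0) fu 0 fv 0 0 0"
proof -
  have "\<exists>q q' p. \<forall>d e. jet (\<lambda>s t. f (of_real s * d) (of_real t * e) $ i $ j) (f 0 0 $ i $ j) (d * q) (e * p) (d * e * q')" for i j
  proof -
    have bl: "bounded_linear (\<lambda>A :: complex^'n^'n. A $ i $ j)"
      using bounded_linear_compose[OF bounded_linear_vec_nth bounded_linear_vec_nth] by blast
    have der: "\<exists>f'. ((\<lambda>z. f (fst z) (snd z) $ i $ j) has_derivative f') (at z) \<and> (\<forall>c a b. f' (c * a, c * b) = c * f' (a, b))"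
      if z: "z \<in> ball 0 e" for z
    proof -
      obtain f' where f': "((\<lambda>z. f (fst z) (snd z)) has_derivative f') (at z)" "\<And>c a b. f' (c * a, c * b) = scale_mat c (f' (a, b))"
        using f[OF z] by blast
      show ?thesis
        using bounded_linear.has_derivative[OF bl f'(1)] f'(2)
        by (intro exI[of _ "\<lambda>h. f' h $ i $ j"]) (simp add: scale_mat_def)
    qed
    obtain q r where q: "r > 0" "q holomorphic_on ball 0 r"
      "\<And>t. t \<in> ball 0 r \<Longrightarrow> ((\<lambda>z. f z t $ i $ j) has_field_derivative q t) (at 0)"
      using holomorphic_two_partial[OF e der] by auto
    obtain f' where f': "((\<lambda>z. f (fst z) (snd z) $ i $ j) has_derivative f') (at (0, 0))" "\<And>c a b. f' (c * a, c * b) = c * f' (a, b)"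
      using der[of "(0, 0)"] e by auto
    have "((\<lambda>w. f (fst (0::complex, w)) (snd (0::complex, w)) $ i $ j) has_derivative (\<lambda>h. f' (0, h))) (at 0)"
      by (rule has_derivative_compose[where f = "\<lambda>w. (0, w)", OF _ f'(1)]) (auto intro!: derivative_eq_intros)
    moreover have "(\<lambda>h. f' (0, h)) = (*) (f' (0, 1))"
      by (rule ext) (metis f'(2) mult.commute mult.right_neutral mult_zero_right)
    ultimately have p: "((\<lambda>w. f 0 w $ i $ j) has_field_derivative f' (0, 1)) (at 0)"
      unfolding has_field_derivative_def by (simp only: fst_conv snd_conv)
    obtain q' where q': "(q has_field_derivative q') (at 0)"
      using holomorphic_derivI[OF q(2) open_ball, of 0] q(1) by auto
    have line: "((\<lambda>s. of_real s * d) has_vector_derivative d) (at 0)" for d :: complex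
      unfolding scaleR_conv_of_real[symmetric] has_vector_derivative_def
      by (rule bounded_linear_imp_has_derivative[OF bounded_linear_scaleR_left])
    have "jet (\<lambda>s t. f (of_real s * d) (of_real t * e) $ i $ j) (f 0 0 $ i $ j) (d * q 0) (e * f' (0, 1)) (d * e * q')" for d e
    proof (rule jetI[where g = "\<lambda>t. d * q (of_real t * e)"])
      obtain \<delta> where \<delta>: "\<delta> > 0" "\<And>s. \<bar>s\<bar> < \<delta> \<Longrightarrow> norm (of_real s * d) < r \<and> norm (of_real s * e) < r"
        using polydisc_line[OF q(1), of d e] by blast
      have "\<forall>\<^sub>F t in nhds 0. t \<in> {-\<delta><..<\<delta>}" using \<delta> by (intro eventually_nhds_in_open) auto
      then show "\<forall>\<^sub>F t in nhds 0. ((\<lambda>s. f (of_real s * d) (of_real t * e) $ i $ j) has_vector_derivative d * q (of_real t * e)) (at 0)"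
      proof eventually_elim
        case (elim t)
        then have "\<bar>t\<bar> < \<delta>" by auto
        then have "((\<lambda>z. f z (of_real t * e) $ i $ j) has_field_derivative q (of_real t * e)) (at (of_real 0 * d))"
          using q(3)[of "of_real t * e"] \<delta>(2)[of t] by simp
        from field_vector_diff_chain_at[OF line this] show ?case by (simp add: o_def)
      qed
      have "((\<lambda>z. f 0 z $ i $ j) has_field_derivative f' (0, 1)) (at (of_real 0 * e))" using p by simp
      from field_vector_diff_chain_at[OF line this]
      show "((\<lambda>t. f (of_real 0 * d) (of_real t * e) $ i $ j) has_vector_derivative e * f' (0, 1)) (at 0)" by (simp add: o_def)
      have "(q has_field_derivative q') (at (of_real 0 * e))" using q' by simp
      from has_vector_derivative_mult_right[OF field_vector_diff_chain_at[OF line this], of d]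
      show "((\<lambda>t. d * q (of_real t * e)) has_vector_derivative d * e * q') (at 0)" by (simp add: o_def mult.assoc)
    qed auto
    then show ?thesis by blast
  qed
  then obtain q q' p where *: "\<And>i j d e. jet (\<lambda>s t. f (of_real s * d) (of_real t * e) $ i $ j) (f 0 0 $ i $ j) (d * q i j) (e * p i j) (d * e * q' i j)"
    by metis
  define M where "M a = (\<Sum>(i, j)\<in>UNIV. scale_mat (a i j) (Eij i j))" for a :: "'n \<Rightarrow> 'n \<Rightarrow> complex"
  have Ms: "M (\<lambda>i j. c * a i j) = scale_mat c (M a)" for c a
    by (simp add: M_def scale_mat_sum scale_mat_scale case_prod_unfold)
  have bl: "bounded_linear (\<lambda>c. scale_mat c E)" for E :: "complex^'n^'n"
    unfolding linear_conv_bounded_linear[symmetric]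
    by (rule linearI) (simp_all add: scale_mat_add_left scale_mat_of_real[symmetric] scale_mat_scale scaleR_conv_of_real)
  have "wjet f (f 0 0) (M q) 0 (M p) 0 0 0"
  proof (rule wjetI[where g = "M q'" and g' = 0])
    fix d e
    have "jet (\<lambda>s t. \<Sum>(i, j)\<in>UNIV. scale_mat (f (of_real s * d) (of_real t * e) $ i $ j) (Eij i j))
        (M (\<lambda>i j. f 0 0 $ i $ j)) (M (\<lambda>i j. d * q i j)) (M (\<lambda>i j. e * p i j)) (M (\<lambda>i j. d * e * q' i j))"
      unfolding M_def case_prod_unfold
      by (rule jet_sum) (auto intro: jet_linear[OF bl *])
    then show "jet (\<lambda>s t. f (of_real s * d) (of_real t * e)) (f 0 0) (scale_mat d (M q) + scale_mat (cnj d) 0)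
           (scale_mat e (M p) + scale_mat (cnj e) 0)
           (scale_mat (d * e) (M q') + scale_mat (d * cnj e) 0 + scale_mat (cnj d * e) 0 + scale_mat (cnj d * cnj e) 0)"
      by (simp add: mat_Eij[symmetric] Ms) (simp add: M_def mat_Eij[symmetric])
  qed
  then show ?thesis by blast
qed

text \<open>In the conclusion, \<open>\<theta>\<close> is \<open>M\<^sup>-\<^sup>1 \<partial>M\<close> along the line \<open>t \<mapsto> t e\<close> in the second parameter, with the
  derivative in the first parameter taken along the directions \<open>1\<close> and \<open>\<i>\<close>.\<close>

lemma wjet_log_derivative:
  fixes M :: "complex \<Rightarrow> complex \<Rightarrow> complex^'n^'n"
  assumes M: "wjet M (mat 1) fu fu' fv fv' fm fm'"
  shows "\<exists>X. \<forall>e. \<exists>g1 gi \<theta>. (\<forall>\<^sub>F t in nhds 0.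
      ((\<lambda>s. M (of_real s) (of_real t * e)) has_vector_derivative g1 t) (at 0) \<and>
      ((\<lambda>s. M (of_real s * \<i>) (of_real t * e)) has_vector_derivative gi t) (at 0) \<and>
      M 0 (of_real t * e) ** \<theta> t = scale_mat (1 / 2) (g1 t - scale_mat \<i> (gi t)) \<and>
      (\<exists>Y. M 0 (of_real t * e) ** Y = mat 1)) \<and>
      (\<theta> has_vector_derivative (scale_mat e X + scale_mat (cnj e) (fm - fv' ** fu))) (at 0)"
proof -
  obtain g g' where *: "\<And>d e. jet (\<lambda>s t. M (of_real s * d) (of_real t * e)) (mat 1)
       (scale_mat d fu + scale_mat (cnj d) fu') (scale_mat e fv + scale_mat (cnj e) fv')
       (scale_mat (d * e) g + scale_mat (d * cnj e) fm + scale_mat (cnj d * e) fm' + scale_mat (cnj d * cnj e) g')"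
    using M unfolding wjet_def by blast
  show ?thesis
  \<comment> \<open>The coefficient of e in the derivative of \<theta>: at the origin, where M = 1
    and D = \<open>fu\<close>, the derivative of M^-1 D is D' - M' D.\<close>
  proof (rule exI[of _ "g - fv ** fu"], rule allI)
    fix e
    obtain g1 where g1: "\<forall>\<^sub>F t in nhds 0. ((\<lambda>s. M (of_real s * 1) (of_real t * e)) has_vector_derivative g1 t) (at 0)"
      "M (of_real 0 * 1) (of_real 0 * e) = mat 1" "g1 0 = scale_mat 1 fu + scale_mat (cnj 1) fu'"
      "((\<lambda>t. M (of_real 0 * 1) (of_real t * e)) has_vector_derivative scale_mat e fv + scale_mat (cnj e) fv') (at 0)"
      "(g1 has_vector_derivative (scale_mat (1 * e) g + scale_mat (1 * cnj e) fm + scale_mat (cnj 1 * e) fm' + scale_mat (cnj 1 * cnj e) g')) (at 0)"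
      using *[of 1 e] by (rule jetE)
    obtain gi where gi: "\<forall>\<^sub>F t in nhds 0. ((\<lambda>s. M (of_real s * \<i>) (of_real t * e)) has_vector_derivative gi t) (at 0)"
      "M (of_real 0 * \<i>) (of_real 0 * e) = mat 1" "gi 0 = scale_mat \<i> fu + scale_mat (cnj \<i>) fu'"
      "((\<lambda>t. M (of_real 0 * \<i>) (of_real t * e)) has_vector_derivative scale_mat e fv + scale_mat (cnj e) fv') (at 0)"
      "(gi has_vector_derivative (scale_mat (\<i> * e) g + scale_mat (\<i> * cnj e) fm + scale_mat (cnj \<i> * e) fm' + scale_mat (cnj \<i> * cnj e) g')) (at 0)"
      using *[of \<i> e] by (rule jetE)
    \<comment> \<open>Combining the directions 1 and i cancels the terms that carry
      \<open>cnj d\<close>, namely those with \<open>fu'\<close>, \<open>fm'\<close> and g'.\<close>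
    define D where "D t = scale_mat (1 / 2) (g1 t - scale_mat \<i> (gi t))" for t
    have D0: "D 0 = fu"
      by (simp add: D_def g1 gi scale_mat_def vec_eq_iff field_simps)
    have D': "(D has_vector_derivative (scale_mat e g + scale_mat (cnj e) fm)) (at 0)"
    proof -
      note s = bounded_linear.has_vector_derivative[OF bounded_linear_scale_mat]
      have "(D has_vector_derivative scale_mat (1 / 2) ((scale_mat (1 * e) g + scale_mat (1 * cnj e) fm + scale_mat (cnj 1 * e) fm' + scale_mat (cnj 1 * cnj e) g')
         - scale_mat \<i> (scale_mat (\<i> * e) g + scale_mat (\<i> * cnj e) fm + scale_mat (cnj \<i> * e) fm' + scale_mat (cnj \<i> * cnj e) g'))) (at 0)"
        unfolding D_def by (intro s has_vector_derivative_diff g1 gi)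
      then show ?thesis
        by (simp add: scale_mat_add scale_mat_diff scale_mat_scale scale_mat_minus_left scale_mat_add_left[symmetric] mult.assoc[symmetric])
          (simp add: scale_mat_def vec_eq_iff field_simps)
    qed
    define N where "N t = M 0 (of_real t * e) - mat 1" for t
    have N0: "N 0 = 0" using g1(2) by (simp add: N_def)
    have N': "(N has_vector_derivative (scale_mat e fv + scale_mat (cnj e) fv')) (at 0)"
      using has_vector_derivative_diff[OF g1(4) has_vector_derivative_const[of "mat 1"]] by (simp add: N_def[abs_def])
    obtain K where K: "K \<ge> 1" "\<And>(A :: complex^'n^'n) (B :: complex^'n^'n). norm (A ** B) \<le> K * norm A * norm B"
      using matrix_mult_bound by blast
    have "continuous (at 0) N" using N' by (rule has_vector_derivative_continuous)
    then have "(N \<longlongrightarrow> N 0) (nhds 0)" by (simp add: continuous_within tendsto_at_iff_tendsto_nhds)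
    then have "\<forall>\<^sub>F t in nhds 0. dist (N t) (N 0) < 1 / (2 * K)" using K by (intro tendstoD) auto
    then obtain \<delta> where \<delta>: "\<delta> > 0" "\<And>t. \<bar>t\<bar> < \<delta> \<Longrightarrow> norm (N t) < 1 / (2 * K)"
      unfolding eventually_nhds_metric by (auto simp: N0)
    have small: "norm (N t ** Y) \<le> norm Y / 2" if "\<bar>t\<bar> < \<delta>" for t and Y :: "complex^'n^'n"
    proof -
      have "norm (N t ** Y) \<le> K * norm (N t) * norm Y" by (rule K)
      also have "\<dots> \<le> (1 / 2) * norm Y" using \<delta>(2)[OF that] K(1) by (intro mult_right_mono) (auto simp: field_simps)
      finally show ?thesis by simp
    qed
    define \<theta> where "\<theta> t = (SOME Y. Y + N t ** Y = D t)" for t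
    have \<theta>: "\<theta> t + N t ** \<theta> t = D t" if "\<bar>t\<bar> < \<delta>" for t
      unfolding \<theta>_def by (rule someI_ex, rule perturbed_identity_solve[OF bounded_linear_matrix_right small[OF that]])
    have \<theta>0: "\<theta> 0 = fu" using \<theta>[of 0] \<delta>(1) by (simp add: N0 D0)
    have near: "\<forall>\<^sub>F t in nhds 0. t \<in> {-\<delta><..<\<delta>}" using \<delta> by (intro eventually_nhds_in_open) auto
    show "\<exists>g1 gi \<theta>. (\<forall>\<^sub>F t in nhds 0.
      ((\<lambda>s. M (of_real s) (of_real t * e)) has_vector_derivative g1 t) (at 0) \<and>
      ((\<lambda>s. M (of_real s * \<i>) (of_real t * e)) has_vector_derivative gi t) (at 0) \<and>
      M 0 (of_real t * e) ** \<theta> t = scale_mat (1 / 2) (g1 t - scale_mat \<i> (gi t)) \<and>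
      (\<exists>Y. M 0 (of_real t * e) ** Y = mat 1)) \<and>
      (\<theta> has_vector_derivative (scale_mat e (g - fv ** fu) + scale_mat (cnj e) (fm - fv' ** fu))) (at 0)"
    proof (rule exI[of _ g1], rule exI[of _ gi], rule exI[of _ \<theta>], rule conjI)
      show "\<forall>\<^sub>F t in nhds 0.
        ((\<lambda>s. M (of_real s) (of_real t * e)) has_vector_derivative g1 t) (at 0) \<and>
        ((\<lambda>s. M (of_real s * \<i>) (of_real t * e)) has_vector_derivative gi t) (at 0) \<and>
        M 0 (of_real t * e) ** \<theta> t = scale_mat (1 / 2) (g1 t - scale_mat \<i> (gi t)) \<and>
        (\<exists>Y. M 0 (of_real t * e) ** Y = mat 1)"
        using g1(1) gi(1) near
      proof eventually_elim
        case (elim t)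
        then have t: "\<bar>t\<bar> < \<delta>" by auto
        then have "M 0 (of_real t * e) ** \<theta> t = D t" using \<theta>[of t] by (auto simp: N_def matrix_diff_rdistrib)
        moreover obtain Y where "Y + N t ** Y = mat 1"
          using perturbed_identity_solve[OF bounded_linear_matrix_right small[OF t]] by blast
        then have "M 0 (of_real t * e) ** Y = mat 1" by (simp add: N_def matrix_diff_rdistrib)
        ultimately show ?case using elim by (auto simp: D_def)
      qed
      show "(\<theta> has_vector_derivative (scale_mat e (g - fv ** fu) + scale_mat (cnj e) (fm - fv' ** fu))) (at 0)"
        by (rule solve_derivative[OF bounded_bilinear_matrix_mult N' D' \<delta>(1)])
          (use small \<theta> in \<open>auto simp: N0 \<theta>0 matrix_add_rdistrib scale_mat_mult_left scale_mat_diff\<close>)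
    qed
  qed
qed

subsection \<open>Graded-polarized mixed Hodge structures\<close>

locale polarized = mhs W F for W :: "int \<Rightarrow> (real ^ 'n) set" and F +
  fixes Q :: "int \<Rightarrow> real ^ 'n \<Rightarrow> real ^ 'n \<Rightarrow> real"
  assumes forms: "graded_forms W Q" and pol: "graded_polarized W Q F"

sublocale polarized \<subseteq> bigrading "deligne W F"
  using deligne_bigrading unfolding is_deligne_bigrading_def by unfold_locales auto

text \<open>The bidegrees that conjugation can produce from A: (r, s) becomes (s, r) up to types
  that are strictly smaller in both places. The same rule serves vectors and endomorphisms.\<close>

definition cj :: "(int \<times> int) set \<Rightarrow> (int \<times> int) set" where
  "cj A = {(a, b). \<exists>(r, s)\<in>A. (a = s \<and> b = r) \<or> (a < s \<and> b < r)}"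

text \<open>Bidegree sets of \<open>lie_n_plus\<close>, \<open>lie_n_minus\<close>, \<open>lie_Lambda\<close>, \<open>lie_q\<close>, and of the
  endomorphisms preserving the weight filtration.\<close>

abbreviation "NP \<equiv> {(a, b). a \<ge> 0 \<and> b < 0} :: (int \<times> int) set"
abbreviation "NM \<equiv> {(a, b). a < 0 \<and> b \<ge> 0} :: (int \<times> int) set"
abbreviation "LA \<equiv> {(a, b). a < 0 \<and> b < 0} :: (int \<times> int) set"
abbreviation "QF \<equiv> {(a, b). a < 0} :: (int \<times> int) set"
abbreviation "Wt \<equiv> {(a, b). a + b \<le> 0} :: (int \<times> int) set"

abbreviation wt :: "int \<times> int \<Rightarrow> int" where "wt i \<equiv> fst i + snd i"

lemma mem_shift: "i \<in> (\<lambda>r. r + j) ` R \<longleftrightarrow> i - j \<in> R" for i j :: "'a::group_add"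
  by (metis (no_types, lifting) add_diff_cancel diff_add_cancel imageE image_eqI)

context polarized
begin

abbreviation "Qc k \<equiv> cplx_form (Q k)"

lemma Q_bilinear: "bilinear (Q k)"
  using forms by (simp add: graded_forms_def)

lemmas Qc_simps = cplx_form_add_left[OF Q_bilinear] cplx_form_add_right[OF Q_bilinear]
  cplx_form_diff_left[OF Q_bilinear] cplx_form_diff_right[OF Q_bilinear]
  cplx_form_scale_left[OF Q_bilinear] cplx_form_scale_right[OF Q_bilinear]
  cplx_form_zero_left[OF Q_bilinear] cplx_form_zero_right[OF Q_bilinear]

section \<open>Filtrations, conjugation and forms in terms of types\<close>

lemma J_mem_VV: "x \<in> J i \<Longrightarrow> i \<in> R \<Longrightarrow> x \<in> VV R"
  using J_VV by blast

lemma F_VV: "F p = VV {(a, b). a \<ge> p}"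
proof -
  have "F p = vec.span (\<Union>a\<in>{p..}. \<Union>b. deligne W F a b)"
    using deligne_bigrading by (simp add: is_deligne_bigrading_def)
  also have "(\<Union>a\<in>{p..}. \<Union>b. deligne W F a b) = (\<Union>i\<in>{(a, b). a \<ge> p}. J i)" by (fastforce simp: J_def)
  finally show ?thesis by (simp add: span_J)
qed

lemma WC_VV: "WC W k = VV {(a, b). a + b \<le> k}"
proof -
  have "WC W k = vec.span (\<Union>(a, b)\<in>{(a, b). a + b \<le> k}. deligne W F a b)"
    using deligne_bigrading by (simp add: is_deligne_bigrading_def)
  also have "(\<Union>(a, b)\<in>{(a, b). a + b \<le> k}. deligne W F a b) = (\<Union>i\<in>{(a, b). a + b \<le> k}. J i)" by (auto simp: J_def)
  finally show ?thesis by (simp add: span_J)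
qed

lemma hodge_U_VV: "hodge_U W F p = VV {(a, b). a = p}"
proof -
  have "(\<Union>q. deligne W F p q) = (\<Union>i\<in>{(a, b). a = p}. J i)" by (auto simp: J_def)
  then show ?thesis by (simp add: hodge_U_def span_J)
qed

lemma J_cnj: assumes "x \<in> J i" shows "cnj_vec x \<in> VV (cj {i})"
proof -
  obtain p q where i: "i = (p, q)" by (cases i)
  let ?L = "vec.span (\<Union>a\<in>{..<q}. \<Union>b\<in>{..<p}. deligne W F a b)"
  have L: "?L = VV {(a, b). a < q \<and> b < p}"
  proof -
    have "(\<Union>a\<in>{..<q}. \<Union>b\<in>{..<p}. deligne W F a b) = (\<Union>i\<in>{(a, b). a < q \<and> b < p}. J i)" by (fastforce simp: J_def)
    then show ?thesis by (simp add: span_J)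
  qed
  have "cnj_vec x + 0 \<in> cnj_vec ` deligne W F p q + ?L"
    using assms vec.span_zero by (intro set_plus_intro) (auto simp: i J_def)
  also have "\<dots> = deligne W F q p + ?L"
    using deligne_bigrading by (simp add: is_deligne_bigrading_def)
  finally obtain z l where zl: "z \<in> J (q, p)" "l \<in> ?L" "cnj_vec x = z + l"
    by (auto simp: J_def elim: set_plus_elim)
  have "z \<in> VV (cj {i})" using zl(1) J_VV[of "(q, p)" "cj {i}"] by (auto simp: cj_def i)
  moreover have "{(a, b). a < q \<and> b < p} \<subseteq> cj {i}" by (auto simp: cj_def i)
  then have "l \<in> VV (cj {i})" using zl(2) VV_mono unfolding L by blast
  ultimately show ?thesis using zl(3) vsub(1)[OF VV_sub] by metis
qed

lemma VV_cnj: assumes "x \<in> VV A" shows "cnj_vec x \<in> VV (cj A)"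
proof -
  have "x \<in> cnj_vec ` VV (cj A)"
  proof (rule VV_induct[OF _ _ assms])
    fix i y assume i: "i \<in> A" "y \<in> J i"
    have "cj {i} \<subseteq> cj A" using i by (auto simp: cj_def)
    then show "y \<in> cnj_vec ` VV (cj A)" using J_cnj[OF i(2)] VV_mono unfolding mem_cnj_image by blast
  qed (rule vec_subspace_cnj[OF VV_sub])
  then show ?thesis by (simp add: mem_cnj_image)
qed

text \<open>Conjugate, apply X, conjugate back. On the starting type the two swaps cancel, on the
  bidegree of X only one acts, and the errors of both conjugations merely lower the two indices
  further.\<close>

lemma supp_cnj: assumes "supp R X" shows "supp (cj R) (cnj_mat X)"
proof (rule suppI)
  fix j x assume "x \<in> J j"
  then have "cnj_vec x \<in> VV (cj {j})" by (rule J_cnj)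
  then have "X *v cnj_vec x \<in> VV {r + a | r a. r \<in> R \<and> a \<in> cj {j}}"
    by (rule supp_VV[OF assms]) auto
  then have "cnj_vec (X *v cnj_vec x) \<in> VV (cj {r + a | r a. r \<in> R \<and> a \<in> cj {j}})" by (rule VV_cnj)
  also have "cnj_vec (X *v cnj_vec x) = cnj_mat X *v x" by (simp add: cnj_mat_mult_vec)
  finally show "cnj_mat X *v x \<in> VV ((\<lambda>r. r + j) ` cj R)"
  proof (rule subsetD[OF VV_mono, rotated])
    show "cj {r + a | r a. r \<in> R \<and> a \<in> cj {j}} \<subseteq> (\<lambda>r. r + j) ` cj R"
    proof
      fix i assume i: "i \<in> cj {r + a | r a. r \<in> R \<and> a \<in> cj {j}}"
      obtain j1 j2 i1 i2 where ij: "j = (j1, j2)" "i = (i1, i2)" by (cases i, cases j) auto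
      from i ij obtain r1 r2 a1 a2 where ra: "(r1, r2) \<in> R"
        "(a1 = j2 \<and> a2 = j1) \<or> (a1 < j2 \<and> a2 < j1)"
        "(i1 = r2 + a2 \<and> i2 = r1 + a1) \<or> (i1 < r2 + a2 \<and> i2 < r1 + a1)"
        unfolding cj_def by (fastforce)
      have "(i1 - j1, i2 - j2) \<in> cj R" using ra(2,3) unfolding cj_def
        by (auto intro!: bexI[OF _ ra(1)])
      then show "i \<in> (\<lambda>r. r + j) ` cj R"
        using ij by (intro image_eqI[of _ _ "(i1 - j1, i2 - j2)"]) auto
    qed
  qed
qed

lemma Wt_iff: "supp Wt X \<longleftrightarrow> (\<forall>k. \<forall>x\<in>WC W k. X *v x \<in> WC W k)"
proof
  assume "supp Wt X"
  then show "\<forall>k. \<forall>x\<in>WC W k. X *v x \<in> WC W k"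
    unfolding WC_VV by (auto elim!: supp_VV)
next
  assume *: "\<forall>k. \<forall>x\<in>WC W k. X *v x \<in> WC W k"
  show "supp Wt X"
  proof (rule suppI)
    fix j x assume "x \<in> J j"
    then have "x \<in> WC W (wt j)" unfolding WC_VV by (rule J_mem_VV) (simp add: case_prod_beta)
    then have "X *v x \<in> WC W (wt j)" using * by blast
    moreover have "{(a, b). a + b \<le> wt j} = (\<lambda>r. r + j) ` Wt"
      by (rule set_eqI) (auto simp: mem_shift case_prod_beta)
    ultimately show "X *v x \<in> VV ((\<lambda>r. r + j) ` Wt)" unfolding WC_VV by simp
  qed
qed

lemma Qc_lower:
  assumes "x \<in> WC W k" "y \<in> WC W k" "x \<in> WC W (k - 1) \<or> y \<in> WC W (k - 1)"
  shows "Qc k x y = 0"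
proof -
  have f: "\<forall>x\<in>W k. \<forall>y\<in>W k. Q k x y = (-1) powi k * Q k y x" "\<forall>x\<in>W k. \<forall>y\<in>W (k - 1). Q k x y = 0"
    using forms unfolding graded_forms_def by blast+
  have sub: "W (k - 1) \<subseteq> W k" using weight by (auto simp: weight_filtration_def mono_def)
  have 1: "Q k a b = 0" if "a \<in> W k" "b \<in> W k" "a \<in> W (k - 1) \<or> b \<in> W (k - 1)" for a b
    using that(3)
  proof
    assume "a \<in> W (k - 1)"
    then have "Q k b a = 0" using f(2) that(2) by blast
    moreover have "Q k a b = (-1) powi k * Q k b a" using f(1) that(1,2) by blast
    ultimately show ?thesis by simp
  qed (use f(2) that(1) in blast)
  have "re_vec x \<in> W k" "im_vec x \<in> W k" "re_vec y \<in> W k" "im_vec y \<in> W k"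
    using assms(1,2) by (auto simp: cplx_space_def)
  moreover have "(re_vec x \<in> W (k - 1) \<and> im_vec x \<in> W (k - 1)) \<or> (re_vec y \<in> W (k - 1) \<and> im_vec y \<in> W (k - 1))"
    using assms(3) by (auto simp: cplx_space_def)
  ultimately have "Q k (re_vec x) (re_vec y) = 0" "Q k (im_vec x) (im_vec y) = 0"
    "Q k (re_vec x) (im_vec y) = 0" "Q k (im_vec x) (re_vec y) = 0"
    using 1 by blast+
  then show ?thesis by (simp add: cplx_form_def zero_complex.ctr)
qed

text \<open>The conjugate of a vector of type (p, q) differs from its component of type (q, p) by
  types smaller in both indices, which have lower weight.\<close>

lemma J_gr: assumes "x \<in> J i" shows "x \<in> gr_filtration W F (wt i) (fst i)" "cnj_vec x \<in> gr_filtration W F (wt i) (snd i)"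
  and "x \<in> WC W (wt i)"
proof -
  show xW: "x \<in> WC W (wt i)" unfolding WC_VV by (rule J_mem_VV[OF assms]) (simp add: case_prod_beta)
  have xF: "x \<in> F (fst i)" by (subst F_VV) (rule J_mem_VV[OF assms], simp add: case_prod_beta)
  show "x \<in> gr_filtration W F (wt i) (fst i)"
    unfolding gr_filtration_def using xW xF vsub(4)[OF WC_subspace] by (intro set_plusI[of x _ 0]) auto
  let ?s = "(snd i, fst i)"
  have c: "cnj_vec x \<in> VV (cj {i})" by (rule J_cnj[OF assms])
  have "Pm ?s *v cnj_vec x \<in> F (snd i) \<inter> WC W (wt i)"
  proof
    show "Pm ?s *v cnj_vec x \<in> F (snd i)" by (subst F_VV) (rule J_mem_VV[OF Pm_mem], simp)
    show "Pm ?s *v cnj_vec x \<in> WC W (wt i)" unfolding WC_VV by (rule J_mem_VV[OF Pm_mem]) (simp add: add.commute)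
  qed
  moreover have "cnj_vec x - Pm ?s *v cnj_vec x \<in> WC W (wt i - 1)"
    unfolding WC_VV VV_iff
  proof (intro allI impI)
    fix l assume l: "l \<notin> {(a, b). a + b \<le> wt i - 1}"
    show "Pm l *v (cnj_vec x - Pm ?s *v cnj_vec x) = 0"
    proof (cases "l = ?s")
      case True then show ?thesis by (simp add: matrix_vector_mult_diff_distrib matrix_vector_mul_assoc Pm_mult)
    next
      case False
      then have "l \<notin> cj {i}" using l by (auto simp: cj_def split: prod.splits)
      then have "Pm l *v cnj_vec x = 0" using c by (simp add: VV_iff)
      then show ?thesis using False by (simp add: matrix_vector_mult_diff_distrib matrix_vector_mul_assoc Pm_mult)
    qed
  qed
  ultimately show "cnj_vec x \<in> gr_filtration W F (wt i) (snd i)"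
    unfolding gr_filtration_def by (intro set_plusI[of "Pm ?s *v cnj_vec x" _ "cnj_vec x - Pm ?s *v cnj_vec x"]) auto
qed

lemma gr_filtration_anti: "p \<le> q \<Longrightarrow> gr_filtration W F k q \<subseteq> gr_filtration W F k p"
  unfolding gr_filtration_def using F_anti by (intro set_plus_mono2) auto

lemma gr_orth: "x \<in> gr_filtration W F k p \<Longrightarrow> y \<in> gr_filtration W F k q \<Longrightarrow> p + q \<ge> k + 1 \<Longrightarrow> Qc k x y = 0"
  using pol gr_filtration_anti[of "k - p + 1" q k] unfolding graded_polarized_def by (smt (verit, best) subsetD)

text \<open>In equal weight k the first indices add up to k only if i is j swapped. If the sum is
  larger, the first Hodge-Riemann relation applies directly; if it is smaller, it applies to the
  conjugates.\<close>

lemma Qc_orth: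
  assumes x: "x \<in> J i" and y: "y \<in> J j" and w: "wt i = k" "wt j = k" and ne: "i \<noteq> (snd j, fst j)"
  shows "Qc k x y = 0"
proof (cases "fst i + fst j \<ge> k + 1")
  case True
  then show ?thesis using gr_orth J_gr(1)[OF x] J_gr(1)[OF y] w by auto
next
  case False
  have "fst i + fst j \<noteq> k" using ne w by (cases i; cases j) auto
  then have "snd i + snd j \<ge> k + 1" using False w by linarith
  then have "Qc k (cnj_vec x) (cnj_vec y) = 0" using gr_orth J_gr(2)[OF x] J_gr(2)[OF y] w by auto
  then show ?thesis by (simp add: cplx_form_cnj[OF Q_bilinear])
qed

subsubsection \<open>The Lie algebra\<close>

definition skew :: "complex ^ 'n ^ 'n \<Rightarrow> bool" where
  "skew X \<longleftrightarrow> (\<forall>k. \<forall>x\<in>WC W k. \<forall>y\<in>WC W k. Qc k (X *v x) y + Qc k x (X *v y) = 0)"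

text \<open>The Lie algebra described by linear conditions; \<open>lie_gC_eq\<close> identifies it
  with the one given by one-parameter groups.\<close>

definition gC :: "(complex ^ 'n ^ 'n) set" where "gC = {X. supp Wt X \<and> skew X}"

lemma supp_mexp: assumes "supp Wt X" shows "supp Wt (mexp X)"
  unfolding supp_def
proof (intro allI impI)
  fix i j assume ij: "i - j \<notin> Wt"
  have "supp Wt (mpow X n)" for n
    by (induction n) (auto simp: supp_one zero_prod_def intro: supp_mult[OF assms])
  then have z: "Pm i ** ((1 / fact n) *\<^sub>R mpow X n) ** Pm j = 0" for n
    using ij by (simp add: supp_def matrix_scaleR_left matrix_scaleR_right)
  have "(\<lambda>n. Pm i ** ((1 / fact n) *\<^sub>R mpow X n) ** Pm j) sums (Pm i ** mexp X ** Pm j)"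
    by (rule bounded_linear.sums[OF bounded_linear_compose[OF bounded_linear_matrix_left bounded_linear_matrix_right] mexp_sums])
  then have "(\<lambda>n. 0) sums (Pm i ** mexp X ** Pm j)" unfolding z .
  then show "Pm i ** mexp X ** Pm j = 0" using sums_zero sums_unique2 by blast
qed

lemma mexp_vec_derivative: "((\<lambda>t. mexp (t *\<^sub>R X) *v x) has_vector_derivative (X *v (mexp (t *\<^sub>R X) *v x))) (at t)"
  using bounded_linear.has_vector_derivative[OF bounded_bilinear.bounded_linear_left[OF bounded_bilinear_matrix_vector_mult] mexp_line[of X t UNIV]]
  by (simp add: matrix_vector_mul_assoc)

lemma mexp_Qc_derivative:
  "((\<lambda>t. Qc k (mexp (t *\<^sub>R X) *v x) (mexp (t *\<^sub>R X) *v y)) has_vector_derivative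
     (Qc k (mexp (t *\<^sub>R X) *v x) (X *v (mexp (t *\<^sub>R X) *v y)) + Qc k (X *v (mexp (t *\<^sub>R X) *v x)) (mexp (t *\<^sub>R X) *v y))) (at t)"
  by (rule bounded_bilinear.has_vector_derivative[OF bounded_bilinear_cplx_form[OF Q_bilinear] mexp_vec_derivative mexp_vec_derivative])

lemma mexp_group: assumes X: "X \<in> gC" shows "mexp X \<in> group_GC W Q"
proof -
  have sX: "supp Wt X" "skew X" using X by (auto simp: gC_def)
  have supp_t: "supp Wt (mexp (t *\<^sub>R X))" for t by (rule supp_mexp) (rule supp_scaleR[OF sX(1)])
  have pres: "mexp (t *\<^sub>R X) *v x \<in> WC W k" if "x \<in> WC W k" for t x k using supp_t Wt_iff that by blast
  have "invertible (mexp X)" unfolding invertible_def using mexp_inverse mexp_inverse' by blast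
  moreover have "(*v) (mexp X) ` WC W k = WC W k" for k
  proof
    show "(*v) (mexp X) ` WC W k \<subseteq> WC W k" using pres[of _ k 1] by auto
    show "WC W k \<subseteq> (*v) (mexp X) ` WC W k"
    proof
      fix x assume x: "x \<in> WC W k"
      show "x \<in> (*v) (mexp X) ` WC W k"
        using pres[OF x, of "-1"] by (intro image_eqI[of _ _ "mexp (- X) *v x"]) (auto simp: matrix_vector_mul_assoc mexp_inverse)
    qed
  qed
  moreover have "Qc k (mexp X *v x) (mexp X *v y) = Qc k x y" if xy: "x \<in> WC W k" "y \<in> WC W k" for k x y
  proof -
    let ?f = "\<lambda>t. Qc k (mexp (t *\<^sub>R X) *v x) (mexp (t *\<^sub>R X) *v y)"
    have "(?f has_derivative (\<lambda>h. 0)) (at t within UNIV)" for t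
    proof -
      have "Qc k (mexp (t *\<^sub>R X) *v x) (X *v (mexp (t *\<^sub>R X) *v y)) + Qc k (X *v (mexp (t *\<^sub>R X) *v x)) (mexp (t *\<^sub>R X) *v y) = 0"
        using sX(2) pres[OF xy(1)] pres[OF xy(2)] unfolding skew_def by (metis add.commute)
      then show ?thesis using mexp_Qc_derivative[of k X x y t] by (simp add: has_vector_derivative_def)
    qed
    then have "?f 1 = ?f 0" using has_derivative_zero_constant[of UNIV ?f] by (metis (no_types, lifting) UNIV_I convex_UNIV)
    then show ?thesis by simp
  qed
  ultimately show ?thesis by (auto simp: group_GC_def)
qed

lemma gC_scale: assumes "X \<in> gC" shows "scale_mat c X \<in> gC"
proof -
  have "c * a + c * b = 0" if "a + b = 0" for a b :: complex
    using that by (metis distrib_left mult_zero_right)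
  then show ?thesis using assms
    by (simp add: gC_def supp_scale skew_def scale_mat_mult_vec Qc_simps)
qed

lemma gC_scaleR: "X \<in> gC \<Longrightarrow> r *\<^sub>R X \<in> gC"
  using gC_scale[of X "of_real r"] by (simp add: scale_mat_of_real)

lemma lie_gC_eq: "lie_gC W Q = gC"
proof
  show "gC \<subseteq> lie_gC W Q" unfolding lie_gC_def using mexp_group gC_scaleR by blast
  show "lie_gC W Q \<subseteq> gC"
  proof
    fix X assume "X \<in> lie_gC W Q"
    then have g: "mexp (t *\<^sub>R X) \<in> group_GC W Q" for t by (simp add: lie_gC_def)
    have pres: "mexp (t *\<^sub>R X) *v x \<in> WC W k" if "x \<in> WC W k" for t x k
      using g[of t] that unfolding group_GC_def by blast
    have "X *v x \<in> WC W k" if x: "x \<in> WC W k" for x k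
    proof -
      \<comment> \<open>The complementary projector turns membership in W_k into a linear equation,
        which can be differentiated at t = 0.\<close>
      let ?P = "mat 1 - PP {(a, b). a + b \<le> k}"
      have P: "y \<in> WC W k \<longleftrightarrow> ?P *v y = 0" for y
        unfolding WC_VV VV_def by (auto simp: matrix_vector_mult_diff_rdistrib)
      have "((\<lambda>t. ?P *v (mexp (t *\<^sub>R X) *v x)) has_vector_derivative ?P *v (X *v x)) (at 0)"
        using bounded_linear.has_vector_derivative[OF bounded_bilinear.bounded_linear_right[OF bounded_bilinear_matrix_vector_mult] mexp_vec_derivative[of X x 0], of ?P]
        by simp
      moreover have "?P *v (mexp (t *\<^sub>R X) *v x) = 0" for t using P pres[OF x] by blast
      ultimately have "((\<lambda>t::real. 0) has_vector_derivative ?P *v (X *v x)) (at 0)" by (simp only:)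
      then have "?P *v (X *v x) = 0" using vector_derivative_unique_at has_vector_derivative_const by blast
      then show ?thesis using P by blast
    qed
    then have "supp Wt X" unfolding Wt_iff by blast
    moreover have "skew X" unfolding skew_def
    proof (intro allI ballI)
      fix k x y assume xy: "x \<in> WC W k" "y \<in> WC W k"
      have "Qc k (mexp (t *\<^sub>R X) *v x) (mexp (t *\<^sub>R X) *v y) = Qc k x y" for t
        using g[of t] xy unfolding group_GC_def by blast
      then have "((\<lambda>t::real. Qc k x y) has_vector_derivative (Qc k x (X *v y) + Qc k (X *v x) y)) (at 0)"
        using mexp_Qc_derivative[of k X x y 0] by simp
      then have "Qc k x (X *v y) + Qc k (X *v x) y = 0" using vector_derivative_unique_at has_vector_derivative_const by blast
      then show "Qc k (X *v x) y + Qc k x (X *v y) = 0" by (simp add: add.commute)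
    qed
    ultimately show "X \<in> gC" by (simp add: gC_def)
  qed
qed

lemma gC_Wt: "X \<in> gC \<Longrightarrow> supp Wt X"
  by (simp add: gC_def)

lemma gC_zero: "0 \<in> gC"
  by (simp add: gC_def supp_zero skew_def Qc_simps)

lemma gC_add: assumes "X \<in> gC" "Y \<in> gC" shows "X + Y \<in> gC"
proof -
  have e: "(a + b) + (c + d) = (a + c) + (b + d)" for a b c d :: complex by simp
  show ?thesis using assms by (simp add: gC_def supp_add skew_def matrix_vector_mult_add_rdistrib Qc_simps e)
qed

lemma gC_minus: "X \<in> gC \<Longrightarrow> - X \<in> gC"
  using gC_scale[of X "- 1"] by (simp add: scale_mat_minus_left)

lemma gC_subspace: "subspace gC"
  by (simp add: subspace_def gC_zero gC_add gC_scaleR)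

lemma gC_commutator: assumes "X \<in> gC" "Y \<in> gC" shows "commutator X Y \<in> gC"
proof -
  have s: "supp Wt X" "supp Wt Y" "skew X" "skew Y" using assms by (auto simp: gC_def)
  have pr: "X *v x \<in> WC W k" "Y *v x \<in> WC W k" if "x \<in> WC W k" for x k using s that Wt_iff by blast+
  have "supp Wt (commutator X Y)" unfolding commutator_def
    by (intro supp_diff) (rule supp_mult[OF s(1,2)], force, rule supp_mult[OF s(2,1)], force)
  moreover have "skew (commutator X Y)" unfolding skew_def
  proof (intro allI ballI)
    fix k x y assume xy: "x \<in> WC W k" "y \<in> WC W k"
    have a: "Qc k (X *v a) b = - Qc k a (X *v b)" "Qc k (Y *v a) b = - Qc k a (Y *v b)" if "a \<in> WC W k" "b \<in> WC W k" for a b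
      using s that unfolding skew_def by (metis eq_neg_iff_add_eq_0)+
    show "Qc k (commutator X Y *v x) y + Qc k x (commutator X Y *v y) = 0"
      using xy pr by (simp add: commutator_def matrix_vector_mult_diff_rdistrib Qc_simps matrix_vector_mul_assoc[symmetric] a)
  qed
  ultimately show ?thesis by (simp add: gC_def)
qed

lemma gC_cnj: assumes "X \<in> gC" shows "cnj_mat X \<in> gC"
proof -
  have s: "supp Wt X" "skew X" using assms by (auto simp: gC_def)
  have e: "cnj_mat X *v x = cnj_vec (X *v cnj_vec x)" for x by (simp add: cnj_mat_mult_vec)
  have "supp Wt (cnj_mat X)" unfolding Wt_iff e using s(1) Wt_iff WC_cnj by blast
  moreover have "skew (cnj_mat X)" unfolding skew_def
  proof (intro allI ballI)
    fix k x y assume xy: "x \<in> WC W k" "y \<in> WC W k"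
    have "Qc k (X *v cnj_vec x) (cnj_vec y) + Qc k (cnj_vec x) (X *v cnj_vec y) = 0"
      using s(2) WC_cnj[OF xy(1)] WC_cnj[OF xy(2)] unfolding skew_def by blast
    then have "cnj (Qc k (X *v cnj_vec x) (cnj_vec y) + Qc k (cnj_vec x) (X *v cnj_vec y)) = 0" by simp
    then show "Qc k (cnj_mat X *v x) y + Qc k x (cnj_mat X *v y) = 0"
      by (simp add: e cplx_form_cnj[OF Q_bilinear, symmetric])
  qed
  ultimately show ?thesis by (simp add: gC_def)
qed

text \<open>On gr_k the form pairs a type only with its swap. For x of type i and y of type j the
  two terms of the skewness identity see the components of X of bidegree swap j - i and swap i - j.
  These coincide in equal weight, so restricting X to R keeps or drops both terms together.\<close>

lemma gC_cmp: assumes X: "X \<in> gC" shows "cmp R X \<in> gC"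
proof -
  have s: "supp Wt X" "skew X" using X by (auto simp: gC_def)
  have sY: "supp Wt (cmp R X)" using supp_cmp'[OF s(1), of R] by (rule supp_mono) auto
  have prX: "X *v x \<in> WC W k" and prY: "cmp R X *v x \<in> WC W k" if "x \<in> WC W k" for x k
    using s(1) sY that Wt_iff by blast+
  define E where "E k x y = Qc k (cmp R X *v x) y + Qc k x (cmp R X *v y)" for k x y
  have core: "E k x y = 0" if x: "x \<in> J i" "wt i \<le> k" and y: "y \<in> J j" "wt j \<le> k" for i j k x y
  proof -
    have xW: "x \<in> WC W k" "y \<in> WC W k" using J_gr(3)[OF x(1)] J_gr(3)[OF y(1)] WC_mono[OF x(2)] WC_mono[OF y(2)] by blast+
    show ?thesis
    proof (cases "wt i = k \<and> wt j = k")
      case False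
      then have lo: "x \<in> WC W (k - 1) \<or> y \<in> WC W (k - 1)"
        using J_gr(3)[OF x(1)] J_gr(3)[OF y(1)] WC_mono[of "wt i" "k - 1"] WC_mono[of "wt j" "k - 1"] x(2) y(2) by fastforce
      then show ?thesis unfolding E_def
        using Qc_lower[of "cmp R X *v x" k y] Qc_lower[of x k "cmp R X *v y"] prY xW by auto
    next
      case True
      \<comment> \<open>Pairing with type j' sees only the swapped component of z: the other
        components of weight k are orthogonal, and those of lower weight lie in the radical.\<close>
      have proj: "Qc k z y' = Qc k (Pm (snd j', fst j') *v z) y'" "Qc k y' z = Qc k y' (Pm (snd j', fst j') *v z)"
        if z: "z \<in> WC W k" and y': "y' \<in> J j'" "wt j' = k" for z y' j'
      proof -
        let ?s = "(snd j', fst j')"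
        have yW: "y' \<in> WC W k" using J_gr(3)[OF y'(1)] y'(2) by simp
        have t: "Qc k (Pm l *v z) y' = 0 \<and> Qc k y' (Pm l *v z) = 0" if l: "l \<noteq> ?s" for l
        proof (cases "wt l = k")
          case True
          have "j' \<noteq> (snd l, fst l)" using l by auto
          then show ?thesis using Qc_orth[OF Pm_mem y'(1) True y'(2) l] Qc_orth[OF y'(1) Pm_mem y'(2) True] by simp
        next
          case False
          have "Pm l *v z \<in> WC W (k - 1)"
          proof (cases "wt l < k")
            case True
            then show ?thesis using J_gr(3)[OF Pm_mem[of l z]] WC_mono[of "wt l" "k - 1"] by auto
          next
            case False
            then have "Pm l *v z = 0" using z \<open>wt l \<noteq> k\<close> unfolding WC_VV VV_iff by (cases l) auto
            then show ?thesis using vsub(4)[OF WC_subspace] by simp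
          qed
          moreover have "Pm l *v z \<in> WC W k" using calculation WC_mono[of "k - 1" k] by auto
          ultimately show ?thesis using Qc_lower yW by blast
        qed
        have "Qc k z y' = (\<Sum>l\<in>S. Qc k (Pm l *v z) y')"
          by (subst vec_expand) (simp add: cplx_form_sum_left[OF Q_bilinear])
        also have "\<dots> = (\<Sum>l\<in>S. if l = ?s then Qc k (Pm l *v z) y' else 0)" by (rule sum.cong) (use t in auto)
        also have "\<dots> = Qc k (Pm ?s *v z) y'" using finite_S Pm_notin_S[of ?s] by (auto simp: sum.delta Qc_simps)
        finally show "Qc k z y' = Qc k (Pm (snd j', fst j') *v z) y'" .
        have "Qc k y' z = (\<Sum>l\<in>S. Qc k y' (Pm l *v z))"
          by (subst vec_expand) (simp add: cplx_form_sum_right[OF Q_bilinear])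
        also have "\<dots> = (\<Sum>l\<in>S. if l = ?s then Qc k y' (Pm l *v z) else 0)" by (rule sum.cong) (use t in auto)
        also have "\<dots> = Qc k y' (Pm ?s *v z)" using finite_S Pm_notin_S[of ?s] by (auto simp: sum.delta Qc_simps)
        finally show "Qc k y' z = Qc k y' (Pm (snd j', fst j') *v z)" .
      qed
      let ?i = "(snd i, fst i)" and ?j = "(snd j, fst j)"
      have eq: "?j - i = ?i - j" using True by (cases i; cases j) auto
      have A: "Pm a *v (cmp R X *v w) = (if a - b \<in> R then Pm a *v (X *v w) else 0)" if "w \<in> J b" for a b w
      proof -
        have w: "Pm b *v w = w" using that by (simp add: Pm_J)
        have "Pm a *v (cmp R X *v w) = (Pm a ** cmp R X ** Pm b) *v w" by (simp add: matrix_vector_mul_assoc[symmetric] w)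
        also have "\<dots> = (if a - b \<in> R then (Pm a ** X ** Pm b) *v w else 0)" by (simp add: Pm_cmp)
        finally show ?thesis by (simp add: matrix_vector_mul_assoc[symmetric] w)
      qed
      have "E k x y = Qc k (Pm ?j *v (cmp R X *v x)) y + Qc k x (Pm ?i *v (cmp R X *v y))"
        unfolding E_def using proj(1)[OF prY[OF xW(1)] y(1)] proj(2)[OF prY[OF xW(2)] x(1)] True by simp
      also have "\<dots> = (if ?j - i \<in> R then Qc k (Pm ?j *v (X *v x)) y + Qc k x (Pm ?i *v (X *v y)) else 0)"
        unfolding A[OF x(1)] A[OF y(1)] eq by (simp add: Qc_simps)
      also have "Qc k (Pm ?j *v (X *v x)) y + Qc k x (Pm ?i *v (X *v y)) = Qc k (X *v x) y + Qc k x (X *v y)"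
        using proj(1)[OF prX[OF xW(1)] y(1)] proj(2)[OF prX[OF xW(2)] x(1)] True by simp
      also have "\<dots> = 0" using s(2) xW unfolding skew_def by blast
      finally show ?thesis by simp
    qed
  qed
  have E_add: "E k (a + b) c = E k a c + E k b c" "E k c (a + b) = E k c a + E k c b"
    "E k (r *s a) c = r * E k a c" "E k c (r *s a) = r * E k c a" "E k 0 c = 0" "E k c 0 = 0" for k a b c r
    by (simp_all add: E_def matrix_vector_right_distrib matrix_vector_scale Qc_simps algebra_simps)
  have "E k x y = 0" if x: "x \<in> WC W k" and y: "y \<in> WC W k" for k x y
  proof -
    have "x \<in> {x. E k x y = 0}"
    proof (rule VV_induct[OF _ _ x[unfolded WC_VV]])
      fix i z assume i: "i \<in> {(a, b). a + b \<le> k}" "z \<in> J i"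
      have "y \<in> {y. E k z y = 0}"
        by (rule VV_induct[OF _ _ y[unfolded WC_VV]]) (use i core in \<open>auto simp: vec.subspace_def E_add\<close>)
      then show "z \<in> {x. E k x y = 0}" by simp
    qed (auto simp: vec.subspace_def E_add)
    then show ?thesis by simp
  qed
  then show ?thesis using sY by (auto simp: gC_def skew_def E_def)
qed

lemma lie_part_eq: "lie_part W Q F r s = {X \<in> gC. supp {(r, s)} X}"
proof -
  have e: "(\<lambda>d. d + (p, q)) ` {(r, s)} = {(p + r, q + s)}" for p q by (auto simp: add.commute)
  have V: "VV {(a, b)} = deligne W F a b" for a b
    using span_J[of "{(a, b)}"] J_sub[of "(a, b)"] by (simp add: vec.span_eq_iff[THEN iffD2] J_def)
  have "supp {(r, s)} X \<longleftrightarrow> (\<forall>p q. (*v) X ` deligne W F p q \<subseteq> deligne W F (p + r) (q + s))" for X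
  proof
    assume "supp {(r, s)} X"
    then show "\<forall>p q. (*v) X ` deligne W F p q \<subseteq> deligne W F (p + r) (q + s)"
      using supp_J[of "{(r, s)}" X _ "(_, _)"] unfolding e V by (auto simp: J_def)
  next
    assume *: "\<forall>p q. (*v) X ` deligne W F p q \<subseteq> deligne W F (p + r) (q + s)"
    show "supp {(r, s)} X"
    proof (rule suppI)
      fix j x assume x: "x \<in> J j"
      obtain p q where j: "j = (p, q)" by (cases j)
      show "X *v x \<in> VV ((\<lambda>d. d + j) ` {(r, s)})" unfolding j e V using * x by (auto simp: J_def j)
    qed
  qed
  then show ?thesis by (auto simp: lie_part_def lie_gC_eq)
qed

text \<open>By \<open>gC_cmp\<close> the homogeneous components of an element of the Lie algebra
  stay in it, and only the finitely many differences of elements of \<open>S\<close> occur as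
  bidegrees.\<close>

lemma span_lie_parts: "span (\<Union>(r, s)\<in>R. lie_part W Q F r s) = {X \<in> gC. supp R X}"
proof
  have "subspace {X \<in> gC. supp R X}"
    using subspace_inter[OF gC_subspace subspace_supp[of R]] by (simp add: Int_def)
  then show "span (\<Union>(r, s)\<in>R. lie_part W Q F r s) \<subseteq> {X \<in> gC. supp R X}"
    by (intro span_minimal) (auto simp: lie_part_eq elim: supp_mono)
  show "{X \<in> gC. supp R X} \<subseteq> span (\<Union>(r, s)\<in>R. lie_part W Q F r s)"
  proof
    fix X assume X: "X \<in> {X \<in> gC. supp R X}"
    define D where "D = (\<lambda>(i, j). i - j) ` (S \<times> S) \<inter> R"
    have finD: "finite D" by (simp add: D_def finite_S)
    have "X = (\<Sum>d\<in>D. cmp {d} X)"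
    proof (rule mat_eq_Pm)
      fix i j assume ij: "i \<in> S" "j \<in> S"
      have "Pm i ** (\<Sum>d\<in>D. cmp {d} X) ** Pm j = (\<Sum>d\<in>D. if d = i - j then Pm i ** X ** Pm j else 0)"
        unfolding matrix_sum_right matrix_sum_left by (rule sum.cong) (auto simp: Pm_cmp)
      also have "\<dots> = (if i - j \<in> D then Pm i ** X ** Pm j else 0)" using finD by (simp add: sum.delta')
      also have "\<dots> = Pm i ** X ** Pm j"
      proof (cases "i - j \<in> R")
        case True then show ?thesis using ij by (auto simp: D_def)
      next
        case False then show ?thesis using X by (simp add: supp_def)
      qed
      finally show "Pm i ** X ** Pm j = Pm i ** (\<Sum>d\<in>D. cmp {d} X) ** Pm j" by simp
    qed
    moreover have "cmp {d} X \<in> (\<Union>(r, s)\<in>R. lie_part W Q F r s)" if "d \<in> D" for d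
      using that X gC_cmp supp_cmp by (auto simp: lie_part_eq D_def intro!: bexI[of _ d])
    ultimately show "X \<in> span (\<Union>(r, s)\<in>R. lie_part W Q F r s)"
      by (metis (no_types, lifting) span_sum span_base)
  qed
qed

lemma lie_q_eq: "lie_q W Q F = {X \<in> gC. supp QF X}"
proof -
  have "(\<Union>r\<in>{..<0}. \<Union>s. lie_part W Q F r s) = (\<Union>(r, s)\<in>QF. lie_part W Q F r s)" by auto
  then show ?thesis by (simp add: lie_q_def span_lie_parts)
qed

lemma lie_Lambda_eq: "lie_Lambda W Q F = {X \<in> gC. supp LA X}"
proof -
  have "(\<Union>r\<in>{..<0}. \<Union>s\<in>{..<0}. lie_part W Q F r s) = (\<Union>(r, s)\<in>LA. lie_part W Q F r s)" by auto
  then show ?thesis by (simp add: lie_Lambda_def span_lie_parts)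
qed

lemma lie_n_plus_eq: "lie_n_plus W Q F = {X \<in> gC. supp NP X}"
proof -
  have "(\<Union>a\<in>{0..}. \<Union>b\<in>{..<0}. lie_part W Q F a b) = (\<Union>(r, s)\<in>NP. lie_part W Q F r s)" by auto
  then show ?thesis by (simp add: lie_n_plus_def span_lie_parts)
qed

lemma lie_n_minus_eq: "lie_n_minus W Q F = {X \<in> gC. supp NM X}"
proof -
  have "(\<Union>a\<in>{..<0}. \<Union>b\<in>{0..}. lie_part W Q F a b) = (\<Union>(r, s)\<in>NM. lie_part W Q F r s)" by auto
  then show ?thesis by (simp add: lie_n_minus_def span_lie_parts)
qed

lemma zero_pair: "{(0, 0)} = {0 :: int \<times> int}"
  by (simp add: zero_prod_def)

lemma dj: "NP \<inter> ({0} \<union> NM \<union> LA) = {}" "({0} \<union> NM) \<inter> LA = {}" "{0} \<inter> NM = {}"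
  "{0} \<inter> (NP \<union> NM \<union> LA) = {}" "(NP \<union> NM) \<inter> LA = {}" "NP \<inter> NM = {}"
  by (auto simp: zero_prod_def)

text \<open>Elements of the Lie algebra have bidegrees with a + b <= 0, where a >= 0 and b >= 0
  leave only (0, 0). So {0}, \<open>NP\<close>, \<open>NM\<close> and \<open>LA\<close> exhaust the
  possibilities, and they are disjoint.\<close>

lemma comp_plus_eq: assumes X: "X \<in> gC" shows "comp_plus W Q F X = cmp NP X"
  unfolding comp_plus_def lie_n_plus_eq lie_part_eq lie_n_minus_eq lie_Lambda_eq zero_pair
proof (rule the_equality)
  have "cmp Wt X = cmp (NP \<union> ({0} \<union> NM \<union> LA)) X"
    by (rule supp_cmp_eq[OF gC_Wt[OF X]]) (auto simp: zero_prod_def)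
  also have "\<dots> = cmp NP X + (cmp {0} X + cmp NM X + cmp LA X)"
    by (simp only: cmp_Un dj)
  finally have "X - cmp NP X = cmp {0} X + cmp NM X + cmp LA X" using cmp_id[OF gC_Wt[OF X]] by (simp add: algebra_simps)
  then show "cmp NP X \<in> {X \<in> gC. supp NP X} \<and> X - cmp NP X \<in> {X \<in> gC. supp {0} X} + {X \<in> gC. supp NM X} + {X \<in> gC. supp LA X}"
    using gC_cmp[OF X] supp_cmp by (auto intro!: set_plus_intro)
  fix y assume y: "y \<in> {X \<in> gC. supp NP X} \<and> X - y \<in> {X \<in> gC. supp {0} X} + {X \<in> gC. supp NM X} + {X \<in> gC. supp LA X}"
  then obtain a b c where abc: "supp {0} a" "supp NM b" "supp LA c" "X - y = a + b + c"
    by (auto elim!: set_plus_elim)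
  have "cmp NP (X - y) = 0" unfolding abc(4) cmp_add
    using cmp_disjoint[OF abc(1), of NP] cmp_disjoint[OF abc(2), of NP] cmp_disjoint[OF abc(3), of NP]
    by (fastforce simp: zero_prod_def)
  then show "y = cmp NP X" using cmp_id[of NP y] y by (simp add: cmp_diff)
qed

lemma comp_zero_eq: assumes X: "X \<in> gC" shows "comp_zero W Q F X = cmp {0} X"
  unfolding comp_zero_def lie_n_plus_eq lie_part_eq lie_n_minus_eq lie_Lambda_eq zero_pair
proof (rule the_equality)
  have "cmp Wt X = cmp ({0} \<union> (NP \<union> NM \<union> LA)) X"
    by (rule supp_cmp_eq[OF gC_Wt[OF X]]) (auto simp: zero_prod_def)
  also have "\<dots> = cmp {0} X + (cmp NP X + cmp NM X + cmp LA X)"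
    by (simp only: cmp_Un dj)
  finally have "X - cmp {0} X = cmp NP X + cmp NM X + cmp LA X" using cmp_id[OF gC_Wt[OF X]] by (simp add: algebra_simps)
  then show "cmp {0} X \<in> {X \<in> gC. supp {0} X} \<and> X - cmp {0} X \<in> {X \<in> gC. supp NP X} + {X \<in> gC. supp NM X} + {X \<in> gC. supp LA X}"
    using gC_cmp[OF X] supp_cmp by (auto intro!: set_plus_intro)
  fix y assume y: "y \<in> {X \<in> gC. supp {0} X} \<and> X - y \<in> {X \<in> gC. supp NP X} + {X \<in> gC. supp NM X} + {X \<in> gC. supp LA X}"
  then obtain a b c where abc: "supp NP a" "supp NM b" "supp LA c" "X - y = a + b + c"
    by (auto elim!: set_plus_elim)
  have "cmp {0} (X - y) = 0" unfolding abc(4) cmp_add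
    using cmp_disjoint[OF abc(1), of "{0}"] cmp_disjoint[OF abc(2), of "{0}"] cmp_disjoint[OF abc(3), of "{0}"]
    by (fastforce simp: zero_prod_def)
  then show "y = cmp {0} X" using cmp_id[of "{0}" y] y by (simp add: cmp_diff)
qed

end

subsection \<open>The mixed Hodge metric\<close>

text \<open>T lists the conjugated values of h against the standard basis. It is linear since h is
  antilinear in the second argument, and definiteness makes it injective, hence invertible.\<close>

lemma Riesz_matrix:
  fixes h :: "complex ^ 'n \<Rightarrow> complex ^ 'n \<Rightarrow> complex"
  assumes add: "\<And>x y z. h x (y + z) = h x y + h x z" and scale: "\<And>x y c. h x (c *s y) = cnj c * h x y"
    and addl: "\<And>x y z. h (x + y) z = h x z + h y z" and scalel: "\<And>x y c. h (c *s x) y = c * h x y"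
    and pos: "\<And>x. x \<noteq> 0 \<Longrightarrow> h x x \<noteq> 0"
    and phi: "\<And>x y. \<phi> (x + y) = \<phi> x + \<phi> y" "\<And>c x. \<phi> (c *s x) = c * \<phi> x"
  shows "\<exists>z. \<forall>x. \<phi> x = h x z"
proof -
  define T :: "complex ^ 'n ^ 'n" where "T = matrix (\<lambda>z. \<chi> a. cnj (h (axis a 1) z))"
  have T: "T *v z = (\<chi> a. cnj (h (axis a 1) z))" for z
    unfolding T_def by (rule matrix_works) (unfold_locales, auto simp: vec_eq_iff add scale algebra_simps)
  have sum_l: "h (sum f A) z = (\<Sum>i\<in>A. h (f i) z)" and sum_phi: "\<phi> (sum f A) = (\<Sum>i\<in>A. \<phi> (f i))"
    for f :: "'n \<Rightarrow> complex ^ 'n" and A z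
  proof -
    have "h 0 z = 0" "\<phi> 0 = 0" using scalel[of 0 0 z] phi(2)[of 0 0] by simp_all
    then show "h (sum f A) z = (\<Sum>i\<in>A. h (f i) z)" "\<phi> (sum f A) = (\<Sum>i\<in>A. \<phi> (f i))"
      by (induction A rule: infinite_finite_induct) (auto simp: addl phi)
  qed
  have exp: "x = (\<Sum>a\<in>UNIV. x $ a *s axis a 1)" for x :: "complex ^ 'n" by (simp add: basis_expansion)
  have hx: "h x z = (\<Sum>a\<in>UNIV. x $ a * h (axis a 1) z)" for x z
    by (subst exp[of x]) (simp add: sum_l scalel)
  have phix: "\<phi> x = (\<Sum>a\<in>UNIV. x $ a * \<phi> (axis a 1))" for x
    by (subst exp[of x]) (simp add: sum_phi phi)
  have "z = 0" if "T *v z = 0" for z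
  proof (rule ccontr)
    assume "z \<noteq> 0"
    have "cnj (h (axis a 1) z) = 0" for a using that unfolding T by (simp add: vec_eq_iff)
    then have "h (axis a 1) z = 0" for a by simp
    then have "h z z = 0" unfolding hx[of z] by simp
    then show False using pos[OF \<open>z \<noteq> 0\<close>] by simp
  qed
  then obtain T' where "T' ** T = mat 1" using matrix_left_invertible_ker by metis
  then have TT: "T ** T' = mat 1" using matrix_left_right_inverse by blast
  define z where "z = T' *v (\<chi> a. cnj (\<phi> (axis a 1)))"
  have "T *v z = (\<chi> a. cnj (\<phi> (axis a 1)))" by (simp add: z_def matrix_vector_mul_assoc TT)
  then have "cnj (h (axis a 1) z) = cnj (\<phi> (axis a 1))" for a unfolding T by (simp add: vec_eq_iff)
  then have "h (axis a 1) z = \<phi> (axis a 1)" for a by simp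
  then have "\<phi> x = h x z" for x unfolding phix[of x] hx[of x z] by simp
  then show ?thesis by blast
qed

context polarized
begin

abbreviation "h \<equiv> hodge_metric W Q F"
abbreviation "adj \<equiv> hodge_adjoint W Q F"

lemma deligne_part_Pm: "deligne_part W F p q x = Pm (p, q) *v x"
  by (simp add: deligne_part_def Pm_part part_def)

lemma S_pairs: "{(p, q). deligne W F p q \<noteq> {0}} = S"
  unfolding S_def J_def by (simp only: case_prod_unfold)

lemma h_sum: "h x y = (\<Sum>i\<in>S. \<i> powi (fst i - snd i) * Qc (wt i) (Pm i *v x) (cnj_vec (Pm i *v y)))"
  unfolding hodge_metric_def S_pairs deligne_part_Pm by (simp add: case_prod_unfold)

lemma h_add_left: "h (x + y) z = h x z + h y z"
  and h_add_right: "h z (x + y) = h z x + h z y"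
  and h_scale_left: "h (c *s x) z = c * h x z"
  and h_scale_right: "h z (c *s x) = cnj c * h z x"
  by (simp_all add: h_sum matrix_vector_right_distrib matrix_vector_scale cnj_vec_add cnj_vec_scale
      Qc_simps sum.distrib sum_distrib_left algebra_simps)

lemma h_zero [simp]: "h 0 z = 0" "h z 0 = 0"
  using h_scale_left[of 0 0 z] h_scale_right[of z 0 0] by simp_all

lemma h_diff_left: "h (x - y) z = h x z - h y z"
  and h_diff_right: "h z (x - y) = h z x - h z y"
  using h_add_left[of "x - y" y z] h_add_right[of z "x - y" y] by simp_all

lemma h_minus_left: "h (- x) z = - h x z"
  and h_minus_right: "h z (- x) = - h z x"
  using h_diff_left[of 0 x z] h_diff_right[of z 0 x] by simp_all

lemma h_sum_left: "h (sum f A) z = (\<Sum>i\<in>A. h (f i) z)"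
  by (induction A rule: infinite_finite_induct) (auto simp: h_add_left)

lemma h_sum_right: "h z (sum f A) = (\<Sum>i\<in>A. h z (f i))"
  by (induction A rule: infinite_finite_induct) (auto simp: h_add_right)

lemma bounded_bilinear_h: "bounded_bilinear h"
  unfolding bilinear_conv_bounded_bilinear[symmetric] bilinear_def
  by (auto intro!: linearI simp: h_add_left h_add_right scaleR_eq_scale h_scale_left h_scale_right)
    (simp_all add: scaleR_conv_of_real)

lemma J_not_lower: assumes "x \<in> J i" "x \<noteq> 0" shows "x \<notin> WC W (wt i - 1)"
proof
  assume "x \<in> WC W (wt i - 1)"
  then have "Pm i *v x = 0" unfolding WC_VV VV_iff by (simp add: case_prod_beta)
  then show False using assms by (simp add: Pm_J)
qed

lemma J_hodge: "x \<in> J i \<Longrightarrow> x \<in> hodge_component W F (fst i) (snd i)"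
  using J_gr(1,2)[of x i] by (simp add: hodge_component_def mem_cnj_image)

lemma J_pos: assumes "x \<in> J i" "x \<noteq> 0" shows "0 < Re (\<i> powi (fst i - snd i) * Qc (wt i) x (cnj_vec x))"
  using pol J_hodge[OF assms(1)] J_not_lower[OF assms] unfolding graded_polarized_def by blast

lemma h_pos: assumes "x \<noteq> 0" shows "0 < Re (h x x)"
proof -
  obtain i where i: "i \<in> S" "Pm i *v x \<noteq> 0" using assms vec_expand[of x] by (metis (no_types, lifting) sum.neutral)
  have nn: "0 \<le> Re (\<i> powi (fst i - snd i) * Qc (wt i) (Pm i *v x) (cnj_vec (Pm i *v x)))" for i
    using J_pos[OF Pm_mem, of i x] by (cases "Pm i *v x = 0") (auto simp: Qc_simps)
  have "0 < (\<Sum>i\<in>S. Re (\<i> powi (fst i - snd i) * Qc (wt i) (Pm i *v x) (cnj_vec (Pm i *v x))))"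
    by (rule sum_pos2[OF finite_S i(1)]) (rule J_pos[OF Pm_mem i(2)], rule nn)
  then show ?thesis by (simp add: h_sum)
qed

lemma h_nondeg': "(\<And>x. h x y = 0) \<Longrightarrow> y = 0"
  using h_pos[of y] by (metis less_irrefl zero_complex.sel(1))

lemma h_Riesz: assumes "\<And>x y. \<phi> (x + y) = \<phi> x + \<phi> y" "\<And>c x. \<phi> (c *s x) = c * \<phi> x"
  shows "\<exists>z. \<forall>x. \<phi> x = h x z"
  by (rule Riesz_matrix) (use assms h_pos in \<open>force simp: h_add_left h_add_right h_scale_left h_scale_right\<close>)+

lemma adj_exists: "\<exists>B. \<forall>x y. h (A *v x) y = h x (B *v y)"
proof -
  have "\<exists>z. \<forall>x. h (A *v x) y = h x z" for y
    by (rule h_Riesz) (simp_all add: matrix_vector_right_distrib matrix_vector_scale h_add_left h_scale_left)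
  then obtain b where b: "\<And>x y. h (A *v x) y = h x (b y)" by metis
  have "b (y + z) = b y + b z" for y z
  proof -
    have "h x (b (y + z) - (b y + b z)) = 0" for x by (simp add: h_diff_right h_add_right b[symmetric])
    then show ?thesis using h_nondeg' by (metis eq_iff_diff_eq_0)
  qed
  moreover have "b (c *s y) = c *s b y" for c y
  proof -
    have "h x (b (c *s y) - c *s b y) = 0" for x by (simp add: h_diff_right h_scale_right b[symmetric])
    then show ?thesis using h_nondeg' by (metis eq_iff_diff_eq_0)
  qed
  ultimately have "Vector_Spaces.linear (*s) (*s) b"
    by unfold_locales (auto simp: vec.scale_right_distrib vec.scale_left_distrib)
  then have "matrix b *v y = b y" for y by (rule matrix_works)
  then show ?thesis using b by (intro exI[of _ "matrix b"]) simp
qed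

lemma adj_unique: assumes "\<And>x y. h x (B *v y) = h x (C *v y)" shows "B = C"
proof (rule matrix_eqI)
  fix y
  have "h x (B *v y - C *v y) = 0" for x using assms by (simp add: h_diff_right)
  then show "B *v y = C *v y" using h_nondeg' by (metis eq_iff_diff_eq_0)
qed

lemma h_adj: "h (A *v x) y = h x (adj A *v y)"
proof -
  have "\<forall>x y. h (A *v x) y = h x ((THE B. \<forall>x y. h (A *v x) y = h x (B *v y)) *v y)"
  proof (rule theI')
    show "\<exists>!B. \<forall>x y. h (A *v x) y = h x (B *v y)" using adj_exists[of A] adj_unique by metis
  qed
  then show ?thesis unfolding hodge_adjoint_def by blast
qed

lemma adjI: "(\<And>x y. h (A *v x) y = h x (B *v y)) \<Longrightarrow> adj A = B"
  by (rule adj_unique) (simp add: h_adj[symmetric])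

lemma adj_mult: "adj (A ** B) = adj B ** adj A"
  by (rule adjI) (simp add: matrix_vector_mul_assoc[symmetric] h_adj)

lemma adj_add: "adj (A + B) = adj A + adj B"
  by (rule adjI) (simp add: matrix_vector_mult_add_rdistrib h_add_left h_add_right h_adj)

lemma adj_scale: "adj (scale_mat c A) = scale_mat (cnj c) (adj A)"
  by (rule adjI) (simp add: scale_mat_mult_vec h_scale_left h_scale_right h_adj)

lemma adj_scaleR: "adj (r *\<^sub>R A) = r *\<^sub>R adj A"
  using adj_scale[of "of_real r" A] by (simp add: scale_mat_of_real)

lemma adj_one [simp]: "adj (mat 1) = mat 1"
  by (rule adjI) simp

lemma adj_minus: "adj (- A) = - adj A"
  by (rule adjI) (simp add: matrix_vector_minus_left h_minus_left h_minus_right h_adj)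

lemma adj_zero [simp]: "adj 0 = 0"
  by (rule adjI) simp

lemma bounded_linear_adj: "bounded_linear adj"
  unfolding linear_conv_bounded_linear[symmetric] by (rule linearI) (simp_all add: adj_add adj_scaleR)

lemma h_Pm: "h (Pm i *v x) y = h x (Pm i *v y)"
proof -
  have "h (Pm i *v x) y = (\<Sum>j\<in>S. if j = i then \<i> powi (fst i - snd i) * Qc (wt i) (Pm i *v x) (cnj_vec (Pm i *v y)) else 0)"
    unfolding h_sum by (rule sum.cong) (auto simp: matrix_vector_mul_assoc Pm_mult Qc_simps)
  moreover have "h x (Pm i *v y) = (\<Sum>j\<in>S. if j = i then \<i> powi (fst i - snd i) * Qc (wt i) (Pm i *v x) (cnj_vec (Pm i *v y)) else 0)"
    unfolding h_sum by (rule sum.cong) (auto simp: matrix_vector_mul_assoc Pm_mult Qc_simps)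
  ultimately show ?thesis by simp
qed

lemma adj_Pm: "adj (Pm i) = Pm i"
  by (rule adjI) (rule h_Pm)

lemma adj_PP: "adj (PP R) = PP R"
proof -
  have "adj (sum Pm A) = sum Pm A" for A
    by (induction A rule: infinite_finite_induct) (simp_all add: adj_add adj_Pm)
  then show ?thesis by (simp add: PP_def)
qed

text \<open>Orthogonality of the bigrading makes the projector along it self-adjoint, so it is the
  orthogonal projection.\<close>

lemma hodge_proj_eq: "hodge_proj W Q F p x = PP {(a, b). a = p} *v x"
proof -
  let ?U = "{(a, b). a = p} :: (int \<times> int) set"
  have orth: "h (x - PP ?U *v x) z = 0" if "z \<in> VV ?U" for z
  proof -
    have "h (x - PP ?U *v x) z = h (x - PP ?U *v x) (PP ?U *v z)" using that by (simp add: PP_VV_id)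
    also have "\<dots> = h (PP ?U *v (x - PP ?U *v x)) z" by (simp add: h_adj adj_PP)
    also have "\<dots> = 0" by (simp add: matrix_vector_mult_diff_distrib matrix_vector_mul_assoc PP_mult)
    finally show ?thesis .
  qed
  show ?thesis
    unfolding hodge_proj_def hodge_U_VV
  proof (rule the_equality)
    show "PP ?U *v x \<in> VV ?U \<and> (\<forall>z\<in>VV ?U. h (x - PP ?U *v x) z = 0)" using PP_VV orth by blast
    fix y assume y: "y \<in> VV ?U \<and> (\<forall>z\<in>VV ?U. h (x - y) z = 0)"
    have d: "PP ?U *v x - y \<in> VV ?U" using PP_VV y vsub(2)[OF VV_sub] by blast
    have "h (PP ?U *v x - y) (PP ?U *v x - y) = h (x - y) (PP ?U *v x - y) - h (x - PP ?U *v x) (PP ?U *v x - y)"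
      by (simp add: h_diff_left)
    also have "\<dots> = 0" using y d orth by simp
    finally show "y = PP ?U *v x" using h_pos[of "PP ?U *v x - y"] by (metis eq_iff_diff_eq_0 less_irrefl zero_complex.sel(1))
  qed
qed

text \<open>Conjugating inside the form: only the component of bidegree \<open>(0, 0)\<close> is seen by \<open>gr\<^sup>W\<close>.\<close>

lemma cj_zero_LA: "cj ({0} \<union> LA) \<subseteq> {0} \<union> LA"
  by (auto simp: cj_def zero_prod_def)

lemma Qc_cnj_zero:
  assumes k: "supp ({0} \<union> LA) k" and x: "x \<in> J i" and y: "y \<in> J i"
  shows "Qc (wt i) x (k *v cnj_vec y) = Qc (wt i) x (cnj_vec (cmp {0} (cnj_mat k) *v y))"
proof -
  let ?c = "cnj_mat k"
  have sc: "supp ({0} \<union> LA) ?c" using supp_cnj[OF k] cj_zero_LA by (rule supp_mono)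
  then have "supp (({0} \<union> LA) \<inter> - {0}) (cmp (- {0}) ?c)" by (rule supp_cmp')
  then have s: "supp LA (?c - cmp {0} ?c)" unfolding cmp_compl by (rule supp_mono) auto
  define z where "z = (?c - cmp {0} ?c) *v y"
  have "z \<in> VV ((\<lambda>r. r + i) ` LA)" unfolding z_def by (rule supp_J[OF s y])
  moreover have "(\<lambda>r. r + i) ` LA \<subseteq> {(a, b). a + b \<le> wt i - 1}"
    unfolding subset_iff mem_shift by (simp add: case_prod_beta mem_Times_iff)
  ultimately have "z \<in> WC W (wt i - 1)" unfolding WC_VV using VV_mono by blast
  then have z: "cnj_vec z \<in> WC W (wt i - 1)" by (rule WC_cnj)
  then have "cnj_vec z \<in> WC W (wt i)" using WC_mono[of "wt i - 1" "wt i"] by auto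
  then have "Qc (wt i) x (cnj_vec z) = 0" using Qc_lower J_gr(3)[OF x] z by blast
  moreover have "k *v cnj_vec y = cnj_vec (cmp {0} ?c *v y) + cnj_vec z"
    unfolding z_def cnj_vec_add[symmetric] by (simp add: cnj_mat_mult_vec matrix_vector_mult_diff_rdistrib)
  ultimately show ?thesis by (simp add: Qc_simps)
qed

lemma Pm_zero_commute: assumes "supp {0} A" shows "Pm i ** A = A ** Pm i"
proof (rule mat_eq_Pm)
  fix k l
  have "Pm k ** A ** Pm l = 0" if "k \<noteq> l" using assms that by (simp add: supp_def)
  then show "Pm k ** (Pm i ** A) ** Pm l = Pm k ** (A ** Pm i) ** Pm l"
    unfolding matrix_mul_assoc Pm_mult
    by (simp add: matrix_mul_assoc[symmetric] Pm_mult) (auto simp: matrix_mul_assoc Pm_mult)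
qed

text \<open>Skewness moves X onto the conjugated argument with a minus sign, and inside the form
  \<open>Qc_cnj_zero\<close> replaces it there by the (0, 0) component of its conjugate.\<close>

lemma adj_gC_zero: assumes X: "X \<in> gC" and z: "supp {0} X" shows "adj X = - cmp {0} (cnj_mat X)"
proof (rule adjI)
  fix x y
  let ?c = "cmp {0} (cnj_mat X)"
  have zX: "supp ({0} \<union> LA) X" using z by (rule supp_mono) auto
  have t: "Qc (wt i) (Pm i *v (X *v x)) (cnj_vec (Pm i *v y)) = Qc (wt i) (Pm i *v x) (cnj_vec (Pm i *v (- ?c *v y)))" for i
  proof -
    have m: "Pm i *v x \<in> WC W (wt i)" "cnj_vec (Pm i *v y) \<in> WC W (wt i)"
      using J_gr(3)[OF Pm_mem] WC_cnj by blast+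
    have c: "Pm i *v (X *v x) = X *v (Pm i *v x)" by (simp add: matrix_vector_mul_assoc Pm_zero_commute[OF z])
    have cc: "?c *v (Pm i *v y) = Pm i *v (?c *v y)" by (simp add: matrix_vector_mul_assoc Pm_zero_commute[OF supp_cmp])
    have "Qc (wt i) (Pm i *v (X *v x)) (cnj_vec (Pm i *v y)) = - Qc (wt i) (Pm i *v x) (X *v cnj_vec (Pm i *v y))"
      unfolding c using X m unfolding gC_def skew_def by (simp add: eq_neg_iff_add_eq_0)
    also have "\<dots> = - Qc (wt i) (Pm i *v x) (cnj_vec (?c *v (Pm i *v y)))"
      using Qc_cnj_zero[OF zX Pm_mem Pm_mem] by simp
    also have "\<dots> = Qc (wt i) (Pm i *v x) (cnj_vec (Pm i *v (- ?c *v y)))"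
      unfolding cc by (simp add: matrix_vector_minus_left matrix_vector_minus_right cnj_vec_minus)
        (use Qc_simps(4)[of "wt i" "Pm i *v x" 0 "cnj_vec (Pm i *v (?c *v y))"] in \<open>simp add: Qc_simps\<close>)
    finally show ?thesis .
  qed
  show "h (X *v x) y = h x (- ?c *v y)" unfolding h_sum using t by simp
qed

end

subsection \<open>Deligne bigrading and metric near the base point\<close>

text \<open>\<open>NP\<close> and \<open>QF\<close> cut down by the weight condition. Together with
  0 they are additively closed, and 1 + y with y supported in \<open>NW\<close> preserves both
  filtrations.\<close>

abbreviation "NW \<equiv> {(a, b). a \<ge> 0 \<and> b < 0 \<and> a + b \<le> 0} :: (int \<times> int) set"
abbreviation "QW \<equiv> {(a, b). a < 0 \<and> a + b \<le> 0} :: (int \<times> int) set"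

lemma matrix_image_plus: "(*v) A ` (X + Y) = (*v) A ` X + (*v) A ` (Y :: (complex^'n) set)"
proof (intro set_eqI iffI)
  fix z assume "z \<in> (*v) A ` (X + Y)"
  then obtain x y where "x \<in> X" "y \<in> Y" "z = A *v (x + y)" by (auto elim: set_plus_elim)
  then show "z \<in> (*v) A ` X + (*v) A ` Y" by (simp add: matrix_vector_right_distrib set_plus_intro)
next
  fix z assume "z \<in> (*v) A ` X + (*v) A ` Y"
  then obtain x y where "x \<in> X" "y \<in> Y" "z = A *v x + A *v y" by (auto elim!: set_plus_elim)
  then show "z \<in> (*v) A ` (X + Y)" by (intro image_eqI[of _ _ "x + y"]) (simp_all add: matrix_vector_right_distrib set_plus_intro)
qed

lemma matrix_image_span: "(*v) A ` vec.span X = vec.span ((*v) A ` (X :: (complex^'n) set))"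
  by (rule vec.linear_span_image[symmetric]) (rule matrix_vector_mul_linear_gen)

context polarized
begin

lemma Qc_sym: assumes "x \<in> WC W k" "y \<in> WC W k" shows "Qc k x y = (-1) powi k * Qc k y x"
proof -
  define c :: real where "c = (-1) powi k"
  have f: "Q k a b = c * Q k b a" if "a \<in> W k" "b \<in> W k" for a b
    using forms that unfolding graded_forms_def c_def by blast
  have m: "re_vec x \<in> W k" "im_vec x \<in> W k" "re_vec y \<in> W k" "im_vec y \<in> W k"
    using assms by (auto simp: cplx_space_def)
  have e: "(-1) powi k = complex_of_real c" by (simp add: power_int_def c_def)
  show ?thesis unfolding e
    unfolding cplx_form_def f[OF m(1) m(3)] f[OF m(2) m(4)] f[OF m(1) m(4)] f[OF m(2) m(3)]
    by (simp add: complex_eq_iff algebra_simps)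
qed

text \<open>Conjugation turns i^(p-q) into (-i)^(p-q), and the symmetry of the form contributes
  (-1)^(p+q). The signs compensate because p - q and p + q have the same parity.\<close>

lemma h_cnj: "h y x = cnj (h x y)"
proof -
  have t: "\<i> powi (fst i - snd i) * Qc (wt i) (Pm i *v y) (cnj_vec (Pm i *v x)) =
      cnj (\<i> powi (fst i - snd i) * Qc (wt i) (Pm i *v x) (cnj_vec (Pm i *v y)))" for i
  proof -
    let ?d = "fst i - snd i"
    have W: "Pm i *v x \<in> WC W (wt i)" "Pm i *v y \<in> WC W (wt i)" using J_gr(3)[OF Pm_mem] by blast+
    have "cnj (Qc (wt i) (Pm i *v x) (cnj_vec (Pm i *v y))) = Qc (wt i) (cnj_vec (Pm i *v x)) (Pm i *v y)"
      by (simp add: cplx_form_cnj[OF Q_bilinear, symmetric])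
    also have "\<dots> = (-1) powi (wt i) * Qc (wt i) (Pm i *v y) (cnj_vec (Pm i *v x))"
      by (rule Qc_sym) (use W WC_cnj in auto)
    finally have 1: "cnj (Qc (wt i) (Pm i *v x) (cnj_vec (Pm i *v y))) = (-1) powi (wt i) * Qc (wt i) (Pm i *v y) (cnj_vec (Pm i *v x))" .
    have "cnj (\<i> powi ?d) * (-1) powi (wt i) = (\<i> powi ?d :: complex)"
    proof -
      have a: "cnj (\<i> powi ?d) = (- \<i>) powi ?d" by (simp add: power_int_def)
      have b: "(-1 :: complex) powi (wt i) = (-1) powi ?d"
      proof -
        have "(-1 :: complex) powi (?d + 2 * snd i) = (-1) powi ?d * (-1) powi (2 * snd i)"
          by (rule power_int_add) simp
        moreover have "(-1 :: complex) powi (2 * snd i) = 1" unfolding power_int_mult by simp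
        moreover have "?d + 2 * snd i = wt i" by simp
        ultimately show ?thesis by simp
      qed
      show ?thesis unfolding a b by (simp add: power_int_mult_distrib[symmetric])
    qed
    then show ?thesis using 1 by (simp add: algebra_simps)
  qed
  show ?thesis unfolding h_sum cnj_sum t ..
qed

lemma h_adj': "h x (A *v y) = h (adj A *v x) y"
  using h_adj[of A y x] h_cnj by metis

lemma VV_image:
  assumes A: "supp R A" and B: "supp R B" and AB: "A ** B = mat 1"
    and R: "\<And>r t. r \<in> R \<Longrightarrow> t \<in> T \<Longrightarrow> r + t \<in> T"
  shows "(*v) A ` VV T = VV T"
proof
  show "(*v) A ` VV T \<subseteq> VV T" using supp_VV[OF A] R by blast
  show "VV T \<subseteq> (*v) A ` VV T"
  proof
    fix x assume "x \<in> VV T"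
    then have "B *v x \<in> VV T" using supp_VV[OF B] R by blast
    moreover have "x = A *v (B *v x)" by (simp add: matrix_vector_mul_assoc AB)
    ultimately show "x \<in> (*v) A ` VV T" by blast
  qed
qed

text \<open>The types that make up the preimage in W_k of F^p gr_k; \<open>Gs'\<close> below is the
  same for its conjugate.\<close>

definition Gs :: "int \<Rightarrow> int \<Rightarrow> (int \<times> int) set" where "Gs k p = {(a, b). (a \<ge> p \<and> a + b = k) \<or> a + b < k}"

lemma gr_VV: "gr_filtration W F k p = VV (Gs k p)"
proof
  have "F p \<inter> WC W k \<subseteq> VV (Gs k p)"
  proof
    fix x assume "x \<in> F p \<inter> WC W k"
    then have "x \<in> VV {(a, b). a \<ge> p}" "x \<in> VV {(a, b). a + b \<le> k}" using F_VV WC_VV by auto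
    then show "x \<in> VV (Gs k p)" unfolding VV_iff Gs_def by (auto simp: case_prod_beta)
  qed
  moreover have "WC W (k - 1) \<subseteq> VV (Gs k p)" unfolding WC_VV by (rule VV_mono) (auto simp: Gs_def)
  ultimately show "gr_filtration W F k p \<subseteq> VV (Gs k p)"
    unfolding gr_filtration_def by (intro subsetI, elim set_plus_elim) (metis vsub(1)[OF VV_sub] subsetD)
  show "VV (Gs k p) \<subseteq> gr_filtration W F k p"
  proof
    fix x assume x: "x \<in> VV (Gs k p)"
    show "x \<in> gr_filtration W F k p"
    proof (rule VV_induct[OF _ _ x])
      fix i z assume i: "i \<in> Gs k p" "z \<in> J i"
      show "z \<in> gr_filtration W F k p"
      proof (cases "wt i < k")
        case True
        then have "z \<in> WC W (k - 1)" using J_gr(3)[OF i(2)] WC_mono[of "wt i" "k - 1"] by auto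
        then show ?thesis unfolding gr_filtration_def
          using vsub(4)[OF F_subspace] vsub(4)[OF WC_subspace] by (intro set_plusI[of 0 _ z]) auto
      next
        case False
        then have "p \<le> fst i" "wt i = k" using i by (auto simp: Gs_def)
        then show ?thesis using J_gr(1)[OF i(2)] gr_filtration_anti by blast
      qed
    next
      show "vec.subspace (gr_filtration W F k p)"
        unfolding gr_filtration_def by (intro vec_subspace_plus vec.subspace_inter F_subspace WC_subspace)
    qed
  qed
qed

definition Gs' :: "int \<Rightarrow> int \<Rightarrow> (int \<times> int) set" where "Gs' k q = {(a, b). (b \<ge> q \<and> a + b = k) \<or> a + b < k}"

lemma cnj_gr_VV: "cnj_vec ` gr_filtration W F k q = VV (Gs' k q)"
proof -
  have 1: "cj (Gs k q) \<subseteq> Gs' k q" and 2: "cj (Gs' k q) \<subseteq> Gs k q" by (auto simp: cj_def Gs_def Gs'_def)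
  show ?thesis unfolding gr_VV
  proof
    show "cnj_vec ` VV (Gs k q) \<subseteq> VV (Gs' k q)" using VV_cnj VV_mono[OF 1] by blast
    have "cnj_vec x \<in> VV (Gs k q)" if "x \<in> VV (Gs' k q)" for x using VV_cnj[OF that] VV_mono[OF 2] by blast
    then show "VV (Gs' k q) \<subseteq> cnj_vec ` VV (Gs k q)" by (intro subsetI) (simp only: mem_cnj_image)
  qed
qed

lemma gr_sub_WC: "VV (Gs k p) \<subseteq> WC W k"
  unfolding WC_VV by (rule VV_mono) (auto simp: Gs_def)

section \<open>Transport of the bigrading by the corrected automorphism\<close>

abbreviation gg :: "complex ^ 'n ^ 'n \<Rightarrow> complex ^ 'n ^ 'n" where
  "gg w \<equiv> mexp (- w) ** mexp (cnj_mat w)"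

abbreviation UU :: "int \<Rightarrow> complex ^ 'n ^ 'n" where "UU p \<equiv> PP {(a, b). a = p}"

end

text \<open>Everything here is algebraic in w and y. Existence of y and invertibility of 1 + y are
  established later for small w; the instance w = y = 0 describes F itself.\<close>

locale deformation = polarized W F Q for W :: "int \<Rightarrow> (real ^ 'n) set" and F Q +
  fixes w y fi :: "complex ^ 'n ^ 'n"
  assumes w: "w \<in> gC" and wQ: "supp QF w" and y: "supp NW y"
    and fi: "(mat 1 + y) ** fi = mat 1" and kill: "cmp NW ((mat 1 + y) ** gg w) = 0"
begin

definition K :: "complex ^ 'n ^ 'n" where "K = cmp {0} (cnj_mat (cmp {0} ((mat 1 + y) ** gg w)))"

definition gam :: "complex ^ 'n ^ 'n" where "gam = mexp w ** fi"
definition gami :: "complex ^ 'n ^ 'n" where "gami = (mat 1 + y) ** mexp (- w)"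
text \<open>This is \<open>gami ** cnj_mat gam\<close>: after transport by \<open>gam\<close>,
  complex conjugation becomes the old conjugation followed by M.\<close>

definition M :: "complex ^ 'n ^ 'n" where "M = (mat 1 + y) ** gg w ** cnj_mat fi"

lemma fi': "fi ** (mat 1 + y) = mat 1"
  using fi by (simp add: matrix_left_right_inverse)

lemma gam_inv: "gam ** gami = mat 1"
proof -
  have "gam ** gami = mexp w ** (fi ** (mat 1 + y)) ** mexp (- w)"
    unfolding gam_def gami_def by (simp only: matrix_mul_assoc)
  then show ?thesis by (simp add: fi' mexp_inverse)
qed

lemma gam_inv': "gami ** gam = mat 1"
  using gam_inv by (simp add: matrix_left_right_inverse)

lemma gam_cnj: "gam ** M = cnj_mat gam"
proof -
  have "gam ** M = mexp w ** (fi ** (mat 1 + y)) ** gg w ** cnj_mat fi"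
    unfolding gam_def M_def by (simp only: matrix_mul_assoc)
  also have "\<dots> = (mexp w ** mexp (- w)) ** mexp (cnj_mat w) ** cnj_mat fi"
    unfolding fi' by (simp add: matrix_mul_assoc)
  finally show ?thesis by (simp add: mexp_inverse gam_def cnj_mat_mult cnj_mat_mexp)
qed

lemma w_Wt: "supp Wt (mexp w)" "supp Wt (mexp (- w))" "supp Wt (gg w)"
proof -
  show 1: "supp Wt (mexp w)" "supp Wt (mexp (- w))" using supp_mexp gC_Wt w gC_minus by blast+
  show "supp Wt (gg w)" by (rule supp_mult[OF 1(2) supp_mexp[OF gC_Wt[OF gC_cnj[OF w]]]]) auto
qed

lemma supp_1y: "supp ({0} \<union> NW) (mat 1 + y)"
  by (intro supp_add supp_one) (auto intro: supp_mono[OF y])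

lemma supp_fi: "supp ({0} \<union> NW) fi"
  by (rule supp_inverse[OF supp_1y fi]) (auto simp: zero_prod_def)

lemma supp_fi1: "supp NW (fi - mat 1)"
proof -
  have e: "fi - mat 1 = - (y ** fi)" using fi by (simp add: matrix_add_rdistrib algebra_simps)
  show ?thesis unfolding e by (intro supp_minus supp_mult[OF y supp_fi]) (auto simp: zero_prod_def)
qed

text \<open>A bidegree with a + b <= 0 outside \<open>NW\<close> satisfies a < 0 or is (0,
  0).\<close>

lemma supp_B: "supp ({0} \<union> QW) ((mat 1 + y) ** gg w)"
proof -
  let ?B = "(mat 1 + y) ** gg w"
  have s: "supp Wt ?B" by (rule supp_mult[OF supp_1y w_Wt(3)]) (auto simp: zero_prod_def)
  have "?B = cmp (- NW) ?B" using kill by (simp add: cmp_compl)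
  then have "supp (Wt \<inter> - NW) ?B" using supp_cmp'[OF s, of "- NW"] by simp
  then show ?thesis by (rule supp_mono) (auto simp: zero_prod_def)
qed

lemma supp_cnj_y: "supp QW (cnj_mat y)"
  by (rule supp_mono[OF supp_cnj[OF y]]) (auto simp: cj_def)

lemma cnj_fi: "(mat 1 + cnj_mat y) ** cnj_mat fi = mat 1"
  using arg_cong[OF fi, of cnj_mat] by (simp add: cnj_mat_mult cnj_mat_add)

lemma supp_cnj_fi: "supp ({0} \<union> QW) (cnj_mat fi)"
proof (rule supp_inverse[OF _ cnj_fi])
  show "supp ({0} \<union> QW) (mat 1 + cnj_mat y)"
    by (intro supp_add supp_one) (auto intro: supp_mono[OF supp_cnj_y])
qed (auto simp: zero_prod_def)

lemma M_inv: "M ** cnj_mat M = mat 1"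
proof -
  have "gam ** (M ** cnj_mat M) = cnj_mat gam ** cnj_mat M" by (simp add: matrix_mul_assoc gam_cnj)
  also have "\<dots> = gam" using arg_cong[OF gam_cnj, of cnj_mat] by (simp add: cnj_mat_mult)
  finally have "gami ** (gam ** (M ** cnj_mat M)) = gami ** gam" by simp
  then show ?thesis by (simp add: matrix_mul_assoc gam_inv')
qed

text \<open>M is supported in {0} and \<open>QW\<close>, an additively closed set, hence so is its
  inverse \<open>cnj_mat M\<close>. Conjugating the latter restricts the second index of M as well:
  away from (0, 0) both indices are negative.\<close>

lemma supp_M: "supp ({0} \<union> LA) M"
proof -
  have 1: "supp ({0} \<union> QW) M" unfolding M_def
    by (rule supp_mult[OF supp_B supp_cnj_fi]) (auto simp: zero_prod_def)
  then have "supp ({0} \<union> QW) (cnj_mat M)" by (rule supp_inverse[OF _ M_inv]) (auto simp: zero_prod_def)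
  then have "supp (cj ({0} \<union> QW)) M" using supp_cnj by fastforce
  then have "supp (({0} \<union> QW) \<inter> cj ({0} \<union> QW)) M" using 1 by (rule supp_Int[rotated])
  then show ?thesis by (rule supp_mono) (auto simp: cj_def zero_prod_def)
qed

lemma supp_cnj_M: "supp ({0} \<union> LA) (cnj_mat M)"
  using supp_cnj[OF supp_M] cj_zero_LA by (rule supp_mono)

text \<open>The factor \<open>cnj_mat fi\<close> differs from 1 by bidegrees with a < 0, so it
  leaves the (0, 0) component of the product alone; the part of M in \<open>LA\<close> stays in
  \<open>LA\<close> under conjugation.\<close>

lemma K_M: "cmp {0} (cnj_mat M) = K"
proof -
  have c1: "cmp {0} (cnj_mat fi) = mat 1"
  proof -
    have e: "cnj_mat fi = mat 1 - cnj_mat y ** cnj_mat fi" using cnj_fi by (simp add: matrix_add_rdistrib algebra_simps)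
    have "supp QW (cnj_mat y ** cnj_mat fi)" by (rule supp_mult[OF supp_cnj_y supp_cnj_fi]) (auto simp: zero_prod_def)
    then have "cmp {0} (cnj_mat y ** cnj_mat fi) = 0" by (rule cmp_disjoint) (auto simp: zero_prod_def)
    moreover have "cmp {0} (mat 1) = mat 1" by (rule cmp_id[OF supp_one]) simp
    ultimately show ?thesis by (subst e) (simp add: cmp_diff)
  qed
  have "cmp {0} M = cmp {0} ((mat 1 + y) ** gg w) ** cmp {0} (cnj_mat fi)"
    unfolding M_def by (rule cmp_mult[OF supp_B supp_cnj_fi]) (auto simp: zero_prod_def)
  then have k: "cmp {0} M = cmp {0} ((mat 1 + y) ** gg w)" by (simp add: c1)
  have "supp (({0} \<union> LA) \<inter> - {0}) (cmp (- {0}) M)" by (rule supp_cmp'[OF supp_M])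
  then have "supp LA (M - cmp {0} M)" unfolding cmp_compl by (rule supp_mono) auto
  then have "cmp {0} (cnj_mat (M - cmp {0} M)) = 0"
    by (rule cmp_disjoint[OF supp_cnj]) (auto simp: cj_def zero_prod_def)
  then show ?thesis by (simp add: K_def k cnj_mat_diff cmp_diff)
qed

lemma gam_cnj_vec: "cnj_vec (gam *v x) = gam *v (M *v cnj_vec x)"
  by (simp add: cnj_mat_mult_vec gam_cnj[symmetric] matrix_vector_mul_assoc)

lemma fi_image: assumes "\<And>r t. r \<in> {0} \<union> NW \<Longrightarrow> t \<in> T \<Longrightarrow> r + t \<in> T" shows "(*v) fi ` VV T = VV T"
  by (rule VV_image[OF supp_fi supp_1y fi' assms])

lemma M_image: assumes "\<And>r t. r \<in> {0} \<union> LA \<Longrightarrow> t \<in> T \<Longrightarrow> r + t \<in> T" shows "(*v) M ` VV T = VV T"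
  by (rule VV_image[OF supp_M supp_cnj_M M_inv assms])

lemma gam_image: "(*v) gam ` A = (*v) (mexp w) ` (*v) fi ` A"
  by (simp add: gam_def image_image matrix_vector_mul_assoc)

text \<open>The correction \<open>fi\<close> stabilises each F^p, so \<open>gam\<close> moves F
  exactly as \<open>mexp w\<close> does.\<close>

lemma chart_gam: "chart F w p = (*v) gam ` F p"
proof -
  have "(*v) fi ` VV {(a, b). a \<ge> p} = VV {(a, b). a \<ge> p}" by (rule fi_image) (auto simp: zero_prod_def)
  then show ?thesis unfolding chart_def gam_image by (simp only: F_VV[of p])
qed

lemma mexp_image_WC: "(*v) (mexp w) ` WC W k = WC W k"
  unfolding WC_VV by (rule VV_image[OF w_Wt(1,2) mexp_inverse]) auto

lemma gam_WC: "(*v) gam ` WC W k = WC W k"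
proof -
  have "(*v) fi ` WC W k = WC W k" unfolding WC_VV by (rule fi_image) (auto simp: zero_prod_def)
  then show ?thesis unfolding gam_image by (simp add: mexp_image_WC)
qed

lemma gam_inj: "inj ((*v) gam)"
  by (rule inj_on_inverseI[of _ "(*v) gami"]) (simp add: matrix_vector_mul_assoc gam_inv')

lemma gam_surj: "\<exists>z. x = gam *v z"
  by (rule exI[of _ "gami *v x"]) (simp add: matrix_vector_mul_assoc gam_inv)

lemma gr_chart: "gr_filtration W (chart F w) k p = (*v) gam ` gr_filtration W F k p"
  unfolding gr_filtration_def matrix_image_plus chart_gam
  by (simp add: image_Int[OF gam_inj] gam_WC)

lemma gr_chart_mexp: "gr_filtration W (chart F w) k p = (*v) (mexp w) ` gr_filtration W F k p"
proof -
  have "(*v) fi ` VV (Gs k p) = VV (Gs k p)" by (rule fi_image) (auto simp: Gs_def zero_prod_def)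
  then show ?thesis unfolding gr_chart gam_image by (simp add: gr_VV)
qed

lemma cnj_gr_chart: "cnj_vec ` gr_filtration W (chart F w) k q = (*v) gam ` cnj_vec ` gr_filtration W F k q"
proof -
  have "cnj_vec ` gr_filtration W (chart F w) k q = (*v) gam ` (*v) M ` cnj_vec ` gr_filtration W F k q"
    unfolding gr_chart by (simp add: image_image gam_cnj_vec)
  moreover have "(*v) M ` VV (Gs' k q) = VV (Gs' k q)" by (rule M_image) (auto simp: Gs'_def zero_prod_def)
  ultimately show ?thesis by (simp add: cnj_gr_VV)
qed

lemma hodge_component_chart: "hodge_component W (chart F w) p q = (*v) gam ` hodge_component W F p q"
  unfolding hodge_component_def cnj_gr_chart unfolding gr_chart by (simp add: image_Int[OF gam_inj])

lemma mhs_chart: "mixed_hodge_structure W (chart F w)"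
  unfolding mixed_hodge_structure_def
proof (intro conjI allI)
  show "hodge_filtration (chart F w)" unfolding hodge_filtration_def
  proof (intro conjI allI)
    show "vec.subspace (chart F w p)" for p unfolding chart_def
      by (rule vec.linear_subspace_image[OF matrix_vector_mul_linear_gen F_subspace])
    show "antimono (chart F w)" unfolding chart_def antimono_def using F_anti by (auto simp: le_fun_def) 
    obtain a where "F a = UNIV" using F_UNIV by blast
    then have "chart F w a = UNIV" unfolding chart_gam using gam_surj by (metis UNIV_eq_I rangeI)
    then show "\<exists>a. chart F w a = UNIV" by blast
    obtain b where "F b = {0}" using F_zero by blast
    then show "\<exists>b. chart F w b = {0}" unfolding chart_def by (intro exI[of _ b]) simp
  qed
  fix k p
  have m: "gr_filtration W F k p + cnj_vec ` gr_filtration W F k (k - p + 1) = WC W k"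
     "gr_filtration W F k p \<inter> cnj_vec ` gr_filtration W F k (k - p + 1) = WC W (k - 1)"
    using mhs unfolding mixed_hodge_structure_def by blast+
  show "gr_filtration W (chart F w) k p + cnj_vec ` gr_filtration W (chart F w) k (k - p + 1) = WC W k"
    unfolding cnj_gr_chart unfolding gr_chart by (simp only: matrix_image_plus[symmetric] m gam_WC)
  show "gr_filtration W (chart F w) k p \<inter> cnj_vec ` gr_filtration W (chart F w) k (k - p + 1) = WC W (k - 1)"
    unfolding cnj_gr_chart unfolding gr_chart by (simp only: image_Int[OF gam_inj, symmetric] m gam_WC)
qed

lemma mexp_Qc: "x \<in> WC W k \<Longrightarrow> z \<in> WC W k \<Longrightarrow> Qc k (mexp w *v x) (mexp w *v z) = Qc k x z"
  using mexp_group[OF w] unfolding group_GC_def by blast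

text \<open>The factor \<open>mexp w\<close> is an isometry but \<open>fi\<close> is not. In weight
  k, \<open>fi\<close> - 1 raises the first index by at least 1 (modulo lower weight), and the
  indices of x and u already add up to k, so its contributions vanish by the first Hodge-Riemann
  relation. What is left is M inside the form, that is K.\<close>

lemma metric_transport:
  assumes x: "x \<in> J i" and z: "z \<in> J i"
  shows "Qc (wt i) (gam *v x) (cnj_vec (gam *v z)) = Qc (wt i) x (cnj_vec (K *v z))"
proof -
  define k where "k = wt i"
  define u where "u = M *v cnj_vec z"
  have fst_snd: "fst i + snd i = k" by (simp add: k_def)
  have xG: "x \<in> VV (Gs k (fst i))" by (rule J_mem_VV[OF x]) (simp add: Gs_def k_def case_prod_beta)
  have c: "cnj_vec z \<in> VV (cj {i})" by (rule J_cnj[OF z])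
  have "cj {i} \<subseteq> Gs k (snd i)" by (auto simp: cj_def Gs_def k_def)
  then have c': "cnj_vec z \<in> VV (Gs k (snd i))" using c VV_mono by blast
  have uG: "u \<in> VV (Gs k (snd i))" unfolding u_def
  proof (rule supp_VV[OF supp_M c])
    fix r a assume "r \<in> {0} \<union> LA" "a \<in> cj {i}"
    then show "r + a \<in> Gs k (snd i)" by (cases i) (auto simp: cj_def Gs_def k_def zero_prod_def)
  qed
  have f1: "(fi - mat 1) *v a \<in> VV (Gs k (p + 1))" if "a \<in> VV (Gs k p)" for a p
    by (rule supp_VV[OF supp_fi1 that]) (auto simp: Gs_def)
  have fG: "fi *v a \<in> VV (Gs k p)" if "a \<in> VV (Gs k p)" for a p
    by (rule supp_VV[OF supp_fi that]) (auto simp: Gs_def zero_prod_def)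
  have fe: "fi *v a = a + (fi - mat 1) *v a" for a by (simp add: matrix_vector_mult_diff_rdistrib)
  have orth: "Qc k a b = 0" if "a \<in> VV (Gs k p)" "b \<in> VV (Gs k q)" "p + q \<ge> k + 1" for a b p q
    using gr_orth[of a k p b q] that by (simp add: gr_VV)
  have "Qc k (gam *v x) (cnj_vec (gam *v z)) = Qc k (mexp w *v (fi *v x)) (mexp w *v (fi *v u))"
    unfolding gam_cnj_vec u_def[symmetric] by (simp add: gam_def matrix_vector_mul_assoc)
  also have "\<dots> = Qc k (fi *v x) (fi *v u)"
    using fG[OF xG] fG[OF uG] gr_sub_WC by (intro mexp_Qc) blast+
  also have "\<dots> = Qc k x (fi *v u)"
    using orth[OF f1[OF xG] fG[OF uG]] fst_snd unfolding fe[of x] by (simp add: Qc_simps)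
  also have "\<dots> = Qc k x u"
    using orth[OF xG f1[OF uG]] fst_snd unfolding fe[of u] by (simp add: Qc_simps)
  also have "\<dots> = Qc k x (cnj_vec (K *v z))"
    unfolding u_def k_def using Qc_cnj_zero[OF supp_M x z] by (simp add: K_M)
  finally show ?thesis by (simp add: k_def)
qed

text \<open>The first relation is invariant under the isometry \<open>mexp w\<close>. For the
  second, x comes from x0 of Hodge type (p, q), whose component a of type (p, q) carries its class
  in gr; by \<open>metric_transport\<close> the value is h (a, K a).\<close>

lemma pol_chart:
  assumes pos: "\<And>x. x \<noteq> 0 \<Longrightarrow> 0 < Re (h x (K *v x))"
  shows "graded_polarized W Q (chart F w)"
  unfolding graded_polarized_def
proof (intro conjI allI ballI)
  fix k p x z assume "x \<in> gr_filtration W (chart F w) k p" "z \<in> gr_filtration W (chart F w) k (k - p + 1)"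
  then obtain x0 z0 where xz: "x0 \<in> gr_filtration W F k p" "x = mexp w *v x0"
    "z0 \<in> gr_filtration W F k (k - p + 1)" "z = mexp w *v z0" unfolding gr_chart_mexp by blast
  then have "x0 \<in> WC W k" "z0 \<in> WC W k" using gr_sub_WC unfolding gr_VV by blast+
  then have "Qc k x z = Qc k x0 z0" by (simp add: xz(2,4) mexp_Qc)
  also have "\<dots> = 0" using gr_orth[OF xz(1,3)] by simp
  finally show "Qc k x z = 0" .
next
  fix p q x assume x: "x \<in> hodge_component W (chart F w) p q - WC W (p + q - 1)"
  define k where "k = p + q"
  obtain x0 where x0: "x0 \<in> hodge_component W F p q" "x = gam *v x0" using x unfolding hodge_component_chart by blast
  define a where "a = Pm (p, q) *v x0"
  have aJ: "a \<in> J (p, q)" unfolding a_def by (rule Pm_mem)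
  have "x0 \<in> VV (Gs k p)" "x0 \<in> VV (Gs' k q)"
    using x0(1) unfolding hodge_component_def cnj_gr_VV unfolding gr_VV k_def by blast+
  then have v: "Pm l *v x0 = 0" if "l \<notin> Gs k p \<or> l \<notin> Gs' k q" for l
    using that unfolding VV_iff by blast
  have "x0 - a \<in> WC W (k - 1)"
    unfolding WC_VV VV_iff
  proof (intro allI impI)
    fix l assume l: "l \<notin> {(a, b). a + b \<le> k - 1}"
    show "Pm l *v (x0 - a) = 0"
    proof (cases "l = (p, q)")
      case False
      then have "l \<notin> Gs k p \<or> l \<notin> Gs' k q" using l by (cases l) (auto simp: Gs_def Gs'_def k_def)
      then show ?thesis using False v[of l]
        by (simp add: a_def matrix_vector_mult_diff_distrib matrix_vector_mul_assoc Pm_mult)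
    qed (simp add: a_def matrix_vector_mult_diff_distrib matrix_vector_mul_assoc Pm_mult)
  qed
  then have l: "gam *v (x0 - a) \<in> WC W (k - 1)" using gam_WC by blast
  have aW: "a \<in> WC W k" using J_gr(3)[OF aJ] by (simp add: k_def)
  then have gaW: "gam *v a \<in> WC W k" using gam_WC by blast
  have lW: "gam *v (x0 - a) \<in> WC W k" using l WC_mono[of "k - 1" k] by auto
  have e: "x = gam *v a + gam *v (x0 - a)" by (simp add: x0(2) matrix_vector_right_distrib[symmetric])
  have "a \<noteq> 0"
  proof
    assume "a = 0"
    then have "x \<in> WC W (k - 1)" using e l by simp
    then show False using x by (simp add: k_def)
  qed
  have z1: "Qc k (gam *v a) (cnj_vec (gam *v (x0 - a))) = 0" "Qc k (gam *v (x0 - a)) (cnj_vec (gam *v a)) = 0"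
    "Qc k (gam *v (x0 - a)) (cnj_vec (gam *v (x0 - a))) = 0"
    using Qc_lower gaW lW l WC_cnj by blast+
  have "Qc k x (cnj_vec x) = Qc k (gam *v a) (cnj_vec (gam *v a))"
    unfolding e by (simp add: cnj_vec_add Qc_simps z1)
  also have "\<dots> = Qc k a (cnj_vec (K *v a))" using metric_transport[OF aJ aJ] by (simp add: k_def)
  finally have q: "Qc k x (cnj_vec x) = Qc k a (cnj_vec (K *v a))" .
  have "h a (K *v a) = \<i> powi (p - q) * Qc k a (cnj_vec (K *v a))"
  proof -
    have "Pm i *v (K *v a) = (if i = (p, q) then K *v a else 0)" for i
    proof -
      have "Pm i *v (K *v a) = K *v (Pm i *v a)"
        unfolding matrix_vector_mul_assoc using Pm_zero_commute[OF supp_cmp] by (metis K_def)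
      then show ?thesis using Pm_J[OF aJ] by simp
    qed
    then have "h a (K *v a) = (\<Sum>i\<in>S. if i = (p, q) then \<i> powi (p - q) * Qc k a (cnj_vec (K *v a)) else 0)"
      unfolding h_sum by (intro sum.cong refl) (auto simp: Pm_J[OF aJ] k_def Qc_simps)
    moreover have "(p, q) \<in> S" using aJ \<open>a \<noteq> 0\<close> unfolding S_def by blast
    ultimately show ?thesis using finite_S by (simp add: sum.delta)
  qed
  then show "0 < Re (\<i> powi (p - q) * Qc (p + q) x (cnj_vec x))"
    using pos[OF \<open>a \<noteq> 0\<close>] q by (simp add: k_def)
qed

text \<open>The transported spaces satisfy the axioms of the Deligne bigrading for the moved
  filtration, so uniqueness applies. The conjugation axiom is the place where the bidegrees of M
  matter.\<close>

lemma deligne_chart: "deligne W (chart F w) = (\<lambda>p q. (*v) gam ` deligne W F p q)"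
proof -
  interpret P: mhs W "chart F w" by unfold_locales (rule mhs_chart)
  have J: "deligne W F a b = J (a, b)" for a b by (simp add: J_def)
  have dec: "\<exists>!c. is_decomposition (\<lambda>p q. (*v) gam ` deligne W F p q) x c" for x
  proof -
    obtain z where z: "x = gam *v z" using gam_surj by blast
    have iff: "is_decomposition (\<lambda>p q. (*v) gam ` deligne W F p q) x c \<longleftrightarrow> is_decomposition (deligne W F) z (\<lambda>p q. gami *v c p q)" for c
    proof -
      have g: "gam *v a = b \<longleftrightarrow> a = gami *v b" for a b
        by (metis gam_inv gam_inv' matrix_vector_mul_assoc matrix_vector_mul_lid)
      have 1: "c p q \<in> (*v) gam ` deligne W F p q \<longleftrightarrow> gami *v c p q \<in> deligne W F p q" for p q
      proof
        assume "c p q \<in> (*v) gam ` deligne W F p q"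
        then obtain a where "a \<in> deligne W F p q" "gam *v a = c p q" by auto
        then show "gami *v c p q \<in> deligne W F p q" unfolding g by simp
      next
        assume a: "gami *v c p q \<in> deligne W F p q"
        have "gam *v (gami *v c p q) = c p q" unfolding g ..
        then show "c p q \<in> (*v) gam ` deligne W F p q" using a by (metis image_eqI)
      qed
      have 2: "gami *v c p q = 0 \<longleftrightarrow> c p q = 0" for p q using g[of 0] by auto
      have 3: "x = sum f A \<longleftrightarrow> z = (\<Sum>i\<in>A. gami *v f i)" for f and A :: "(int \<times> int) set"
        unfolding z g by (simp add: matrix_vector_sum_right)
      show ?thesis unfolding is_decomposition_def by (simp add: 1 2 3 case_prod_unfold)
    qed
    obtain d where d: "is_decomposition (deligne W F) z d" "\<And>e. is_decomposition (deligne W F) z e \<Longrightarrow> e = d"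
      using I_dec by metis
    show ?thesis
    proof (rule ex1I[of _ "\<lambda>p q. gam *v d p q"])
      show "is_decomposition (\<lambda>p q. (*v) gam ` deligne W F p q) x (\<lambda>p q. gam *v d p q)"
        unfolding iff using d(1) by (simp add: matrix_vector_mul_assoc gam_inv')
      fix c assume "is_decomposition (\<lambda>p q. (*v) gam ` deligne W F p q) x c"
      then have "(\<lambda>p q. gami *v c p q) = d" unfolding iff by (rule d(2))
      then have "d p q = gami *v c p q" for p q by auto
      then show "c = (\<lambda>p q. gam *v d p q)" by (simp add: matrix_vector_mul_assoc gam_inv)
    qed
  qed
  have span: "vec.span (\<Union>a\<in>A. \<Union>b\<in>B a. (*v) gam ` deligne W F a b) = (*v) gam ` VV (Sigma A B)" for A B
  proof -
    have "(\<Union>a\<in>A. \<Union>b\<in>B a. (*v) gam ` deligne W F a b) = (*v) gam ` (\<Union>i\<in>Sigma A B. J i)" by (auto simp: J)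
    then show ?thesis by (simp add: matrix_image_span[symmetric] span_J)
  qed
  have "is_deligne_bigrading W (chart F w) (\<lambda>p q. (*v) gam ` deligne W F p q)"
    unfolding is_deligne_bigrading_def
  proof (intro conjI allI)
    show "vec.subspace ((*v) gam ` deligne W F p q)" for p q
      by (rule vec.linear_subspace_image[OF matrix_vector_mul_linear_gen I_sub])
    show "chart F w p = vec.span (\<Union>a\<in>{p..}. \<Union>b. (*v) gam ` deligne W F a b)" for p
    proof -
      have "({(a, b). a \<ge> p} :: (int \<times> int) set) = Sigma {p..} (\<lambda>_. UNIV)" by auto
      then show ?thesis unfolding span chart_gam F_VV[of p] by (simp only:)
    qed
    show "WC W k = vec.span (\<Union>(a, b)\<in>{(a, b). a + b \<le> k}. (*v) gam ` deligne W F a b)" for k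
    proof -
      have "(\<Union>(a, b)\<in>{(a, b). a + b \<le> k}. (*v) gam ` deligne W F a b) = (*v) gam ` (\<Union>i\<in>{(a, b). a + b \<le> k}. J i)"
        by (auto simp: J)
      then have "vec.span (\<Union>(a, b)\<in>{(a, b). a + b \<le> k}. (*v) gam ` deligne W F a b) = (*v) gam ` WC W k"
        by (simp add: matrix_image_span[symmetric] span_J WC_VV)
      then show ?thesis using gam_WC by simp
    qed
    fix p q
    let ?L = "Sigma {..<q} (\<lambda>_. {..<p}) :: (int \<times> int) set"
    \<comment> \<open>The lower types, with or without (q, p), are stable under bidegrees 0 and
      \<open>LA\<close>; hence applying M respects the congruence between the conjugate of I^{p,q}
      and I^{q,p}.\<close>
    have Mlow: "(*v) M ` VV ?L = VV ?L" by (rule M_image) (auto simp: zero_prod_def)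
    have MT: "(*v) M ` VV ({(q, p)} \<union> ?L) = VV ({(q, p)} \<union> ?L)" by (rule M_image) (auto simp: zero_prod_def)
    have sp: "vec.span (\<Union>a\<in>{..<q}. \<Union>b\<in>{..<p}. deligne W F a b) = VV ?L"
    proof -
      have "(\<Union>a\<in>{..<q}. \<Union>b\<in>{..<p}. deligne W F a b) = (\<Union>i\<in>?L. J i)" by (auto simp: J)
      then show ?thesis by (simp add: span_J)
    qed
    have T: "deligne W F q p + VV ?L = VV ({(q, p)} \<union> ?L)"
      using J_sub[of "(q, p)"] by (simp only: span_J[symmetric] UN_Un vec_span_union_plus) (simp add: J vec.span_eq_iff[THEN iffD2])
    have "cnj_vec ` deligne W F p q + VV ?L = deligne W F q p + VV ?L"
    proof -
      have "cnj_vec ` deligne W F p q + vec.span (\<Union>a\<in>{..<q}. \<Union>b\<in>{..<p}. deligne W F a b) =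
          deligne W F q p + vec.span (\<Union>a\<in>{..<q}. \<Union>b\<in>{..<p}. deligne W F a b)"
        using deligne_bigrading unfolding is_deligne_bigrading_def by blast
      then show ?thesis unfolding sp .
    qed
    then have "(*v) M ` (cnj_vec ` deligne W F p q + VV ?L) = VV ({(q, p)} \<union> ?L)" by (simp only: T MT)
    then have MI: "(*v) M ` cnj_vec ` deligne W F p q + VV ?L = deligne W F q p + VV ?L"
      by (simp only: matrix_image_plus Mlow T)
    have "cnj_vec ` (*v) gam ` deligne W F p q = (*v) gam ` (*v) M ` cnj_vec ` deligne W F p q"
      by (simp add: image_image gam_cnj_vec)
    then show "cnj_vec ` (*v) gam ` deligne W F p q + vec.span (\<Union>a\<in>{..<q}. \<Union>b\<in>{..<p}. (*v) gam ` deligne W F a b) =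
        (*v) gam ` deligne W F q p + vec.span (\<Union>a\<in>{..<q}. \<Union>b\<in>{..<p}. (*v) gam ` deligne W F a b)"
      unfolding span by (simp only: matrix_image_plus[symmetric] MI)
  qed (rule dec)
  then show ?thesis by (rule P.deligne_eqI)
qed

text \<open>The projectors of the new bigrading are the old ones conjugated by \<open>gam\<close>,
  and K commutes with them; the sums over types agree term by term by
  \<open>metric_transport\<close>.\<close>

lemma chart_metric:
  assumes pos: "\<And>x. x \<noteq> 0 \<Longrightarrow> 0 < Re (h x (K *v x))"
  shows "hodge_metric W Q (chart F w) (gam *v x) (gam *v z) = h x (K *v z)"
proof -
  interpret P: polarized W "chart F w" Q
    by unfold_locales (rule mhs_chart, rule forms, rule pol_chart[OF pos])
  have PJ: "P.J i = (*v) gam ` J i" for i unfolding P.J_def J_def by (simp only: deligne_chart)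
  have PS: "P.S = S"
  proof -
    have "(*v) gam ` J i = {0} \<longleftrightarrow> J i = {0}" for i
      using inj_image_eq_iff[OF gam_inj, of "J i" "{0}"] by simp
    then show ?thesis unfolding P.S_def S_def PJ by simp
  qed
  have part: "P.Pm i *v (gam *v x) = gam *v (Pm i *v x)" for i x
  proof -
    have "P.part (gam *v x) = (\<lambda>i. gam *v (Pm i *v x))"
    proof (rule P.partI[OF finite_S])
      show "gam *v (Pm i *v x) \<in> P.J i" for i unfolding PJ using Pm_mem by blast
      show "gam *v (Pm i *v x) = 0" if "i \<notin> S" for i using Pm_notin_S[OF that] by simp
      show "gam *v x = (\<Sum>i\<in>S. gam *v (Pm i *v x))"
        unfolding matrix_vector_sum_right[symmetric] vec_expand[symmetric] ..
    qed
    then show ?thesis by (simp add: P.Pm_part)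
  qed
  have "Pm i *v (K *v z) = K *v (Pm i *v z)" for i
    unfolding matrix_vector_mul_assoc using Pm_zero_commute[OF supp_cmp] by (metis K_def)
  then show ?thesis unfolding P.h_sum h_sum PS part
    by (intro sum.cong refl) (simp add: metric_transport[OF Pm_mem Pm_mem])
qed

text \<open>Since mexp w z = gam (1 + y) z, the representative is gam applied to the U^p component
  of (1 + y) z. As 1 + y preserves F^{p+1}, only the U^p component of z enters.\<close>

lemma quot_rep_chart:
  assumes z: "z \<in> F p"
  shows "quot_rep W (chart F w) p (mexp w *v z) = gam *v ((mat 1 + UU p ** y ** UU p) *v (UU p *v z))"
proof -
  define c where "c = (mat 1 + UU p ** y ** UU p) *v (UU p *v z)"
  let ?U = "{(a, b). a = p} :: (int \<times> int) set"
  have UF: "VV ?U \<subseteq> F p" by (subst F_VV) (rule VV_mono, auto)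
  have sU: "hodge_U W (chart F w) p = (*v) gam ` VV ?U"
  proof -
    have "(\<Union>q. deligne W F p q) = (\<Union>i\<in>?U. J i)" by (auto simp: J_def)
    then have "(\<Union>q. (*v) gam ` deligne W F p q) = (*v) gam ` (\<Union>i\<in>?U. J i)" by (simp only: image_UN[symmetric])
    then show ?thesis unfolding hodge_U_def deligne_chart by (simp add: matrix_image_span[symmetric] span_J)
  qed
  have lowF: "a - UU p *v a \<in> F (p + 1)" if "a \<in> F p" for a
  proof -
    have "a \<in> VV {(a, b). a \<ge> p}" using that F_VV by blast
    then have "a - UU p *v a \<in> VV {(a, b). a \<ge> p + 1}" unfolding VV_iff
      by (auto simp: matrix_vector_mult_diff_distrib matrix_vector_mul_assoc Pm_PP case_prod_beta)
    then show ?thesis using F_VV by blast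
  qed
  have Fpres: "A *v a \<in> F r" if "supp ({0} \<union> NW) A" "a \<in> F r" for A a r
  proof -
    have "a \<in> VV {(a, b). a \<ge> r}" using that F_VV by blast
    then have "A *v a \<in> VV {(a, b). a \<ge> r}" by (rule supp_VV[OF that(1)]) (auto simp: zero_prod_def)
    then show ?thesis using F_VV by blast
  qed
  have Ukill: "UU p *v a = 0" if "a \<in> F (p + 1)" for a
  proof -
    have "a \<in> VV {(a, b). a \<ge> p + 1}" using that F_VV by blast
    then have "Pm i *v a = 0" if "i \<in> ?U" for i using that unfolding VV_iff by (auto simp: case_prod_beta)
    then show ?thesis by (simp add: PP_def matrix_vector_sum_left)
  qed
  have c: "c = UU p *v ((mat 1 + y) *v z)"
  proof -
    have "UU p *v ((mat 1 + y) *v (z - UU p *v z)) = 0"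
      by (intro Ukill Fpres[OF supp_1y] lowF z)
    then have "UU p *v ((mat 1 + y) *v z) = UU p *v ((mat 1 + y) *v (UU p *v z))"
      by (simp add: matrix_vector_mult_diff_distrib)
    moreover have "UU p *v (UU p *v a) = UU p *v a" for a by (simp add: matrix_vector_mul_assoc PP_mult)
    ultimately show ?thesis
      by (simp add: c_def matrix_vector_mult_add_rdistrib matrix_vector_right_distrib matrix_vector_mul_assoc[symmetric])
  qed
  have cU: "c \<in> VV ?U" unfolding c by (rule PP_VV)
  have "(mat 1 + y) *v z - c \<in> F (p + 1)" unfolding c by (intro lowF Fpres[OF supp_1y] z)
  then have "gam *v ((mat 1 + y) *v z - c) \<in> chart F w (p + 1)" unfolding chart_gam by blast
  moreover have "gam *v ((mat 1 + y) *v z) = mexp w *v z"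
  proof -
    have "gam ** (mat 1 + y) = mexp w ** (fi ** (mat 1 + y))" by (simp add: gam_def matrix_mul_assoc)
    then show ?thesis by (simp add: matrix_vector_mul_assoc fi')
  qed
  ultimately have d: "mexp w *v z - gam *v c \<in> chart F w (p + 1)" by (simp add: matrix_vector_mult_diff_distrib)
  show ?thesis unfolding quot_rep_def c_def[symmetric]
  proof (rule the_equality)
    show "gam *v c \<in> hodge_U W (chart F w) p \<and> mexp w *v z - gam *v c \<in> chart F w (p + 1)"
      using d cU sU by blast
    fix v assume v: "v \<in> hodge_U W (chart F w) p \<and> mexp w *v z - v \<in> chart F w (p + 1)"
    then obtain c' where c': "c' \<in> VV ?U" "v = gam *v c'" unfolding sU by blast
    have sub: "vec.subspace (chart F w (p + 1))" unfolding chart_def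
      by (rule vec.linear_subspace_image[OF matrix_vector_mul_linear_gen F_subspace])
    have "(mexp w *v z - v) - (mexp w *v z - gam *v c) \<in> chart F w (p + 1)"
      using v d vsub(2)[OF sub] by blast
    then have "gam *v (c - c') \<in> (*v) gam ` F (p + 1)" unfolding chart_gam c'(2) by (simp add: matrix_vector_mult_diff_distrib)
    then have "c - c' \<in> F (p + 1)" by (simp only: inj_image_mem_iff[OF gam_inj])
    then have "UU p *v (c - c') = 0" by (rule Ukill)
    then show "v = gam *v c" using cU c' by (simp add: matrix_vector_mult_diff_distrib PP_VV_id)
  qed
qed

lemma classifying_chart:
  assumes pos: "\<And>x. x \<noteq> 0 \<Longrightarrow> 0 < Re (h x (K *v x))" and F: "F \<in> classifying_space W Q hn"
  shows "chart F w \<in> classifying_space W Q hn"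
proof -
  have "vec.dim ((*v) gam ` A) = vec.dim A" for A
    by (rule vec.dim_image_eq[OF matrix_vector_mul_linear_gen]) (use gam_inj in \<open>auto intro: inj_on_subset\<close>)
  then show ?thesis using F mhs_chart pol_chart[OF pos] by (simp add: classifying_space_def hodge_component_chart)
qed

end

section \<open>The correction for small parameters\<close>

context polarized
begin

text \<open>The inner projection extends the equation to all matrices, where the perturbation
  argument applies; the outer one forces its solutions into \<open>NW\<close>, on which the inner
  one is the identity.\<close>

definition BN :: "complex ^ 'n ^ 'n \<Rightarrow> complex ^ 'n ^ 'n \<Rightarrow> complex ^ 'n ^ 'n" where
  "BN A Y = cmp NW (cmp NW Y ** A)"

text \<open>\<open>yy w\<close> is the element of \<open>lie_n_plus\<close>-type support for which \<open>(1 + yy w) ** gg w\<close> has no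
  component there.\<close>

definition yy :: "complex ^ 'n ^ 'n \<Rightarrow> complex ^ 'n ^ 'n" where
  "yy w = (SOME y. y + BN (gg w - mat 1) y = - cmp NW (gg w))"

definition kk :: "complex ^ 'n ^ 'n \<Rightarrow> complex ^ 'n ^ 'n" where
  "kk w = cmp {0} ((mat 1 + yy w) ** gg w)"

definition KK :: "complex ^ 'n ^ 'n \<Rightarrow> complex ^ 'n ^ 'n" where
  "KK w = cmp {0} (cnj_mat (kk w))"

definition XX :: "int \<Rightarrow> complex ^ 'n ^ 'n \<Rightarrow> complex ^ 'n ^ 'n" where
  "XX p w = mat 1 + UU p ** yy w ** UU p"

definition NN :: "int \<Rightarrow> complex ^ 'n ^ 'n \<Rightarrow> complex ^ 'n ^ 'n" where
  "NN p w = adj (XX p w) ** (adj (KK w) ** XX p w)"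

lemma bounded_linear_cmp: "bounded_linear (cmp R)"
  using linear_cmp linear_conv_bounded_linear by blast

lemma BN_bilinear: "bounded_bilinear BN"
  unfolding bilinear_conv_bounded_bilinear[symmetric] bilinear_def BN_def
  by (auto intro!: linearI simp: cmp_add cmp_scaleR matrix_add_ldistrib matrix_add_rdistrib
      matrix_scaleR_left matrix_scaleR_right)

lemma BN_scale_left: "BN (scale_mat c A) Y = scale_mat c (BN A Y)"
  and BN_scale_right: "BN A (scale_mat c Y) = scale_mat c (BN A Y)"
  by (simp_all add: BN_def cmp_scale scale_mat_mult_left scale_mat_mult_right)

lemma cmp_NW_one [simp]: "cmp NW (mat 1) = 0"
  by (rule cmp_disjoint[OF supp_one[of "{0}"]]) (auto simp: zero_prod_def)

lemma cmp_0_one [simp]: "cmp {0} (mat 1) = mat 1"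
  by (rule cmp_id[OF supp_one]) simp

lemma gg_tendsto: "(gg \<longlongrightarrow> mat 1) (nhds 0)"
proof -
  have m: "(mexp \<longlongrightarrow> mat 1) (nhds (0 :: complex^'n^'n))"
    using has_derivative_continuous[OF mexp_has_derivative[of "0 :: complex^'n^'n"]]
    unfolding continuous_within tendsto_at_iff_tendsto_nhds by simp
  have id: "((\<lambda>w. w) \<longlongrightarrow> (0 :: complex^'n^'n)) (nhds 0)" by (simp add: filterlim_ident)
  have n: "((\<lambda>w. - w) \<longlongrightarrow> (0 :: complex^'n^'n)) (nhds 0)" using tendsto_minus[OF id] by simp
  have c: "(cnj_mat \<longlongrightarrow> (0 :: complex^'n^'n)) (nhds 0)"
    using bounded_linear.tendsto[OF bounded_linear_cnj_mat id] by simp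
  have "((\<lambda>w. mexp (- w)) \<longlongrightarrow> mat 1) (nhds (0 :: complex^'n^'n))"
    "((\<lambda>w. mexp (cnj_mat w)) \<longlongrightarrow> mat 1) (nhds (0 :: complex^'n^'n))"
    using filterlim_compose[OF m n] filterlim_compose[OF m c] by simp_all
  then show ?thesis using bounded_bilinear.tendsto[OF bounded_bilinear_matrix_mult] by fastforce
qed

lemma ev_norm_less:
  assumes "(f \<longlongrightarrow> (0 :: 'a::real_normed_vector)) Fl" "d > 0" shows "\<forall>\<^sub>F x in Fl. norm (f x) < d"
  using tendstoD[OF assms] by (simp add: dist_norm)

lemma bilinear_small:
  fixes B :: "'a::real_normed_vector \<Rightarrow> 'b::real_normed_vector \<Rightarrow> 'c::real_normed_vector"
  assumes B: "bounded_bilinear B" and f: "(f \<longlongrightarrow> 0) Fl"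
  shows "\<forall>\<^sub>F x in Fl. \<forall>Y. norm (B (f x) Y) \<le> norm Y / 2"
proof -
  obtain C where C: "C > 0" "\<And>a b. norm (B a b) \<le> norm a * norm b * C"
    using bounded_bilinear.pos_bounded[OF B] by blast
  have "\<forall>\<^sub>F x in Fl. norm (f x) < 1 / (2 * C)" using C by (intro ev_norm_less[OF f]) auto
  then show ?thesis
  proof eventually_elim
    case (elim x)
    show ?case
    proof
      fix Y
      have "norm (B (f x) Y) \<le> norm (f x) * C * norm Y" using C(2)[of "f x" Y] by (simp add: mult_ac)
      also have "\<dots> \<le> (1 / 2) * norm Y"
        using elim C(1) by (intro mult_right_mono) (auto simp: field_simps)
      finally show "norm (B (f x) Y) \<le> norm Y / 2" by simp
    qed
  qed
qed

lemma gg1_tendsto: "((\<lambda>w. gg w - mat 1) \<longlongrightarrow> 0) (nhds 0)"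
  using tendsto_diff[OF gg_tendsto tendsto_const[of "mat 1"]] by simp

lemma ev_BN: "\<forall>\<^sub>F w in nhds 0. \<forall>Y. norm (BN (gg w - mat 1) Y) \<le> norm Y / 2"
  by (rule bilinear_small[OF BN_bilinear gg1_tendsto])

lemma yy_eq:
  assumes "\<forall>Y. norm (BN (gg w - mat 1) Y) \<le> norm Y / 2"
  shows "yy w + BN (gg w - mat 1) (yy w) = - cmp NW (gg w)"
  unfolding yy_def
  by (rule someI_ex, rule perturbed_identity_solve[OF bounded_bilinear.bounded_linear_right[OF BN_bilinear]])
    (use assms in blast)

text \<open>The perturbation has norm at most 1/2, so the solution is at most twice the right-hand
  side, which tends to the \<open>NW\<close> component of 1, namely 0.\<close>

lemma yy_tendsto: "(yy \<longlongrightarrow> 0) (nhds 0)"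
proof (rule Lim_null_comparison)
  show "\<forall>\<^sub>F w in nhds 0. norm (yy w) \<le> 2 * norm (cmp NW (gg w))"
    using ev_BN
  proof eventually_elim
    case (elim w)
    define a where "a = cmp NW (gg w)"
    define b where "b = BN (gg w - mat 1) (yy w)"
    have e: "- a - b = yy w" using yy_eq[OF elim] by (simp add: a_def b_def diff_eq_eq)
    have "norm (yy w) \<le> norm a + norm b" using norm_triangle_ineq4[of "- a" b] unfolding e by simp
    moreover have "norm b \<le> norm (yy w) / 2" unfolding b_def using elim by blast
    ultimately show ?case unfolding a_def by linarith
  qed
  have "((\<lambda>w. norm (cmp NW (gg w))) \<longlongrightarrow> norm (cmp NW (mat 1))) (nhds 0)"
    by (intro tendsto_norm bounded_linear.tendsto[OF bounded_linear_cmp] gg_tendsto)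
  then show "((\<lambda>w. 2 * norm (cmp NW (gg w))) \<longlongrightarrow> 0) (nhds 0)"
    using tendsto_mult_right_zero by fastforce
qed

lemma ev_inverse: "\<forall>\<^sub>F w in nhds 0. \<exists>fi. (mat 1 + yy w) ** fi = mat 1"
  using bilinear_small[OF bounded_bilinear_matrix_mult yy_tendsto]
proof eventually_elim
  case (elim w)
  have "\<exists>z. z + yy w ** z = mat 1"
    by (rule perturbed_identity_solve[OF bounded_linear_matrix_right]) (use elim in blast)
  then show ?case by (simp add: matrix_add_rdistrib)
qed

lemma KK_tendsto: "(KK \<longlongrightarrow> mat 1) (nhds 0)"
proof -
  have "((\<lambda>w. (mat 1 + yy w) ** gg w) \<longlongrightarrow> (mat 1 + 0) ** mat 1) (nhds 0)"
    by (intro bounded_bilinear.tendsto[OF bounded_bilinear_matrix_mult] tendsto_add tendsto_const yy_tendsto gg_tendsto)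
  then have "((\<lambda>w. cmp {0} (cnj_mat (cmp {0} ((mat 1 + yy w) ** gg w)))) \<longlongrightarrow> cmp {0} (cnj_mat (cmp {0} ((mat 1 + 0) ** mat 1)))) (nhds 0)"
    by (intro bounded_linear.tendsto[OF bounded_linear_cmp] bounded_linear.tendsto[OF bounded_linear_cnj_mat])
  then show ?thesis by (simp add: KK_def[abs_def] kk_def)
qed

text \<open>The constant is the minimum of the metric on the compact unit sphere; it makes
  positivity stable under small perturbations.\<close>

lemma h_coercive: "\<exists>c>0. \<forall>x. c * (norm x)\<^sup>2 \<le> Re (h x x)"
proof -
  have cont: "continuous_on (sphere 0 1) (\<lambda>x. Re (h x x))"
    by (intro continuous_intros bounded_bilinear.continuous_on[OF bounded_bilinear_h])
  have "axis undefined 1 \<in> sphere (0 :: complex^'n) 1" by (simp add: norm_axis_1)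
  then obtain m where m: "m \<in> sphere 0 1" "\<And>x. x \<in> sphere 0 1 \<Longrightarrow> Re (h m m) \<le> Re (h x x)"
    using continuous_attains_inf[OF compact_sphere _ cont] by blast
  have "m \<noteq> 0" using m(1) by auto
  show ?thesis
  proof (intro exI[of _ "Re (h m m)"] conjI allI)
    show "0 < Re (h m m)" by (rule h_pos[OF \<open>m \<noteq> 0\<close>])
    fix x
    show "Re (h m m) * (norm x)\<^sup>2 \<le> Re (h x x)"
    proof (cases "x = 0")
      case False
      define e where "e = (1 / norm x) *\<^sub>R x"
      have x: "x = of_real (norm x) *s e" using False by (simp add: e_def scaleR_eq_scale)
      have "e \<in> sphere 0 1" using False by (simp add: e_def)
      then have "Re (h m m) \<le> Re (h e e)" by (rule m(2))
      moreover have "h x x = of_real ((norm x)\<^sup>2) * h e e"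
        by (subst x, subst (2) x) (simp add: h_scale_left h_scale_right power2_eq_square)
      then have "Re (h x x) = (norm x)\<^sup>2 * Re (h e e)" by simp
      ultimately show ?thesis by (simp add: mult.commute mult_left_mono)
    qed simp
  qed
qed

lemma ev_pos: "\<forall>\<^sub>F w in nhds 0. \<forall>x. x \<noteq> 0 \<longrightarrow> 0 < Re (h x (KK w *v x))"
proof -
  obtain c where c: "c > 0" "\<And>x. c * (norm x)\<^sup>2 \<le> Re (h x x)" using h_coercive by blast
  obtain C where C: "C > 0" "\<And>a b. norm (h a b) \<le> norm a * norm b * C"
    using bounded_bilinear.pos_bounded[OF bounded_bilinear_h] by blast
  obtain D where D: "D > 0" "\<And>(A :: complex^'n^'n) (x :: complex^'n). norm (A *v x) \<le> norm A * norm x * D"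
    using bounded_bilinear.pos_bounded[OF bounded_bilinear_matrix_vector_mult] by blast
  have "((\<lambda>w. KK w - mat 1) \<longlongrightarrow> 0) (nhds 0)"
    using tendsto_diff[OF KK_tendsto tendsto_const[of "mat 1"]] by simp
  then have "\<forall>\<^sub>F w in nhds 0. norm (KK w - mat 1) < c / (C * D)" using c C D by (intro ev_norm_less) auto
  then show ?thesis
  proof eventually_elim
    case (elim w)
    show ?case
    proof (intro allI impI)
      fix x :: "complex^'n" assume x: "x \<noteq> 0"
      let ?E = "KK w - mat 1"
      have "norm (h x (?E *v x)) \<le> norm x * norm (?E *v x) * C" by (rule C(2))
      also have "\<dots> \<le> norm x * (norm ?E * norm x * D) * C"
        using D(2)[of ?E x] C(1) by (intro mult_right_mono mult_left_mono) auto
      also have "\<dots> = (norm ?E * (C * D)) * (norm x)\<^sup>2" by (simp add: power2_eq_square)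
      also have "\<dots> < c * (norm x)\<^sup>2"
        using elim C D x by (intro mult_strict_right_mono) (auto simp: field_simps)
      also have "\<dots> \<le> Re (h x x)" by (rule c(2))
      finally have "norm (h x (?E *v x)) < Re (h x x)" .
      moreover have "- Re (h x (?E *v x)) \<le> norm (h x (?E *v x))" using abs_Re_le_cmod[of "h x (?E *v x)"] by linarith
      moreover have "h x (KK w *v x) = h x x + h x (?E *v x)"
        by (simp add: h_add_right[symmetric] matrix_vector_mult_diff_rdistrib)
      ultimately show "0 < Re (h x (KK w *v x))" by simp
    qed
  qed
qed

lemma deformationI:
  assumes w: "w \<in> lie_q W Q F" and s: "\<forall>Y. norm (BN (gg w - mat 1) Y) \<le> norm Y / 2"
    and fi: "(mat 1 + yy w) ** fi = mat 1"
  shows "deformation W F Q w (yy w) fi"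
proof -
  have ye: "yy w = cmp NW (- gg w - cmp NW (yy w) ** (gg w - mat 1))"
    using yy_eq[OF s] by (simp add: BN_def cmp_diff cmp_minus eq_diff_eq)
  have y: "supp NW (yy w)" by (subst ye) (rule supp_cmp)
  then have yc: "cmp NW (yy w) = yy w" by (rule cmp_id)
  have "cmp NW ((mat 1 + yy w) ** gg w) = yy w + BN (gg w - mat 1) (yy w) + cmp NW (gg w)"
    unfolding BN_def yc by (simp add: matrix_add_rdistrib matrix_diff_ldistrib cmp_add cmp_diff yc)
  then have "cmp NW ((mat 1 + yy w) ** gg w) = 0" using yy_eq[OF s] by simp
  moreover have "w \<in> gC" "supp QF w" using w by (auto simp: lie_q_eq)
  ultimately show ?thesis using y fi by unfold_locales auto
qed

text \<open>One ball on which y exists, 1 + y is invertible and K is positive for h. There the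
  algebraic results apply, and the metric of the moved quotient becomes the fixed metric on U^p
  twisted by \<open>NN\<close>.\<close>

lemma chart_near:
  "\<exists>\<epsilon>>0. \<forall>w\<in>lie_q W Q F. norm w < \<epsilon> \<longrightarrow>
     (\<forall>Y. norm (BN (gg w - mat 1) Y) \<le> norm Y / 2) \<and>
     (\<forall>hn. F \<in> classifying_space W Q hn \<longrightarrow> chart F w \<in> classifying_space W Q hn) \<and>
     (\<forall>p z z'. z \<in> F p \<longrightarrow> z' \<in> F p \<longrightarrow>
        hodge_metric W Q (chart F w) (quot_rep W (chart F w) p (mexp w *v z)) (quot_rep W (chart F w) p (mexp w *v z'))
        = h (NN p w *v (UU p *v z)) (UU p *v z'))"
proof -
  have "\<forall>\<^sub>F w in nhds 0. (\<forall>Y. norm (BN (gg w - mat 1) Y) \<le> norm Y / 2) \<and> (\<exists>fi. (mat 1 + yy w) ** fi = mat 1) \<and>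
     (\<forall>x. x \<noteq> 0 \<longrightarrow> 0 < Re (h x (KK w *v x)))"
    using ev_BN ev_inverse ev_pos by eventually_elim blast
  then obtain \<epsilon> where \<epsilon>: "\<epsilon> > 0" "\<And>w. norm w < \<epsilon> \<Longrightarrow> (\<forall>Y. norm (BN (gg w - mat 1) Y) \<le> norm Y / 2) \<and> (\<exists>fi. (mat 1 + yy w) ** fi = mat 1) \<and>
     (\<forall>x. x \<noteq> 0 \<longrightarrow> 0 < Re (h x (KK w *v x)))"
    unfolding eventually_nhds_metric by auto
  show ?thesis
  proof (intro exI[of _ \<epsilon>] conjI ballI impI \<epsilon>(1))
    fix w assume w: "w \<in> lie_q W Q F" "norm w < \<epsilon>"
    note s = conjunct1[OF \<epsilon>(2)[OF w(2)]]
    show "\<forall>Y. norm (BN (gg w - mat 1) Y) \<le> norm Y / 2" by (rule s)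
    obtain fi where fi: "(mat 1 + yy w) ** fi = mat 1" using \<epsilon>(2)[OF w(2)] by blast
    interpret D: deformation W F Q w "yy w" fi by (rule deformationI[OF w(1) s fi])
    have K: "D.K = KK w" by (simp add: D.K_def KK_def kk_def)
    have pos: "0 < Re (h x (D.K *v x))" if "x \<noteq> 0" for x using \<epsilon>(2)[OF w(2)] that K by simp
    have cm: "hodge_metric W Q (chart F w) (D.gam *v a) (D.gam *v b) = h a (KK w *v b)" for a b
      using D.chart_metric[OF pos] K by simp
    show "\<forall>hn. F \<in> classifying_space W Q hn \<longrightarrow> chart F w \<in> classifying_space W Q hn"
      using D.classifying_chart[OF pos] by blast
    show "\<forall>p z z'. z \<in> F p \<longrightarrow> z' \<in> F p \<longrightarrow>
        hodge_metric W Q (chart F w) (quot_rep W (chart F w) p (mexp w *v z)) (quot_rep W (chart F w) p (mexp w *v z'))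
        = h (NN p w *v (UU p *v z)) (UU p *v z')"
    proof (intro allI impI)
      fix p z z' assume z: "z \<in> F p" "z' \<in> F p"
      define a b where "a = UU p *v z" and "b = UU p *v z'"
      have "hodge_metric W Q (chart F w) (quot_rep W (chart F w) p (mexp w *v z)) (quot_rep W (chart F w) p (mexp w *v z'))
        = h (XX p w *v a) (KK w *v (XX p w *v b))" unfolding a_def b_def
        unfolding D.quot_rep_chart[OF z(1)] D.quot_rep_chart[OF z(2)] cm XX_def by simp
      also have "\<dots> = h (adj (XX p w) *v (adj (KK w) *v (XX p w *v a))) b" by (simp only: h_adj')
      also have "\<dots> = h (NN p w *v a) b" by (simp add: NN_def matrix_vector_mul_assoc matrix_mul_assoc)
      finally show "hodge_metric W Q (chart F w) (quot_rep W (chart F w) p (mexp w *v z)) (quot_rep W (chart F w) p (mexp w *v z'))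
        = h (NN p w *v (UU p *v z)) (UU p *v z')" unfolding a_def b_def .
    qed
  qed
qed

lemma adj_adj [simp]: "adj (adj A) = A"
  by (rule adjI) (simp add: h_adj'[symmetric])

lemma quot_rep_base: assumes "z \<in> F p" shows "quot_rep W F p z = UU p *v z"
proof -
  interpret D: deformation W F Q 0 0 "mat 1"
    by unfold_locales (simp_all add: gC_zero supp_zero)
  have "chart F 0 = F" by (simp add: chart_def fun_eq_iff)
  then show ?thesis using D.quot_rep_chart[OF assms] by (simp add: D.gam_def)
qed

lemma cmp_cnj_zero: assumes "supp Wt X" shows "cmp {0} (cnj_mat (cmp {0} X)) = cmp {0} (cnj_mat X)"
proof -
  have "supp (Wt \<inter> - {0}) (cmp (- {0}) X)" by (rule supp_cmp'[OF assms])
  then have "cmp {0} (cnj_mat (cmp (- {0}) X)) = 0"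
    by (rule cmp_disjoint[OF supp_cnj]) (auto simp: cj_def zero_prod_def)
  then show ?thesis by (simp add: cmp_compl cnj_mat_diff cmp_diff)
qed

subsection \<open>Second-order expansion of the metric\<close>

context
  fixes u v :: "complex ^ 'n ^ 'n"
  assumes u: "u \<in> lie_q W Q F" and v: "v \<in> lie_q W Q F"
begin

abbreviation "pl \<equiv> comp_plus W Q F"
abbreviation "z0 \<equiv> comp_zero W Q F"
abbreviation "cu \<equiv> cnj_mat u"
abbreviation "cv \<equiv> cnj_mat v"
abbreviation "wl z t \<equiv> scale_mat z u + scale_mat t v"

lemma uv_gC: "u \<in> gC" "v \<in> gC" "cu \<in> gC" "cv \<in> gC" and uv_QF: "supp QF u" "supp QF v"
  using u v gC_cnj by (auto simp: lie_q_eq)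

lemma wl_lie_q: "wl z t \<in> lie_q W Q F"
  using uv_gC uv_QF by (auto simp: lie_q_eq intro: gC_add gC_scale supp_add supp_scale)

lemma pl_NW: assumes "X \<in> gC" shows "pl X = cmp NW X"
  unfolding comp_plus_eq[OF assms] by (rule supp_cmp_eq[OF gC_Wt[OF assms]]) auto

text \<open>Conjugation turns a < 0 into b < 0; once \<open>NW\<close> is removed, the remaining
  bidegrees have a < 0 again.\<close>

lemma cnj_rest: assumes "X \<in> gC" "supp QF X" shows "supp QF (cnj_mat X - cmp NW (cnj_mat X))"
proof -
  have "supp (cj QF \<inter> Wt) (cnj_mat X)" using supp_Int[OF supp_cnj[OF assms(2)] gC_Wt[OF gC_cnj[OF assms(1)]]] .
  then have "supp (cj QF \<inter> Wt \<inter> - NW) (cmp (- NW) (cnj_mat X))" by (rule supp_cmp')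
  then show ?thesis unfolding cmp_compl by (rule supp_mono) (auto simp: cj_def)
qed

lemma cmp_QF: "supp QF X \<Longrightarrow> cmp NW X = 0" "supp QF X \<Longrightarrow> cmp {0} X = 0"
  by (rule cmp_disjoint, assumption, force simp: zero_prod_def)+

text \<open>Replacing the \<open>NW\<close> part of the conjugate of b by the whole conjugate adds a
  product of two endomorphisms supported in a < 0, which has no component in \<open>NW\<close> or at
  (0, 0). The expression thus becomes a bracket.\<close>

lemma NW_bracket:
  assumes "a \<in> gC" "supp QF a" "b \<in> gC" "supp QF b" and R: "R = NW \<or> R = {0}"
  shows "cmp R (cmp NW (cnj_mat b) ** a) - cmp R (a ** cnj_mat b) = cmp R (commutator (cnj_mat b) a)"
proof -
  have "supp QF ((cnj_mat b - cmp NW (cnj_mat b)) ** a)"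
    by (rule supp_mult[OF cnj_rest[OF assms(3,4)] assms(2)]) auto
  then have "cmp R ((cnj_mat b - cmp NW (cnj_mat b)) ** a) = 0" using cmp_QF R by blast
  then show ?thesis by (simp add: commutator_def matrix_diff_rdistrib cmp_diff)
qed

text \<open>The first factor is holomorphic and the second antiholomorphic, so the mixed second
  derivatives are products of first derivatives.\<close>

lemma wjet_gg: "wjet (\<lambda>z t. gg (wl z t)) (mat 1) (- u) cu (- v) cv (- (u ** cv)) (- (v ** cu))"
proof -
  have "(\<lambda>z t. mexp (- (scale_mat z (- u) + scale_mat t (- v)))) = (\<lambda>z t. mexp (wl z t))"
    by (simp add: scale_mat_minus add.commute)
  then have "wjet (\<lambda>z t. mexp (wl z t)) (mat 1) u 0 v 0 0 0" using wjet_mexp[of "- u" "- v"] by simp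
  from wjet_antilinear[OF bounded_linear_cnj_mat cnj_mat_scale this]
  have 2: "wjet (\<lambda>z t. mexp (cnj_mat (wl z t))) (mat 1) 0 cu 0 cv 0 0" by (simp add: cnj_mat_mexp)
  show ?thesis using wjet_mult[OF wjet_mexp[of u v] 2] by (simp add: matrix_minus_left)
qed

text \<open>Implicit differentiation of the linear equation for y. The raw mixed coefficients
  contain one projected and one unprojected product; \<open>NW_bracket\<close> combines them into
  the component of a commutator.\<close>

lemma wjet_yy:
  "wjet (\<lambda>z t. yy (wl z t)) 0 0 (- pl cu) 0 (- pl cv) (- pl (commutator cv u)) (- pl (commutator cu v))"
proof -
  obtain \<epsilon> where \<epsilon>: "\<epsilon> > 0" "\<And>w. w \<in> lie_q W Q F \<Longrightarrow> norm w < \<epsilon> \<Longrightarrow> \<forall>Y. norm (BN (gg w - mat 1) Y) \<le> norm Y / 2"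
    using chart_near by blast
  obtain C where C: "C > 0" "\<And>z (A :: complex^'n^'n). norm (scale_mat z A) \<le> norm z * norm A * C"
  proof -
    have "bounded_bilinear (scale_mat :: complex \<Rightarrow> complex^'n^'n \<Rightarrow> _)"
      unfolding bilinear_conv_bounded_bilinear[symmetric] bilinear_def
      by (auto intro!: linearI simp: scale_mat_add_left scale_mat_add scale_mat_scaleR scale_mat_of_real[symmetric] scale_mat_scale scaleR_conv_of_real mult.commute)
    then show ?thesis using bounded_bilinear.pos_bounded that by blast
  qed
  \<comment> \<open>Small enough that z and t of modulus below \<delta> keep w in the ball of radius
    \<epsilon>; the summand 1 keeps the denominator positive for u = v = 0.\<close>
  define \<delta> where "\<delta> = \<epsilon> / (2 * C * (norm u + norm v + 1))"
  have p: "2 * C * (norm u + norm v + 1) > 0" using C(1) by (simp add: add_nonneg_pos)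
  have \<delta>: "\<delta> > 0" using \<epsilon>(1) p by (simp add: \<delta>_def)
  have near: "norm (wl z t) < \<epsilon>" if "norm z < \<delta>" "norm t < \<delta>" for z t
  proof -
    have "norm (wl z t) \<le> norm (scale_mat z u) + norm (scale_mat t v)" by (rule norm_triangle_ineq)
    also have "\<dots> \<le> norm z * norm u * C + norm t * norm v * C" using C(2)[of z u] C(2)[of t v] by linarith
    also have "\<dots> \<le> \<delta> * norm u * C + \<delta> * norm v * C" using that C(1) by (intro add_mono mult_right_mono) auto
    also have "\<dots> < \<delta> * (2 * C * (norm u + norm v + 1))"
    proof -
      have "norm u * C + norm v * C < 2 * C * (norm u + norm v + 1)"
        using C(1) by (simp add: algebra_simps add_pos_nonneg add_nonneg_pos)
      then have "\<delta> * (norm u * C + norm v * C) < \<delta> * (2 * C * (norm u + norm v + 1))" using \<delta> by (rule mult_strict_left_mono)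
      then show ?thesis by (simp add: algebra_simps)
    qed
    also have "\<dots> = \<epsilon>" using p unfolding \<delta>_def by (metis less_irrefl nonzero_eq_divide_eq)
    finally show ?thesis .
  qed
  have small: "norm (BN (gg (wl z t) - mat 1) Y) \<le> norm Y / 2" if "norm z < \<delta>" "norm t < \<delta>" for z t Y
    using \<epsilon>(2)[OF wl_lie_q near[OF that]] by blast
  have eqn: "yy (wl z t) + BN (gg (wl z t) - mat 1) (yy (wl z t)) = - cmp NW (gg (wl z t))"
    if "norm z < \<delta>" "norm t < \<delta>" for z t
    by (rule yy_eq) (use small[OF that] in blast)
  have A: "wjet (\<lambda>z t. gg (wl z t) - mat 1) 0 (- u) cu (- v) cv (- (u ** cv)) (- (v ** cu))"
    using wjet_add[OF wjet_gg wjet_const[of "- mat 1"]] by simp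
  have "bounded_linear (\<lambda>X. - cmp NW X)" by (rule bounded_linear_minus[OF bounded_linear_cmp])
  from wjet_linear[OF this _ wjet_gg]
  have b: "wjet (\<lambda>z t. - cmp NW (gg (wl z t))) 0 0 (- pl cu) 0 (- pl cv) (cmp NW (u ** cv)) (cmp NW (v ** cu))"
    using uv_gC uv_QF by (simp add: cmp_scale scale_mat_minus cmp_minus cmp_QF pl_NW)
  have z: "BN X 0 = 0" for X by (simp add: BN_def cmp_zero)
  have "wjet (\<lambda>z t. yy (wl z t)) 0 0 (- pl cu) 0 (- pl cv)
     (cmp NW (u ** cv) - BN cv 0 - (BN (- u) (- pl cv) + BN (- (u ** cv)) 0))
     (cmp NW (v ** cu) - BN (- v) (- pl cu) - (BN cu 0 + BN (- (v ** cu)) 0))"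
    by (rule wjet_solve[OF BN_bilinear BN_scale_left BN_scale_right A b \<delta> small eqn]) (simp_all add: z)
  moreover have cc: "cmp NW (cmp NW X) = cmp NW X" for X by (simp add: cmp_cmp)
  have BNn: "BN (- a) (- pl (cnj_mat b)) = cmp NW (cmp NW (cnj_mat b) ** a)" if "b \<in> gC" for a b
    using gC_cnj[OF that] by (simp add: BN_def pl_NW cmp_minus cc matrix_minus_left matrix_minus_right)
  have "cmp NW (u ** cv) - BN cv 0 - (BN (- u) (- pl cv) + BN (- (u ** cv)) 0) = - pl (commutator cv u)"
    using NW_bracket[of u v NW] uv_gC uv_QF pl_NW[OF gC_commutator[OF uv_gC(4,1)]] BNn[OF uv_gC(2), of u]
    by (simp add: z algebra_simps)
  moreover have "cmp NW (v ** cu) - BN (- v) (- pl cu) - (BN cu 0 + BN (- (v ** cu)) 0) = - pl (commutator cu v)"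
    using NW_bracket[of v u NW] uv_gC uv_QF pl_NW[OF gC_commutator[OF uv_gC(3,2)]] BNn[OF uv_gC(1), of v]
    by (simp add: z algebra_simps)
  ultimately show ?thesis by simp
qed

text \<open>Neither u nor its conjugate has a (0, 0) component, so the first order vanishes. In the
  mixed term the first order of y times that of \<open>gg\<close> joins the second order of
  \<open>gg\<close> to form the bracket.\<close>

lemma wjet_kk: "wjet (\<lambda>z t. kk (wl z t)) (mat 1) 0 0 0 0 (z0 (commutator cv u)) (z0 (commutator cu v))"
proof -
  have 1: "wjet (\<lambda>z t. mat 1 + yy (wl z t)) (mat 1) 0 (- pl cu) 0 (- pl cv) (- pl (commutator cv u)) (- pl (commutator cu v))"
    using wjet_add[OF wjet_const[of "mat 1"] wjet_yy] by simp
  have p0: "cmp {0} (pl X) = 0" if "X \<in> gC" for X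
    using cmp_disjoint[OF supp_cmp, of NW "{0}" X] by (simp add: pl_NW[OF that] zero_prod_def)
  have c0: "cmp {0} (cnj_mat X) = 0" if "X \<in> gC" "supp QF X" for X
    using cmp_QF(2)[OF cnj_rest[OF that]] p0[OF gC_cnj[OF that(1)]] by (simp add: cmp_diff pl_NW[OF gC_cnj[OF that(1)]])
  have e: "cmp {0} (pl (cnj_mat b) ** a) - cmp {0} (a ** cnj_mat b) = z0 (commutator (cnj_mat b) a)"
    if "a \<in> gC" "supp QF a" "b \<in> gC" "supp QF b" for a b
    using NW_bracket[OF that, of "{0}"] by (simp add: comp_zero_eq[OF gC_commutator[OF gC_cnj[OF that(3)] that(1)]] pl_NW[OF gC_cnj[OF that(3)]])
  from wjet_linear[OF bounded_linear_cmp cmp_scale wjet_mult[OF 1 wjet_gg], of "{0}"]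
  show ?thesis
    using e[OF uv_gC(1) uv_QF(1) uv_gC(2) uv_QF(2)] e[OF uv_gC(2) uv_QF(2) uv_gC(1) uv_QF(1)] uv_gC uv_QF
    by (simp add: kk_def cmp_add cmp_minus cmp_diff cmp_QF p0 c0 gC_commutator matrix_minus_left matrix_minus_right algebra_simps)
qed

lemma z0_cnj: assumes "X \<in> gC" shows "adj (z0 X) = - z0 (cnj_mat X)"
  using adj_gC_zero[OF gC_cmp[OF assms] supp_cmp]
  by (simp add: comp_zero_eq assms gC_cnj cmp_cnj_zero[OF gC_Wt[OF assms]])

text \<open>Adjoint and conjugation are both antilinear, so their composite is complex linear and no
  coefficients are exchanged. On the (0, 0) part of the Lie algebra it is -1 by
  \<open>adj_gC_zero\<close>.\<close>

lemma wjet_adj_KK: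
  "wjet (\<lambda>z t. adj (KK (wl z t))) (mat 1) 0 0 0 0 (- z0 (commutator cv u)) (- z0 (commutator cu v))"
proof -
  have bl: "bounded_linear (\<lambda>X. adj (cmp {0} (cnj_mat X)))"
    by (intro bounded_linear_compose[OF bounded_linear_adj] bounded_linear_compose[OF bounded_linear_cmp] bounded_linear_cnj_mat)
  have e: "adj (cmp {0} (cnj_mat (z0 X))) = - z0 X" if "X \<in> gC" for X
  proof -
    have "adj (z0 X) = - cmp {0} (cnj_mat (z0 X))"
      using adj_gC_zero[OF gC_cmp[OF that] supp_cmp] by (simp add: comp_zero_eq that)
    then have "cmp {0} (cnj_mat (z0 X)) = - adj (z0 X)" by simp
    then show ?thesis by (simp add: adj_minus)
  qed
  from wjet_linear[OF bl _ wjet_kk]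
  show ?thesis using uv_gC
    by (simp add: KK_def cnj_mat_scale cmp_scale adj_scale e gC_commutator cmp_zero)
qed

text \<open>Product rule for the three factors. The adjoint exchanges the two mixed coefficients of
  \<open>XX\<close>, which is why the bracket of cnj u and v appears under
  \<open>adj\<close>.\<close>

lemma wjet_NN:
  fixes p :: int
  defines "a \<equiv> UU p ** pl cu ** UU p" and "b \<equiv> UU p ** pl cv ** UU p"
  shows "\<exists>Nu' Nv Nm'. wjet (\<lambda>z t. NN p (wl z t)) (mat 1) (- adj a) Nu' Nv (- b)
     (adj a ** b - UU p ** pl (commutator cv u) ** UU p - z0 (commutator cv u) - adj (UU p ** pl (commutator cu v) ** UU p)) Nm'"
proof -
  have bl: "bounded_linear (\<lambda>X. UU p ** X ** UU p)"
    by (rule bounded_linear_compose[OF bounded_linear_matrix_left bounded_linear_matrix_right])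
  have X: "wjet (\<lambda>z t. XX p (wl z t)) (mat 1) 0 (- a) 0 (- b) (- (UU p ** pl (commutator cv u) ** UU p)) (- (UU p ** pl (commutator cu v) ** UU p))"
    unfolding XX_def using wjet_add[OF wjet_const[of "mat 1"] wjet_linear[OF bl _ wjet_yy]]
    by (simp add: a_def b_def scale_mat_mult_left scale_mat_mult_right matrix_minus_left matrix_minus_right)
  from wjet_antilinear[OF bounded_linear_adj adj_scale X]
  have aX: "wjet (\<lambda>z t. adj (XX p (wl z t))) (mat 1) (- adj a) 0 (- adj b) 0
      (- adj (UU p ** pl (commutator cu v) ** UU p)) (- adj (UU p ** pl (commutator cv u) ** UU p))"
    by (simp add: adj_minus)
  from wjet_mult[OF aX wjet_mult[OF wjet_adj_KK X]]
  show ?thesis unfolding NN_def[abs_def]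
    by (simp add: matrix_minus_left matrix_minus_right algebra_simps) blast
qed

end

section \<open>Endomorphisms commuting with the projection to U^p\<close>

lemma UU_adj [simp]: "adj (UU p) = UU p"
  by (rule adj_PP)

lemma UU_idem [simp]: "UU p ** UU p = UU p"
  by (simp add: PP_mult)

lemma UU_idem_vec [simp]: "UU p *v (UU p *v x) = UU p *v x"
  by (simp add: matrix_vector_mul_assoc)

lemma UU_zero_commute: "supp {0} A \<Longrightarrow> UU p ** A = A ** UU p"
  by (simp add: PP_def matrix_sum_left matrix_sum_right Pm_zero_commute)

lemma UU_XX: "UU p ** XX p w = XX p w ** UU p"
proof -
  have "UU p ** (UU p ** yy w ** UU p) = (UU p ** UU p) ** yy w ** UU p"
    "(UU p ** yy w ** UU p) ** UU p = UU p ** yy w ** (UU p ** UU p)"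
    by (simp_all only: matrix_mul_assoc)
  then show ?thesis by (simp add: XX_def matrix_add_ldistrib matrix_add_rdistrib)
qed

lemma UU_adj_commute: "UU p ** A = A ** UU p \<Longrightarrow> UU p ** adj A = adj A ** UU p"
  using adj_mult[of A "UU p"] adj_mult[of "UU p" A] by simp

lemma UU_NN: "UU p ** NN p w = NN p w ** UU p"
proof -
  have "UU p ** KK w = KK w ** UU p" unfolding KK_def by (rule UU_zero_commute[OF supp_cmp])
  note K = UU_adj_commute[OF this]
  have "UU p ** NN p w = (UU p ** adj (XX p w)) ** adj (KK w) ** XX p w" by (simp only: NN_def matrix_mul_assoc)
  also have "\<dots> = adj (XX p w) ** (UU p ** adj (KK w)) ** XX p w"
    unfolding UU_adj_commute[OF UU_XX] by (simp only: matrix_mul_assoc)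
  also have "\<dots> = adj (XX p w) ** adj (KK w) ** (UU p ** XX p w)" unfolding K by (simp only: matrix_mul_assoc)
  also have "\<dots> = NN p w ** UU p" unfolding UU_XX by (simp only: NN_def matrix_mul_assoc)
  finally show ?thesis .
qed

end

subsection \<open>Local frames and the curvature\<close>

text \<open>Uniqueness by associativity from the left inverse; the value 0 outside the block matches
  the convention of \<open>inv_mat\<close>.\<close>

lemma inv_mat_eq:
  assumes AB: "\<And>i j. i < r \<Longrightarrow> j < r \<Longrightarrow> (\<Sum>k<r. A i k * B k j) = (if i = j then 1 else 0)"
    and BA: "\<And>i j. i < r \<Longrightarrow> j < r \<Longrightarrow> (\<Sum>k<r. B i k * A k j) = (if i = j then 1 else 0)"
    and B: "\<And>i j. i \<ge> r \<or> j \<ge> r \<Longrightarrow> B i j = 0"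
  shows "inv_mat r A = B"
  unfolding inv_mat_def
proof (rule the_equality)
  show "(\<forall>i j. r \<le> i \<or> r \<le> j \<longrightarrow> B i j = 0) \<and> (\<forall>i<r. \<forall>j<r. (\<Sum>k<r. A i k * B k j) = (if i = j then 1 else 0))"
    using AB B by blast
  fix C assume C: "(\<forall>i j. r \<le> i \<or> r \<le> j \<longrightarrow> C i j = 0) \<and> (\<forall>i<r. \<forall>j<r. (\<Sum>k<r. A i k * C k j) = (if i = j then 1 else 0))"
  show "C = B"
  proof (intro ext)
    fix i j
    show "C i j = B i j"
    proof (cases "i < r \<and> j < r")
      case True
      have "C i j = (\<Sum>k<r. if i = k then C k j else 0)" using True by simp
      also have "\<dots> = (\<Sum>k<r. (\<Sum>l<r. B i l * A l k) * C k j)" by (rule sum.cong) (use BA True in auto)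
      also have "\<dots> = (\<Sum>k<r. \<Sum>l<r. B i l * (A l k * C k j))" by (simp add: sum_distrib_right mult.assoc)
      also have "\<dots> = (\<Sum>l<r. \<Sum>k<r. B i l * (A l k * C k j))" by (rule sum.swap)
      also have "\<dots> = (\<Sum>l<r. B i l * (\<Sum>k<r. A l k * C k j))" by (simp add: sum_distrib_left)
      also have "\<dots> = (\<Sum>l<r. B i l * (if l = j then 1 else 0))" by (rule sum.cong) (use C True in auto)
      also have "\<dots> = B i j" using True by (simp add: if_distrib[of "\<lambda>x. B i _ * x"] cong: if_cong)
      finally show ?thesis .
    next
      case False
      then show ?thesis using C B[of i j] by (auto simp: not_less)
    qed
  qed
qed

lemma span_family:
  fixes b :: "nat \<Rightarrow> complex ^ 'n"
  assumes "x \<in> vec.span ((\<lambda>j. b j) ` {..<r})" shows "\<exists>c. x = (\<Sum>j<r. c j *s (b j :: complex ^ 'n))"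
proof -
  have "vec.span ((\<lambda>j. b j) ` {..<r}) \<subseteq> {x. \<exists>c. x = (\<Sum>j<r. c j *s b j)}"
  proof (rule vec.span_minimal)
    show "vec.subspace {x. \<exists>c. x = (\<Sum>j<r. c j *s b j)}"
    proof (rule vec.subspaceI)
      show "0 \<in> {x. \<exists>c. x = (\<Sum>j<r. c j *s b j)}" by (auto intro: exI[of _ "\<lambda>_. 0"])
      fix x y assume "x \<in> {x. \<exists>c. x = (\<Sum>j<r. c j *s b j)}" "y \<in> {x. \<exists>c. x = (\<Sum>j<r. c j *s b j)}"
      then obtain c d where "x = (\<Sum>j<r. c j *s b j)" "y = (\<Sum>j<r. d j *s b j)" by blast
      then show "x + y \<in> {x. \<exists>c. x = (\<Sum>j<r. c j *s b j)}"
        by (auto intro!: exI[of _ "\<lambda>j. c j + d j"] simp: vec.scale_left_distrib sum.distrib)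
    next
      fix k x assume "x \<in> {x. \<exists>c. x = (\<Sum>j<r. c j *s b j)}"
      then obtain c where "x = (\<Sum>j<r. c j *s b j)" by blast
      then show "k *s x \<in> {x. \<exists>c. x = (\<Sum>j<r. c j *s b j)}"
        by (auto intro!: exI[of _ "\<lambda>j. k * c j"] simp: vec.scale_sum_right)
    qed
    show "(\<lambda>j. b j) ` {..<r} \<subseteq> {x. \<exists>c. x = (\<Sum>j<r. c j *s b j)}"
    proof clarify
      fix i assume "i < r"
      then have "b i = (\<Sum>j<r. if j = i then b j else 0)" by simp
      also have "\<dots> = (\<Sum>j<r. (if j = i then 1 else 0) *s b j)" by (rule sum.cong) auto
      finally have "b i = (\<Sum>j<r. (if j = i then 1 else 0) *s b j)" .
      then show "\<exists>c. b i = (\<Sum>j<r. c j *s b j)" by (intro exI[of _ "\<lambda>j. if j = i then 1 else 0"])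
    qed
  qed
  then show ?thesis using assms by blast
qed

text \<open>The rank one endomorphism that multiplies a by the bilinear pairing of b and x. It
  packages a frame change as one matrix depending linearly on the sections.\<close>

definition outer :: "complex ^ 'n \<Rightarrow> complex ^ 'n \<Rightarrow> complex ^ 'n ^ 'n" where
  "outer b a = (\<chi> k l. a $ k * b $ l)"

lemma outer_linear: "bounded_linear (outer b)" and outer_scale: "outer b (c *s a) = scale_mat c (outer b a)"
proof -
  show "outer b (c *s a) = scale_mat c (outer b a)" for c a
    by (simp add: outer_def scale_mat_def vec_eq_iff)
  show "bounded_linear (outer b)" unfolding linear_conv_bounded_linear[symmetric]
    by (rule linearI) (simp_all add: outer_def vec_eq_iff algebra_simps)
qed

lemma outer_mult: "outer b a *v x = (\<Sum>l\<in>UNIV. x $ l * b $ l) *s a"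
  by (simp add: outer_def matrix_vector_mult_def vec_eq_iff sum_distrib_left sum_distrib_right mult_ac)

lemma mexp_holomorphic: "((\<lambda>w. mexp w *v b) has_derivative (\<lambda>k. dexp w k *v b)) (at w within A)"
  by (rule bounded_linear.has_derivative[OF bounded_bilinear.bounded_linear_left[OF bounded_bilinear_matrix_vector_mult]
        has_derivative_at_withinI[OF mexp_has_derivative]])

context polarized
begin

text \<open>The coordinates in b of the projection to U^p are linear forms, so h represents them by
  vectors d. Pairing with d reads off matrix entries of endomorphisms of U^p.\<close>

lemma dual_frame:
  fixes b :: "nat \<Rightarrow> complex ^ 'n"
  assumes indep: "\<And>c. (\<Sum>j<r. c j *s b j) = 0 \<Longrightarrow> \<forall>j<r. c j = 0"
    and span: "\<And>x. \<exists>c. UU p *v x = (\<Sum>j<r. c j *s b j)" and bU: "\<And>j. j < r \<Longrightarrow> UU p *v b j = b j"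
  shows "\<exists>d. (\<forall>i<r. \<forall>j<r. h (b i) (d j) = (if i = j then 1 else 0)) \<and> (\<forall>x. UU p *v x = (\<Sum>j<r. h x (d j) *s b j))"
proof -
  define \<kappa> where "\<kappa> x = (SOME c. UU p *v x = (\<Sum>j<r. c j *s b j))" for x
  have \<kappa>: "UU p *v x = (\<Sum>j<r. \<kappa> x j *s b j)" for x unfolding \<kappa>_def by (rule someI_ex[OF span])
  have uniq: "c j = d j" if "(\<Sum>j<r. c j *s b j) = (\<Sum>j<r. d j *s b j)" "j < r" for c d j
    using indep[of "\<lambda>j. c j - d j"] that by (simp add: vec.scale_left_diff_distrib sum_subtractf)
  have "\<exists>d. \<forall>x. \<kappa> x j = h x d" if j: "j < r" for j
  proof (rule h_Riesz)
    show "\<kappa> (x + y) j = \<kappa> x j + \<kappa> y j" for x y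
    proof (rule uniq[OF _ j])
      show "(\<Sum>j<r. \<kappa> (x + y) j *s b j) = (\<Sum>j<r. (\<kappa> x j + \<kappa> y j) *s b j)"
        by (simp add: \<kappa>[symmetric] vec.scale_left_distrib sum.distrib matrix_vector_right_distrib)
    qed
    show "\<kappa> (c *s x) j = c * \<kappa> x j" for c x
    proof (rule uniq[OF _ j])
      have "(\<Sum>j<r. (c * \<kappa> x j) *s b j) = c *s (\<Sum>j<r. \<kappa> x j *s b j)" by (simp add: vec.scale_sum_right)
      then show "(\<Sum>j<r. \<kappa> (c *s x) j *s b j) = (\<Sum>j<r. (c * \<kappa> x j) *s b j)"
        by (simp add: \<kappa>[symmetric] matrix_vector_scale)
    qed
  qed
  then obtain d where d: "\<And>j x. j < r \<Longrightarrow> \<kappa> x j = h x (d j)" by metis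
  show ?thesis
  proof (intro exI[of _ d] conjI allI impI)
    show "UU p *v x = (\<Sum>j<r. h x (d j) *s b j)" for x unfolding \<kappa> using d by simp
    fix i j assume ij: "i < r" "j < r"
    have "(\<Sum>k<r. \<kappa> (b i) k *s b k) = b i" unfolding \<kappa>[symmetric] by (rule bU[OF ij(1)])
    also have "\<dots> = (\<Sum>k<r. if i = k then b k else 0)" using ij by simp
    also have "\<dots> = (\<Sum>k<r. (if i = k then 1 else 0) *s b k)" by (rule sum.cong) auto
    finally have "(\<Sum>k<r. \<kappa> (b i) k *s b k) = (\<Sum>k<r. (if i = k then 1 else 0) *s b k)" .
    then show "h (b i) (d j) = (if i = j then 1 else 0)" using uniq[of "\<kappa> (b i)" "\<lambda>k. if i = k then 1 else 0" j] d[OF ij(2), of "b i"] ij(2) by simp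
  qed
qed

lemma F_split:
  assumes "x \<in> F p" shows "UU p *v x = 0 \<longleftrightarrow> x \<in> F (p + 1)" and "UU p *v x \<in> F p"
proof -
  have x: "x \<in> VV {(a :: int, b :: int). a \<ge> p}" using assms F_VV by blast
  have "UU p *v x \<in> VV {(a :: int, b :: int). a \<ge> p}" using PP_VV VV_mono[of "{(a :: int, b :: int). a = p}" "{(a :: int, b :: int). a \<ge> p}"] by blast
  then show "UU p *v x \<in> F p" using F_VV by blast
  have i: "Pm i *v x = Pm i *v (UU p *v x)" if "fst i = p" for i
    using that by (simp add: matrix_vector_mul_assoc Pm_PP case_prod_beta)
  show "UU p *v x = 0 \<longleftrightarrow> x \<in> F (p + 1)"
  proof
    assume z: "UU p *v x = 0"
    have "x \<in> VV {(a :: int, b :: int). a \<ge> p + 1}" unfolding VV_iff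
    proof (intro allI impI)
      fix l assume "l \<notin> {(a :: int, b :: int). a \<ge> p + 1}"
      then have "fst l = p \<or> fst l < p" by (auto simp: case_prod_beta)
      then show "Pm l *v x = 0" using x i[of l] z unfolding VV_iff by (auto simp: case_prod_beta)
    qed
    then show "x \<in> F (p + 1)" using F_VV by blast
  next
    assume "x \<in> F (p + 1)"
    then have "x \<in> VV {(a :: int, b :: int). a \<ge> p + 1}" using F_VV by blast
    then have "Pm i *v x = 0" if "i \<in> {(a :: int, b :: int). a = p}" for i using that unfolding VV_iff by (auto simp: case_prod_beta)
    then show "UU p *v x = 0" by (simp add: PP_def matrix_vector_sum_left)
  qed
qed

lemma chart_0: "chart F 0 = F"
  by (simp add: chart_def fun_eq_iff)

lemma zero_lie_q: "0 \<in> lie_q W Q F"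
  by (simp add: lie_q_eq gC_zero supp_zero)

text \<open>Without some frame the condition defining \<open>hodge_curvature\<close> would hold
  vacuously for every value. The one used is the holomorphic transport of a basis of U^p by
  \<open>mexp w\<close>.\<close>

lemma standard_frame:
  assumes F: "F \<in> classifying_space W Q hn"
  shows "\<exists>r s. local_frame W Q hn F p r s \<and> (\<forall>x\<in>hodge_U W F p. \<exists>c. x = (\<Sum>j<r. c j *s quot_rep W F p (s j 0)))"
proof -
  let ?U = "VV {(a, b). a = p} :: (complex^'n) set"
  obtain B where B: "B \<subseteq> ?U" "vec.independent B" "?U \<subseteq> vec.span B" "card B = vec.dim ?U"
    using vec.basis_exists[of ?U] by blast
  have finB: "finite B" using B(2) by (rule vec.finiteI_independent)
  define r where "r = card B"
  obtain b where b: "bij_betw b {..<r} B"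
    using ex_bij_betw_nat_finite[OF finB] by (auto simp: r_def atLeast0LessThan)
  have bB: "b ` {..<r} = B" and inj: "inj_on b {..<r}" using b by (auto simp: bij_betw_def)
  have UF: "?U \<subseteq> F p" by (subst F_VV) (rule VV_mono, auto)
  have bU: "b j \<in> ?U" if "j < r" for j using that bB B(1) by blast
  have indep: "\<forall>j<r. c j = 0" if "(\<Sum>j<r. c j *s b j) = 0" for c
  proof -
    have "(\<Sum>v\<in>B. c (the_inv_into {..<r} b v) *s v) = (\<Sum>j<r. c j *s b j)"
      unfolding bB[symmetric] sum.reindex[OF inj] by (rule sum.cong) (auto simp: the_inv_into_f_f[OF inj])
    then have z: "(\<Sum>v\<in>B. c (the_inv_into {..<r} b v) *s v) = 0" using that by simp
    have "c (the_inv_into {..<r} b v) = 0" if "v \<in> B" for v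
      by (rule vec.independentD[OF B(2) finB subset_refl z that])
    then show ?thesis using bB the_inv_into_f_f[OF inj] by (metis imageI lessThan_iff)
  qed
  define s where "s j w = mexp w *v b j" for j and w :: "complex^'n^'n"
  obtain \<epsilon> where \<epsilon>: "\<epsilon> > 0" "\<And>w hn. w \<in> lie_q W Q F \<Longrightarrow> norm w < \<epsilon> \<Longrightarrow> F \<in> classifying_space W Q hn \<Longrightarrow> chart F w \<in> classifying_space W Q hn"
    using chart_near by blast
  have Fp: "F p = vec.span (b ` {..<r}) + F (p + 1)"
  proof
    show "vec.span (b ` {..<r}) + F (p + 1) \<subseteq> F p"
    proof -
      have "vec.span (b ` {..<r}) \<subseteq> F p" using bB B(1) UF by (intro vec.span_minimal F_subspace) auto
      moreover have "F (p + 1) \<subseteq> F p" by (rule F_anti) simp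
      ultimately show ?thesis using vsub(1)[OF F_subspace[of p]] by (auto elim!: set_plus_elim)
    qed
    show "F p \<subseteq> vec.span (b ` {..<r}) + F (p + 1)"
    proof
      fix x assume x: "x \<in> F p"
      have "UU p *v x \<in> vec.span (b ` {..<r})" using PP_VV B(3) bB by auto
      moreover have "x - UU p *v x \<in> F p" using x F_split(2)[OF x] vsub(2)[OF F_subspace] by blast
      then have "x - UU p *v x \<in> F (p + 1)" using F_split(1)[of "x - UU p *v x" p] by (simp add: matrix_vector_mult_diff_distrib UU_idem_vec)
      ultimately show "x \<in> vec.span (b ` {..<r}) + F (p + 1)" by (rule set_plusI) simp
    qed
  qed
  have frame: "local_frame W Q hn F p r s" unfolding local_frame_def
  proof (intro exI[of _ "ball 0 \<epsilon>"] conjI allI ballI impI)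
    show "holomorphic_in (lie_q W Q F) (ball 0 \<epsilon> \<inter> lie_q W Q F) (s j)" for j
      unfolding holomorphic_in_def s_def
    proof
      fix w
      show "\<exists>f'. ((\<lambda>w. mexp w *v b j) has_derivative f') (at w within ball 0 \<epsilon> \<inter> lie_q W Q F) \<and> (\<forall>x\<in>lie_q W Q F. f' (scale_mat \<i> x) = \<i> *s f' x)"
        using mexp_holomorphic[of "b j" w] by (intro exI[of _ "\<lambda>k. dexp w k *v b j"]) (auto simp: dexp_scale scale_mat_mult_vec)
    qed
    fix w assume w: "w \<in> ball 0 \<epsilon> \<inter> lie_q W Q F"
    show "chart F w \<in> classifying_space W Q hn" using \<epsilon>(2)[of w hn] w F by simp
    show "s j w \<in> chart F w p" if "j < r" for j using bU[OF that] UF by (auto simp: s_def chart_def)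
    show "c j = 0" if c: "(\<Sum>j<r. c j *s s j w) \<in> chart F w (p + 1)" "j < r" for c j
    proof -
      have "(\<Sum>j<r. c j *s s j w) = mexp w *v (\<Sum>j<r. c j *s b j)"
        by (simp add: s_def matrix_vector_sum_right matrix_vector_scale)
      then obtain z where z: "z \<in> F (p + 1)" "mexp w *v (\<Sum>j<r. c j *s b j) = mexp w *v z"
        using c(1) by (auto simp: chart_def)
      have "mexp (- w) *v (mexp w *v (\<Sum>j<r. c j *s b j)) = mexp (- w) *v (mexp w *v z)" by (simp only: z(2))
      then have "(\<Sum>j<r. c j *s b j) = z" by (simp add: matrix_vector_mul_assoc mexp_inverse')
      then have S: "(\<Sum>j<r. c j *s b j) \<in> F (p + 1)" using z by simp
      then have "UU p *v (\<Sum>j<r. c j *s b j) = 0" using F_split(1) F_anti[of p "p + 1"] by auto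
      moreover have "(\<Sum>j<r. c j *s b j) \<in> ?U"
        by (intro vec.subspace_sum[OF VV_sub] vsub(5)[OF VV_sub] bU) auto
      ultimately have "(\<Sum>j<r. c j *s b j) = 0" by (simp add: PP_VV_id)
      then show ?thesis using indep c(2) by blast
    qed
    have "(\<lambda>j. s j w) ` {..<r} = (*v) (mexp w) ` b ` {..<r}" by (auto simp: s_def image_image)
    then show "chart F w p = vec.span ((\<lambda>j. s j w) ` {..<r}) + chart F w (p + 1)"
      by (simp only: chart_def matrix_image_span[symmetric] matrix_image_plus[symmetric]) (simp only: Fp)
  qed (use \<epsilon>(1) in auto)
  have q: "quot_rep W F p (s j 0) = b j" if "j < r" for j
    using quot_rep_base[of "b j" p] bU[OF that] UF by (auto simp: s_def PP_VV_id)
  have "\<exists>c. x = (\<Sum>j<r. c j *s quot_rep W F p (s j 0))" if "x \<in> hodge_U W F p" for x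
  proof -
    have "x \<in> vec.span ((\<lambda>j. b j) ` {..<r})" using that B(3) bB unfolding hodge_U_VV by auto
    then obtain c where "x = (\<Sum>j<r. c j *s b j)" using span_family by blast
    then show ?thesis using q by (intro exI[of _ c]) simp
  qed
  then show ?thesis using frame by blast
qed

section \<open>Curvature in an arbitrary holomorphic frame\<close>

context
  fixes u v :: "complex ^ 'n ^ 'n" and p :: int
  assumes u: "u \<in> lie_q W Q F" and v: "v \<in> lie_q W Q F"
begin

abbreviation (input) "wz z t \<equiv> scale_mat z u + scale_mat t v"

lemma wz_lie: "wz z t \<in> lie_q W Q F"
  by (rule wl_lie_q[OF u v])

text \<open>Modulo \<open>F\<^sup>p\<^sup>+\<^sup>1\<close>, every frame is \<open>mexp w ** C w\<close> applied to a constant frame, with \<open>C\<close> holomorphic.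
  Its Gram matrix comes from \<open>C\<^sup>* N C\<close>, and the holomorphic \<open>C\<close> drops out of \<open>N\<^sub>u\<^sub>v - N\<^sub>v N\<^sub>u\<close>.\<close>

lemma frame_curvature_eq:
  assumes frame: "local_frame W Q hn F p r s"
    and N: "wjet (\<lambda>z t. NN p (wz z t)) (mat 1) Nu Nu' Nv Nv' Nm Nm'"
    and x: "x \<in> hodge_U W F p" "x = (\<Sum>j<r. c j *s quot_rep W F p (s j 0))"
  shows "(\<Sum>i<r. (\<Sum>j<r. frame_curvature W Q F p r s u v i j * c j) *s quot_rep W F p (s i 0))
     = - (UU p *v ((Nm - Nv' ** Nu) *v x))"
proof -
  obtain N0 where FR: "open N0 \<and> 0 \<in> N0 \<and>
      (\<forall>j<r. holomorphic_in (lie_q W Q F) (N0 \<inter> lie_q W Q F) (s j)) \<and>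
      (\<forall>w\<in>N0 \<inter> lie_q W Q F. chart F w \<in> classifying_space W Q hn \<and> (\<forall>j<r. s j w \<in> chart F w p) \<and>
         (\<forall>c. (\<Sum>j<r. c j *s s j w) \<in> chart F w (p + 1) \<longrightarrow> (\<forall>j<r. c j = 0)) \<and>
         chart F w p = vec.span ((\<lambda>j. s j w) ` {..<r}) + chart F w (p + 1))"
    using frame unfolding local_frame_def by (rule exE)
  have N0: "open N0" "0 \<in> N0"
    "\<And>j. j < r \<Longrightarrow> holomorphic_in (lie_q W Q F) (N0 \<inter> lie_q W Q F) (s j)"
    "\<And>w j. w \<in> N0 \<inter> lie_q W Q F \<Longrightarrow> j < r \<Longrightarrow> s j w \<in> chart F w p"
    "\<And>w c. w \<in> N0 \<inter> lie_q W Q F \<Longrightarrow> (\<Sum>j<r. c j *s s j w) \<in> chart F w (p + 1) \<Longrightarrow> \<forall>j<r. c j = 0"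
    "\<And>w. w \<in> N0 \<inter> lie_q W Q F \<Longrightarrow> chart F w p = vec.span ((\<lambda>j. s j w) ` {..<r}) + chart F w (p + 1)"
    using FR by (blast, blast, blast, blast, blast, blast)
  have z0: "0 \<in> N0 \<inter> lie_q W Q F" using N0(2) zero_lie_q by blast
  have sF: "s j 0 \<in> F p" if "j < r" for j using N0(4)[OF z0 that] by (simp add: chart_0)
  define b where "b j = UU p *v s j 0" for j
  have bq: "quot_rep W F p (s j 0) = b j" if "j < r" for j using quot_rep_base[OF sF[OF that]] by (simp add: b_def)
  have bU: "UU p *v b j = b j" for j by (simp add: b_def)
  have indep: "\<forall>j<r. k j = 0" if "(\<Sum>j<r. k j *s b j) = 0" for k
  proof -
    have "UU p *v (\<Sum>j<r. k j *s s j 0) = 0"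
      using that by (simp add: b_def matrix_vector_sum_right matrix_vector_scale)
    moreover have "(\<Sum>j<r. k j *s s j 0) \<in> F p"
      by (intro vec.subspace_sum[OF F_subspace] vsub(5)[OF F_subspace] sF) auto
    ultimately have "(\<Sum>j<r. k j *s s j 0) \<in> F (p + 1)" using F_split(1) by blast
    then show ?thesis using N0(5)[OF z0] by (simp add: chart_0)
  qed
  have spanU: "\<exists>k. UU p *v y = (\<Sum>j<r. k j *s b j)" for y
  proof -
    have "UU p *v y \<in> VV {(a, b). a = p}" by (rule PP_VV)
    then have "UU p *v y \<in> F p" by (subst F_VV) (rule subsetD[OF VV_mono, rotated], auto)
    then have "UU p *v y \<in> vec.span ((\<lambda>j. s j 0) ` {..<r}) + F (p + 1)" using N0(6)[OF z0] by (simp add: chart_0)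
    then obtain a f where af: "a \<in> vec.span ((\<lambda>j. s j 0) ` {..<r})" "f \<in> F (p + 1)" "UU p *v y = a + f" by (rule set_plus_elim)
    obtain k where k: "a = (\<Sum>j<r. k j *s s j 0)" using span_family[OF af(1)] by blast
    have "UU p *v f = 0" using af(2) F_split(1) F_anti[of p "p + 1"] by auto
    then have "UU p *v y = UU p *v a" using arg_cong[OF af(3), of "\<lambda>x. UU p *v x"] by (simp add: matrix_vector_right_distrib)
    then show ?thesis using k by (intro exI[of _ k]) (simp add: b_def matrix_vector_sum_right matrix_vector_scale)
  qed
  obtain d where d: "\<And>i j. i < r \<Longrightarrow> j < r \<Longrightarrow> h (b i) (d j) = (if i = j then 1 else 0)"
    "\<And>x. UU p *v x = (\<Sum>j<r. h x (d j) *s b j)"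
    using dual_frame[where r = r and b = b and p = p, OF indep spanU bU] by blast
  \<comment> \<open>The frame brought back by e^-w and reduced modulo F^{p+1}, so that it takes
    values in the fixed space U^p.\<close>
  define cc where "cc j w = UU p *v (mexp (- w) *v s j w)" for j w
  define \<psi> where "\<psi> j = (\<chi> l. h (axis l 1) (d j))" for j
  \<comment> \<open>The frame change as an endomorphism: it sends b_j to \<open>cc j w\<close> and
    is the identity on the complement of U^p, hence commutes with the projection.\<close>
  define Cm where "Cm w = mat 1 - UU p + (\<Sum>j<r. outer (\<psi> j) (cc j w))" for w
  have out: "outer (\<psi> j) a *v x = h x (d j) *s a" for j a x
  proof -
    have "h x (d j) = h (\<Sum>l\<in>UNIV. x $ l *s axis l 1) (d j)" by (simp add: basis_expansion)
    also have "\<dots> = (\<Sum>l\<in>UNIV. x $ l * \<psi> j $ l)" by (simp add: h_sum_left h_scale_left \<psi>_def)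
    finally show ?thesis by (simp add: outer_mult)
  qed
  have Cm: "Cm w *v x = x - UU p *v x + (\<Sum>j<r. h x (d j) *s cc j w)" for w x
    by (simp add: Cm_def matrix_vector_mult_add_rdistrib matrix_vector_mult_diff_rdistrib matrix_vector_sum_left out)
  have Cb: "Cm w *v b i = cc i w" if "i < r" for w i
  proof -
    have "(\<Sum>j<r. h (b i) (d j) *s cc j w) = (\<Sum>j<r. if i = j then cc j w else 0)"
      by (rule sum.cong) (use d(1)[OF that] in auto)
    then show ?thesis using that by (simp add: Cm bU)
  qed
  have C0: "Cm 0 = mat 1"
  proof (rule matrix_eqI)
    fix x
    have "(\<Sum>j<r. h x (d j) *s cc j 0) = UU p *v x" unfolding d(2) by (simp add: cc_def b_def)
    then show "Cm 0 *v x = mat 1 *v x" by (simp add: Cm)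
  qed
  have CU: "UU p ** Cm w = Cm w ** UU p" for w
  proof (rule matrix_eqI)
    fix x
    have "h (UU p *v x) (d j) = h x (d j)" if "j < r" for j
    proof -
      have "h (UU p *v x) (d j) = (\<Sum>i<r. h x (d i) * h (b i) (d j))"
        unfolding d(2)[of x] by (simp add: h_sum_left h_scale_left)
      also have "\<dots> = (\<Sum>i<r. if i = j then h x (d i) else 0)" by (rule sum.cong) (use d(1) that in auto)
      finally show ?thesis using that by simp
    qed
    then have "(\<Sum>j<r. h (UU p *v x) (d j) *s cc j w) = (\<Sum>j<r. h x (d j) *s cc j w)" by simp
    moreover have "UU p *v (\<Sum>j<r. h x (d j) *s cc j w) = (\<Sum>j<r. h x (d j) *s cc j w)"
      by (simp add: matrix_vector_sum_right matrix_vector_scale cc_def)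
    ultimately show "(UU p ** Cm w) *v x = (Cm w ** UU p) *v x"
      by (simp add: matrix_vector_mul_assoc[symmetric] Cm matrix_vector_right_distrib matrix_vector_mult_diff_distrib)
  qed
  have "\<exists>Cu Cv. wjet (\<lambda>z t. Cm (wz z t)) (Cm (wz 0 0)) Cu 0 Cv 0 0 0"
  proof -
    \<comment> \<open>Holomorphy of the frame is given within the subspace \<open>lie_q\<close>
      only. Pulling back along this linear map yields derivatives on an open set of pairs of
      parameters, as \<open>wjet_holomorphic\<close> requires.\<close>
    define \<phi> where "\<phi> z = wz (fst z) (snd z)" for z :: "complex \<times> complex"
    have \<phi>lin: "linear \<phi>" unfolding \<phi>_def
      by (rule linearI) (simp_all add: scale_mat_add_left scaleR_conv_of_real[where 'a=complex] scale_mat_scale[symmetric] scale_mat_of_real scaleR_add_right)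
    then have \<phi>bl: "bounded_linear \<phi>" by (simp add: linear_conv_bounded_linear)
    have \<phi>c: "\<phi> (k * a, k * e) = scale_mat k (\<phi> (a, e))" for k a e by (simp add: \<phi>_def scale_mat_add scale_mat_scale)
    have \<phi>q: "\<phi> z \<in> lie_q W Q F" for z unfolding \<phi>_def by (rule wz_lie)
    have \<phi>d: "(\<phi> has_derivative \<phi>) (at z within A)" for z A by (rule bounded_linear_imp_has_derivative[OF \<phi>bl])
    have op: "open (\<phi> -` N0)"
      using N0(1) by (intro continuous_open_vimage) (auto intro: linear_continuous_at[OF \<phi>bl])
    have "0 \<in> \<phi> -` N0" using N0(2) by (simp add: \<phi>_def)
    then obtain e where e: "e > 0" "ball 0 e \<subseteq> \<phi> -` N0" using op open_contains_ball by blast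
    show ?thesis
    proof (rule wjet_holomorphic[OF e(1)])
      fix z :: "complex \<times> complex" assume z: "z \<in> ball 0 e"
      have zN: "\<phi> z \<in> N0 \<inter> lie_q W Q F" using z e(2) \<phi>q by blast
      have "\<exists>D. ((\<lambda>z. s j (\<phi> z)) has_derivative D) (at z) \<and> (\<forall>k a e. D (k * a, k * e) = k *s D (a, e))" if j: "j < r" for j
      proof -
        obtain f' where f': "(s j has_derivative f') (at (\<phi> z) within N0 \<inter> lie_q W Q F)"
          "\<And>x. x \<in> lie_q W Q F \<Longrightarrow> f' (scale_mat \<i> x) = \<i> *s f' x"
          using N0(3)[OF j] zN unfolding holomorphic_in_def by blast
        have img: "\<phi> ` (\<phi> -` N0) \<subseteq> N0 \<inter> lie_q W Q F" using \<phi>q by blast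
        have "((s j \<circ> \<phi>) has_derivative (f' \<circ> \<phi>)) (at z within \<phi> -` N0)"
          by (rule diff_chain_within[OF \<phi>d has_derivative_subset[OF f'(1) img]])
        then have D: "((\<lambda>z. s j (\<phi> z)) has_derivative (\<lambda>k. f' (\<phi> k))) (at z)"
          using at_within_open[OF _ op] zN by (simp add: o_def)
        have l: "linear f'" using f'(1) by (rule has_derivative_linear)
        have "f' (scale_mat k x) = k *s f' x" if "x \<in> lie_q W Q F" for k x
        proof -
          have "scale_mat k x = Re k *\<^sub>R x + Im k *\<^sub>R scale_mat \<i> x"
            by (simp add: scale_mat_of_real[symmetric] scale_mat_scale scale_mat_add_left[symmetric] complex_eq[symmetric] mult.commute)
          then have "f' (scale_mat k x) = Re k *\<^sub>R f' x + Im k *\<^sub>R (\<i> *s f' x)"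
            using f'(2)[OF that] by (simp add: linear_add[OF l] linear_scale[OF l])
          also have "\<dots> = k *s f' x"
            by (simp add: scaleR_eq_scale vec.scale_left_distrib[symmetric] complex_eq[symmetric] mult.commute)
          finally show ?thesis .
        qed
        then have "f' (\<phi> (k * a, k * e)) = k *s f' (\<phi> (a, e))" for k a e using \<phi>q by (simp add: \<phi>c)
        then show ?thesis using D by blast
      qed
      then obtain D where D: "\<And>j. j < r \<Longrightarrow> ((\<lambda>z. s j (\<phi> z)) has_derivative D j) (at z)"
        "\<And>j k a e. j < r \<Longrightarrow> D j (k * a, k * e) = k *s D j (a, e)" by metis
      have E: "((\<lambda>z. mexp (- \<phi> z)) has_derivative (\<lambda>k. dexp (- \<phi> z) (- \<phi> k))) (at z)"
        by (rule has_derivative_compose[OF has_derivative_minus[OF \<phi>d] mexp_has_derivative])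
      define T where "T j k = UU p *v (mexp (- \<phi> z) *v D j k + dexp (- \<phi> z) (- \<phi> k) *v s j (\<phi> z))" for j k
      have T: "((\<lambda>z. cc j (\<phi> z)) has_derivative T j) (at z)" if "j < r" for j
        unfolding cc_def T_def
        by (rule bounded_linear.has_derivative[OF bounded_bilinear.bounded_linear_right[OF bounded_bilinear_matrix_vector_mult]
              bounded_bilinear.FDERIV[OF bounded_bilinear_matrix_vector_mult E D(1)[OF that]]])
      have Tc: "T j (k * a, k * e) = k *s T j (a, e)" if "j < r" for j k a e
      proof -
        have m: "- scale_mat k A = scale_mat k (- A)" for A :: "complex^'n^'n" by (simp add: scale_mat_def vec_eq_iff)
        show ?thesis
          unfolding T_def D(2)[OF that] \<phi>c m dexp_scale scale_mat_mult_vec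
          by (simp add: matrix_vector_scale vec.scale_right_distrib matrix_vector_right_distrib)
      qed
      have "((\<lambda>z. Cm (\<phi> z)) has_derivative (\<lambda>k. 0 + (\<Sum>j<r. outer (\<psi> j) (T j k)))) (at z)"
        unfolding Cm_def
        by (intro has_derivative_add has_derivative_const has_derivative_sum bounded_linear.has_derivative[OF outer_linear] T) auto
      moreover have "0 + (\<Sum>j<r. outer (\<psi> j) (T j (k * a, k * e))) = scale_mat k (0 + (\<Sum>j<r. outer (\<psi> j) (T j (a, e))))" for k a e
        by (simp add: Tc outer_scale scale_mat_sum)
      ultimately show "\<exists>f'. ((\<lambda>z. Cm (wz (fst z) (snd z))) has_derivative f') (at z) \<and> (\<forall>c a b. f' (c * a, c * b) = scale_mat c (f' (a, b)))"
        unfolding \<phi>_def by blast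
    qed
  qed
  then obtain Cu Cv where C: "wjet (\<lambda>z t. Cm (wz z t)) (mat 1) Cu 0 Cv 0 0 0" by (auto simp: C0)
  define M where "M z t = adj (Cm (wz z t)) ** (NN p (wz z t) ** Cm (wz z t))" for z t
  have aC: "wjet (\<lambda>z t. adj (Cm (wz z t))) (mat 1) 0 (adj Cu) 0 (adj Cv) 0 0"
    using wjet_antilinear[OF bounded_linear_adj adj_scale C] by simp
  have Mj: "wjet M (mat 1) (Cu + Nu) (Nu' + adj Cu) (Cv + Nv) (Nv' + adj Cv)
     (Nv' ** Cu + Nm + adj Cv ** (Cu + Nu)) (Nu' ** Cv + Nm' + adj Cu ** (Cv + Nv))"
    unfolding M_def[abs_def] using wjet_mult[OF aC wjet_mult[OF N C]] by (simp add: algebra_simps)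
  \<comment> \<open>In the mixed derivative of M minus the product of its first derivatives, each
    term with \<open>Cu\<close> or \<open>adj Cv\<close> occurs once with either sign.\<close>
  have Y: "Nv' ** Cu + Nm + adj Cv ** (Cu + Nu) - (Nv' + adj Cv) ** (Cu + Nu) = Nm - Nv' ** Nu"
    by (simp add: matrix_add_ldistrib matrix_add_rdistrib)
  have MU: "UU p ** M z t = M z t ** UU p" for z t
  proof -
    have "UU p ** M z t = (UU p ** adj (Cm (wz z t))) ** NN p (wz z t) ** Cm (wz z t)" by (simp only: M_def matrix_mul_assoc)
    also have "\<dots> = adj (Cm (wz z t)) ** (UU p ** NN p (wz z t)) ** Cm (wz z t)"
      unfolding UU_adj_commute[OF CU] by (simp only: matrix_mul_assoc)
    also have "\<dots> = adj (Cm (wz z t)) ** NN p (wz z t) ** (UU p ** Cm (wz z t))" unfolding UU_NN by (simp only: matrix_mul_assoc)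
    also have "\<dots> = M z t ** UU p" unfolding CU by (simp only: M_def matrix_mul_assoc)
    finally show ?thesis .
  qed
  obtain \<epsilon> where \<epsilon>: "\<epsilon> > 0" "\<And>w z z'. w \<in> lie_q W Q F \<Longrightarrow> norm w < \<epsilon> \<Longrightarrow> z \<in> F p \<Longrightarrow> z' \<in> F p \<Longrightarrow>
        hodge_metric W Q (chart F w) (quot_rep W (chart F w) p (mexp w *v z)) (quot_rep W (chart F w) p (mexp w *v z'))
        = h (NN p w *v (UU p *v z)) (UU p *v z')"
    using chart_near by blast
  have "open (N0 \<inter> ball 0 \<epsilon>)" "0 \<in> N0 \<inter> ball 0 \<epsilon>" using N0(1,2) \<epsilon>(1) by auto
  then have ev: "\<forall>\<^sub>F w in nhds 0. w \<in> N0 \<inter> ball 0 \<epsilon>" by (rule eventually_nhds_in_open)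
  have "((\<lambda>zt. wz (fst zt) (snd zt)) \<longlongrightarrow> 0) (nhds (0, 0))"
  proof -
    have "linear (\<lambda>zt :: complex \<times> complex. wz (fst zt) (snd zt))"
      by (rule linearI) (simp_all add: scale_mat_add_left scaleR_conv_of_real[where 'a=complex] scale_mat_scale[symmetric] scale_mat_of_real scaleR_add_right)
    then have "bounded_linear (\<lambda>zt :: complex \<times> complex. wz (fst zt) (snd zt))" by (simp add: linear_conv_bounded_linear)
    from bounded_linear.tendsto[OF this, of "\<lambda>x. x" "(0, 0)" "nhds (0, 0)"] show ?thesis by (simp add: filterlim_ident)
  qed
  from eventually_compose_filterlim[OF ev this] obtain \<eta> where \<eta>0: "\<eta> > 0"
    "\<And>zt. dist zt (0, 0) < \<eta> \<Longrightarrow> wz (fst zt) (snd zt) \<in> N0 \<inter> ball 0 \<epsilon>"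
    unfolding eventually_nhds_metric by blast
  define \<delta> where "\<delta> = \<eta> / 2"
  have \<delta>: "\<delta> > 0" using \<eta>0(1) by (simp add: \<delta>_def)
  have near: "wz z t \<in> N0 \<inter> ball 0 \<epsilon>" if "norm z < \<delta>" "norm t < \<delta>" for z t
  proof -
    have "norm (z, t) \<le> norm z + norm t" by (rule norm_Pair_le)
    then have "dist (z, t) (0, 0) < \<eta>" using that by (simp add: dist_norm \<delta>_def)
    from \<eta>0(2)[OF this] show ?thesis by simp
  qed
  have gram: "frame_gram W Q F p s (wz z t) i j = h (M z t *v b j) (b i)"
    if zt: "norm z < \<delta>" "norm t < \<delta>" and ij: "i < r" "j < r" for z t i j
  proof -
    let ?w = "wz z t"
    have w: "?w \<in> N0 \<inter> lie_q W Q F" "norm ?w < \<epsilon>" using near[OF zt] wz_lie by auto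
    have S: "mexp (- ?w) *v s k ?w \<in> F p" "s k ?w = mexp ?w *v (mexp (- ?w) *v s k ?w)" if k: "k < r" for k
    proof -
      show "s k ?w = mexp ?w *v (mexp (- ?w) *v s k ?w)" by (simp only: matrix_vector_mul_assoc mexp_inverse matrix_vector_mul_lid)
      obtain f where "f \<in> F p" "s k ?w = mexp ?w *v f" using N0(4)[OF w(1) k] by (auto simp: chart_def)
      then show "mexp (- ?w) *v s k ?w \<in> F p" by (simp only: matrix_vector_mul_assoc mexp_inverse' matrix_vector_mul_lid)
    qed
    have "frame_gram W Q F p s ?w i j = h (NN p ?w *v cc j ?w) (cc i ?w)"
      unfolding frame_gram_def cc_def
      by (subst S(2)[OF ij(2)], subst S(2)[OF ij(1)], rule \<epsilon>(2)[OF wz_lie w(2) S(1)[OF ij(2)] S(1)[OF ij(1)]])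
    also have "\<dots> = h (M z t *v b j) (b i)"
      unfolding Cb[OF ij(1), symmetric] Cb[OF ij(2), symmetric] M_def h_adj'
      by (simp only: matrix_vector_mul_assoc)
    finally show ?thesis .
  qed
  \<comment> \<open>Counterpart of the expansion in b: the values of h against the b_k are the
    coordinates in the projected dual vectors.\<close>
  have sumd: "(\<Sum>k<r. h y (b k) *s (UU p *v d k)) = UU p *v y" for y
  proof -
    have "h x ((\<Sum>k<r. h y (b k) *s (UU p *v d k)) - UU p *v y) = 0" for x
    proof -
      have "h x (\<Sum>k<r. h y (b k) *s (UU p *v d k)) = (\<Sum>k<r. cnj (h y (b k)) * h x (UU p *v d k))"
        by (simp add: h_sum_right h_scale_right)
      also have "\<dots> = (\<Sum>k<r. h (UU p *v x) (d k) * h (b k) y)"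
        by (rule sum.cong) (simp_all add: h_cnj[symmetric] h_adj' mult.commute)
      also have "\<dots> = h (\<Sum>k<r. h (UU p *v x) (d k) *s b k) y" by (simp add: h_sum_left h_scale_left)
      also have "\<dots> = h x (UU p *v y)" unfolding d(2)[symmetric] by (simp add: h_adj')
      finally show ?thesis by (simp add: h_diff_right)
    qed
    from h_nondeg'[OF this] show ?thesis by simp
  qed
  \<comment> \<open>The connection matrix consists of the entries, in the basis b with dual d, of
    the endomorphism \<open>th\<close> that solves M th = del M.\<close>
  have theta: "frame_theta W Q F p r s u (wz 0 (of_real t * e)) i j = h (UU p *v (th *v b j)) (d i)"
    if ij: "i < r" "j < r" and te: "norm (of_real t * e) < \<delta>"
      and g1: "((\<lambda>s. M (of_real s) (of_real t * e)) has_vector_derivative g1) (at 0)"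
      and gi: "((\<lambda>s. M (of_real s * \<i>) (of_real t * e)) has_vector_derivative gi) (at 0)"
      and th: "M 0 (of_real t * e) ** th = scale_mat (1 / 2) (g1 - scale_mat \<i> gi)"
      and inv: "M 0 (of_real t * e) ** Mi = mat 1" for t e i j g1 gi th Mi
  proof -
    let ?t = "of_real t * e" let ?w = "wz 0 ?t" let ?M = "M 0 ?t"
    have inv': "Mi ** ?M = mat 1" using inv by (simp add: matrix_left_right_inverse)
    have UMi: "UU p ** Mi = Mi ** UU p"
    proof -
      have "Mi ** (UU p ** ?M) ** Mi = Mi ** (?M ** UU p) ** Mi" by (simp only: MU)
      then have "(Mi ** UU p) ** (?M ** Mi) = (Mi ** ?M) ** (UU p ** Mi)" by (simp only: matrix_mul_assoc)
      then show ?thesis by (simp add: inv inv')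
    qed
    have UM: "UU p *v (Mi *v y) = Mi *v (UU p *v y)" for y by (simp add: matrix_vector_mul_assoc UMi)
    have n0: "norm (0 :: complex) < \<delta>" using \<delta> by simp
    have hl: "((\<lambda>s. h (f s *v b k) (b l)) has_vector_derivative h (f' *v b k) (b l)) (at 0)"
      if "(f has_vector_derivative f') (at 0)" for f f' k l
    proof -
      have "bounded_linear (\<lambda>A. h (A *v b k) (b l))"
        by (rule bounded_linear_compose[OF bounded_bilinear.bounded_linear_left[OF bounded_bilinear_h]
              bounded_bilinear.bounded_linear_left[OF bounded_bilinear_matrix_vector_mult]])
      from bounded_linear.has_vector_derivative[OF this that] show ?thesis .
    qed
    have o: "open {-\<delta><..<\<delta>}" "0 \<in> {-\<delta><..<\<delta>}" using \<delta> by auto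
    have del: "del u (\<lambda>w. frame_gram W Q F p s w k j) ?w = h (?M *v (th *v b j)) (b k)" if k: "k < r" for k
    proof -
      have "((\<lambda>s'. frame_gram W Q F p s (?w + s' *\<^sub>R u) k j) has_vector_derivative h (g1 *v b j) (b k)) (at 0)"
      proof (rule has_vector_derivative_transform_within_open[OF hl[OF g1] o])
        fix s' assume "s' \<in> {-\<delta><..<\<delta>}"
        then have "norm (complex_of_real s') < \<delta>" by auto
        from gram[OF this te k ij(2)] show "h (M (of_real s') ?t *v b j) (b k) = frame_gram W Q F p s (?w + s' *\<^sub>R u) k j"
          by (simp add: scale_mat_of_real add.commute)
      qed
      moreover have "((\<lambda>s'. frame_gram W Q F p s (?w + s' *\<^sub>R scale_mat \<i> u) k j) has_vector_derivative h (gi *v b j) (b k)) (at 0)"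
      proof (rule has_vector_derivative_transform_within_open[OF hl[OF gi] o])
        fix s' assume "s' \<in> {-\<delta><..<\<delta>}"
        then have "norm (complex_of_real s' * \<i>) < \<delta>" by (auto simp: norm_mult)
        from gram[OF this te k ij(2)] show "h (M (of_real s' * \<i>) ?t *v b j) (b k) = frame_gram W Q F p s (?w + s' *\<^sub>R scale_mat \<i> u) k j"
          by (simp add: scale_mat_scale[symmetric] scale_mat_of_real add.commute)
      qed
      ultimately have "del u (\<lambda>w. frame_gram W Q F p s w k j) ?w = (h (g1 *v b j) (b k) - \<i> * h (gi *v b j) (b k)) / 2"
        unfolding del_def by (simp add: vector_derivative_at)
      also have "\<dots> = h (scale_mat (1 / 2) (g1 - scale_mat \<i> gi) *v b j) (b k)"
        by (simp add: scale_mat_mult_vec matrix_vector_mult_diff_rdistrib h_scale_left h_diff_left)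
      finally show ?thesis unfolding th[symmetric] by (simp add: matrix_vector_mul_assoc)
    qed
    \<comment> \<open>The Gram matrix pairs M with b on both sides, so its inverse pairs M^-1 with
      the dual vectors on both sides.\<close>
    define B where "B k l = (if k < r \<and> l < r then h (Mi *v (UU p *v d l)) (d k) else 0)" for k l
    have Bsum: "(\<Sum>k<r. B i k * h y (b k)) = h (UU p *v (Mi *v y)) (d i)" if i: "i < r" for i y
    proof -
      have "(\<Sum>k<r. B i k * h y (b k)) = h (Mi *v (\<Sum>k<r. h y (b k) *s (UU p *v d k))) (d i)"
        using i by (simp add: B_def matrix_vector_sum_right matrix_vector_scale h_sum_left h_scale_left mult.commute)
      also have "\<dots> = h (UU p *v (Mi *v y)) (d i)" unfolding sumd by (simp add: matrix_vector_mul_assoc UMi)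
      finally show ?thesis .
    qed
    have G: "frame_gram W Q F p s ?w k l = h (?M *v b l) (b k)" if "k < r" "l < r" for k l
      by (rule gram[OF n0 te that])
    have invB: "inv_mat r (frame_gram W Q F p s ?w) = B"
    proof (rule inv_mat_eq)
      fix k l assume kl: "k < r" "l < r"
      have "(\<Sum>m<r. B k m * frame_gram W Q F p s ?w m l) = (\<Sum>m<r. B k m * h (?M *v b l) (b m))"
        by (rule sum.cong) (use G kl in auto)
      also have "\<dots> = h (b l) (d k)" unfolding Bsum[OF kl(1)] by (simp add: matrix_vector_mul_assoc inv' bU)
      finally show "(\<Sum>m<r. B k m * frame_gram W Q F p s ?w m l) = (if k = l then 1 else 0)" using d(1) kl by auto
      have "(\<Sum>m<r. frame_gram W Q F p s ?w k m * B m l) = (\<Sum>m<r. h (Mi *v (UU p *v d l)) (d m) * h (?M *v b m) (b k))"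
        by (rule sum.cong) (use G kl in \<open>auto simp: B_def\<close>)
      also have "\<dots> = h (?M *v (\<Sum>m<r. h (Mi *v (UU p *v d l)) (d m) *s b m)) (b k)"
        by (simp add: matrix_vector_sum_right matrix_vector_scale h_sum_left h_scale_left)
      also have "(\<Sum>m<r. h (Mi *v (UU p *v d l)) (d m) *s b m) = Mi *v (UU p *v d l)"
        unfolding d(2)[symmetric] by (simp only: UM UU_idem_vec)
      also have "h (?M *v (Mi *v (UU p *v d l))) (b k) = h (UU p *v d l) (b k)" unfolding matrix_vector_mul_assoc[of ?M] inv by simp
      also have "\<dots> = cnj (h (b k) (d l))" using h_adj[of "UU p" "d l" "b k"] h_cnj[of "d l" "b k"] by (simp add: bU)
      finally show "(\<Sum>m<r. frame_gram W Q F p s ?w k m * B m l) = (if k = l then 1 else 0)" using d(1) kl by auto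
    qed (auto simp: B_def)
    have "frame_theta W Q F p r s u ?w i j = (\<Sum>k<r. B i k * h (?M *v (th *v b j)) (b k))"
      unfolding frame_theta_def invB by (rule sum.cong) (use del in auto)
    also have "\<dots> = h (UU p *v (th *v b j)) (d i)"
      unfolding Bsum[OF ij(1)] unfolding matrix_vector_mul_assoc[of Mi] inv' by simp
    finally show ?thesis .
  qed
  let ?Y = "Nm - Nv' ** Nu"
  obtain X where X: "\<And>e. \<exists>g1 gi \<theta>. (\<forall>\<^sub>F t in nhds 0.
      ((\<lambda>s. M (of_real s) (of_real t * e)) has_vector_derivative g1 t) (at 0) \<and>
      ((\<lambda>s. M (of_real s * \<i>) (of_real t * e)) has_vector_derivative gi t) (at 0) \<and>
      M 0 (of_real t * e) ** \<theta> t = scale_mat (1 / 2) (g1 t - scale_mat \<i> (gi t)) \<and>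
      (\<exists>Y. M 0 (of_real t * e) ** Y = mat 1)) \<and>
      (\<theta> has_vector_derivative (scale_mat e X + scale_mat (cnj e) ?Y)) (at 0)"
    using wjet_log_derivative[OF Mj] unfolding Y by blast
  have curv: "frame_curvature W Q F p r s u v i j = - h (UU p *v (?Y *v b j)) (d i)" if ij: "i < r" "j < r" for i j
  proof -
    have der: "((\<lambda>t. frame_theta W Q F p r s u (wz 0 (of_real t * e)) i j) has_vector_derivative
        h (UU p *v ((scale_mat e X + scale_mat (cnj e) ?Y) *v b j)) (d i)) (at 0)" if e: "norm e = 1" for e
    proof -
      obtain g1 gi \<theta> where g: "\<forall>\<^sub>F t in nhds 0.
        ((\<lambda>s. M (of_real s) (of_real t * e)) has_vector_derivative g1 t) (at 0) \<and>
        ((\<lambda>s. M (of_real s * \<i>) (of_real t * e)) has_vector_derivative gi t) (at 0) \<and>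
        M 0 (of_real t * e) ** \<theta> t = scale_mat (1 / 2) (g1 t - scale_mat \<i> (gi t)) \<and>
        (\<exists>Y. M 0 (of_real t * e) ** Y = mat 1)"
        "(\<theta> has_vector_derivative (scale_mat e X + scale_mat (cnj e) ?Y)) (at 0)" using X[of e] by blast
      have "\<forall>\<^sub>F t in nhds 0. t \<in> {-\<delta><..<\<delta>}" using \<delta> by (intro eventually_nhds_in_open) auto
      with g(1) have "\<forall>\<^sub>F t in nhds 0. h (UU p *v (\<theta> t *v b j)) (d i) = frame_theta W Q F p r s u (wz 0 (of_real t * e)) i j"
      proof eventually_elim
        case (elim t)
        then have "norm (of_real t * e) < \<delta>" using e by (auto simp: norm_mult)
        then show ?case using theta[OF ij] elim by metis
      qed
      then obtain A where A: "open A" "0 \<in> A" "\<And>t. t \<in> A \<Longrightarrow> h (UU p *v (\<theta> t *v b j)) (d i) = frame_theta W Q F p r s u (wz 0 (of_real t * e)) i j"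
        unfolding eventually_nhds by blast
      have "bounded_linear (\<lambda>A. h (UU p *v (A *v b j)) (d i))"
        by (rule bounded_linear_compose[OF bounded_bilinear.bounded_linear_left[OF bounded_bilinear_h]
              bounded_linear_compose[OF bounded_bilinear.bounded_linear_right[OF bounded_bilinear_matrix_vector_mult]
                bounded_bilinear.bounded_linear_left[OF bounded_bilinear_matrix_vector_mult]]])
      from bounded_linear.has_vector_derivative[OF this g(2)]
      show ?thesis by (rule has_vector_derivative_transform_within_open[OF _ A(1,2)]) (rule A(3))
    qed
    \<comment> \<open>Along v and i v the endomorphism has derivatives X + Y and i X - i Y, with Y
      standing for \<open>?Y\<close>; the combination in \<open>del_bar\<close> cancels X and
      returns Y.\<close>
    have 1: "vector_derivative (\<lambda>t. frame_theta W Q F p r s u (0 + t *\<^sub>R v) i j) (at 0) = h (UU p *v ((X + ?Y) *v b j)) (d i)"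
      using vector_derivative_at[OF der[of 1]] by (simp add: scale_mat_of_real)
    have 2: "vector_derivative (\<lambda>t. frame_theta W Q F p r s u (0 + t *\<^sub>R scale_mat \<i> v) i j) (at 0) = h (UU p *v ((scale_mat \<i> X - scale_mat \<i> ?Y) *v b j)) (d i)"
      using vector_derivative_at[OF der[of \<i>]] by (simp add: scale_mat_scale[symmetric] scale_mat_of_real scale_mat_minus_left)
    show ?thesis
      unfolding frame_curvature_def del_bar_def 1 2
      by (simp add: matrix_vector_mult_add_rdistrib matrix_vector_mult_diff_rdistrib matrix_vector_right_distrib matrix_vector_mult_diff_distrib
          scale_mat_mult_vec matrix_vector_scale h_add_left h_diff_left h_scale_left algebra_simps) (simp add: field_simps)
  qed
  have xb: "x = (\<Sum>j<r. c j *s b j)" using x(2) bq by simp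
  have "(\<Sum>j<r. frame_curvature W Q F p r s u v i j * c j) = - h (UU p *v (?Y *v x)) (d i)" if "i < r" for i
  proof -
    have "(\<Sum>j<r. frame_curvature W Q F p r s u v i j * c j) = (\<Sum>j<r. - (c j * h (UU p *v (?Y *v b j)) (d i)))"
      by (rule sum.cong) (use curv that in auto)
    also have "\<dots> = - h (UU p *v (?Y *v (\<Sum>j<r. c j *s b j))) (d i)"
      by (simp add: matrix_vector_sum_right matrix_vector_scale h_sum_left h_scale_left sum_negf)
    finally show ?thesis unfolding xb .
  qed
  then have "(\<Sum>i<r. (\<Sum>j<r. frame_curvature W Q F p r s u v i j * c j) *s quot_rep W F p (s i 0)) =
      (\<Sum>i<r. - h (UU p *v (?Y *v x)) (d i) *s b i)" by (intro sum.cong) (auto simp: bq)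
  also have "\<dots> = - (\<Sum>i<r. h (UU p *v (?Y *v x)) (d i) *s b i)" by (simp add: sum_negf)
  also have "\<dots> = - (UU p *v (UU p *v (?Y *v x)))" unfolding d(2)[symmetric] ..
  finally show ?thesis by simp
qed

text \<open>All frames give the same value by \<open>frame_curvature_eq\<close>, and
  \<open>standard_frame\<close> supplies one, which makes the described value unique.\<close>

lemma hodge_curvature_eq:
  assumes F: "F \<in> classifying_space W Q hn" and x: "x \<in> hodge_U W F p"
    and N: "wjet (\<lambda>z t. NN p (wz z t)) (mat 1) Nu Nu' Nv Nv' Nm Nm'"
  shows "hodge_curvature W Q hn F p u v x = - (UU p *v ((Nm - Nv' ** Nu) *v x))"
  unfolding hodge_curvature_def
proof (rule the_equality)
  show "\<forall>r s c. local_frame W Q hn F p r s \<longrightarrow> x = (\<Sum>j<r. c j *s quot_rep W F p (s j 0)) \<longrightarrow>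
      - (UU p *v ((Nm - Nv' ** Nu) *v x)) = (\<Sum>i<r. (\<Sum>j<r. frame_curvature W Q F p r s u v i j * c j) *s quot_rep W F p (s i 0))"
    by (intro allI impI, rule frame_curvature_eq[symmetric, OF _ N x])
  fix y assume y: "\<forall>r s c. local_frame W Q hn F p r s \<longrightarrow> x = (\<Sum>j<r. c j *s quot_rep W F p (s j 0)) \<longrightarrow>
      y = (\<Sum>i<r. (\<Sum>j<r. frame_curvature W Q F p r s u v i j * c j) *s quot_rep W F p (s i 0))"
  obtain r s c where rs: "local_frame W Q hn F p r s" "x = (\<Sum>j<r. c j *s quot_rep W F p (s j 0))"
    using standard_frame[OF F, of p] x by blast
  have "y = (\<Sum>i<r. (\<Sum>j<r. frame_curvature W Q F p r s u v i j * c j) *s quot_rep W F p (s i 0))"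
    by (rule y[rule_format, OF rs])
  also have "\<dots> = - (UU p *v ((Nm - Nv' ** Nu) *v x))" by (rule frame_curvature_eq[OF rs(1) N x rs(2)])
  finally show "y = - (UU p *v ((Nm - Nv' ** Nu) *v x))" .
qed

lemma curvature_formula:
  assumes F: "F \<in> classifying_space W Q hn" and x: "x \<in> hodge_U W F p"
  defines "P \<equiv> hodge_proj W Q F p"
  shows "hodge_curvature W Q hn F p u v x =
    - (P (adj (pl (cnj_mat u)) *v P (pl (cnj_mat v) *v x)) - P (pl (cnj_mat v) *v P (adj (pl (cnj_mat u)) *v x)))
    - (1 / 2) *s ((z0 (commutator u (cnj_mat v)) + adj (z0 (commutator v (cnj_mat u)))) *v x)
    + P ((pl (commutator (cnj_mat v) u) + adj (pl (commutator (cnj_mat u) v))) *v x)"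
proof -
  let ?cu = "cnj_mat u" and ?cv = "cnj_mat v"
  define a b q q' z where "a = pl ?cu" and "b = pl ?cv" and "q = pl (commutator ?cv u)" and "q' = pl (commutator ?cu v)"
    and "z = z0 (commutator ?cv u)"
  note g = uv_gC[OF u v]
  obtain Nu' Nv Nm' where N: "wjet (\<lambda>z t. NN p (wz z t)) (mat 1) (- adj (UU p ** a ** UU p)) Nu' Nv (- (UU p ** b ** UU p))
     (adj (UU p ** a ** UU p) ** (UU p ** b ** UU p) - UU p ** q ** UU p - z - adj (UU p ** q' ** UU p)) Nm'"
    using wjet_NN[OF u v, of p] unfolding a_def b_def q_def q'_def z_def by blast
  have Ux: "UU p *v x = x" using x unfolding hodge_U_VV by (rule PP_VV_id)
  have z1: "z0 (commutator u ?cv) = - z"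
  proof -
    have "commutator u ?cv = - commutator ?cv u" by (simp add: commutator_def)
    then show ?thesis unfolding z_def using gC_commutator[OF g(4,1)] gC_minus[OF gC_commutator[OF g(4,1)]]
      by (simp add: comp_zero_eq cmp_minus)
  qed
  have z2: "adj (z0 (commutator v ?cu)) = - z"
    unfolding z_def z0_cnj[OF u v gC_commutator[OF g(2,3)]] by (simp add: cnj_mat_commutator)
  have zU: "UU p *v (z *v x) = z *v x"
  proof -
    have "supp {0} z" unfolding z_def comp_zero_eq[OF gC_commutator[OF g(4,1)]] by (rule supp_cmp)
    then show ?thesis using Ux by (simp add: matrix_vector_mul_assoc UU_zero_commute) (simp add: matrix_vector_mul_assoc[symmetric])
  qed
  \<comment> \<open>Both terms of bidegree (0, 0) equal -z; half their sum is the contribution of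
    the adjoint of K to the mixed derivative of the metric.\<close>
  have half: "(1 / 2) *s ((- z + - z) *v x) = - (z *v x)"
    unfolding matrix_vector_mult_add_rdistrib matrix_vector_minus_left by (simp add: vec_eq_iff)
  have aU: "adj (UU p ** A ** UU p) = UU p ** adj A ** UU p" for A by (simp add: adj_mult matrix_mul_assoc)
  show ?thesis
    unfolding hodge_curvature_eq[OF F x N] P_def hodge_proj_eq z1 z2 half
    unfolding a_def[symmetric] b_def[symmetric] q_def[symmetric] q'_def[symmetric] aU
    by (simp add: matrix_vector_mult_diff_rdistrib matrix_vector_mult_add_rdistrib matrix_vector_right_distrib matrix_vector_mult_diff_distrib
        matrix_vector_mul_assoc[symmetric] matrix_minus_left matrix_minus_right matrix_vector_minus_left matrix_vector_minus_right Ux zU)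
qed

end

end

theorem corollary5p2:
  fixes W :: "int \<Rightarrow> (real ^ 'n) set"
    and Q :: "int \<Rightarrow> real ^ 'n \<Rightarrow> real ^ 'n \<Rightarrow> real"
    and hn :: "int \<Rightarrow> int \<Rightarrow> nat"
    and F :: "int \<Rightarrow> (complex ^ 'n) set"
    and p :: int
    and u v :: "complex ^ 'n ^ 'n"
    and x :: "complex ^ 'n"
  defines "P \<equiv> hodge_proj W Q F p"
    and "adj \<equiv> hodge_adjoint W Q F"
    and "pl \<equiv> comp_plus W Q F"
    and "z0 \<equiv> comp_zero W Q F"
  assumes "weight_filtration W"
    and "graded_forms W Q"
    and "F \<in> classifying_space W Q hn"
    and "u \<in> lie_q W Q F"
    and "v \<in> lie_q W Q F"
    and "x \<in> hodge_U W F p"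
  shows "hodge_curvature W Q hn F p u v x =
    - (P (adj (pl (cnj_mat u)) *v P (pl (cnj_mat v) *v x))
       - P (pl (cnj_mat v) *v P (adj (pl (cnj_mat u)) *v x)))
    - (1 / 2) *s ((z0 (commutator u (cnj_mat v))
                   + adj (z0 (commutator v (cnj_mat u)))) *v x)
    + P ((pl (commutator (cnj_mat v) u)
          + adj (pl (commutator (cnj_mat u) v))) *v x)"
proof -
  interpret polarized W F Q
    by unfold_locales (use assms in \<open>auto simp: classifying_space_def\<close>)
  show ?thesis unfolding P_def adj_def pl_def z0_def
    by (rule curvature_formula) (use assms in auto)
qed

end
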